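(* Let $k$ be a commutative ring and $A$ a unital associative $k$-algebra. The symmetric homology $HS_*(A)\cong H_*(CA_* )$ admits a Pontryagin product (the product induced on homology by the $E_\infty$ structure of $CA_*$, as defined in the context), giving $HS_*(A)$ the structure of an associative, graded commutative algebra over $k$.
   Context: **The category $\Delta S_+$.** For $n\ge 0$ let $[n]=\{0,1,\dots,n\}$. The category $\Delta S$ has objects $[n]$, $n\geq 0$; a morphism $[n]\to[m]$ is a pair $(\phi,\gamma)$ with $\phi:[n]\to[m]$ a non-decreasing map and $\gamma$ a permutation of $[n]$. For $\psi:[n]\to[m]$ non-decreasing and $\gamma$ a permutation of $[m]$, let $\psi^\gamma:[n]\to[m]$ be the unique non-decreasing map with $|(\psi^\gamma)^{-1}(i)|=|\psi^{-1}(\gamma(i))|$ for all $i$, and let $\gamma^\psi$ be the permutation of $[n]$ restricting to the order-preserving bijections $(\psi^\gamma)^{-1}(i)\to\psi^{-1}(\gamma(i))$. Composition is $(\phi,\gamma)\circ(\psi,\delta)=(\phi\psi^\gamma,\delta\gamma^\psi)$ (permutations compose as functions, right factor first). $\Delta S_+$ is $\Delta S$ with an initial object $[-1]$ added (and no morphisms $[n]\to[-1]$ for $n\ge0$). It has a strictly associative product $\odot$ with unit $[-1]$: $[n]\odot[m]=[n+m+1]$, and on morphisms $\odot$ is juxtaposition (side by side). **Symmetric homology.** $B^{sym_+}_*A:\Delta S_+\to k\text{-}\mathbf{Mod}$ sends $[n]$ to $A^{\otimes(n+1)}$ ($A^{\otimes 0}=k$); $(\mathrm{id},\gamma)$ acts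 by $a_0\otimes\cdots\otimes a_n\mapsto a_{\gamma(0)}\otimes\cdots\otimes a_{\gamma(n)}$; a non-decreasing $\phi:[n]\to[m]$ acts by $a_0\otimes\cdots\otimes a_n\mapsto b_0\otimes\cdots\otimes b_m$, where $b_i$ is the product of the $a_j$ with $\phi(j)=i$ in increasing order of $j$ (empty product $=1$); $[-1]\to[n]$ sends $1$ to $1^{\otimes(n+1)}$. Write $\langle f,V\rangle$ for the value of $f$ on $V$. $B^{sym}_*A$ is its restriction to $\Delta S$, and $HS_*(A)=\mathrm{Tor}^{\Delta S}_*(\underline{k},B^{sym}_*A)$ with $\underline{k}$ the trivial (constant) $\Delta S^{\mathrm{op}}$-module. Let $N$ denote the nerve and $[n]\setminus\Delta S_+$ the under-category. Set $CA_*=k[N(-\setminus\Delta S_+)]\otimes_{\Delta S_+}B^{sym_+}_*A$: in simplicial degree $i$ it is generated by elements $([n_i]\xleftarrow{f_i}\cdots\xleftarrow{f_1}[n_0]\xleftarrow{f_0}[n])\otimes V$ with $f_s$ morphisms of $\Delta S_+$ and $V\in A^{\otimes(n+1)}$, linear in $V$, modulo $(f_i,\dots,f_1,f_0g)\otimes V=(f_i,\dots,f_1,f_0)\otimes\langle g,V\rangle$; faces and degeneracies are those of the nerve of the under-category. It is known that $HS_*(A)\cong H_*(CA_* )$, and this is used as an identification. **Pontryagin product.** $CA_*$ is an algebra over the $E_\infty$ operad $\mathscr D_{\mathbf{Mod}}$ (with $\mathscr D_{\mathbf{Mod}}(m)=k[N E\Sigma_m]$, $E\Sigma_m$ being the category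 with object set $\Sigma_m$ and a unique morphism between any two objects), with structure maps $\nu:\mathscr D_{\mathbf{Mod}}(n)\otimes_{\Sigma_n}(CA_* )^{\otimes n}\to CA_*$. The product is $x\otimes y\mapsto\nu(c\otimes(x\otimes y))$, where $c\in\mathscr D_{\mathbf{Mod}}(2)$ is the vertex $\mathrm{id}\in\Sigma_2$ (and its degeneracies). Explicitly it is the map of simplicial $k$-modules $CA_*\otimes CA_*\to CA_*$ given in each degree $i$ by $$\big((f_i,\dots,f_0)\otimes V\big)\otimes\big((g_i,\dots,g_0)\otimes W\big)\mapsto(f_i\odot g_i,\dots,f_0\odot g_0)\otimes(V\otimes W).$$ The induced product on $H_*(CA_* )$ is obtained by composing with the Eilenberg-Zilber shuffle map (and the homology cross product). *)

theory Defs
  imports "HOL-Algebra.Module" "HOL-Algebra.AbelCoset" "HOL-Combinatorics.Permutations"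
begin

section \<open>Modules over a commutative ring\<close>

locale assoc_algebra = module k A + ring A
  for k :: "('k, 'r) ring_scheme" and A :: "('k, 'a, 's) module_scheme" +
  assumes smult_mult_left: "\<lbrakk>r \<in> carrier k; x \<in> carrier A; y \<in> carrier A\<rbrakk> \<Longrightarrow>
      (r \<odot>\<^bsub>A\<^esub> x) \<otimes>\<^bsub>A\<^esub> y = r \<odot>\<^bsub>A\<^esub> (x \<otimes>\<^bsub>A\<^esub> y)"
    and smult_mult_right: "\<lbrakk>r \<in> carrier k; x \<in> carrier A; y \<in> carrier A\<rbrakk> \<Longrightarrow>
      x \<otimes>\<^bsub>A\<^esub> (r \<odot>\<^bsub>A\<^esub> y) = r \<odot>\<^bsub>A\<^esub> (x \<otimes>\<^bsub>A\<^esub> y)"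

definition module_hom ::
  "('k, 'r) ring_scheme \<Rightarrow> ('k, 'm, 's) module_scheme \<Rightarrow> ('k, 'n, 't) module_scheme \<Rightarrow> ('m \<Rightarrow> 'n) set"
where
  "module_hom k M N = {h. h \<in> carrier M \<rightarrow> carrier N \<and>
     (\<forall>x\<in>carrier M. \<forall>y\<in>carrier M. h (x \<oplus>\<^bsub>M\<^esub> y) = h x \<oplus>\<^bsub>N\<^esub> h y) \<and>
     (\<forall>r\<in>carrier k. \<forall>x\<in>carrier M. h (r \<odot>\<^bsub>M\<^esub> x) = r \<odot>\<^bsub>N\<^esub> h x)}"

definition module_bilinear ::
  "('k, 'r) ring_scheme \<Rightarrow> ('k, 'm, 's) module_scheme \<Rightarrow> ('k, 'n, 't) module_scheme \<Rightarrow>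
   ('k, 'p, 'u) module_scheme \<Rightarrow> ('m \<Rightarrow> 'n \<Rightarrow> 'p) \<Rightarrow> bool"
where
  "module_bilinear k M N P f \<longleftrightarrow>
     (\<forall>y\<in>carrier N. (\<lambda>x. f x y) \<in> module_hom k M P) \<and>
     (\<forall>x\<in>carrier M. f x \<in> module_hom k N P)"

text \<open>Modules reuse the library record, which also has multiplicative fields; these carry
  no meaning for a module and are left \<^const>\<open>undefined\<close>.\<close>

definition free_mod :: "('k, 'r) ring_scheme \<Rightarrow> 'x set \<Rightarrow> ('k, 'x \<Rightarrow> 'k) module" where
  "free_mod k X =
     \<lparr>carrier = {c. (\<forall>x. c x \<in> carrier k) \<and> (\<forall>x. x \<notin> X \<longrightarrow> c x = \<zero>\<^bsub>k\<^esub>) \<and> finite {x. c x \<noteq> \<zero>\<^bsub>k\<^esub>}},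
      monoid.mult = undefined, one = undefined,
      zero = (\<lambda>x. \<zero>\<^bsub>k\<^esub>), add = (\<lambda>c d x. c x \<oplus>\<^bsub>k\<^esub> d x),
      smult = (\<lambda>r c x. r \<otimes>\<^bsub>k\<^esub> c x)\<rparr>"

definition basis_elt :: "('k, 'r) ring_scheme \<Rightarrow> 'x \<Rightarrow> 'x \<Rightarrow> 'k" where
  "basis_elt k x = (\<lambda>y. if y = x then \<one>\<^bsub>k\<^esub> else \<zero>\<^bsub>k\<^esub>)"

definition submod_span ::
  "('k, 'r) ring_scheme \<Rightarrow> ('k, 'm, 's) module_scheme \<Rightarrow> 'm set \<Rightarrow> 'm set" where
  "submod_span k M S = \<Inter>{N. submodule N k M \<and> S \<subseteq> N}"

definition quot_mod :: "('k, 'm, 's) module_scheme \<Rightarrow> 'm set \<Rightarrow> ('k, 'm set) module" where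
  "quot_mod M N =
     \<lparr>carrier = a_rcosets\<^bsub>M\<^esub> N, monoid.mult = undefined, one = undefined,
      zero = N, add = set_add M,
      smult = (\<lambda>r C. \<Union>x\<in>C. N +>\<^bsub>M\<^esub> (r \<odot>\<^bsub>M\<^esub> x))\<rparr>"

text \<open>The module with generators \<open>X\<close> and relators \<open>S\<close>, the class of a generator, and the
  linear map out of a presented module with prescribed values \<open>\<phi>\<close> on the generators.
  The value of the latter on a coset is the common value of the linear extension of \<open>\<phi>\<close> on that
  coset; it is meaningful whenever the extension vanishes on \<open>S\<close>.\<close>

definition presented :: "('k, 'r) ring_scheme \<Rightarrow> 'x set \<Rightarrow> ('x \<Rightarrow> 'k) set \<Rightarrow> ('k, ('x \<Rightarrow> 'k) set) module" where
  "presented k X S = quot_mod (free_mod k X) (submod_span k (free_mod k X) S)"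

definition gen_class :: "('k, 'r) ring_scheme \<Rightarrow> 'x set \<Rightarrow> ('x \<Rightarrow> 'k) set \<Rightarrow> 'x \<Rightarrow> ('x \<Rightarrow> 'k) set" where
  "gen_class k X S x = submod_span k (free_mod k X) S +>\<^bsub>free_mod k X\<^esub> basis_elt k x"

definition lin_ext ::
  "('k, 'r) ring_scheme \<Rightarrow> ('k, 'm, 's) module_scheme \<Rightarrow> ('x \<Rightarrow> 'm) \<Rightarrow> ('x \<Rightarrow> 'k) \<Rightarrow> 'm" where
  "lin_ext k M \<phi> c = (\<Oplus>\<^bsub>M\<^esub>x\<in>{x. c x \<noteq> \<zero>\<^bsub>k\<^esub>}. c x \<odot>\<^bsub>M\<^esub> \<phi> x)"

definition lin_lift ::
  "('k, 'r) ring_scheme \<Rightarrow> ('k, 'm, 's) module_scheme \<Rightarrow> ('x \<Rightarrow> 'm) \<Rightarrow> ('x \<Rightarrow> 'k) set \<Rightarrow> 'm" where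
  "lin_lift k M \<phi> C = the_elem (lin_ext k M \<phi> ` C)"


section \<open>The category $\Delta S_+$\<close>

text \<open>An object is given by its cardinality: \<open>p\<close> stands for $[p-1] = \{0,\dots,p-1\}$, so that \<open>0\<close> is
  the initial object $[-1]$. There is exactly one arrow from \<open>0\<close> to each object and none from a
  nonzero object to \<open>0\<close>. Non-decreasing maps are extensional, and permutations are the
  identity outside their domain, so that equality of arrows is equality of the data.\<close>

datatype arrow = Arrow (src: nat) (tgt: nat) (mon: "nat \<Rightarrow> nat") (perm: "nat \<Rightarrow> nat")

definition mono_maps :: "nat \<Rightarrow> nat \<Rightarrow> (nat \<Rightarrow> nat) set" where
  "mono_maps p q = {\<phi> \<in> {..<p} \<rightarrow>\<^sub>E {..<q}. mono_on {..<p} \<phi>}"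

definition is_arrow :: "arrow \<Rightarrow> bool" where
  "is_arrow f \<longleftrightarrow> mon f \<in> mono_maps (src f) (tgt f) \<and> perm f permutes {..<src f}"

definition fiber :: "nat \<Rightarrow> (nat \<Rightarrow> nat) \<Rightarrow> nat \<Rightarrow> nat set" where
  "fiber p \<psi> i = {j \<in> {..<p}. \<psi> j = i}"

text \<open>For \<open>\<psi>\<close> from \<open>p\<close> to \<open>q\<close> and a permutation \<open>\<gamma>\<close> of \<open>q\<close>: the map $\psi^\gamma$ and the
  permutation $\gamma^\psi$.\<close>

definition twist_map :: "nat \<Rightarrow> nat \<Rightarrow> (nat \<Rightarrow> nat) \<Rightarrow> (nat \<Rightarrow> nat) \<Rightarrow> nat \<Rightarrow> nat" where
  "twist_map p q \<psi> \<gamma> = (THE \<theta>. \<theta> \<in> mono_maps p q \<and>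
     (\<forall>i<q. card (fiber p \<theta> i) = card (fiber p \<psi> (\<gamma> i))))"

definition twist_perm :: "nat \<Rightarrow> nat \<Rightarrow> (nat \<Rightarrow> nat) \<Rightarrow> (nat \<Rightarrow> nat) \<Rightarrow> nat \<Rightarrow> nat" where
  "twist_perm p q \<psi> \<gamma> = (THE \<sigma>. \<sigma> permutes {..<p} \<and>
     (\<forall>i<q. bij_betw \<sigma> (fiber p (twist_map p q \<psi> \<gamma>) i) (fiber p \<psi> (\<gamma> i)) \<and>
            strict_mono_on (fiber p (twist_map p q \<psi> \<gamma>) i) \<sigma>))"

definition arr_id :: "nat \<Rightarrow> arrow" where
  "arr_id p = Arrow p p (\<lambda>j\<in>{..<p}. j) id"

definition arr_comp :: "arrow \<Rightarrow> arrow \<Rightarrow> arrow" where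
  "arr_comp f g = Arrow (src g) (tgt f)
     (compose {..<src g} (mon f) (twist_map (src g) (tgt g) (mon g) (perm f)))
     (perm g \<circ> twist_perm (src g) (tgt g) (mon g) (perm f))"

definition arr_prod :: "arrow \<Rightarrow> arrow \<Rightarrow> arrow" where
  "arr_prod f g = Arrow (src f + src g) (tgt f + tgt g)
     (\<lambda>j\<in>{..<src f + src g}. if j < src f then mon f j else tgt f + mon g (j - src f))
     (\<lambda>j. if j < src f then perm f j
          else if j < src f + src g then src f + perm g (j - src f) else j)"


section \<open>Tensor powers and the symmetric bar construction\<close>

definition words :: "('k, 'a, 's) module_scheme \<Rightarrow> nat \<Rightarrow> 'a list set" where
  "words A p = {w. length w = p \<and> set w \<subseteq> carrier A}"

definition tensor_rels ::
  "('k, 'r) ring_scheme \<Rightarrow> ('k, 'a, 's) module_scheme \<Rightarrow> nat \<Rightarrow> ('a list \<Rightarrow> 'k) set" where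
  "tensor_rels k A p = (let F = free_mod k (words A p) in
     {basis_elt k (u @ (a \<oplus>\<^bsub>A\<^esub> b) # v) \<ominus>\<^bsub>F\<^esub> (basis_elt k (u @ a # v) \<oplus>\<^bsub>F\<^esub> basis_elt k (u @ b # v))
       | u a b v. u @ a # v \<in> words A p \<and> b \<in> carrier A} \<union>
     {basis_elt k (u @ (r \<odot>\<^bsub>A\<^esub> a) # v) \<ominus>\<^bsub>F\<^esub> (r \<odot>\<^bsub>F\<^esub> basis_elt k (u @ a # v))
       | u r a v. u @ a # v \<in> words A p \<and> r \<in> carrier k})"

definition tensor_power ::
  "('k, 'r) ring_scheme \<Rightarrow> ('k, 'a, 's) module_scheme \<Rightarrow> nat \<Rightarrow> ('k, ('a list \<Rightarrow> 'k) set) module" where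
  "tensor_power k A p = presented k (words A p) (tensor_rels k A p)"

definition pure_tensor ::
  "('k, 'r) ring_scheme \<Rightarrow> ('k, 'a, 's) module_scheme \<Rightarrow> 'a list \<Rightarrow> ('a list \<Rightarrow> 'k) set" where
  "pure_tensor k A w = gen_class k (words A (length w)) (tensor_rels k A (length w)) w"

definition tensor_concat ::
  "('k, 'r) ring_scheme \<Rightarrow> ('k, 'a, 's) module_scheme \<Rightarrow> nat \<Rightarrow> nat \<Rightarrow>
   ('a list \<Rightarrow> 'k) set \<Rightarrow> ('a list \<Rightarrow> 'k) set \<Rightarrow> ('a list \<Rightarrow> 'k) set" where
  "tensor_concat k A p q V W =
     lin_lift k (tensor_power k A (p + q))
       (\<lambda>v. lin_lift k (tensor_power k A (p + q)) (\<lambda>w. pure_tensor k A (v @ w)) W) V"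

text \<open>An arrow $(\phi,\gamma)$ equals $(\phi,\mathrm{id})\circ(\mathrm{id},\gamma)$: first permute,
  then multiply along the fibers of $\phi$, in increasing order.\<close>

definition word_act :: "('k, 'a, 's) module_scheme \<Rightarrow> arrow \<Rightarrow> 'a list \<Rightarrow> 'a list" where
  "word_act A g w =
     map (\<lambda>i. foldr (\<otimes>\<^bsub>A\<^esub>) (map (\<lambda>j. w ! perm g j) (filter (\<lambda>j. mon g j = i) [0..<src g])) \<one>\<^bsub>A\<^esub>)
         [0..<tgt g]"

definition bar_act ::
  "('k, 'r) ring_scheme \<Rightarrow> ('k, 'a, 's) module_scheme \<Rightarrow> arrow \<Rightarrow>
   ('a list \<Rightarrow> 'k) set \<Rightarrow> ('a list \<Rightarrow> 'k) set" where
  "bar_act k A g = lin_lift k (tensor_power k A (tgt g)) (\<lambda>w. pure_tensor k A (word_act A g w))"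


section \<open>The simplicial module $CA_*$\<close>

text \<open>An \<open>i\<close>-simplex $([n_i]\leftarrow\cdots\leftarrow[n_0]\leftarrow[n])$ of the nerve of an under-category
  is the list $f_0,\dots,f_i$ of composable arrows; $[n]$ is the source of $f_0$.\<close>

definition is_chain :: "nat \<Rightarrow> arrow list \<Rightarrow> bool" where
  "is_chain i F \<longleftrightarrow> length F = Suc i \<and> (\<forall>f\<in>set F. is_arrow f) \<and>
     (\<forall>s<i. tgt (F ! s) = src (F ! Suc s))"

definition chain_face :: "nat \<Rightarrow> arrow list \<Rightarrow> arrow list" where
  "chain_face j F = (if Suc j < length F
     then take j F @ [arr_comp (F ! Suc j) (F ! j)] @ drop (j + 2) F
     else butlast F)"

definition chain_degen :: "nat \<Rightarrow> arrow list \<Rightarrow> arrow list" where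
  "chain_degen j F = take (Suc j) F @ [arr_id (tgt (F ! j))] @ drop (Suc j) F"

definition ca_gens ::
  "('k, 'r) ring_scheme \<Rightarrow> ('k, 'a, 's) module_scheme \<Rightarrow> nat \<Rightarrow> (arrow list \<times> ('a list \<Rightarrow> 'k) set) set" where
  "ca_gens k A i = {(F, V). is_chain i F \<and> V \<in> carrier (tensor_power k A (src (hd F)))}"

definition ca_rels ::
  "('k, 'r) ring_scheme \<Rightarrow> ('k, 'a, 's) module_scheme \<Rightarrow> nat \<Rightarrow>
   (arrow list \<times> ('a list \<Rightarrow> 'k) set \<Rightarrow> 'k) set" where
  "ca_rels k A i = (let M = free_mod k (ca_gens k A i); T = tensor_power k A in
     {basis_elt k (F, V \<oplus>\<^bsub>T (src (hd F))\<^esub> W) \<ominus>\<^bsub>M\<^esub> (basis_elt k (F, V) \<oplus>\<^bsub>M\<^esub> basis_elt k (F, W))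
       | F V W. (F, V) \<in> ca_gens k A i \<and> (F, W) \<in> ca_gens k A i} \<union>
     {basis_elt k (F, r \<odot>\<^bsub>T (src (hd F))\<^esub> V) \<ominus>\<^bsub>M\<^esub> (r \<odot>\<^bsub>M\<^esub> basis_elt k (F, V))
       | F r V. (F, V) \<in> ca_gens k A i \<and> r \<in> carrier k} \<union>
     {basis_elt k (arr_comp f g # F, V) \<ominus>\<^bsub>M\<^esub> basis_elt k (f # F, bar_act k A g V)
       | f g F V. is_chain i (f # F) \<and> is_arrow g \<and> tgt g = src f \<and> V \<in> carrier (T (src g))})"

definition CA ::
  "('k, 'r) ring_scheme \<Rightarrow> ('k, 'a, 's) module_scheme \<Rightarrow> nat \<Rightarrow>
   ('k, (arrow list \<times> ('a list \<Rightarrow> 'k) set \<Rightarrow> 'k) set) module" where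
  "CA k A i = presented k (ca_gens k A i) (ca_rels k A i)"

definition ca_gen ::
  "('k, 'r) ring_scheme \<Rightarrow> ('k, 'a, 's) module_scheme \<Rightarrow> nat \<Rightarrow> arrow list \<Rightarrow> ('a list \<Rightarrow> 'k) set \<Rightarrow>
   (arrow list \<times> ('a list \<Rightarrow> 'k) set \<Rightarrow> 'k) set" where
  "ca_gen k A i F V = gen_class k (ca_gens k A i) (ca_rels k A i) (F, V)"

text \<open>The face $d_j : CA_i \to CA_{i-1}$ (for $i \ge 1$) and the degeneracy $s_j : CA_i \to CA_{i+1}$.\<close>

definition ca_face ::
  "('k, 'r) ring_scheme \<Rightarrow> ('k, 'a, 's) module_scheme \<Rightarrow> nat \<Rightarrow> nat \<Rightarrow>
   (arrow list \<times> ('a list \<Rightarrow> 'k) set \<Rightarrow> 'k) set \<Rightarrow> (arrow list \<times> ('a list \<Rightarrow> 'k) set \<Rightarrow> 'k) set" where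
  "ca_face k A i j = lin_lift k (CA k A (i - 1)) (\<lambda>(F, V). ca_gen k A (i - 1) (chain_face j F) V)"

definition ca_degen ::
  "('k, 'r) ring_scheme \<Rightarrow> ('k, 'a, 's) module_scheme \<Rightarrow> nat \<Rightarrow> nat \<Rightarrow>
   (arrow list \<times> ('a list \<Rightarrow> 'k) set \<Rightarrow> 'k) set \<Rightarrow> (arrow list \<times> ('a list \<Rightarrow> 'k) set \<Rightarrow> 'k) set" where
  "ca_degen k A i j = lin_lift k (CA k A (Suc i)) (\<lambda>(F, V). ca_gen k A (Suc i) (chain_degen j F) V)"


section \<open>Symmetric homology\<close>

definition alt_sign :: "('k, 'm, 's) module_scheme \<Rightarrow> nat \<Rightarrow> 'm \<Rightarrow> 'm" where
  "alt_sign M n x = (if even n then x else \<ominus>\<^bsub>M\<^esub> x)"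

definition ca_boundary ::
  "('k, 'r) ring_scheme \<Rightarrow> ('k, 'a, 's) module_scheme \<Rightarrow> nat \<Rightarrow>
   (arrow list \<times> ('a list \<Rightarrow> 'k) set \<Rightarrow> 'k) set \<Rightarrow> (arrow list \<times> ('a list \<Rightarrow> 'k) set \<Rightarrow> 'k) set" where
  "ca_boundary k A i x = (\<Oplus>\<^bsub>CA k A (i - 1)\<^esub>j\<in>{..i}. alt_sign (CA k A (i - 1)) j (ca_face k A i j x))"

definition ca_cycles ::
  "('k, 'r) ring_scheme \<Rightarrow> ('k, 'a, 's) module_scheme \<Rightarrow> nat \<Rightarrow>
   (arrow list \<times> ('a list \<Rightarrow> 'k) set \<Rightarrow> 'k) set set" where
  "ca_cycles k A i = (if i = 0 then carrier (CA k A 0)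
     else a_kernel (CA k A i) (CA k A (i - 1)) (ca_boundary k A i))"

definition ca_boundaries ::
  "('k, 'r) ring_scheme \<Rightarrow> ('k, 'a, 's) module_scheme \<Rightarrow> nat \<Rightarrow>
   (arrow list \<times> ('a list \<Rightarrow> 'k) set \<Rightarrow> 'k) set set" where
  "ca_boundaries k A i = ca_boundary k A (Suc i) ` carrier (CA k A (Suc i))"

text \<open>Symmetric homology $HS_i(A) = \mathrm{Tor}_i^{\Delta S}(k, B^{sym}_*A)$, under its standard
  identification with $H_i(CA_*)$.\<close>

definition HS ::
  "('k, 'r) ring_scheme \<Rightarrow> ('k, 'a, 's) module_scheme \<Rightarrow> nat \<Rightarrow>
   ('k, (arrow list \<times> ('a list \<Rightarrow> 'k) set \<Rightarrow> 'k) set set) module" where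
  "HS k A i = quot_mod ((CA k A i)\<lparr>carrier := ca_cycles k A i\<rparr>) (ca_boundaries k A i)"

definition hs_class ::
  "('k, 'r) ring_scheme \<Rightarrow> ('k, 'a, 's) module_scheme \<Rightarrow> nat \<Rightarrow>
   (arrow list \<times> ('a list \<Rightarrow> 'k) set \<Rightarrow> 'k) set \<Rightarrow> (arrow list \<times> ('a list \<Rightarrow> 'k) set \<Rightarrow> 'k) set set" where
  "hs_class k A i z = ca_boundaries k A i +>\<^bsub>CA k A i\<^esub> z"


section \<open>The Pontryagin product\<close>

definition ca_mult ::
  "('k, 'r) ring_scheme \<Rightarrow> ('k, 'a, 's) module_scheme \<Rightarrow> nat \<Rightarrow>
   (arrow list \<times> ('a list \<Rightarrow> 'k) set \<Rightarrow> 'k) set \<Rightarrow> (arrow list \<times> ('a list \<Rightarrow> 'k) set \<Rightarrow> 'k) set \<Rightarrow>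
   (arrow list \<times> ('a list \<Rightarrow> 'k) set \<Rightarrow> 'k) set" where
  "ca_mult k A i x y =
     lin_lift k (CA k A i) (\<lambda>(F, V).
       lin_lift k (CA k A i) (\<lambda>(G, W).
         ca_gen k A i (map2 arr_prod F G) (tensor_concat k A (src (hd F)) (src (hd G)) V W)) y) x"

text \<open>Applies $s_{j_r}\cdots s_{j_1}$ to an element of degree \<open>i\<close>, for the list $j_1,\dots,j_r$.\<close>

primrec ca_degens ::
  "('k, 'r) ring_scheme \<Rightarrow> ('k, 'a, 's) module_scheme \<Rightarrow> nat \<Rightarrow> nat list \<Rightarrow>
   (arrow list \<times> ('a list \<Rightarrow> 'k) set \<Rightarrow> 'k) set \<Rightarrow> (arrow list \<times> ('a list \<Rightarrow> 'k) set \<Rightarrow> 'k) set" where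
  "ca_degens k A i [] x = x"
| "ca_degens k A i (j # js) x = ca_degens k A (Suc i) js (ca_degen k A i j x)"

text \<open>The Eilenberg-Zilber shuffle map followed by \<^const>\<open>ca_mult\<close>. A $(p,q)$-shuffle
  $\mu_1<\dots<\mu_p$, $\nu_1<\dots<\nu_q$ of $0,\dots,p+q-1$ is encoded by the set $S$ of the $\mu$'s;
  its term is $\mathrm{sgn}(\mu,\nu)\, s_{\nu_q}\cdots s_{\nu_1}x \cdot s_{\mu_p}\cdots s_{\mu_1}y$, and the sign is
  given by the number of inversions of $(\mu_1,\dots,\mu_p,\nu_1,\dots,\nu_q)$.\<close>

definition ca_shuffle_mult ::
  "('k, 'r) ring_scheme \<Rightarrow> ('k, 'a, 's) module_scheme \<Rightarrow> nat \<Rightarrow> nat \<Rightarrow>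
   (arrow list \<times> ('a list \<Rightarrow> 'k) set \<Rightarrow> 'k) set \<Rightarrow> (arrow list \<times> ('a list \<Rightarrow> 'k) set \<Rightarrow> 'k) set \<Rightarrow>
   (arrow list \<times> ('a list \<Rightarrow> 'k) set \<Rightarrow> 'k) set" where
  "ca_shuffle_mult k A p q x y =
     (\<Oplus>\<^bsub>CA k A (p + q)\<^esub>S\<in>{S. S \<subseteq> {..<p + q} \<and> card S = p}.
        alt_sign (CA k A (p + q)) (card {(m, n). m \<in> S \<and> n \<in> {..<p + q} - S \<and> n < m})
          (ca_mult k A (p + q)
            (ca_degens k A p (sorted_list_of_set ({..<p + q} - S)) x)
            (ca_degens k A q (sorted_list_of_set S) y)))"

definition pontryagin ::
  "('k, 'r) ring_scheme \<Rightarrow> ('k, 'a, 's) module_scheme \<Rightarrow> nat \<Rightarrow> nat \<Rightarrow>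
   (arrow list \<times> ('a list \<Rightarrow> 'k) set \<Rightarrow> 'k) set set \<Rightarrow> (arrow list \<times> ('a list \<Rightarrow> 'k) set \<Rightarrow> 'k) set set \<Rightarrow>
   (arrow list \<times> ('a list \<Rightarrow> 'k) set \<Rightarrow> 'k) set set" where
  "pontryagin k A p q X Y =
     the_elem ((\<lambda>(x, y). hs_class k A (p + q) (ca_shuffle_mult k A p q x y)) ` (X \<times> Y))"


section \<open>Graded commutative algebras\<close>

text \<open>A graded module is the family of its homogeneous parts, and a graded multiplication is
  given by its components in the individual bidegrees.\<close>

locale graded_comm_algebra =
  fixes k :: "('k, 'r) ring_scheme"
    and H :: "nat \<Rightarrow> ('k, 'm, 's) module_scheme"
    and mul :: "nat \<Rightarrow> nat \<Rightarrow> 'm \<Rightarrow> 'm \<Rightarrow> 'm"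
  assumes module: "module k (H n)"
    and bilinear: "module_bilinear k (H p) (H q) (H (p + q)) (mul p q)"
    and assoc: "\<lbrakk>x \<in> carrier (H p); y \<in> carrier (H q); z \<in> carrier (H r)\<rbrakk> \<Longrightarrow>
      mul (p + q) r (mul p q x y) z = mul p (q + r) x (mul q r y z)"
    and unital: "\<exists>e\<in>carrier (H 0). \<forall>p. \<forall>x\<in>carrier (H p). mul 0 p e x = x \<and> mul p 0 x e = x"
    and graded_comm: "\<lbrakk>x \<in> carrier (H p); y \<in> carrier (H q)\<rbrakk> \<Longrightarrow>
      mul p q x y = alt_sign (H (p + q)) (p * q) (mul q p y x)"

end

theory Submission
  imports Defs
begin

text \<open>The product exists already on the level of simplicial modules. Juxtaposition of arrows is a
strictly associative and unital monoidal structure on $\Delta S_+$, and the block transposition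
\<open>braiding\<close> is a natural isomorphism from \<open>f \<odot> g\<close> to \<open>g \<odot> f\<close>. Since the bar construction sends
juxtaposition to concatenation of tensors (\<open>bar_act_prod\<close>) and the block transposition to the swap
of the two tensor factors (\<open>bar_act_braiding\<close>), the degreewise multiplication \<open>ca_mult\<close> of $CA_*$ is
well defined, bilinear, strictly associative and unital, and commutes with faces and degeneracies.
It is not commutative, but it is simplicially homotopic to its opposite: the \<open>j\<close>-th prism follows
\<open>f \<odot> g\<close> up to and including the \<open>j\<close>-th arrow, then passes through the braiding, and then follows
\<open>g \<odot> f\<close>. The inner faces of adjacent prisms agree by naturality of the braiding, and the two
outermost faces are the two products; here the face that leaves a braiding at the start of the
chain is absorbed into the coefficients by the relation that defines the tensor product over
$\Delta S_+$.

The rest is the Eilenberg-Zilber theory of the shuffle sum. A \<open>(p,q)\<close>-shuffle is a lattice path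
with \<open>p\<close> steps in the first and \<open>q\<close> steps in the second direction, recorded by the set \<open>S\<close> of the
times of the first kind; the two iterated degeneracies that it prescribes are the pullbacks along
the two coordinate functions of the path, and the coordinate \<open>cnt S t\<close> is the number of elements of
\<open>S\<close> below \<open>t\<close>. Three properties carry the theorem.

 \<^item> The Leibniz rule \<open>shuffle_leibniz\<close>: the face that removes a vertex at which the path turns is
   the same for the path with the opposite corner, which has the opposite sign, so these
   faces cancel; the face that removes a vertex at which the path goes straight on (or an end
   vertex) removes one step of \<open>x\<close> or one step of \<open>y\<close>. Hence products of cycles are cycles, and products
   of a cycle and a boundary are boundaries.
 \<^item> Associativity (\<open>shuffle_product_assoc\<close>): both bracketings are the same sum over ordered
   partitions of the steps into three sets. It holds on chains, as does unitality.
 \<^item> Symmetry (\<open>shuffle_sum_flip\<close>): passing from \<open>S\<close> to its complement changes the sign of the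
   shuffle by $(-1)^{pq}$. So the shuffle product of \<open>y\<close> and \<open>x\<close> is, up to that sign, the shuffle
   sum of \<open>x\<close> and \<open>y\<close> for the opposite of \<open>ca_mult\<close>.

The Leibniz rule is proved for an arbitrary bilinear map in place of \<open>ca_mult\<close>. Applied to the
homotopy between \<open>ca_mult\<close> and its opposite, it shows that the error term of the homotopy vanishes on
cycles, so that the two products of cycles differ by an explicit boundary
(\<open>shuffle_product_commute\<close>). This is graded commutativity.

Two devices keep the verifications finite. All modules in sight are given by generators and
relators, so that maps are constructed and compared on generators (\<open>lin_lift_hom\<close>, \<open>bilin_lift\<close>,
\<open>CA_bilinear_eqI\<close>). Arrows are encoded by their blocks, the lists of source letters that are
multiplied into the letters of the target; this turns identities between arrows, whose composition
is defined by a unique-existence condition, into identities between lists of lists.\<close>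

section \<open>Free, quotient and presented modules\<close>

lemma module_cring: "module k M \<Longrightarrow> cring k" by (rule module.axioms)
lemma module_group: "module k M \<Longrightarrow> abelian_group M" by (rule module.axioms)
lemma free_mod_simps:
  "carrier (free_mod k X) = {c. (\<forall>x. c x \<in> carrier k) \<and> (\<forall>x. x \<notin> X \<longrightarrow> c x = \<zero>\<^bsub>k\<^esub>) \<and> finite {x. c x \<noteq> \<zero>\<^bsub>k\<^esub>}}"
  "\<zero>\<^bsub>free_mod k X\<^esub> = (\<lambda>x. \<zero>\<^bsub>k\<^esub>)"
  "c \<oplus>\<^bsub>free_mod k X\<^esub> d = (\<lambda>x. c x \<oplus>\<^bsub>k\<^esub> d x)"
  "r \<odot>\<^bsub>free_mod k X\<^esub> c = (\<lambda>x. r \<otimes>\<^bsub>k\<^esub> c x)"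
  by (simp_all add: free_mod_def)

lemma module_free_mod:
  fixes k :: "('k, 'r) ring_scheme" (structure) and X :: "'x set"
  assumes "cring k"
  shows "module k (free_mod k X)"
proof -
  interpret cring k by fact
  have add: "finite {x. c x \<oplus> d x \<noteq> \<zero>}"
    if "finite {x. c x \<noteq> \<zero>}" "finite {x. d x \<noteq> \<zero>}" "\<forall>x. c x \<in> carrier k" "\<forall>x. d x \<in> carrier k"
    for c d :: "'x \<Rightarrow> 'k"
    by (rule finite_subset[OF _ finite_UnI[OF that(1,2)]]) auto
  have sm: "finite {x. r \<otimes> c x \<noteq> \<zero>}"
    if "finite {x. c x \<noteq> \<zero>}" "r \<in> carrier k" for r and c :: "'x \<Rightarrow> 'k"
    by (rule finite_subset[OF _ that(1)]) (auto simp: that(2))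
  show ?thesis
  proof (rule moduleI)
    show "abelian_group (free_mod k X)"
    proof (rule abelian_groupI)
      fix c assume c: "c \<in> carrier (free_mod k X)"
      have "{x. \<ominus> c x \<noteq> \<zero>} \<subseteq> {x. c x \<noteq> \<zero>}" by auto
      then have "finite {x. \<ominus> c x \<noteq> \<zero>}"
        using c by (auto simp: free_mod_simps intro: finite_subset)
      then have "(\<lambda>x. \<ominus> c x) \<in> carrier (free_mod k X)" using c by (auto simp: free_mod_simps)
      moreover have "(\<lambda>x. \<ominus> c x) \<oplus>\<^bsub>free_mod k X\<^esub> c = \<zero>\<^bsub>free_mod k X\<^esub>"
        using c by (auto simp: free_mod_simps fun_eq_iff l_neg)
      ultimately show "\<exists>d\<in>carrier (free_mod k X). d \<oplus>\<^bsub>free_mod k X\<^esub> c = \<zero>\<^bsub>free_mod k X\<^esub>"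
        by blast
    qed (auto simp: free_mod_simps fun_eq_iff add a_ac)
  qed (auto simp: free_mod_simps fun_eq_iff add sm l_distr r_distr m_assoc assms)
qed

lemma basis_elt_closed:
  "cring k \<Longrightarrow> x \<in> X \<Longrightarrow> basis_elt k x \<in> carrier (free_mod k X)"
  by (auto simp: free_mod_simps basis_elt_def cring.cring_simprules
      intro: finite_subset[of _ "{x}"])

text \<open>The induction principle behind all uniqueness statements: a linear map is determined by its values
on the basis.\<close>

lemma free_mod_induct [consumes 2, case_names zero step]:
  fixes k (structure)
  assumes k: "cring k" and c: "c \<in> carrier (free_mod k X)"
    and zero: "P \<zero>\<^bsub>free_mod k X\<^esub>"
    and step: "\<And>c r x. \<lbrakk>c \<in> carrier (free_mod k X); P c; r \<in> carrier k; x \<in> X\<rbrakk> \<Longrightarrow>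
      P (c \<oplus>\<^bsub>free_mod k X\<^esub> r \<odot>\<^bsub>free_mod k X\<^esub> basis_elt k x)"
  shows "P c"
proof -
  interpret cring k by fact
  have fin: "finite {x. c x \<noteq> \<zero>}" using c by (simp add: free_mod_simps)
  have "\<And>d. d \<in> carrier (free_mod k X) \<Longrightarrow> {x. d x \<noteq> \<zero>} = B \<Longrightarrow> P d" if "finite B" for B
    using that
  proof (induction B rule: finite_induct)
    case empty
    then have "d = \<zero>\<^bsub>free_mod k X\<^esub>" by (auto simp: free_mod_simps)
    then show ?case using zero by simp
  next
    case (insert x F)
    let ?d = "d(x := \<zero>)"
    have supp: "{y. ?d y \<noteq> \<zero>} = F" using insert.prems(2) insert.hyps(2) by auto
    have d': "?d \<in> carrier (free_mod k X)"
      using insert.prems(1) supp insert.hyps(1) by (auto simp: free_mod_simps)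
    have "P ?d" by (rule insert.IH[OF d' supp])
    moreover have "d x \<in> carrier k" "x \<in> X" using insert.prems
      by (auto simp: free_mod_simps)
    ultimately have "P (?d \<oplus>\<^bsub>free_mod k X\<^esub> d x \<odot>\<^bsub>free_mod k X\<^esub> basis_elt k x)"
      using step d' by blast
    moreover have "?d \<oplus>\<^bsub>free_mod k X\<^esub> d x \<odot>\<^bsub>free_mod k X\<^esub> basis_elt k x = d"
      using insert.prems(1) by (auto simp: free_mod_simps basis_elt_def fun_eq_iff)
    ultimately show ?case by simp
  qed
  then show ?thesis using c fin by blast
qed

lemma module_homD:
  assumes "h \<in> module_hom k M N"
  shows "x \<in> carrier M \<Longrightarrow> h x \<in> carrier N"
    and "x \<in> carrier M \<Longrightarrow> y \<in> carrier M \<Longrightarrow> h (x \<oplus>\<^bsub>M\<^esub> y) = h x \<oplus>\<^bsub>N\<^esub> h y"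
    and "r \<in> carrier k \<Longrightarrow> x \<in> carrier M \<Longrightarrow> h (r \<odot>\<^bsub>M\<^esub> x) = r \<odot>\<^bsub>N\<^esub> h x"
  using assms by (auto simp: module_hom_def)

lemma module_homI:
  assumes "\<And>x. x \<in> carrier M \<Longrightarrow> h x \<in> carrier N"
    and "\<And>x y. x \<in> carrier M \<Longrightarrow> y \<in> carrier M \<Longrightarrow> h (x \<oplus>\<^bsub>M\<^esub> y) = h x \<oplus>\<^bsub>N\<^esub> h y"
    and "\<And>r x. r \<in> carrier k \<Longrightarrow> x \<in> carrier M \<Longrightarrow> h (r \<odot>\<^bsub>M\<^esub> x) = r \<odot>\<^bsub>N\<^esub> h x"
  shows "h \<in> module_hom k M N"
  using assms by (auto simp: module_hom_def)

lemma module_hom_cong: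
  assumes "h \<in> module_hom k M N" and "module k M" and "\<And>x. x \<in> carrier M \<Longrightarrow> g x = h x"
  shows "g \<in> module_hom k M N"
proof -
  interpret module k M by fact
  show ?thesis using assms by (auto simp: module_hom_def)
qed

lemma module_hom_group_hom:
  assumes "h \<in> module_hom k M N" "module k M" "module k N"
  shows "abelian_group_hom M N h"
proof -
  interpret M: module k M by fact
  interpret N: module k N by fact
  show ?thesis
    by (rule abelian_group_homI)
       (use assms in \<open>auto intro!: group_hom.intro M.abelian_group_axioms N.abelian_group_axioms
          group_hom_axioms.intro simp: hom_def module_hom_def M.add.is_group N.add.is_group\<close>)
qed

lemma module_hom_zero:
  "h \<in> module_hom k M N \<Longrightarrow> module k M \<Longrightarrow> module k N \<Longrightarrow> h \<zero>\<^bsub>M\<^esub> = \<zero>\<^bsub>N\<^esub>"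
  by (rule abelian_group_hom.hom_zero[OF module_hom_group_hom])

lemma module_hom_neg:
  "h \<in> module_hom k M N \<Longrightarrow> module k M \<Longrightarrow> module k N \<Longrightarrow> x \<in> carrier M \<Longrightarrow>
   h (\<ominus>\<^bsub>M\<^esub> x) = \<ominus>\<^bsub>N\<^esub> h x"
  by (rule abelian_group_hom.hom_a_inv[OF module_hom_group_hom])

lemma module_hom_minus:
  assumes "h \<in> module_hom k M N" "module k M" "module k N" "x \<in> carrier M" "y \<in> carrier M"
  shows "h (x \<ominus>\<^bsub>M\<^esub> y) = h x \<ominus>\<^bsub>N\<^esub> h y"
proof -
  interpret M: module k M by fact
  show ?thesis using assms
    by (simp add: a_minus_def module_homD(2)[OF assms(1)] module_hom_neg[OF assms(1-3)])
qed

lemma module_hom_finsum: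
  assumes h: "h \<in> module_hom k M N" and M: "module k M" and N: "module k N"
    and f: "\<And>i. i \<in> I \<Longrightarrow> f i \<in> carrier M"
  shows "h (\<Oplus>\<^bsub>M\<^esub>i\<in>I. f i) = (\<Oplus>\<^bsub>N\<^esub>i\<in>I. h (f i))"
proof (cases "finite I")
  interpret M: module k M by fact
  interpret N: module k N by fact
  case True
  then show ?thesis using f
    by (induction I) (auto simp: module_hom_zero[OF h M N] module_homD[OF h] Pi_iff)
next
  interpret M: module k M by fact
  interpret N: module k N by fact
  case False
  then show ?thesis by (simp add: module_hom_zero[OF h M N])
qed

lemma module_hom_comp:
  assumes "h \<in> module_hom k N P" "g \<in> module_hom k M N"
  shows "(\<lambda>x. h (g x)) \<in> module_hom k M P"
  using assms by (auto simp: module_hom_def Pi_iff)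

lemma module_hom_id: "(\<lambda>x. x) \<in> module_hom k M M"
  by (auto simp: module_hom_def)

lemma module_hom_const_zero:
  assumes "module k N"
  shows "(\<lambda>x. \<zero>\<^bsub>N\<^esub>) \<in> module_hom k M N"
proof -
  interpret module k N by fact
  show ?thesis by (auto simp: module_hom_def)
qed

lemma module_hom_add:
  assumes N: "module k N" and h: "h \<in> module_hom k M N" "g \<in> module_hom k M N"
  shows "(\<lambda>x. h x \<oplus>\<^bsub>N\<^esub> g x) \<in> module_hom k M N"
proof -
  interpret module k N by fact
  show ?thesis using h
    by (auto simp: module_hom_def Pi_iff smult_r_distr M.a_ac)
qed

lemma module_hom_smult:
  assumes N: "module k N" and h: "h \<in> module_hom k M N" and r: "r \<in> carrier k"
  shows "(\<lambda>x. r \<odot>\<^bsub>N\<^esub> h x) \<in> module_hom k M N"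
proof -
  interpret module k N by fact
  show ?thesis using h r
    by (auto simp: module_hom_def Pi_iff smult_r_distr smult_assoc1[symmetric] R.m_comm)
qed

lemma module_hom_uminus:
  assumes N: "module k N" and h: "h \<in> module_hom k M N"
  shows "(\<lambda>x. \<ominus>\<^bsub>N\<^esub> h x) \<in> module_hom k M N"
proof -
  interpret module k N by fact
  show ?thesis using h
    by (auto simp: module_hom_def Pi_iff smult_r_minus M.minus_add)
qed

lemma module_hom_sum:
  assumes M: "module k M" and N: "module k N" and h: "\<And>i. i \<in> I \<Longrightarrow> h i \<in> module_hom k M N"
  shows "(\<lambda>x. \<Oplus>\<^bsub>N\<^esub>i\<in>I. h i x) \<in> module_hom k M N"
proof (cases "finite I")
  interpret module k N by fact
  case True
  then show ?thesis using h
  proof (induction I)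
    case empty
    then show ?case by (simp add: module_hom_const_zero N)
  next
    case (insert i I)
    have "(\<lambda>x. h i x \<oplus>\<^bsub>N\<^esub> (\<Oplus>\<^bsub>N\<^esub>i\<in>I. h i x)) \<in> module_hom k M N"
      by (rule module_hom_add[OF N]) (use insert in auto)
    moreover have "(\<Oplus>\<^bsub>N\<^esub>i\<in>insert i I. h i x) = h i x \<oplus>\<^bsub>N\<^esub> (\<Oplus>\<^bsub>N\<^esub>i\<in>I. h i x)"
      if "x \<in> carrier M" for x
      using insert.hyps insert.prems that
      by (intro M.finsum_insert) (auto intro: module_homD(1))
    ultimately show ?case by (rule module_hom_cong[OF _ M])
  qed
next
  interpret module k N by fact
  case False
  then show ?thesis by (simp add: module_hom_const_zero N)
qed

text \<open>The support of a sum is smaller than the union of the supports when coefficients cancel; allowing any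
finite index set above the support makes additivity of \<open>lin_ext\<close> termwise.\<close>

lemma lin_ext_superset:
  fixes k (structure)
  assumes M: "module k M" and c: "c \<in> carrier (free_mod k X)"
    and \<phi>: "\<And>x. x \<in> X \<Longrightarrow> \<phi> x \<in> carrier M"
    and B: "finite B" "{x. c x \<noteq> \<zero>} \<subseteq> B" "B \<subseteq> X"
  shows "lin_ext k M \<phi> c = (\<Oplus>\<^bsub>M\<^esub>x\<in>B. c x \<odot>\<^bsub>M\<^esub> \<phi> x)"
proof -
  interpret module k M by fact
  show ?thesis unfolding lin_ext_def
    by (rule M.add.finprod_mono_neutral_cong_left)
       (use B \<phi> c in \<open>auto simp: free_mod_simps Pi_iff intro!: smult_l_null\<close>)
qed

lemma lin_ext_hom:
  fixes k (structure)
  assumes M: "module k M" and \<phi>: "\<And>x. x \<in> X \<Longrightarrow> \<phi> x \<in> carrier M"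
  shows "lin_ext k M \<phi> \<in> module_hom k (free_mod k X) M"
proof (rule module_homI)
  interpret module k M by fact
  interpret F: module k "free_mod k X" by (rule module_free_mod) (rule R.is_cring)
  note sup = lin_ext_superset[OF M _ \<phi>]
  have supp: "finite {x. c x \<noteq> \<zero>}" "{x. c x \<noteq> \<zero>} \<subseteq> X" if "c \<in> carrier (free_mod k X)" for c
    using that by (auto simp: free_mod_simps)
  have cl: "c x \<in> carrier k" if "c \<in> carrier (free_mod k X)" for c x
    using that by (auto simp: free_mod_simps)
  fix c assume c: "c \<in> carrier (free_mod k X)"
  show "lin_ext k M \<phi> c \<in> carrier M"
    using supp[OF c] \<phi> cl[OF c] by (subst sup[OF c _ _ order.refl]) (auto intro!: M.finsum_closed)
  { fix d assume d: "d \<in> carrier (free_mod k X)"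
    let ?B = "{x. c x \<noteq> \<zero>} \<union> {x. d x \<noteq> \<zero>}"
    have B: "finite ?B" "?B \<subseteq> X" using supp[OF c] supp[OF d] by auto
    have "lin_ext k M \<phi> (c \<oplus>\<^bsub>free_mod k X\<^esub> d) = (\<Oplus>\<^bsub>M\<^esub>x\<in>?B. (c x \<oplus> d x) \<odot>\<^bsub>M\<^esub> \<phi> x)"
      by (subst sup[OF F.a_closed[OF c d] _ B(1) _ B(2)]) (use c d in \<open>auto simp: free_mod_simps\<close>)
    also have "\<dots> = (\<Oplus>\<^bsub>M\<^esub>x\<in>?B. c x \<odot>\<^bsub>M\<^esub> \<phi> x \<oplus>\<^bsub>M\<^esub> d x \<odot>\<^bsub>M\<^esub> \<phi> x)"
      using B(2) \<phi> cl[OF c] cl[OF d]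
      by (intro M.finsum_cong' refl) (auto simp: smult_l_distr subset_iff)
    also have "\<dots> = (\<Oplus>\<^bsub>M\<^esub>x\<in>?B. c x \<odot>\<^bsub>M\<^esub> \<phi> x) \<oplus>\<^bsub>M\<^esub> (\<Oplus>\<^bsub>M\<^esub>x\<in>?B. d x \<odot>\<^bsub>M\<^esub> \<phi> x)"
      using B(2) \<phi> cl[OF c] cl[OF d] by (intro M.finsum_addf) (auto simp: subset_iff)
    also have "\<dots> = lin_ext k M \<phi> c \<oplus>\<^bsub>M\<^esub> lin_ext k M \<phi> d"
      by (simp only: sup[OF c _ B(1) _ B(2)] sup[OF d _ B(1) _ B(2)] Un_upper1 Un_upper2)
    finally show "lin_ext k M \<phi> (c \<oplus>\<^bsub>free_mod k X\<^esub> d) = lin_ext k M \<phi> c \<oplus>\<^bsub>M\<^esub> lin_ext k M \<phi> d" . }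
  fix r assume r: "r \<in> carrier k"
  let ?B = "{x. c x \<noteq> \<zero>}"
  note B = supp[OF c]
  have "lin_ext k M \<phi> (r \<odot>\<^bsub>free_mod k X\<^esub> c) = (\<Oplus>\<^bsub>M\<^esub>x\<in>?B. (r \<otimes> c x) \<odot>\<^bsub>M\<^esub> \<phi> x)"
    by (subst sup[OF F.smult_closed[OF r c] _ B(1) _ B(2)]) (use c r in \<open>auto simp: free_mod_simps\<close>)
  also have "\<dots> = (\<Oplus>\<^bsub>M\<^esub>x\<in>?B. r \<odot>\<^bsub>M\<^esub> (c x \<odot>\<^bsub>M\<^esub> \<phi> x))"
    using B(2) \<phi> cl[OF c] r
    by (intro M.finsum_cong' refl) (auto simp: smult_assoc1 subset_iff)
  also have "\<dots> = r \<odot>\<^bsub>M\<^esub> (\<Oplus>\<^bsub>M\<^esub>x\<in>?B. c x \<odot>\<^bsub>M\<^esub> \<phi> x)"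
    using B \<phi> cl[OF c] r by (intro finsum_smult_ldistr[symmetric]) (auto simp: subset_iff)
  finally show "lin_ext k M \<phi> (r \<odot>\<^bsub>free_mod k X\<^esub> c) = r \<odot>\<^bsub>M\<^esub> lin_ext k M \<phi> c"
    by (simp add: lin_ext_def)
qed

lemma lin_ext_basis:
  fixes k (structure)
  assumes M: "module k M" and x: "\<phi> x \<in> carrier M"
  shows "lin_ext k M \<phi> (basis_elt k x) = \<phi> x"
proof -
  interpret module k M by fact
  have "basis_elt k x \<in> carrier (free_mod k {x})" by (rule basis_elt_closed) (auto intro: R.is_cring)
  then have "lin_ext k M \<phi> (basis_elt k x) = (\<Oplus>\<^bsub>M\<^esub>y\<in>{x}. basis_elt k x y \<odot>\<^bsub>M\<^esub> \<phi> y)"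
    by (rule lin_ext_superset[OF M]) (use x in \<open>auto simp: basis_elt_def\<close>)
  also have "\<dots> = basis_elt k x x \<odot>\<^bsub>M\<^esub> \<phi> x \<oplus>\<^bsub>M\<^esub> \<zero>\<^bsub>M\<^esub>"
    using x by (subst M.finsum_insert) (auto simp: basis_elt_def)
  finally show ?thesis using x by (simp add: basis_elt_def)
qed

lemma submodule_span:
  assumes M: "module k M" and S: "S \<subseteq> carrier M"
  shows "submodule (submod_span k M S) k M" and "S \<subseteq> submod_span k M S"
proof -
  interpret module k M by fact
  let ?U = "{N. submodule N k M \<and> S \<subseteq> N}"
  have car: "carrier M \<in> ?U" using S carrier_is_submodule by auto
  show "submodule (submod_span k M S) k M" unfolding submod_span_def
  proof (rule submoduleI)
    show "\<Inter> ?U \<subseteq> carrier M" using car by blast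
    show "\<zero>\<^bsub>M\<^esub> \<in> \<Inter> ?U" using submodule.axioms(1) subgroup.one_closed by fastforce
  qed (auto dest: submoduleE(3,4,5))
  show "S \<subseteq> submod_span k M S" unfolding submod_span_def by blast
qed

lemma submod_span_least: "submodule N k M \<Longrightarrow> S \<subseteq> N \<Longrightarrow> submod_span k M S \<subseteq> N"
  unfolding submod_span_def by blast

lemma submodule_abelian_subgroup:
  assumes M: "module k M" and N: "submodule N k M"
  shows "abelian_subgroup N M"
  by (rule abelian_subgroupI3)
     (use M N in \<open>auto simp: additive_subgroup_def submodule_def module_group\<close>)

lemma submodule_kernel:
  assumes h: "h \<in> module_hom k M N" and M: "module k M" and N: "module k N"
  shows "submodule {x \<in> carrier M. h x = \<zero>\<^bsub>N\<^esub>} k M"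
proof -
  interpret M: module k M by fact
  interpret N: module k N by fact
  show ?thesis
    by (rule M.submoduleI)
       (auto simp: module_hom_zero[OF h M N] module_hom_neg[OF h M N] module_homD[OF h])
qed

lemma submodule_image:
  assumes h: "h \<in> module_hom k M N" and M: "module k M" and N: "module k N"
  shows "submodule (h ` carrier M) k N"
proof -
  interpret M: module k M by fact
  interpret N: module k N by fact
  show ?thesis
  proof (rule N.submoduleI)
    show "\<zero>\<^bsub>N\<^esub> \<in> h ` carrier M"
      using module_hom_zero[OF h M N] by (intro image_eqI[of _ h "\<zero>\<^bsub>M\<^esub>"]) simp_all
    show "\<ominus>\<^bsub>N\<^esub> a \<in> h ` carrier M" if "a \<in> h ` carrier M" for a
      using that by (auto simp: module_hom_neg[OF h M N, symmetric])
    show "a \<oplus>\<^bsub>N\<^esub> b \<in> h ` carrier M" if "a \<in> h ` carrier M" "b \<in> h ` carrier M" for a b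
      using that by (auto simp: module_homD(2)[OF h, symmetric])
    show "a \<odot>\<^bsub>N\<^esub> b \<in> h ` carrier M" if "a \<in> carrier k" "b \<in> h ` carrier M" for a b
      using that by (auto simp: module_homD(3)[OF h, symmetric])
  qed (auto simp: module_homD(1)[OF h])
qed

lemma quot_mod_simps:
  "carrier (quot_mod M N) = (\<lambda>x. N +>\<^bsub>M\<^esub> x) ` carrier M"
  "\<zero>\<^bsub>quot_mod M N\<^esub> = N"
  "C \<oplus>\<^bsub>quot_mod M N\<^esub> D = C <+>\<^bsub>M\<^esub> D"
  "r \<odot>\<^bsub>quot_mod M N\<^esub> C = (\<Union>x\<in>C. N +>\<^bsub>M\<^esub> (r \<odot>\<^bsub>M\<^esub> x))"
  by (auto simp: quot_mod_def A_RCOSETS_def RCOSETS_def a_r_coset_def)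

context
  fixes k (structure) and M :: "('a, 'b, 's) module_scheme" and N
  assumes M: "module k M" and N: "submodule N k M"
begin

interpretation module k M by (rule M)
interpretation N: abelian_subgroup N M by (rule submodule_abelian_subgroup[OF M N])

lemma coset_eq_iff:
  assumes "x \<in> carrier M" "y \<in> carrier M"
  shows "N +>\<^bsub>M\<^esub> x = N +>\<^bsub>M\<^esub> y \<longleftrightarrow> x \<ominus>\<^bsub>M\<^esub> y \<in> N"
proof
  assume "N +>\<^bsub>M\<^esub> x = N +>\<^bsub>M\<^esub> y"
  then have "x \<in> N +>\<^bsub>M\<^esub> y" using assms N.a_rcos_self by blast
  then show "x \<ominus>\<^bsub>M\<^esub> y \<in> N" using assms N.a_rcos_module by (simp add: a_minus_def)
next
  assume "x \<ominus>\<^bsub>M\<^esub> y \<in> N"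
  then have "x \<in> N +>\<^bsub>M\<^esub> y" using assms N.a_rcos_module by (simp add: a_minus_def)
  then show "N +>\<^bsub>M\<^esub> x = N +>\<^bsub>M\<^esub> y" using assms N.a_repr_independence' by blast
qed

lemma coset_add:
  "x \<in> carrier M \<Longrightarrow> y \<in> carrier M \<Longrightarrow>
   (N +>\<^bsub>M\<^esub> x) \<oplus>\<^bsub>quot_mod M N\<^esub> (N +>\<^bsub>M\<^esub> y) = N +>\<^bsub>M\<^esub> (x \<oplus>\<^bsub>M\<^esub> y)"
  by (simp add: quot_mod_simps N.a_rcos_sum)

lemma coset_smult:
  assumes r: "r \<in> carrier k" and x: "x \<in> carrier M"
  shows "r \<odot>\<^bsub>quot_mod M N\<^esub> (N +>\<^bsub>M\<^esub> x) = N +>\<^bsub>M\<^esub> (r \<odot>\<^bsub>M\<^esub> x)"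
proof -
  have "N +>\<^bsub>M\<^esub> (r \<odot>\<^bsub>M\<^esub> y) = N +>\<^bsub>M\<^esub> (r \<odot>\<^bsub>M\<^esub> x)" if y: "y \<in> N +>\<^bsub>M\<^esub> x" for y
  proof -
    have yc: "y \<in> carrier M" using y x N.a_elemrcos_carrier by blast
    have "y \<ominus>\<^bsub>M\<^esub> x \<in> N" using y x yc N.a_rcos_module by (simp add: a_minus_def)
    then have "r \<odot>\<^bsub>M\<^esub> (y \<ominus>\<^bsub>M\<^esub> x) \<in> N" using r submoduleE(4)[OF N] by blast
    moreover have "r \<odot>\<^bsub>M\<^esub> (y \<ominus>\<^bsub>M\<^esub> x) = r \<odot>\<^bsub>M\<^esub> y \<ominus>\<^bsub>M\<^esub> r \<odot>\<^bsub>M\<^esub> x"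
      using r x yc by (simp add: a_minus_def smult_r_distr smult_r_minus)
    ultimately show ?thesis using r x yc by (simp add: coset_eq_iff)
  qed
  moreover have "x \<in> N +>\<^bsub>M\<^esub> x" using x N.a_rcos_self by blast
  ultimately show ?thesis unfolding quot_mod_simps by blast
qed

lemma module_quot_mod: "module k (quot_mod M N)"
proof (rule moduleI)
  have zero: "\<zero>\<^bsub>quot_mod M N\<^esub> = N +>\<^bsub>M\<^esub> \<zero>\<^bsub>M\<^esub>"
    by (simp add: quot_mod_simps N.a_subset)
  show "abelian_group (quot_mod M N)"
  proof (rule abelian_groupI)
    fix C assume "C \<in> carrier (quot_mod M N)"
    then obtain x where x: "x \<in> carrier M" "C = N +>\<^bsub>M\<^esub> x" by (auto simp: quot_mod_simps(1))
    then show "\<exists>D\<in>carrier (quot_mod M N). D \<oplus>\<^bsub>quot_mod M N\<^esub> C = \<zero>\<^bsub>quot_mod M N\<^esub>"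
      by (intro bexI[of _ "N +>\<^bsub>M\<^esub> (\<ominus>\<^bsub>M\<^esub> x)"])
         (simp_all add: coset_add M.l_neg zero, simp add: quot_mod_simps(1))
  qed (auto simp: zero coset_add quot_mod_simps(1) M.a_ac)
qed (auto simp: coset_add coset_smult quot_mod_simps(1) smult_l_distr smult_r_distr smult_assoc1
     intro!: R.is_cring)

lemma coset_hom: "(\<lambda>x. N +>\<^bsub>M\<^esub> x) \<in> module_hom k M (quot_mod M N)"
  by (rule module_homI) (simp_all add: coset_add coset_smult, simp add: quot_mod_simps(1))

text \<open>A linear map that vanishes on \<open>N\<close> takes one value on each coset, which is what the choice of
\<open>the_elem\<close> in \<open>lin_lift\<close> relies on.\<close>

lemma the_elem_coset_image:
  assumes Q: "module k Q" and h: "h \<in> module_hom k M Q" and van: "\<And>x. x \<in> N \<Longrightarrow> h x = \<zero>\<^bsub>Q\<^esub>"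
    and x: "x \<in> carrier M"
  shows "the_elem (h ` (N +>\<^bsub>M\<^esub> x)) = h x"
proof -
  interpret Q: module k Q by fact
  have "h y = h x" if y: "y \<in> N +>\<^bsub>M\<^esub> x" for y
  proof -
    obtain n where n: "n \<in> N" "y = n \<oplus>\<^bsub>M\<^esub> x" using y by (auto simp: a_r_coset_def')
    then show ?thesis
      using x van[OF n(1)] N.a_Hcarr[OF n(1)] module_homD[OF h] by (auto)
  qed
  moreover have "x \<in> N +>\<^bsub>M\<^esub> x" using x N.a_rcos_self by blast
  ultimately have "h ` (N +>\<^bsub>M\<^esub> x) = {h x}" by blast
  then show ?thesis by (metis the_elem_eq)
qed

end


lemma module_hom_diff_zeroD:
  assumes "h \<in> module_hom k M N" "module k M" "module k N" "x \<in> carrier M" "y \<in> carrier M"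
    and "h (x \<ominus>\<^bsub>M\<^esub> y) = \<zero>\<^bsub>N\<^esub>"
  shows "h x = h y"
proof -
  interpret N: module k N by fact
  have "h x \<ominus>\<^bsub>N\<^esub> h y = \<zero>\<^bsub>N\<^esub>" using module_hom_minus[OF assms(1-5)] assms(6) by simp
  moreover have "h x \<in> carrier N" "h y \<in> carrier N" using assms by (auto intro: module_homD(1))
  ultimately show ?thesis using N.M.minus_equality[of "h x" "\<ominus>\<^bsub>N\<^esub> h y"] by (simp add: a_minus_def)
qed

lemma lin_ext_cong:
  fixes k (structure)
  assumes "module k M" "c \<in> carrier (free_mod k X)" "\<And>x. x \<in> X \<Longrightarrow> \<phi> x = \<psi> x"
    and "\<And>x. x \<in> X \<Longrightarrow> \<psi> x \<in> carrier M"
  shows "lin_ext k M \<phi> c = lin_ext k M \<psi> c"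
proof -
  interpret module k M by fact
  show ?thesis unfolding lin_ext_def
  proof (rule M.finsum_cong')
    show "c x \<odot>\<^bsub>M\<^esub> \<phi> x = c x \<odot>\<^bsub>M\<^esub> \<psi> x" if "x \<in> {x. c x \<noteq> \<zero>}" for x
      using that assms by (cases "x \<in> X") (auto simp: free_mod_simps)
    show "(\<lambda>x. c x \<odot>\<^bsub>M\<^esub> \<psi> x) \<in> {x. c x \<noteq> \<zero>} \<rightarrow> carrier M"
    proof
      show "c x \<odot>\<^bsub>M\<^esub> \<psi> x \<in> carrier M" if "x \<in> {x. c x \<noteq> \<zero>}" for x
        using that assms by (cases "x \<in> X") (auto simp: free_mod_simps)
    qed
  qed simp
qed

text \<open>For fixed coefficients, \<open>lin_ext\<close> is a linear combination of its values on generators, so it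
inherits linearity in any parameter from them. This is how linearity in the second argument passes
through the lifting in the first argument in \<open>bilin_lift\<close>.\<close>

lemma lin_ext_hom_parameter:
  fixes k (structure)
  assumes Q: "module k Q" and M: "module k M" and c: "c \<in> carrier (free_mod k X)"
    and h: "\<And>x. x \<in> X \<Longrightarrow> \<phi> x \<in> module_hom k Q M"
  shows "(\<lambda>q. lin_ext k M (\<lambda>x. \<phi> x q) c) \<in> module_hom k Q M"
  unfolding lin_ext_def
  by (rule module_hom_sum[OF Q M], rule module_hom_smult[OF M], rule h)
     (use c in \<open>auto simp: free_mod_simps\<close>)

text \<open>The three shapes of relators that occur in tensor powers and in $CA_*$: additivity, homogeneity
and equality of two generators.\<close>

lemma lin_ext_additive_relator:
  assumes M: "module k M" and \<phi>: "\<And>x. x \<in> X \<Longrightarrow> \<phi> x \<in> carrier M"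
    and X: "a \<in> X" "b \<in> X" "c \<in> X" and eq: "\<phi> a = \<phi> b \<oplus>\<^bsub>M\<^esub> \<phi> c"
  shows "lin_ext k M \<phi> (basis_elt k a \<ominus>\<^bsub>free_mod k X\<^esub> (basis_elt k b \<oplus>\<^bsub>free_mod k X\<^esub> basis_elt k c)) = \<zero>\<^bsub>M\<^esub>"
proof -
  interpret M: module k M by fact
  interpret F: module k "free_mod k X" by (rule module_free_mod[OF module_cring[OF M]])
  note b = basis_elt_closed[OF module_cring[OF M]]
  note h = lin_ext_hom[OF M \<phi>, of X]
  show ?thesis using X eq \<phi>
    by (simp add: module_hom_neg[OF h F.module_axioms M] module_homD(2)[OF h] b lin_ext_basis[OF M]
         a_minus_def M.M.r_neg)
qed

lemma lin_ext_scalar_relator: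
  assumes M: "module k M" and \<phi>: "\<And>x. x \<in> X \<Longrightarrow> \<phi> x \<in> carrier M"
    and X: "a \<in> X" "b \<in> X" "r \<in> carrier k" and eq: "\<phi> a = r \<odot>\<^bsub>M\<^esub> \<phi> b"
  shows "lin_ext k M \<phi> (basis_elt k a \<ominus>\<^bsub>free_mod k X\<^esub> (r \<odot>\<^bsub>free_mod k X\<^esub> basis_elt k b)) = \<zero>\<^bsub>M\<^esub>"
proof -
  interpret M: module k M by fact
  interpret F: module k "free_mod k X" by (rule module_free_mod[OF module_cring[OF M]])
  note b = basis_elt_closed[OF module_cring[OF M]]
  note h = lin_ext_hom[OF M \<phi>, of X]
  show ?thesis using X eq \<phi>
    by (simp add: module_hom_neg[OF h F.module_axioms M] module_homD(2)[OF h] b module_homD(3)[OF h] lin_ext_basis[OF M]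
         a_minus_def M.M.r_neg)
qed

lemma lin_ext_equality_relator:
  assumes M: "module k M" and \<phi>: "\<And>x. x \<in> X \<Longrightarrow> \<phi> x \<in> carrier M"
    and X: "a \<in> X" "b \<in> X" and eq: "\<phi> a = \<phi> b"
  shows "lin_ext k M \<phi> (basis_elt k a \<ominus>\<^bsub>free_mod k X\<^esub> basis_elt k b) = \<zero>\<^bsub>M\<^esub>"
proof -
  interpret M: module k M by fact
  interpret F: module k "free_mod k X" by (rule module_free_mod[OF module_cring[OF M]])
  note b = basis_elt_closed[OF module_cring[OF M]]
  note h = lin_ext_hom[OF M \<phi>, of X]
  show ?thesis using X eq \<phi>
    by (simp add: module_hom_neg[OF h F.module_axioms M] module_homD(2)[OF h] b lin_ext_basis[OF M]
         a_minus_def M.M.r_neg)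
qed

lemma carrier_presented:
  "carrier (presented k X S)
     = (\<lambda>c. submod_span k (free_mod k X) S +>\<^bsub>free_mod k X\<^esub> c) ` carrier (free_mod k X)"
  by (simp add: presented_def quot_mod_simps)

context
  fixes k :: "('k, 'r) ring_scheme" and X :: "'x set" and S
  assumes k: "cring k" and S: "S \<subseteq> carrier (free_mod k X)"
begin

interpretation F: module k "free_mod k X" by (rule module_free_mod[OF k])

private lemma spanS: "submodule (submod_span k (free_mod k X) S) k (free_mod k X)"
  by (rule submodule_span(1)[OF F.module_axioms S])

lemma module_presented: "module k (presented k X S)"
  unfolding presented_def by (rule module_quot_mod[OF F.module_axioms spanS])

lemma presentation_hom:
  "(\<lambda>c. submod_span k (free_mod k X) S +>\<^bsub>free_mod k X\<^esub> c)
     \<in> module_hom k (free_mod k X) (presented k X S)"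
  unfolding presented_def by (rule coset_hom[OF F.module_axioms spanS])

lemma gen_class_closed: "x \<in> X \<Longrightarrow> gen_class k X S x \<in> carrier (presented k X S)"
  unfolding gen_class_def
  by (rule module_homD(1)[OF presentation_hom]) (rule basis_elt_closed[OF k])

lemma presentation_relator:
  assumes "s \<in> S"
  shows "submod_span k (free_mod k X) S +>\<^bsub>free_mod k X\<^esub> s = \<zero>\<^bsub>presented k X S\<^esub>"
proof -
  have "s \<in> submod_span k (free_mod k X) S" using assms submodule_span(2)[OF F.module_axioms S] by blast
  then show ?thesis
    unfolding presented_def quot_mod_simps
    by (rule abelian_subgroup.a_rcos_const[OF submodule_abelian_subgroup[OF F.module_axioms spanS]])
qed

lemma gen_class_additive:
  assumes "a \<in> X" "b \<in> X" "c \<in> X"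
    and "basis_elt k a \<ominus>\<^bsub>free_mod k X\<^esub> (basis_elt k b \<oplus>\<^bsub>free_mod k X\<^esub> basis_elt k c) \<in> S"
  shows "gen_class k X S a = gen_class k X S b \<oplus>\<^bsub>presented k X S\<^esub> gen_class k X S c"
proof -
  note b = basis_elt_closed[OF k]
  have "submod_span k (free_mod k X) S +>\<^bsub>free_mod k X\<^esub> basis_elt k a
      = submod_span k (free_mod k X) S +>\<^bsub>free_mod k X\<^esub> (basis_elt k b \<oplus>\<^bsub>free_mod k X\<^esub> basis_elt k c)"
    by (rule module_hom_diff_zeroD[OF presentation_hom F.module_axioms module_presented])
       (use assms b presentation_relator in \<open>auto intro!: F.a_closed F.smult_closed\<close>)
  also have "\<dots> = gen_class k X S b \<oplus>\<^bsub>presented k X S\<^esub> gen_class k X S c"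
    unfolding gen_class_def by (rule module_homD(2)[OF presentation_hom]) (rule b assms)+
  finally show ?thesis unfolding gen_class_def .
qed

lemma gen_class_scalar:
  assumes "a \<in> X" "b \<in> X" "r \<in> carrier k"
    and "basis_elt k a \<ominus>\<^bsub>free_mod k X\<^esub> (r \<odot>\<^bsub>free_mod k X\<^esub> basis_elt k b) \<in> S"
  shows "gen_class k X S a = r \<odot>\<^bsub>presented k X S\<^esub> gen_class k X S b"
proof -
  note b = basis_elt_closed[OF k]
  have "submod_span k (free_mod k X) S +>\<^bsub>free_mod k X\<^esub> basis_elt k a
      = submod_span k (free_mod k X) S +>\<^bsub>free_mod k X\<^esub> (r \<odot>\<^bsub>free_mod k X\<^esub> basis_elt k b)"
    by (rule module_hom_diff_zeroD[OF presentation_hom F.module_axioms module_presented])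
       (use assms b presentation_relator in \<open>auto intro!: F.a_closed F.smult_closed\<close>)
  also have "\<dots> = r \<odot>\<^bsub>presented k X S\<^esub> gen_class k X S b"
    unfolding gen_class_def by (rule module_homD(3)[OF presentation_hom]) (rule b assms)+
  finally show ?thesis unfolding gen_class_def .
qed

lemma gen_class_equal:
  assumes "a \<in> X" "b \<in> X" and "basis_elt k a \<ominus>\<^bsub>free_mod k X\<^esub> basis_elt k b \<in> S"
  shows "gen_class k X S a = gen_class k X S b"
proof -
  note b = basis_elt_closed[OF k]
  have "submod_span k (free_mod k X) S +>\<^bsub>free_mod k X\<^esub> basis_elt k a
      = submod_span k (free_mod k X) S +>\<^bsub>free_mod k X\<^esub> (basis_elt k b)"
    by (rule module_hom_diff_zeroD[OF presentation_hom F.module_axioms module_presented])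
       (use assms b presentation_relator in \<open>auto intro!: F.a_closed F.smult_closed\<close>)
  then show ?thesis unfolding gen_class_def .
qed

lemma presented_hom_eqI:
  assumes M: "module k M" and h: "h \<in> module_hom k (presented k X S) M"
    and g: "g \<in> module_hom k (presented k X S) M"
    and eq: "\<And>x. x \<in> X \<Longrightarrow> h (gen_class k X S x) = g (gen_class k X S x)"
    and p: "p \<in> carrier (presented k X S)"
  shows "h p = g p"
proof -
  let ?\<pi> = "\<lambda>c. submod_span k (free_mod k X) S +>\<^bsub>free_mod k X\<^esub> c"
  obtain c where c: "c \<in> carrier (free_mod k X)" "p = ?\<pi> c"
    using p by (auto simp: carrier_presented)
  have "h (?\<pi> c) = g (?\<pi> c)" using k c(1)
  proof (induction c rule: free_mod_induct)
    case zero
    then show ?case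
      by (simp add: module_hom_zero[OF presentation_hom F.module_axioms module_presented]
         module_hom_zero[OF h module_presented M] module_hom_zero[OF g module_presented M])
  next
    case (step c r x)
    note b = basis_elt_closed[OF k step.hyps(3)]
    note cl = module_homD(1)[OF presentation_hom]
    have "h (?\<pi> (basis_elt k x)) = g (?\<pi> (basis_elt k x))"
      using eq[OF step.hyps(3)] by (simp add: gen_class_def)
    then show ?case using step.hyps step.IH
      by (simp add: module_homD(2,3)[OF presentation_hom] module_homD(2,3)[OF h]
           module_homD(2,3)[OF g] b cl module.smult_closed[OF module_presented])
  qed
  then show ?thesis using c by simp
qed

context
  fixes M :: "('k, 'm, 's) module_scheme" and \<phi>
  assumes M: "module k M" and \<phi>: "\<And>x. x \<in> X \<Longrightarrow> \<phi> x \<in> carrier M"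
    and rel: "\<And>s. s \<in> S \<Longrightarrow> lin_ext k M \<phi> s = \<zero>\<^bsub>M\<^esub>"
begin

lemma lin_lift_coset:
  assumes c: "c \<in> carrier (free_mod k X)"
  shows "lin_lift k M \<phi> (submod_span k (free_mod k X) S +>\<^bsub>free_mod k X\<^esub> c) = lin_ext k M \<phi> c"
proof -
  have "submod_span k (free_mod k X) S \<subseteq> {c \<in> carrier (free_mod k X). lin_ext k M \<phi> c = \<zero>\<^bsub>M\<^esub>}"
    by (rule submod_span_least[OF submodule_kernel[OF lin_ext_hom[OF M \<phi>] F.module_axioms M]])
       (use S rel in auto)
  then show ?thesis unfolding lin_lift_def
    by (intro the_elem_coset_image[OF F.module_axioms spanS M lin_ext_hom[OF M \<phi>] _ c]) auto
qed

lemma lin_lift_gen_class: "x \<in> X \<Longrightarrow> lin_lift k M \<phi> (gen_class k X S x) = \<phi> x"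
  by (simp add: gen_class_def lin_lift_coset basis_elt_closed[OF k] lin_ext_basis[OF M] \<phi>)

lemma lin_lift_hom: "lin_lift k M \<phi> \<in> module_hom k (presented k X S) M"
proof -
  note h = lin_ext_hom[OF M \<phi>]
  show ?thesis
    by (rule module_homI)
       (auto simp: carrier_presented lin_lift_coset module_homD[OF h]
          module_homD(2,3)[OF presentation_hom, symmetric])
qed

end

end

lemma bilinearD:
  assumes "module_bilinear k M N P f"
  shows bilinear_left: "y \<in> carrier N \<Longrightarrow> (\<lambda>x. f x y) \<in> module_hom k M P"
    and bilinear_right: "x \<in> carrier M \<Longrightarrow> f x \<in> module_hom k N P"
    and bilinear_closed: "x \<in> carrier M \<Longrightarrow> y \<in> carrier N \<Longrightarrow> f x y \<in> carrier P"
  using assms by (auto simp: module_bilinear_def module_hom_def)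

text \<open>Bilinear maps out of a pair of presented modules, built by nested lifting. The relators of the
second factor are killed by assumption. For the relators of the first factor the assumption
only covers generators in the second argument; since the expression is linear in the second
argument, it then vanishes for all of them.\<close>

lemma bilin_lift:
  fixes k :: "('k, 'r) ring_scheme" and X :: "'x set" and Y :: "'y set" and S T
    and M :: "('k, 'm, 's) module_scheme"
  assumes k: "cring k" and S: "S \<subseteq> carrier (free_mod k X)" and T: "T \<subseteq> carrier (free_mod k Y)"
    and M: "module k M" and \<phi>: "\<And>x y. x \<in> X \<Longrightarrow> y \<in> Y \<Longrightarrow> \<phi> x y \<in> carrier M"
    and relS: "\<And>s y. s \<in> S \<Longrightarrow> y \<in> Y \<Longrightarrow> lin_ext k M (\<lambda>x. \<phi> x y) s = \<zero>\<^bsub>M\<^esub>"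
    and relT: "\<And>t x. t \<in> T \<Longrightarrow> x \<in> X \<Longrightarrow> lin_ext k M (\<phi> x) t = \<zero>\<^bsub>M\<^esub>"
  defines "B \<equiv> (\<lambda>p q. lin_lift k M (\<lambda>x. lin_lift k M (\<phi> x) q) p)"
  shows bilin_lift_bilinear: "module_bilinear k (presented k X S) (presented k Y T) M B"
    and bilin_lift_gen_class: "\<lbrakk>x \<in> X; y \<in> Y\<rbrakk> \<Longrightarrow> B (gen_class k X S x) (gen_class k Y T y) = \<phi> x y"
proof -
  have inner: "lin_lift k M (\<phi> x) \<in> module_hom k (presented k Y T) M" if "x \<in> X" for x
    by (rule lin_lift_hom[OF k T M \<phi>[OF that] relT[OF _ that]])
  have inner_gen: "lin_lift k M (\<phi> x) (gen_class k Y T y) = \<phi> x y" if "x \<in> X" "y \<in> Y" for x y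
    by (rule lin_lift_gen_class[OF k T M \<phi>[OF that(1)] relT[OF _ that(1)] that(2)])
  note mQ = module_presented[OF k T]
  have par: "(\<lambda>q. lin_ext k M (\<lambda>x. lin_lift k M (\<phi> x) q) c) \<in> module_hom k (presented k Y T) M"
    if "c \<in> carrier (free_mod k X)" for c
    by (rule lin_ext_hom_parameter[OF mQ M that inner])
  have rel: "lin_ext k M (\<lambda>x. lin_lift k M (\<phi> x) q) s = \<zero>\<^bsub>M\<^esub>"
    if s: "s \<in> S" and q: "q \<in> carrier (presented k Y T)" for s q
  proof (rule presented_hom_eqI[OF k T M par module_hom_const_zero[OF M] _ q])
    show "s \<in> carrier (free_mod k X)" using s S by blast
    fix y assume y: "y \<in> Y"
    have "lin_ext k M (\<lambda>x. lin_lift k M (\<phi> x) (gen_class k Y T y)) s = lin_ext k M (\<lambda>x. \<phi> x y) s"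
      by (rule lin_ext_cong[OF M, of _ X]) (use s S y in \<open>auto simp: inner_gen \<phi>\<close>)
    then show "lin_ext k M (\<lambda>x. lin_lift k M (\<phi> x) (gen_class k Y T y)) s = \<zero>\<^bsub>M\<^esub>"
      using relS s y by simp
  qed
  have cl: "lin_lift k M (\<phi> x) q \<in> carrier M" if "x \<in> X" "q \<in> carrier (presented k Y T)" for x q
    using module_homD(1)[OF inner] that by blast
  have outer: "lin_lift k M (\<lambda>x. lin_lift k M (\<phi> x) q) \<in> module_hom k (presented k X S) M"
    if "q \<in> carrier (presented k Y T)" for q
    by (rule lin_lift_hom[OF k S M cl rel]) (use that in auto)
  have left: "(\<lambda>p. B p q) \<in> module_hom k (presented k X S) M" if "q \<in> carrier (presented k Y T)" for q
    unfolding B_def by (rule outer[OF that])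
  have right: "B p \<in> module_hom k (presented k Y T) M" if p: "p \<in> carrier (presented k X S)" for p
  proof -
    obtain c where c: "c \<in> carrier (free_mod k X)"
      "p = submod_span k (free_mod k X) S +>\<^bsub>free_mod k X\<^esub> c"
      using p by (auto simp: carrier_presented)
    show ?thesis
      by (rule module_hom_cong[OF par[OF c(1)] mQ])
         (simp add: B_def c lin_lift_coset[OF k S M cl rel])
  qed
  show "module_bilinear k (presented k X S) (presented k Y T) M B"
    unfolding module_bilinear_def using left right by blast
  show "B (gen_class k X S x) (gen_class k Y T y) = \<phi> x y" if "x \<in> X" "y \<in> Y"
    using that gen_class_closed[OF k T] unfolding B_def
    by (simp add: lin_lift_gen_class[OF k S M cl rel] inner_gen)
qed

lemma module_bilinear_hom_comp:
  assumes "h \<in> module_hom k P Q" "module_bilinear k M N P f"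
  shows "module_bilinear k M N Q (\<lambda>x y. h (f x y))"
  unfolding module_bilinear_def
  using module_hom_comp[OF assms(1) bilinear_left[OF assms(2)]]
    module_hom_comp[OF assms(1) bilinear_right[OF assms(2)]] by blast

lemma module_bilinear_comp_homs:
  assumes f: "module_bilinear k M N P f" and g: "g \<in> module_hom k M' M" and h: "h \<in> module_hom k N' N"
  shows "module_bilinear k M' N' P (\<lambda>x y. f (g x) (h y))"
  unfolding module_bilinear_def
proof (intro conjI ballI)
  show "(\<lambda>x. f (g x) (h y)) \<in> module_hom k M' P" if "y \<in> carrier N'" for y
    using module_hom_comp[OF bilinear_left[OF f] g] module_homD(1)[OF h that] by blast
  show "(\<lambda>y. f (g x) (h y)) \<in> module_hom k N' P" if "x \<in> carrier M'" for x
    using module_hom_comp[OF bilinear_right[OF f] h] module_homD(1)[OF g that] by blast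
qed

lemma module_bilinear_sum:
  assumes M: "module k M" and N: "module k N" and P: "module k P"
    and f: "\<And>i. i \<in> I \<Longrightarrow> module_bilinear k M N P (f i)"
  shows "module_bilinear k M N P (\<lambda>x y. \<Oplus>\<^bsub>P\<^esub>i\<in>I. f i x y)"
  unfolding module_bilinear_def
  by (intro conjI ballI module_hom_sum[OF M P] module_hom_sum[OF N P] bilinear_left[OF f] bilinear_right[OF f])

lemma module_bilinear_flip:
  "module_bilinear k M N P f \<Longrightarrow> module_bilinear k N M P (\<lambda>x y. f y x)"
  unfolding module_bilinear_def by blast

lemma alt_sign_hom:
  assumes M: "module k M"
  shows "alt_sign M n \<in> module_hom k M M"
  using module_hom_uminus[OF M module_hom_id] module_hom_id[of k M]
  by (cases "even n") (auto simp: alt_sign_def[abs_def] fun_eq_iff)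

lemma module_bilinear_alt_sign:
  assumes "module k P" "module_bilinear k M N P f"
  shows "module_bilinear k M N P (\<lambda>x y. alt_sign P n (f x y))"
  by (rule module_bilinear_hom_comp[OF alt_sign_hom[OF assms(1)] assms(2)])

section \<open>The category: arrows as lists of blocks\<close>

text \<open>The \<open>i\<close>-th block is the word of source letters that are multiplied, in this order, to give the
\<open>i\<close>-th target letter. The concatenation of all blocks lists the permutation, and their lengths
determine the non-decreasing map. Composition of arrows is substitution of blocks into blocks
(\<open>blocks_comp\<close>).\<close>

definition blocks :: "arrow \<Rightarrow> nat list list" where
  "blocks g = map (\<lambda>i. map (perm g) (filter (\<lambda>j. mon g j = i) [0..<src g])) [0..<tgt g]"

lemma filter_less_append_filter_eq:
  "sorted (map \<theta> xs) \<Longrightarrow>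
   filter (\<lambda>j. \<theta> j < q) xs @ filter (\<lambda>j. \<theta> j = q) xs = filter (\<lambda>j. \<theta> j < Suc q) xs"
  for \<theta> :: "'a \<Rightarrow> nat"
proof (induction xs)
  case (Cons x xs)
  have "filter (\<lambda>j. \<theta> j < q) xs = []" if "\<theta> x \<ge> q"
    using Cons.prems that by (auto simp: filter_empty_conv)
  with Cons show ?case by auto
qed simp

text \<open>Along a non-decreasing map the fibers are consecutive intervals.\<close>

lemma concat_fibers:
  fixes \<theta> :: "'a \<Rightarrow> nat"
  assumes "sorted (map \<theta> xs)"
  shows "concat (map (\<lambda>i. filter (\<lambda>j. \<theta> j = i) xs) [0..<q]) = filter (\<lambda>j. \<theta> j < q) xs"
  by (induction q) (simp_all add: filter_less_append_filter_eq[OF assms])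

lemma concat_map_if:
  "concat (map (\<lambda>i. if P i then f i else []) xs) = concat (map f (filter P xs))"
  by (induction xs) auto

lemma filter_comp_eq_concat_fibers:
  fixes \<theta> :: "'a \<Rightarrow> nat"
  assumes "sorted (map \<theta> xs)" "\<And>j. j \<in> set xs \<Longrightarrow> \<theta> j < q"
  shows "filter (\<lambda>j. \<phi> (\<theta> j) = l) xs
       = concat (map (\<lambda>i. filter (\<lambda>j. \<theta> j = i) xs) (filter (\<lambda>i. \<phi> i = l) [0..<q]))"
proof -
  have "xs = concat (map (\<lambda>i. filter (\<lambda>j. \<theta> j = i) xs) [0..<q])"
    using assms by (simp add: concat_fibers)
  then have "filter (\<lambda>j. \<phi> (\<theta> j) = l) xs
      = filter (\<lambda>j. \<phi> (\<theta> j) = l) (concat (map (\<lambda>i. filter (\<lambda>j. \<theta> j = i) xs) [0..<q]))"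
    by (rule arg_cong)
  also have "\<dots> = concat (map (\<lambda>i. if \<phi> i = l then filter (\<lambda>j. \<theta> j = i) xs else []) [0..<q])"
    unfolding filter_concat map_map
    by (intro arg_cong[where f = concat] map_cong refl) (auto simp: filter_empty_conv intro: filter_cong)
  finally show ?thesis by (simp add: concat_map_if)
qed

lemma mono_mapsD:
  assumes "\<theta> \<in> mono_maps p q"
  shows "j < p \<Longrightarrow> \<theta> j < q" and "sorted (map \<theta> [0..<p])" and "\<not> j < p \<Longrightarrow> \<theta> j = undefined"
    and "i \<le> j \<Longrightarrow> j < p \<Longrightarrow> \<theta> i \<le> \<theta> j"
  using assms
  by (auto simp: mono_maps_def PiE_iff extensional_def sorted_iff_nth_mono mono_on_def Pi_iff)

lemma down_closed_eq_lessThan_card: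
  fixes S :: "nat set"
  assumes "finite S" and down: "\<And>i j. j \<in> S \<Longrightarrow> i \<le> j \<Longrightarrow> i \<in> S"
  shows "S = {..<card S}"
proof -
  have "\<exists>n. n \<notin> S" using assms(1) by (rule ex_new_if_finite[OF infinite_UNIV_nat])
  define m where "m = (LEAST n. n \<notin> S)"
  have "m \<notin> S" "\<And>n. n < m \<Longrightarrow> n \<in> S"
    using LeastI_ex[OF \<open>\<exists>n. n \<notin> S\<close>] not_less_Least unfolding m_def by blast+
  then have "S = {..<m}" using down by (metis lessThan_iff linorder_not_less subsetI subset_antisym)
  then show ?thesis by simp
qed

text \<open>The preimage of each initial segment is an initial segment, and its length is a sum of cardinalities of
fibers.\<close>

lemma mono_maps_eqI:
  assumes "\<theta> \<in> mono_maps p q" "\<theta>' \<in> mono_maps p q"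
    and card: "\<And>i. i < q \<Longrightarrow> card (fiber p \<theta> i) = card (fiber p \<theta>' i)"
  shows "\<theta> = \<theta>'"
proof -
  have below: "{j. j < p \<and> \<zeta> j < i} = {..<(\<Sum>l<i. card (fiber p \<zeta> l))}"
    if \<zeta>: "\<zeta> \<in> mono_maps p q" for \<zeta> i
  proof -
    have init: "{j. j < p \<and> \<zeta> j < i} = {..<card {j. j < p \<and> \<zeta> j < i}}"
      by (rule down_closed_eq_lessThan_card) (use mono_mapsD(4)[OF \<zeta>] in \<open>auto intro: le_less_trans\<close>)
    have "{j. j < p \<and> \<zeta> j < i} = (\<Union>l<i. fiber p \<zeta> l)" by (auto simp: fiber_def)
    also have "card \<dots> = (\<Sum>l<i. card (fiber p \<zeta> l))"
      by (rule card_UN_disjoint) (auto simp: fiber_def)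
    finally show ?thesis using init by simp
  qed
  have "\<theta> j = \<theta>' j" for j
  proof (cases "j < p")
    case True
    have "\<theta> j < i \<longleftrightarrow> \<theta>' j < i" if "i \<le> q" for i
    proof -
      have "(\<Sum>l<i. card (fiber p \<theta> l)) = (\<Sum>l<i. card (fiber p \<theta>' l))"
        using that by (intro sum.cong refl card) auto
      then have "{j. j < p \<and> \<theta> j < i} = {j. j < p \<and> \<theta>' j < i}"
        using below assms(1,2) by simp
      then show ?thesis using True by blast
    qed
    from this[of "Suc (\<theta> j)"] this[of "Suc (\<theta>' j)"] show ?thesis
      using mono_mapsD(1)[OF assms(1) True] mono_mapsD(1)[OF assms(2) True] by auto
  next
    case False
    then show ?thesis using mono_mapsD(3) assms(1,2) by metis
  qed
  then show ?thesis by blast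
qed

lemma card_fiber: "card (fiber p \<theta> i) = length (filter (\<lambda>j. \<theta> j = i) [0..<p])"
proof -
  have "fiber p \<theta> i = set (filter (\<lambda>j. \<theta> j = i) [0..<p])" by (auto simp: fiber_def)
  then show ?thesis by (metis distinct_card distinct_filter distinct_upt)
qed

text \<open>Any list of words is cut out of its concatenation by a unique non-decreasing map; this is its
existence, with the lengths of the words as the cardinalities of the fibers.\<close>

lemma ex_mono_map_with_blocks:
  "\<exists>\<theta>\<in>mono_maps (length (concat N)) (length N). \<forall>i<length N.
     map ((!) (concat N)) (filter (\<lambda>j. \<theta> j = i) [0..<length (concat N)]) = N ! i"
proof (induction N rule: rev_induct)
  case Nil
  then show ?case by (auto simp: mono_maps_def mono_on_def)
next
  case (snoc x N)
  let ?n = "length (concat N)" and ?m = "length N"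
  obtain \<theta> where \<theta>: "\<theta> \<in> mono_maps ?n ?m"
    and bl: "\<And>i. i < ?m \<Longrightarrow> map ((!) (concat N)) (filter (\<lambda>j. \<theta> j = i) [0..<?n]) = N ! i"
    using snoc by blast
  define \<theta>' where "\<theta>' = (\<lambda>j\<in>{..<?n + length x}. if j < ?n then \<theta> j else ?m)"
  have "\<theta>' \<in> mono_maps (?n + length x) (Suc ?m)"
    using less_SucI[OF mono_mapsD(1)[OF \<theta>]] less_imp_le[OF mono_mapsD(1)[OF \<theta>]] mono_mapsD(4)[OF \<theta>]
    unfolding mono_maps_def mono_on_def \<theta>'_def by auto
  moreover have "map ((!) (concat N @ x)) (filter (\<lambda>j. \<theta>' j = i) [0..<?n + length x]) = (N @ [x]) ! i"
    if i: "i < Suc ?m" for i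
  proof -
    have upt_split: "[0..<?n + length x] = [0..<?n] @ [?n..<?n + length x]"
      using upt_add_eq_append[of 0 ?n "length x"] by simp
    have l: "filter (\<lambda>j. \<theta>' j = i) [0..<?n] = filter (\<lambda>j. \<theta> j = i) [0..<?n]"
      by (rule filter_cong) (auto simp: \<theta>'_def)
    have r: "filter (\<lambda>j. \<theta>' j = i) [?n..<?n + length x] = (if i = ?m then [?n..<?n + length x] else [])"
      by (auto simp: \<theta>'_def filter_empty_conv filter_id_conv)
    show ?thesis
    proof (cases "i = ?m")
      case True
      have "filter (\<lambda>j. \<theta> j = i) [0..<?n] = []"
        using mono_mapsD(1)[OF \<theta>] True by (fastforce simp: filter_empty_conv)
      moreover have "map ((!) (concat N @ x)) [?n..<?n + length x] = x"
        by (rule nth_equalityI) (auto simp: nth_append)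
      ultimately show ?thesis using True unfolding upt_split filter_append l r by simp
    next
      case False
      then have "map ((!) (concat N @ x)) (filter (\<lambda>j. \<theta> j = i) [0..<?n])
          = map ((!) (concat N)) (filter (\<lambda>j. \<theta> j = i) [0..<?n])"
        by (auto simp: nth_append)
      then show ?thesis using False i bl by (simp add: upt_split l r nth_append)
    qed
  qed
  ultimately show ?case by (intro bexI[of _ \<theta>']) auto
qed

lemma mset_concat_map_cong:
  "mset xs = mset ys \<Longrightarrow> mset (concat (map f xs)) = mset (concat (map f ys))"
proof -
  have "mset (concat (map f zs)) = sum_mset (image_mset (\<lambda>x. mset (f x)) (mset zs))" for zs
    by (induction zs) auto
  then show "mset xs = mset ys \<Longrightarrow> ?thesis" by simp
qed

lemma strict_mono_on_if_sorted_map: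
  fixes \<sigma> :: "nat \<Rightarrow> nat"
  assumes "sorted_wrt (<) xs" "sorted_wrt (<) (map \<sigma> xs)"
  shows "strict_mono_on (set xs) \<sigma>"
proof (rule strict_mono_onI)
  fix x y assume "x \<in> set xs" "y \<in> set xs" and less: "x < y"
  then obtain i j where ij: "i < length xs" "x = xs ! i" "j < length xs" "y = xs ! j"
    by (auto simp: in_set_conv_nth)
  have "i < j"
  proof (rule ccontr)
    assume "\<not> i < j"
    then consider "i = j" | "j < i" by linarith
    then show False
      using ij less sorted_wrt_nth_less[OF assms(1)] by cases (auto dest: less_asym)
  qed
  then show "\<sigma> x < \<sigma> y" using sorted_wrt_nth_less[OF assms(2), of i j] ij by simp
qed

lemma sorted_map_if_strict_mono_on:
  fixes \<sigma> :: "nat \<Rightarrow> nat"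
  assumes "sorted_wrt (<) xs" "strict_mono_on (set xs) \<sigma>"
  shows "sorted_wrt (<) (map \<sigma> xs)"
  unfolding sorted_wrt_map
  by (rule sorted_wrt_mono_rel[OF _ assms(1)]) (use assms(2) in \<open>auto simp: strict_mono_on_def\<close>)

lemma sorted_wrt_less_unique:
  fixes xs ys :: "nat list"
  assumes "sorted_wrt (<) xs" "sorted_wrt (<) ys" "set xs = set ys"
  shows "xs = ys"
  using assms by (meson sorted_distinct_set_unique strict_sorted_iff)

lemma sorted_wrt_filter_upt: "sorted_wrt (<) (filter P [m..<n])"
  by (rule sorted_wrt_filter) simp

text \<open>The two definite descriptions behind composition are witnessed by one construction. Let \<open>N\<close> be
the list of the fibers of \<open>\<psi>\<close>, rearranged by \<open>\<gamma>\<close>: its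
concatenation lists the permutation, and its word lengths give the non-decreasing map. The
last property characterises both at once in terms of blocks and is the only one used afterwards.\<close>

lemma twist:
  assumes \<psi>: "\<psi> \<in> mono_maps p q" and \<gamma>: "\<gamma> permutes {..<q}"
  shows twist_map_mono: "twist_map p q \<psi> \<gamma> \<in> mono_maps p q"
    and twist_perm_permutes: "twist_perm p q \<psi> \<gamma> permutes {..<p}"
    and twist_blocks: "i < q \<Longrightarrow>
      map (twist_perm p q \<psi> \<gamma>) (filter (\<lambda>j. twist_map p q \<psi> \<gamma> j = i) [0..<p])
        = filter (\<lambda>j. \<psi> j = \<gamma> i) [0..<p]"
proof -
  define F where "F = (\<lambda>i. filter (\<lambda>j. \<psi> j = i) [0..<p])"
  define N where "N = map F (map \<gamma> [0..<q])"
  \<comment> \<open>Rearranging the fibers does not change which letters occur, so \<open>concat N\<close> is a permutation of the letters.\<close>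
  have "mset (map \<gamma> [0..<q]) = mset [0..<q]"
    using permutes_image_mset[OF \<gamma>] by (simp flip: atLeast_upt lessThan_atLeast0)
  then have "mset (concat N) = mset (concat (map F [0..<q]))"
    unfolding N_def by (rule mset_concat_map_cong)
  also have "concat (map F [0..<q]) = [0..<p]"
    unfolding F_def using mono_mapsD(1)[OF \<psi>] mono_mapsD(2)[OF \<psi>]
    by (subst concat_fibers) (auto simp: filter_id_conv)
  finally have mN: "mset (concat N) = mset [0..<p]" .
  then have N: "length (concat N) = p" "distinct (concat N)" "set (concat N) = {..<p}"
    using mset_eq_length[OF mN] mset_eq_imp_distinct_iff[OF mN] mset_eq_setD[OF mN] by auto
  have Ni: "N ! i = F (\<gamma> i)" if "i < q" for i using that by (simp add: N_def)
  have lN: "length N = q" by (simp add: N_def)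
  obtain \<theta> where \<theta>: "\<theta> \<in> mono_maps p q"
    and bl: "\<And>i. i < q \<Longrightarrow> map ((!) (concat N)) (filter (\<lambda>j. \<theta> j = i) [0..<p]) = F (\<gamma> i)"
    using ex_mono_map_with_blocks[of N] unfolding N(1) lN by (auto simp: Ni)
  define \<sigma> where "\<sigma> = (\<lambda>j. if j < p then concat N ! j else j)"
  have "bij_betw \<sigma> {..<p} {..<p}"
    using bij_betw_nth[OF N(2), of "{..<p}" "{..<p}"] N(1,3)
    by (subst bij_betw_cong[of _ _ "(!) (concat N)"]) (auto simp: \<sigma>_def)
  then have \<sigma>: "\<sigma> permutes {..<p}"
    by (rule bij_imp_permutes) (simp add: \<sigma>_def)
  have \<sigma>bl: "map \<sigma> (filter (\<lambda>j. \<theta> j = i) [0..<p]) = F (\<gamma> i)" if "i < q" for i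
    unfolding bl[OF that, symmetric] by (rule map_cong) (auto simp: \<sigma>_def)
  have fib: "fiber p \<zeta> i = set (filter (\<lambda>j. \<zeta> j = i) [0..<p])" for \<zeta> i by (auto simp: fiber_def)
  have card: "card (fiber p \<theta> i) = card (fiber p \<psi> (\<gamma> i))" if "i < q" for i
    using arg_cong[OF \<sigma>bl[OF that], of length] by (simp add: card_fiber F_def)
  have T: "twist_map p q \<psi> \<gamma> = \<theta>"
    unfolding twist_map_def
  proof (rule the_equality)
    show "\<theta> \<in> mono_maps p q \<and> (\<forall>i<q. card (fiber p \<theta> i) = card (fiber p \<psi> (\<gamma> i)))"
      using \<theta> card by blast
    show "\<zeta> = \<theta>" if "\<zeta> \<in> mono_maps p q \<and> (\<forall>i<q. card (fiber p \<zeta> i) = card (fiber p \<psi> (\<gamma> i)))" for \<zeta>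
      using that card by (intro mono_maps_eqI[OF _ \<theta>]) auto
  qed
  have P: "twist_perm p q \<psi> \<gamma> = \<sigma>"
    unfolding twist_perm_def T
  proof (rule the_equality)
    have "bij_betw \<sigma> (fiber p \<theta> i) (fiber p \<psi> (\<gamma> i))" "strict_mono_on (fiber p \<theta> i) \<sigma>" if "i < q" for i
    proof -
      have "\<sigma> ` fiber p \<theta> i = fiber p \<psi> (\<gamma> i)"
        using arg_cong[OF \<sigma>bl[OF that], of set] by (simp only: fib set_map F_def)
      then show "bij_betw \<sigma> (fiber p \<theta> i) (fiber p \<psi> (\<gamma> i))"
        using permutes_inj_on[OF \<sigma>] by (simp add: bij_betw_def)
      show "strict_mono_on (fiber p \<theta> i) \<sigma>"
        unfolding fib using \<sigma>bl[OF that]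
        by (intro strict_mono_on_if_sorted_map) (simp_all add: F_def sorted_wrt_filter_upt)
    qed
    then show "\<sigma> permutes {..<p} \<and> (\<forall>i<q. bij_betw \<sigma> (fiber p \<theta> i) (fiber p \<psi> (\<gamma> i)) \<and>
        strict_mono_on (fiber p \<theta> i) \<sigma>)" using \<sigma> by blast
    \<comment> \<open>Uniqueness: on each fiber, a strictly increasing bijection lists the target in increasing order.\<close>
    fix \<tau> assume \<tau>: "\<tau> permutes {..<p} \<and> (\<forall>i<q. bij_betw \<tau> (fiber p \<theta> i) (fiber p \<psi> (\<gamma> i)) \<and>
        strict_mono_on (fiber p \<theta> i) \<tau>)"
    have eq: "map \<tau> (filter (\<lambda>j. \<theta> j = i) [0..<p]) = F (\<gamma> i)" if "i < q" for i
    proof (rule sorted_wrt_less_unique)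
      show "sorted_wrt (<) (map \<tau> (filter (\<lambda>j. \<theta> j = i) [0..<p]))"
        by (rule sorted_map_if_strict_mono_on[OF sorted_wrt_filter_upt]) (use \<tau> that fib in metis)
      show "sorted_wrt (<) (F (\<gamma> i))" by (simp add: F_def sorted_wrt_filter_upt)
      have "\<tau> ` fiber p \<theta> i = fiber p \<psi> (\<gamma> i)" using \<tau> that by (simp add: bij_betw_def)
      then show "set (map \<tau> (filter (\<lambda>j. \<theta> j = i) [0..<p])) = set (F (\<gamma> i))"
        by (simp only: fib set_map F_def)
    qed
    have "\<tau> j = \<sigma> j" for j
    proof (cases "j < p")
      case True
      then have "map \<tau> (filter (\<lambda>j'. \<theta> j' = \<theta> j) [0..<p]) = map \<sigma> (filter (\<lambda>j'. \<theta> j' = \<theta> j) [0..<p])"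
        using eq \<sigma>bl mono_mapsD(1)[OF \<theta> True] by simp
      then show ?thesis using True by (simp add: map_eq_conv)
    next
      case False
      then show ?thesis using \<tau> \<sigma> by (simp add: permutes_def)
    qed
    then show "\<tau> = \<sigma>" by blast
  qed
  show "twist_map p q \<psi> \<gamma> \<in> mono_maps p q" using T \<theta> by simp
  show "twist_perm p q \<psi> \<gamma> permutes {..<p}" using P \<sigma> by simp
  show "i < q \<Longrightarrow> map (twist_perm p q \<psi> \<gamma>) (filter (\<lambda>j. twist_map p q \<psi> \<gamma> j = i) [0..<p])
        = filter (\<lambda>j. \<psi> j = \<gamma> i) [0..<p]"
    using T P \<sigma>bl by (simp add: F_def)
qed

lemma is_arrowD:
  assumes "is_arrow f"
  shows "mon f \<in> mono_maps (src f) (tgt f)" "perm f permutes {..<src f}"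
  using assms by (auto simp: is_arrow_def)

lemma length_blocks [simp]: "length (blocks f) = tgt f"
  by (simp add: blocks_def)

lemma concat_blocks:
  assumes "is_arrow f"
  shows "concat (blocks f) = map (perm f) [0..<src f]"
proof -
  have "concat (blocks f)
      = map (perm f) (concat (map (\<lambda>i. filter (\<lambda>j. mon f j = i) [0..<src f]) [0..<tgt f]))"
    by (simp add: blocks_def map_concat o_def)
  also have "concat (map (\<lambda>i. filter (\<lambda>j. mon f j = i) [0..<src f]) [0..<tgt f]) = [0..<src f]"
    using mono_mapsD(1,2)[OF is_arrowD(1)[OF assms]]
    by (subst concat_fibers) (auto simp: filter_id_conv)
  finally show ?thesis .
qed

lemma blocks_bound:
  assumes "is_arrow f" "M \<in> set (blocks f)" "i \<in> set M"
  shows "i < src f"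
proof -
  have "i \<in> set (concat (blocks f))" using assms by auto
  then obtain j where "j < src f" "i = perm f j"
    unfolding concat_blocks[OF assms(1)] by auto
  then show ?thesis using permutes_in_image[OF is_arrowD(2)[OF assms(1)], of j] by simp
qed

text \<open>The criterion by which all identities between arrows are checked: the concatenation of the blocks
recovers the permutation, and their lengths recover the non-decreasing map.\<close>

lemma arrow_eqI:
  assumes f: "is_arrow f" and g: "is_arrow g" and src: "src f = src g" and bl: "blocks f = blocks g"
  shows "f = g"
proof -
  have tgt: "tgt f = tgt g" using arg_cong[OF bl, of length] by simp
  have "map (perm f) [0..<src g] = map (perm g) [0..<src g]"
    using concat_blocks[OF f] concat_blocks[OF g] bl src by simp
  then have "perm f j = perm g j" for j
    using is_arrowD(2)[OF f] is_arrowD(2)[OF g] src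
    by (cases "j < src g") (auto simp: permutes_def)
  moreover have "mon f = mon g"
  proof (rule mono_maps_eqI)
    show "mon f \<in> mono_maps (src g) (tgt g)" "mon g \<in> mono_maps (src g) (tgt g)"
      using is_arrowD(1)[OF f] is_arrowD(1)[OF g] src tgt by simp_all
    fix i assume "i < tgt g"
    then show "card (fiber (src g) (mon f) i) = card (fiber (src g) (mon g) i)"
      using arg_cong[OF bl, of "\<lambda>b. length (b ! i)"] by (simp add: card_fiber blocks_def src tgt)
  qed
  ultimately show ?thesis using src tgt by (intro arrow.expand) (auto simp: fun_eq_iff)
qed

lemma arr_comp_simps [simp]: "src (arr_comp f g) = src g" "tgt (arr_comp f g) = tgt f"
  by (simp_all add: arr_comp_def)

lemma is_arrow_comp:
  assumes f: "is_arrow f" and g: "is_arrow g" and fg: "tgt g = src f"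
  shows "is_arrow (arr_comp f g)"
proof -
  let ?T = "twist_map (src g) (tgt g) (mon g) (perm f)"
  have T: "?T \<in> mono_maps (src g) (src f)"
    using twist_map_mono[OF is_arrowD(1)[OF g], of "perm f"] is_arrowD(2)[OF f] fg by simp
  have "compose {..<src g} (mon f) ?T \<in> mono_maps (src g) (tgt f)"
    using mono_mapsD(1,4)[OF T] mono_mapsD(1,4)[OF is_arrowD(1)[OF f]]
    by (auto simp: mono_maps_def mono_on_def compose_def)
  moreover have "twist_perm (src g) (tgt g) (mon g) (perm f) permutes {..<src g}"
    using twist_perm_permutes[OF is_arrowD(1)[OF g], of "perm f"] is_arrowD(2)[OF f] fg by simp
  ultimately show ?thesis
    using is_arrowD(2)[OF g] by (auto simp: is_arrow_def arr_comp_def intro: permutes_compose)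
qed

text \<open>Composition substitutes blocks: each source letter of \<open>f\<close> occurring in a block of \<open>f\<close> is replaced by
the corresponding block of \<open>g\<close>, and the results are concatenated. Associativity of composition becomes
associativity of concatenation.\<close>

lemma blocks_comp:
  assumes f: "is_arrow f" and g: "is_arrow g" and fg: "tgt g = src f"
  shows "blocks (arr_comp f g) = map (\<lambda>M. concat (map ((!) (blocks g)) M)) (blocks f)"
proof -
  let ?T = "twist_map (src g) (tgt g) (mon g) (perm f)"
  let ?P = "twist_perm (src g) (tgt g) (mon g) (perm f)"
  have T: "?T \<in> mono_maps (src g) (tgt g)"
    using twist_map_mono[OF is_arrowD(1)[OF g], of "perm f"] is_arrowD(2)[OF f] fg by simp
  have "map (perm g \<circ> ?P) (filter (\<lambda>j. compose {..<src g} (mon f) ?T j = l) [0..<src g])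
      = concat (map (\<lambda>i. blocks g ! perm f i) (filter (\<lambda>i. mon f i = l) [0..<src f]))" for l
  proof -
    have "filter (\<lambda>j. compose {..<src g} (mon f) ?T j = l) [0..<src g]
        = filter (\<lambda>j. mon f (?T j) = l) [0..<src g]"
      by (rule filter_cong) (auto simp: compose_def)
    also have "\<dots> = concat (map (\<lambda>i. filter (\<lambda>j. ?T j = i) [0..<src g]) (filter (\<lambda>i. mon f i = l) [0..<tgt g]))"
      by (rule filter_comp_eq_concat_fibers) (use mono_mapsD(1,2)[OF T] in auto)
    finally have "map (perm g \<circ> ?P) (filter (\<lambda>j. compose {..<src g} (mon f) ?T j = l) [0..<src g])
      = concat (map (\<lambda>i. map (perm g) (map ?P (filter (\<lambda>j. ?T j = i) [0..<src g])))
          (filter (\<lambda>i. mon f i = l) [0..<tgt g]))"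
      by (simp add: map_concat o_def)
    also have "\<dots> = concat (map (\<lambda>i. blocks g ! perm f i) (filter (\<lambda>i. mon f i = l) [0..<src f]))"
    proof (rule arg_cong[where f = concat], rule map_cong)
      fix i assume "i \<in> set (filter (\<lambda>i. mon f i = l) [0..<src f])"
      then have i: "i < src f" by simp
      then have "perm f i < src f" using permutes_in_image[OF is_arrowD(2)[OF f]] by simp
      then show "map (perm g) (map ?P (filter (\<lambda>j. ?T j = i) [0..<src g])) = blocks g ! perm f i"
        using twist_blocks[OF is_arrowD(1)[OF g], of "perm f" i] is_arrowD(2)[OF f] fg i
        by (simp only: blocks_def) simp
    qed (simp add: fg)
    finally show ?thesis .
  qed
  then show ?thesis by (simp add: blocks_def[of f] blocks_def[of "arr_comp f g"]) (simp add: arr_comp_def o_def)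
qed

lemma nth_blocks_comp:
  assumes "is_arrow f" "is_arrow g" "tgt g = src f" "i < tgt f"
  shows "blocks (arr_comp f g) ! i = concat (map ((!) (blocks g)) (blocks f ! i))"
  using assms by (simp add: blocks_comp)

lemma arr_comp_assoc:
  assumes f: "is_arrow f" and g: "is_arrow g" and h: "is_arrow h"
    and fg: "tgt g = src f" and gh: "tgt h = src g"
  shows "arr_comp (arr_comp f g) h = arr_comp f (arr_comp g h)"
proof (rule arrow_eqI)
  have "concat (map ((!) (blocks h)) (concat (map ((!) (blocks g)) M)))
      = concat (map ((!) (blocks (arr_comp g h))) M)" if "M \<in> set (blocks f)" for M
  proof -
    have "\<forall>i\<in>set M. i < tgt g" using blocks_bound[OF f that] fg by auto
    then show ?thesis by (induction M) (simp_all add: nth_blocks_comp[OF g h gh])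
  qed
  then show "blocks (arr_comp (arr_comp f g) h) = blocks (arr_comp f (arr_comp g h))"
    using assms by (simp add: blocks_comp is_arrow_comp)
qed (use assms in \<open>auto intro!: is_arrow_comp\<close>)

lemma arr_id_simps [simp]: "src (arr_id p) = p" "tgt (arr_id p) = p"
  by (simp_all add: arr_id_def)

lemma filter_eq_upt: "filter (\<lambda>j. j = i) [0..<p] = (if i < p then [i] else [])" for i :: nat
  by (induction p) auto

lemma filter_restrict_eq_upt:
  "filter (\<lambda>j. (\<lambda>j\<in>{..<p}. j) j = i) [0..<p] = (if i < p then [i] else [])" for i :: nat
proof -
  have "filter (\<lambda>j. (\<lambda>j\<in>{..<p}. j) j = i) [0..<p] = filter (\<lambda>j. j = i) [0..<p]"
    by (rule filter_cong) auto
  then show ?thesis by (simp only: filter_eq_upt)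
qed

lemma is_arrow_permutation:
  "\<gamma> permutes {..<p} \<Longrightarrow> is_arrow (Arrow p p (\<lambda>j\<in>{..<p}. j) \<gamma>)"
  by (auto simp: is_arrow_def mono_maps_def mono_on_def)

lemma blocks_permutation: "blocks (Arrow p p (\<lambda>j\<in>{..<p}. j) \<gamma>) = map (\<lambda>i. [\<gamma> i]) [0..<p]"
proof -
  have "map \<gamma> (filter (\<lambda>j. (\<lambda>j\<in>{..<p}. j) j = i) [0..<p]) = [\<gamma> i]" if "i < p" for i
    unfolding filter_restrict_eq_upt using that by simp
  then show ?thesis by (simp add: blocks_def del: restrict_apply)
qed

lemma is_arrow_id [simp]: "is_arrow (arr_id p)"
  unfolding arr_id_def by (rule is_arrow_permutation[OF permutes_id])

lemma blocks_id: "blocks (arr_id p) = map (\<lambda>i. [i]) [0..<p]"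
  unfolding arr_id_def by (simp add: blocks_permutation)

lemma arr_comp_id_left:
  assumes f: "is_arrow f"
  shows "arr_comp (arr_id (tgt f)) f = f"
proof (rule arrow_eqI[OF is_arrow_comp f])
  have "map ((!) (blocks f)) [0..<tgt f] = blocks f" by (rule nth_equalityI) simp_all
  then show "blocks (arr_comp (arr_id (tgt f)) f) = blocks f"
    using f by (simp add: blocks_comp blocks_id o_def)
qed (use f in auto)

lemma arr_comp_id_right:
  assumes f: "is_arrow f"
  shows "arr_comp f (arr_id (src f)) = f"
proof (rule arrow_eqI[OF is_arrow_comp f])
  have "concat (map ((!) (map (\<lambda>i. [i]) [0..<src f])) M) = M" if "M \<in> set (blocks f)" for M
  proof -
    have "\<forall>i\<in>set M. i < src f" using blocks_bound[OF f that] by auto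
    then show ?thesis by (induction M) simp_all
  qed
  then show "blocks (arr_comp f (arr_id (src f))) = blocks f"
    using f by (simp add: blocks_comp blocks_id map_idI)
qed (use f in auto)

lemma arr_prod_simps [simp]: "src (arr_prod f g) = src f + src g" "tgt (arr_prod f g) = tgt f + tgt g"
  by (simp_all add: arr_prod_def)

lemma is_arrow_prod:
  assumes f: "is_arrow f" and g: "is_arrow g"
  shows "is_arrow (arr_prod f g)"
proof -
  note mf = mono_mapsD(1,4)[OF is_arrowD(1)[OF f]] and mg = mono_mapsD(1,4)[OF is_arrowD(1)[OF g]]
  let ?m = "\<lambda>j. if j < src f then mon f j else tgt f + mon g (j - src f)"
  let ?p = "\<lambda>j. if j < src f then perm f j
          else if j < src f + src g then src f + perm g (j - src f) else j"
  have "?m \<in> {..<src f + src g} \<rightarrow> {..<tgt f + tgt g}"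
    using mf(1) mg(1) by (auto simp: trans_less_add1)
  moreover have "?m i \<le> ?m j" if "i \<le> j" "j < src f + src g" for i j
    using that mf mg(2)[of "i - src f" "j - src f"]
    by (auto simp: trans_less_add1 intro: less_imp_le)
  ultimately have m: "restrict ?m {..<src f + src g} \<in> mono_maps (src f + src g) (tgt f + tgt g)"
    by (auto simp: mono_maps_def mono_on_def)
  have pf: "perm f j < src f \<longleftrightarrow> j < src f" for j
    using permutes_in_image[OF is_arrowD(2)[OF f], of j] by simp
  have pg: "perm g j < src g \<longleftrightarrow> j < src g" for j
    using permutes_in_image[OF is_arrowD(2)[OF g], of j] by simp
  have inj: "inj (perm f)" "inj (perm g)"
    using is_arrowD(2) f g permutes_inj by blast+
  have inj_p: "inj_on ?p {..<src f + src g}"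
  proof (rule inj_onI)
    fix i j assume ij: "i \<in> {..<src f + src g}" "j \<in> {..<src f + src g}" "?p i = ?p j"
    show "i = j"
      using ij pf[of i] pf[of j] injD[OF inj(1), of i j] injD[OF inj(2), of "i - src f" "j - src f"]
      by (auto split: if_splits)
  qed
  have "?p ` {..<src f + src g} \<subseteq> {..<src f + src g}"
  proof (rule image_subsetI)
    show "?p j \<in> {..<src f + src g}" if "j \<in> {..<src f + src g}" for j
      using that pf[of j] pg[of "j - src f"] by auto
  qed
  from endo_inj_surj[OF finite_lessThan this inj_p] inj_p
  have "bij_betw ?p {..<src f + src g} {..<src f + src g}"
    unfolding bij_betw_def by blast
  then have "?p permutes {..<src f + src g}" by (rule bij_imp_permutes) simp
  with m show ?thesis by (simp add: is_arrow_def arr_prod_def)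
qed

lemma blocks_prod:
  assumes f: "is_arrow f" and g: "is_arrow g"
  shows "blocks (arr_prod f g) = blocks f @ map (map (\<lambda>i. src f + i)) (blocks g)"
proof (rule nth_equalityI)
  fix i assume "i < length (blocks (arr_prod f g))"
  then have i: "i < tgt f + tgt g" by simp
  note mf = mono_mapsD(1)[OF is_arrowD(1)[OF f]]
  have upt_split: "[0..<src f + src g] = [0..<src f] @ map (\<lambda>j. src f + j) [0..<src g]"
    by (rule nth_equalityI) (auto simp: nth_append)
  let ?m = "mon (arr_prod f g)"
  have l: "filter (\<lambda>j. ?m j = i) [0..<src f] = filter (\<lambda>j. mon f j = i) [0..<src f]"
    by (rule filter_cong) (auto simp: arr_prod_def)
  have r: "filter (\<lambda>j. ?m (src f + j) = i) [0..<src g]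
      = (if i < tgt f then [] else filter (\<lambda>j. mon g j = i - tgt f) [0..<src g])"
    by (auto simp: arr_prod_def filter_empty_conv intro!: filter_cong)
  have l': "filter (\<lambda>j. mon f j = i) [0..<src f] = []" if "\<not> i < tgt f"
    using mf that by (auto simp: filter_empty_conv)
  have pl: "map (perm (arr_prod f g)) (filter P [0..<src f]) = map (perm f) (filter P [0..<src f])" for P
    by (auto simp: arr_prod_def)
  have pr: "map (\<lambda>j. perm (arr_prod f g) (src f + j)) (filter P [0..<src g])
      = map (\<lambda>j. src f + perm g j) (filter P [0..<src g])" for P
    by (auto simp: arr_prod_def)
  have "blocks (arr_prod f g) ! i
      = map (perm (arr_prod f g)) (filter (\<lambda>j. ?m j = i) [0..<src f + src g])"
    using i by (simp add: blocks_def)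
  also have "\<dots> = map (perm f) (filter (\<lambda>j. mon f j = i) [0..<src f]) @
      (if i < tgt f then [] else map (\<lambda>j. src f + perm g j) (filter (\<lambda>j. mon g j = i - tgt f) [0..<src g]))"
    unfolding upt_split filter_append map_append l pl filter_map map_map o_def r
    by (simp add: pr)
  also have "\<dots> = (blocks f @ map (map (\<lambda>i. src f + i)) (blocks g)) ! i"
    using i l' by (auto simp: nth_append) (auto simp: blocks_def)
  finally show "blocks (arr_prod f g) ! i = (blocks f @ map (map (\<lambda>i. src f + i)) (blocks g)) ! i" .
qed simp

lemma arr_prod_assoc:
  assumes "is_arrow f" "is_arrow g" "is_arrow h"
  shows "arr_prod (arr_prod f g) h = arr_prod f (arr_prod g h)"
  by (rule arrow_eqI) (use assms in \<open>auto simp: blocks_prod is_arrow_prod add.assoc intro!: is_arrow_prod\<close>)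

lemma arr_prod_unit:
  assumes "is_arrow f"
  shows "arr_prod (arr_id 0) f = f" "arr_prod f (arr_id 0) = f"
  by (rule arrow_eqI; use assms in \<open>auto simp: blocks_prod is_arrow_prod blocks_id map_idI\<close>)+

lemma arr_prod_id: "arr_prod (arr_id p) (arr_id q) = arr_id (p + q)"
proof (rule arrow_eqI)
  show "blocks (arr_prod (arr_id p) (arr_id q)) = blocks (arr_id (p + q))"
    by (rule nth_equalityI) (auto simp: blocks_prod blocks_id nth_append)
qed (auto intro: is_arrow_prod)

lemma arr_prod_comp:
  assumes f: "is_arrow f" "is_arrow f'" "tgt f' = src f" and g: "is_arrow g" "is_arrow g'" "tgt g' = src g"
  shows "arr_prod (arr_comp f f') (arr_comp g g') = arr_comp (arr_prod f g) (arr_prod f' g')"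
proof (rule arrow_eqI)
  have 1: "map ((!) (blocks (arr_prod f' g'))) M = map ((!) (blocks f')) M" if "M \<in> set (blocks f)" for M
    using blocks_bound[OF f(1) that] f(3) by (auto simp: blocks_prod f g nth_append)
  have 2: "map ((!) (blocks (arr_prod f' g'))) (map (\<lambda>i. src f + i) M)
      = map (map (\<lambda>i. src f' + i)) (map ((!) (blocks g')) M)" if "M \<in> set (blocks g)" for M
    using blocks_bound[OF g(1) that] f(3) g(3) by (auto simp: blocks_prod f g nth_append)
  show "blocks (arr_prod (arr_comp f f') (arr_comp g g')) = blocks (arr_comp (arr_prod f g) (arr_prod f' g'))"
    using f g by (simp add: blocks_prod[of "arr_comp f f'"] blocks_prod[of f] blocks_comp is_arrow_comp
        is_arrow_prod 1 2[simplified] map_concat o_def cong: map_cong)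
qed (use f g in \<open>auto intro!: is_arrow_prod is_arrow_comp\<close>)

text \<open>The block transposition. It moves the last \<open>q\<close> letters in front of the first \<open>p\<close> letters, in the
convention that the permutation of an arrow maps a target position to the source letter found
there.\<close>

definition braiding :: "nat \<Rightarrow> nat \<Rightarrow> arrow" where
  "braiding p q = Arrow (p + q) (p + q) (\<lambda>j\<in>{..<p + q}. j)
     (\<lambda>j. if j < q then p + j else if j < p + q then j - q else j)"

lemma braiding_simps [simp]: "src (braiding p q) = p + q" "tgt (braiding p q) = p + q"
  by (simp_all add: braiding_def)

lemma is_arrow_braiding: "is_arrow (braiding p q)"
proof -
  let ?\<beta> = "\<lambda>j. if j < q then p + j else if j < p + q then j - q else j"
  have "bij_betw ?\<beta> {..<p + q} {..<p + q}"
    by (rule bij_betw_byWitness[where f' = "\<lambda>j. if j < p then q + j else j - p"]) auto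
  then have "?\<beta> permutes {..<p + q}" by (rule bij_imp_permutes) auto
  then show ?thesis unfolding braiding_def by (rule is_arrow_permutation)
qed

lemma blocks_braiding:
  "blocks (braiding p q) = map (\<lambda>i. [if i < q then p + i else i - q]) [0..<p + q]"
  unfolding braiding_def blocks_permutation by auto

text \<open>Both sides first list the blocks of \<open>g\<close>, shifted by the source of \<open>f\<close>, and then the blocks of \<open>f\<close>:
on the left because the blocks of the product are permuted, on the right because the letters in the
blocks of the opposite product are relabelled.\<close>

lemma braiding_natural:
  assumes f: "is_arrow f" and g: "is_arrow g"
  shows "arr_comp (braiding (tgt f) (tgt g)) (arr_prod f g) = arr_comp (arr_prod g f) (braiding (src f) (src g))"
proof (rule arrow_eqI)
  let ?\<beta> = "blocks (braiding (src f) (src g))"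
  define C where "C = (\<lambda>M. concat (map ((!) ?\<beta>) M))"
  have 1: "C M = map (\<lambda>i. src f + i) M" if "M \<in> set (blocks g)" for M
  proof -
    have "\<forall>i\<in>set M. i < src g" using blocks_bound[OF g that] by auto
    then show ?thesis by (induction M) (simp_all add: C_def blocks_braiding)
  qed
  have 2: "C (map (\<lambda>i. src g + i) M) = M" if "M \<in> set (blocks f)" for M
  proof -
    have "\<forall>i\<in>set M. i < src f" using blocks_bound[OF f that] by auto
    then show ?thesis by (induction M) (simp_all add: C_def blocks_braiding)
  qed
  have "blocks (arr_comp (arr_prod g f) (braiding (src f) (src g)))
      = map C (blocks g @ map (map (\<lambda>i. src g + i)) (blocks f))"
    unfolding C_def by (simp add: blocks_comp is_arrow_prod blocks_prod f g is_arrow_braiding)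
  also have "\<dots> = map C (blocks g) @ map (\<lambda>M. C (map (\<lambda>i. src g + i) M)) (blocks f)"
    by (simp add: o_def)
  also have "map C (blocks g) = map (map (\<lambda>i. src f + i)) (blocks g)"
    using 1 by (rule map_cong[OF refl])
  also have "map (\<lambda>M. C (map (\<lambda>i. src g + i) M)) (blocks f) = blocks f"
    using 2 by (rule map_idI)
  also have "map (map (\<lambda>i. src f + i)) (blocks g) @ blocks f
      = blocks (arr_comp (braiding (tgt f) (tgt g)) (arr_prod f g))"
    using f g is_arrow_braiding
    by (intro nth_equalityI) (auto simp: blocks_comp is_arrow_prod blocks_prod blocks_braiding nth_append)
  finally show "blocks (arr_comp (braiding (tgt f) (tgt g)) (arr_prod f g))
      = blocks (arr_comp (arr_prod g f) (braiding (src f) (src g)))" ..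
qed (use f g is_arrow_braiding in \<open>auto simp: is_arrow_prod intro!: is_arrow_comp\<close>)

section \<open>Tensor powers and the symmetric bar construction\<close>

lemma word_act_blocks:
  "word_act A g w = map (\<lambda>L. foldr (\<otimes>\<^bsub>A\<^esub>) (map ((!) w) L) \<one>\<^bsub>A\<^esub>) (blocks g)"
  by (simp add: word_act_def blocks_def o_def)

lemma length_word_act [simp]: "length (word_act A g w) = tgt g"
  by (simp add: word_act_blocks)

lemma tensor_relsE:
  assumes "s \<in> tensor_rels k A p"
  obtains (add) u a b v where "u @ a # v \<in> words A p" "b \<in> carrier A"
      "s = basis_elt k (u @ (a \<oplus>\<^bsub>A\<^esub> b) # v) \<ominus>\<^bsub>free_mod k (words A p)\<^esub>
         (basis_elt k (u @ a # v) \<oplus>\<^bsub>free_mod k (words A p)\<^esub> basis_elt k (u @ b # v))"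
    | (smult) u r a v where "u @ a # v \<in> words A p" "r \<in> carrier k"
      "s = basis_elt k (u @ (r \<odot>\<^bsub>A\<^esub> a) # v) \<ominus>\<^bsub>free_mod k (words A p)\<^esub>
         (r \<odot>\<^bsub>free_mod k (words A p)\<^esub> basis_elt k (u @ a # v))"
  using assms unfolding tensor_rels_def Let_def by blast

lemma ca_relsE:
  assumes "s \<in> ca_rels k A i"
  obtains (add) F V W where "(F, V) \<in> ca_gens k A i" "(F, W) \<in> ca_gens k A i"
      "s = basis_elt k (F, V \<oplus>\<^bsub>tensor_power k A (src (hd F))\<^esub> W) \<ominus>\<^bsub>free_mod k (ca_gens k A i)\<^esub>
         (basis_elt k (F, V) \<oplus>\<^bsub>free_mod k (ca_gens k A i)\<^esub> basis_elt k (F, W))"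
    | (smult) F r V where "(F, V) \<in> ca_gens k A i" "r \<in> carrier k"
      "s = basis_elt k (F, r \<odot>\<^bsub>tensor_power k A (src (hd F))\<^esub> V) \<ominus>\<^bsub>free_mod k (ca_gens k A i)\<^esub>
         (r \<odot>\<^bsub>free_mod k (ca_gens k A i)\<^esub> basis_elt k (F, V))"
    | (act) f g F V where "is_chain i (f # F)" "is_arrow g" "tgt g = src f"
      "V \<in> carrier (tensor_power k A (src g))"
      "s = basis_elt k (arr_comp f g # F, V) \<ominus>\<^bsub>free_mod k (ca_gens k A i)\<^esub>
         basis_elt k (f # F, bar_act k A g V)"
  using assms unfolding ca_rels_def Let_def by blast

lemma is_chain_Cons: "is_chain i F \<Longrightarrow> \<exists>f F'. F = f # F'"
  by (cases F) (auto simp: is_chain_def)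

lemma is_chain_hd_arrow: "is_chain i F \<Longrightarrow> is_arrow (hd F)"
  by (cases F) (auto simp: is_chain_def)

lemma is_chain_precomp:
  assumes "is_chain i (f # F)" "is_arrow g" "tgt g = src f"
  shows "is_chain i (arr_comp f g # F)"
  using assms by (auto simp: is_chain_def is_arrow_comp nth_Cons split: nat.splits)

context assoc_algebra
begin

lemma words_letter:
  assumes "u @ a # v \<in> words A p"
  shows "a \<in> carrier A" "b \<in> carrier A \<Longrightarrow> u @ b # v \<in> words A p"
  using assms by (auto simp: words_def)

lemma words_append: "v \<in> words A p \<Longrightarrow> w \<in> words A q \<Longrightarrow> v @ w \<in> words A (p + q)"
  by (auto simp: words_def)

lemma tensor_rels_closed: "tensor_rels k A p \<subseteq> carrier (free_mod k (words A p))"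
proof
  interpret F: module k "free_mod k (words A p)" by (rule module_free_mod) (rule R.is_cring)
  fix s assume "s \<in> tensor_rels k A p"
  then show "s \<in> carrier (free_mod k (words A p))"
  proof (cases rule: tensor_relsE)
    case (add u a b v)
    note l = words_letter[OF add(1)]
    show ?thesis unfolding add(3)
      by (intro F.minus_closed F.a_closed basis_elt_closed R.is_cring l(2) add M.a_closed l(1))
  next
    case (smult u r a v)
    note l = words_letter[OF smult(1)]
    show ?thesis unfolding smult(3)
      by (intro F.minus_closed F.smult_closed basis_elt_closed R.is_cring l(2) smult smult_closed l(1))
  qed
qed

lemma module_tensor_power: "module k (tensor_power k A p)"
  unfolding tensor_power_def by (rule module_presented[OF R.is_cring tensor_rels_closed])

lemma pure_tensor_gen_class:
  "w \<in> words A p \<Longrightarrow> pure_tensor k A w = gen_class k (words A p) (tensor_rels k A p) w"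
  by (auto simp: pure_tensor_def words_def)

lemma pure_tensor_closed: "w \<in> words A p \<Longrightarrow> pure_tensor k A w \<in> carrier (tensor_power k A p)"
  by (simp add: pure_tensor_gen_class tensor_power_def gen_class_closed[OF R.is_cring tensor_rels_closed])

lemma pure_tensor_add:
  assumes w: "u @ a # v \<in> words A p" and b: "b \<in> carrier A"
  shows "pure_tensor k A (u @ (a \<oplus>\<^bsub>A\<^esub> b) # v)
    = pure_tensor k A (u @ a # v) \<oplus>\<^bsub>tensor_power k A p\<^esub> pure_tensor k A (u @ b # v)"
proof -
  have ws: "u @ (a \<oplus>\<^bsub>A\<^esub> b) # v \<in> words A p" "u @ b # v \<in> words A p"
    by (intro words_letter(2)[OF w] M.a_closed words_letter(1)[OF w] b)+
  show ?thesis
    unfolding pure_tensor_gen_class[OF ws(1)] pure_tensor_gen_class[OF ws(2)] pure_tensor_gen_class[OF w]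
      tensor_power_def
    by (rule gen_class_additive[OF R.is_cring tensor_rels_closed ws(1) w ws(2)])
       (use w b in \<open>auto simp: tensor_rels_def Let_def\<close>)
qed

lemma pure_tensor_smult:
  assumes w: "u @ a # v \<in> words A p" and r: "r \<in> carrier k"
  shows "pure_tensor k A (u @ (r \<odot>\<^bsub>A\<^esub> a) # v) = r \<odot>\<^bsub>tensor_power k A p\<^esub> pure_tensor k A (u @ a # v)"
proof -
  have ws: "u @ (r \<odot>\<^bsub>A\<^esub> a) # v \<in> words A p"
    by (intro words_letter(2)[OF w] smult_closed words_letter(1)[OF w] r)
  show ?thesis
    unfolding pure_tensor_gen_class[OF ws] pure_tensor_gen_class[OF w] tensor_power_def
    by (rule gen_class_scalar[OF R.is_cring tensor_rels_closed ws w r])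
       (use w r in \<open>auto simp: tensor_rels_def Let_def\<close>)
qed

text \<open>The relators of the tensor power say precisely that pure tensors are additive and homogeneous
in each slot.\<close>

lemma multilinear_tensor_rels:
  assumes M: "module k M" and cl: "\<And>w. w \<in> words A p \<Longrightarrow> \<phi> w \<in> carrier M"
    and add: "\<And>u a b v. u @ a # v \<in> words A p \<Longrightarrow> b \<in> carrier A \<Longrightarrow>
      \<phi> (u @ (a \<oplus>\<^bsub>A\<^esub> b) # v) = \<phi> (u @ a # v) \<oplus>\<^bsub>M\<^esub> \<phi> (u @ b # v)"
    and smult: "\<And>u r a v. u @ a # v \<in> words A p \<Longrightarrow> r \<in> carrier k \<Longrightarrow>
      \<phi> (u @ (r \<odot>\<^bsub>A\<^esub> a) # v) = r \<odot>\<^bsub>M\<^esub> \<phi> (u @ a # v)"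
    and s: "s \<in> tensor_rels k A p"
  shows "lin_ext k M \<phi> s = \<zero>\<^bsub>M\<^esub>"
  using s
proof (cases rule: tensor_relsE)
  case (add u a b v)
  note l = words_letter[OF add(1)]
  show ?thesis unfolding add(3)
    by (rule lin_ext_additive_relator[OF M cl]) (use l add(1,2) assms(3)[OF add(1,2)] in auto)
next
  case (smult u r a v)
  note l = words_letter[OF smult(1)]
  show ?thesis unfolding smult(3)
    by (rule lin_ext_scalar_relator[OF M cl]) (use l smult(1,2) assms(4)[OF smult(1,2)] in auto)
qed

lemma tensor_concat:
  shows tensor_concat_bilinear: "module_bilinear k (tensor_power k A p) (tensor_power k A q)
      (tensor_power k A (p + q)) (tensor_concat k A p q)"
    and tensor_concat_pure: "v \<in> words A p \<Longrightarrow> w \<in> words A q \<Longrightarrow>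
      tensor_concat k A p q (pure_tensor k A v) (pure_tensor k A w) = pure_tensor k A (v @ w)"
proof -
  note M = module_tensor_power[of "p + q"]
  have eq: "tensor_concat k A p q = (\<lambda>V W. lin_lift k (tensor_power k A (p + q))
       (\<lambda>v. lin_lift k (tensor_power k A (p + q)) (\<lambda>w. pure_tensor k A (v @ w)) W) V)"
    by (simp add: tensor_concat_def fun_eq_iff)
  have cl: "pure_tensor k A (v @ w) \<in> carrier (tensor_power k A (p + q))"
    if "v \<in> words A p" "w \<in> words A q" for v w
    by (rule pure_tensor_closed[OF words_append[OF that]])
  have left: "lin_ext k (tensor_power k A (p + q)) (\<lambda>v. pure_tensor k A (v @ w)) s
      = \<zero>\<^bsub>tensor_power k A (p + q)\<^esub>" if "s \<in> tensor_rels k A p" "w \<in> words A q" for s w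
  proof (rule multilinear_tensor_rels[OF M cl[OF _ that(2)] _ _ that(1)])
    fix u a v assume *: "u @ a # v \<in> words A p"
    have w: "u @ a # (v @ w) \<in> words A (p + q)" using words_append[OF * that(2)] by simp
    show "pure_tensor k A ((u @ (a \<oplus>\<^bsub>A\<^esub> b) # v) @ w) = pure_tensor k A ((u @ a # v) @ w)
        \<oplus>\<^bsub>tensor_power k A (p + q)\<^esub> pure_tensor k A ((u @ b # v) @ w)" if "b \<in> carrier A" for b
      using pure_tensor_add[OF w that] by simp
    show "pure_tensor k A ((u @ (r \<odot>\<^bsub>A\<^esub> a) # v) @ w)
        = r \<odot>\<^bsub>tensor_power k A (p + q)\<^esub> pure_tensor k A ((u @ a # v) @ w)" if "r \<in> carrier k" for r
      using pure_tensor_smult[OF w that] by simp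
  qed
  have right: "lin_ext k (tensor_power k A (p + q)) (\<lambda>w. pure_tensor k A (v @ w)) s
      = \<zero>\<^bsub>tensor_power k A (p + q)\<^esub>" if "s \<in> tensor_rels k A q" "v \<in> words A p" for s v
  proof (rule multilinear_tensor_rels[OF M cl[OF that(2)] _ _ that(1)])
    fix u a w assume *: "u @ a # w \<in> words A q"
    have w: "(v @ u) @ a # w \<in> words A (p + q)" using words_append[OF that(2) *] by simp
    show "pure_tensor k A (v @ (u @ (a \<oplus>\<^bsub>A\<^esub> b) # w)) = pure_tensor k A (v @ (u @ a # w))
        \<oplus>\<^bsub>tensor_power k A (p + q)\<^esub> pure_tensor k A (v @ (u @ b # w))" if "b \<in> carrier A" for b
      using pure_tensor_add[OF w that] by simp
    show "pure_tensor k A (v @ (u @ (r \<odot>\<^bsub>A\<^esub> a) # w))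
        = r \<odot>\<^bsub>tensor_power k A (p + q)\<^esub> pure_tensor k A (v @ (u @ a # w))" if "r \<in> carrier k" for r
      using pure_tensor_smult[OF w that] by simp
  qed
  show "module_bilinear k (tensor_power k A p) (tensor_power k A q)
      (tensor_power k A (p + q)) (tensor_concat k A p q)"
    unfolding eq tensor_power_def[of k A p] tensor_power_def[of k A q]
    by (rule bilin_lift_bilinear[OF R.is_cring tensor_rels_closed tensor_rels_closed M])
       (rule cl left right, assumption+)+
  show "tensor_concat k A p q (pure_tensor k A v) (pure_tensor k A w) = pure_tensor k A (v @ w)"
    if "v \<in> words A p" "w \<in> words A q"
    unfolding eq pure_tensor_gen_class[OF that(1)] pure_tensor_gen_class[OF that(2)]
    by (rule bilin_lift_gen_class[OF R.is_cring tensor_rels_closed tensor_rels_closed M])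
       (rule cl left right that | assumption)+
qed

lemma tensor_concat_closed:
  "V \<in> carrier (tensor_power k A p) \<Longrightarrow> W \<in> carrier (tensor_power k A q) \<Longrightarrow>
   tensor_concat k A p q V W \<in> carrier (tensor_power k A (p + q))"
  by (rule bilinear_closed[OF tensor_concat_bilinear])

lemma tensor_hom_eqI:
  assumes M: "module k M" and h: "h \<in> module_hom k (tensor_power k A p) M"
    and g: "g \<in> module_hom k (tensor_power k A p) M"
    and eq: "\<And>w. w \<in> words A p \<Longrightarrow> h (pure_tensor k A w) = g (pure_tensor k A w)"
    and V: "V \<in> carrier (tensor_power k A p)"
  shows "h V = g V"
proof (rule presented_hom_eqI[OF R.is_cring tensor_rels_closed M
      h[unfolded tensor_power_def] g[unfolded tensor_power_def] _ V[unfolded tensor_power_def]])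
  fix w assume "w \<in> words A p"
  from eq[OF this] show "h (gen_class k (words A p) (tensor_rels k A p) w)
      = g (gen_class k (words A p) (tensor_rels k A p) w)"
    unfolding pure_tensor_gen_class[OF \<open>w \<in> words A p\<close>] .
qed

lemma tensor_bilinear_eqI:
  assumes M: "module k M" and f: "module_bilinear k (tensor_power k A p) (tensor_power k A q) M f"
    and g: "module_bilinear k (tensor_power k A p) (tensor_power k A q) M g"
    and eq: "\<And>v w. v \<in> words A p \<Longrightarrow> w \<in> words A q \<Longrightarrow>
       f (pure_tensor k A v) (pure_tensor k A w) = g (pure_tensor k A v) (pure_tensor k A w)"
    and V: "V \<in> carrier (tensor_power k A p)" and W: "W \<in> carrier (tensor_power k A q)"
  shows "f V W = g V W"
proof (rule tensor_hom_eqI[OF M bilinear_left[OF f W] bilinear_left[OF g W] _ V])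
  fix v assume v: "v \<in> words A p"
  note c = pure_tensor_closed[OF v]
  show "f (pure_tensor k A v) W = g (pure_tensor k A v) W"
    by (rule tensor_hom_eqI[OF M bilinear_right[OF f c] bilinear_right[OF g c] eq[OF v] W])
qed

lemma tensor_concat_assoc:
  assumes U: "U \<in> carrier (tensor_power k A p)" and V: "V \<in> carrier (tensor_power k A q)"
    and W: "W \<in> carrier (tensor_power k A r)"
  shows "tensor_concat k A (p + q) r (tensor_concat k A p q U V) W
       = tensor_concat k A p (q + r) U (tensor_concat k A q r V W)"
proof (rule tensor_hom_eqI[OF module_tensor_power[of "p + q + r"] _ _ _ U])
  note b = tensor_concat_bilinear
  have b': "module_bilinear k (tensor_power k A p) (tensor_power k A (q + r)) (tensor_power k A (p + q + r))
      (tensor_concat k A p (q + r))"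
    using b[of p "q + r"] by (simp add: add.assoc)
  show "(\<lambda>U. tensor_concat k A (p + q) r (tensor_concat k A p q U V) W)
      \<in> module_hom k (tensor_power k A p) (tensor_power k A (p + q + r))"
    by (rule module_hom_comp[OF bilinear_left[OF b W] bilinear_left[OF b V]])
  show "(\<lambda>U. tensor_concat k A p (q + r) U (tensor_concat k A q r V W))
      \<in> module_hom k (tensor_power k A p) (tensor_power k A (p + q + r))"
    by (rule bilinear_left[OF b' tensor_concat_closed[OF V W]])
  fix u assume u: "u \<in> words A p"
  note pu = pure_tensor_closed[OF u]
  show "tensor_concat k A (p + q) r (tensor_concat k A p q (pure_tensor k A u) V) W
      = tensor_concat k A p (q + r) (pure_tensor k A u) (tensor_concat k A q r V W)"
  proof (rule tensor_bilinear_eqI[OF module_tensor_power[of "p + q + r"] _ _ _ V W])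
    show "module_bilinear k (tensor_power k A q) (tensor_power k A r) (tensor_power k A (p + q + r))
       (\<lambda>V W. tensor_concat k A (p + q) r (tensor_concat k A p q (pure_tensor k A u) V) W)"
      by (rule module_bilinear_comp_homs[OF b bilinear_right[OF b pu] module_hom_id])
    show "module_bilinear k (tensor_power k A q) (tensor_power k A r) (tensor_power k A (p + q + r))
       (\<lambda>V W. tensor_concat k A p (q + r) (pure_tensor k A u) (tensor_concat k A q r V W))"
      by (rule module_bilinear_hom_comp[OF bilinear_right[OF b' pu] b])
    fix v w assume v: "v \<in> words A q" and w: "w \<in> words A r"
    show "tensor_concat k A (p + q) r (tensor_concat k A p q (pure_tensor k A u) (pure_tensor k A v)) (pure_tensor k A w)
      = tensor_concat k A p (q + r) (pure_tensor k A u) (tensor_concat k A q r (pure_tensor k A v) (pure_tensor k A w))"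
      using u v w words_append by (simp add: tensor_concat_pure)
  qed
qed

lemma Nil_word: "[] \<in> words A 0"
  by (simp add: words_def)

lemma tensor_concat_unit:
  assumes V: "V \<in> carrier (tensor_power k A p)"
  shows "tensor_concat k A 0 p (pure_tensor k A []) V = V"
    and "tensor_concat k A p 0 V (pure_tensor k A []) = V"
proof -
  note e = pure_tensor_closed[OF Nil_word]
  have b: "module_bilinear k (tensor_power k A 0) (tensor_power k A p) (tensor_power k A p) (tensor_concat k A 0 p)"
    "module_bilinear k (tensor_power k A p) (tensor_power k A 0) (tensor_power k A p) (tensor_concat k A p 0)"
    using tensor_concat_bilinear[of 0 p] tensor_concat_bilinear[of p 0] by simp_all
  show "tensor_concat k A 0 p (pure_tensor k A []) V = V"
    by (rule tensor_hom_eqI[OF module_tensor_power bilinear_right[OF b(1) e] module_hom_id _ V])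
       (simp add: tensor_concat_pure Nil_word)
  show "tensor_concat k A p 0 V (pure_tensor k A []) = V"
    by (rule tensor_hom_eqI[OF module_tensor_power bilinear_left[OF b(2) e] module_hom_id _ V])
       (simp add: tensor_concat_pure Nil_word)
qed

lemma foldr_mult_closed:
  "set xs \<subseteq> carrier A \<Longrightarrow> y \<in> carrier A \<Longrightarrow> foldr (\<otimes>\<^bsub>A\<^esub>) xs y \<in> carrier A"
  by (induction xs) auto

lemma foldr_mult_add:
  "set xs \<subseteq> carrier A \<Longrightarrow> y \<in> carrier A \<Longrightarrow> z \<in> carrier A \<Longrightarrow>
   foldr (\<otimes>\<^bsub>A\<^esub>) xs (y \<oplus>\<^bsub>A\<^esub> z) = foldr (\<otimes>\<^bsub>A\<^esub>) xs y \<oplus>\<^bsub>A\<^esub> foldr (\<otimes>\<^bsub>A\<^esub>) xs z"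
  by (induction xs) (auto simp: foldr_mult_closed r_distr)

lemma foldr_mult_smult:
  "set xs \<subseteq> carrier A \<Longrightarrow> y \<in> carrier A \<Longrightarrow> r \<in> carrier k \<Longrightarrow>
   foldr (\<otimes>\<^bsub>A\<^esub>) xs (r \<odot>\<^bsub>A\<^esub> y) = r \<odot>\<^bsub>A\<^esub> foldr (\<otimes>\<^bsub>A\<^esub>) xs y"
  by (induction xs) (auto simp: foldr_mult_closed smult_mult_right)

lemma word_act_words:
  assumes g: "is_arrow g" and w: "w \<in> words A (src g)"
  shows "word_act A g w \<in> words A (tgt g)"
proof -
  have "foldr (\<otimes>\<^bsub>A\<^esub>) (map ((!) w) L) \<one>\<^bsub>A\<^esub> \<in> carrier A" if "L \<in> set (blocks g)" for L
    using blocks_bound[OF g that] w by (intro foldr_mult_closed) (auto simp: words_def subset_iff)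
  then show ?thesis unfolding words_def word_act_blocks by (auto simp del: foldr_map)
qed

text \<open>As a function of the letter in one position, the action of an arrow has the shape
\<open>b \<mapsto> U, X \<cdot> b \<cdot> y, V\<close> with everything except \<open>b\<close> fixed. The reason is that each source letter
occurs in exactly one block, and there only once. So the action is linear in each letter.\<close>

lemma word_act_slot:
  assumes g: "is_arrow g" and w: "u @ a # v \<in> words A (src g)"
  obtains U X y V where "set X \<subseteq> carrier A" "y \<in> carrier A"
    and "\<And>b. word_act A g (u @ b # v) = U @ foldr (\<otimes>\<^bsub>A\<^esub>) X (b \<otimes>\<^bsub>A\<^esub> y) # V"
proof -
  let ?s = "length u"
  have s: "?s < src g" using w by (auto simp: words_def)
  have dist: "distinct (concat (blocks g))"
    unfolding concat_blocks[OF g]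
    using permutes_inj_on[OF is_arrowD(2)[OF g]] by (simp add: distinct_map)
  have "?s \<in> perm g ` {..<src g}" using permutes_image[OF is_arrowD(2)[OF g]] s by simp
  then have "?s \<in> set (concat (blocks g))" unfolding concat_blocks[OF g] by auto
  then obtain L where L: "L \<in> set (blocks g)" "?s \<in> set L" by auto
  obtain B1 B2 where B: "blocks g = B1 @ L # B2" using split_list[OF L(1)] by blast
  obtain L1 L2 where LL: "L = L1 @ ?s # L2" using split_list[OF L(2)] by blast
  have notin: "?s \<notin> set L1" "?s \<notin> set L2" "\<And>M. M \<in> set B1 \<Longrightarrow> ?s \<notin> set M" "\<And>M. M \<in> set B2 \<Longrightarrow> ?s \<notin> set M"
    using dist unfolding B LL by auto
  have indep: "map ((!) (u @ b # v)) M = map ((!) (u @ a # v)) M" if "?s \<notin> set M" for M b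
    using that by (auto simp: nth_append nth_Cons split: nat.splits)
  have carr: "set (map ((!) (u @ a # v)) M) \<subseteq> carrier A" if "set M \<subseteq> set L" for M
  proof
    fix c assume "c \<in> set (map ((!) (u @ a # v)) M)"
    then obtain i where i: "i \<in> set M" "c = (u @ a # v) ! i" by auto
    then have "i < length (u @ a # v)" using blocks_bound[OF g L(1)] that w by (auto simp: words_def)
    then have "c \<in> set (u @ a # v)" unfolding i(2) by (rule nth_mem)
    then show "c \<in> carrier A" using w by (auto simp: words_def)
  qed
  let ?e = "\<lambda>b M. foldr (\<otimes>\<^bsub>A\<^esub>) (map ((!) (u @ b # v)) M) \<one>\<^bsub>A\<^esub>"
  show thesis
  proof (rule that)
    show "set (map ((!) (u @ a # v)) L1) \<subseteq> carrier A" by (rule carr) (auto simp: LL)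
    show "?e a L2 \<in> carrier A" by (rule foldr_mult_closed[OF carr]) (auto simp: LL)
    fix b
    have "?e b L = foldr (\<otimes>\<^bsub>A\<^esub>) (map ((!) (u @ b # v)) L1) (b \<otimes>\<^bsub>A\<^esub> ?e b L2)"
      unfolding LL by simp
    then have slot: "?e b L = foldr (\<otimes>\<^bsub>A\<^esub>) (map ((!) (u @ a # v)) L1) (b \<otimes>\<^bsub>A\<^esub> ?e a L2)"
      unfolding indep[OF notin(1), of b] indep[OF notin(2), of b] .
    have eb: "?e b M = ?e a M" if "?s \<notin> set M" for M
      unfolding indep[OF that, of b] ..
    have "map (?e b) B1 = map (?e a) B1" "map (?e b) B2 = map (?e a) B2"
      using notin(3,4) by (auto intro!: eb simp del: foldr_map)
    with slot show "word_act A g (u @ b # v) = map (?e a) B1 @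
        foldr (\<otimes>\<^bsub>A\<^esub>) (map ((!) (u @ a # v)) L1) (b \<otimes>\<^bsub>A\<^esub> ?e a L2) # map (?e a) B2"
      by (simp add: word_act_blocks B del: foldr_map)
  qed
qed

lemma bar_act:
  assumes g: "is_arrow g"
  shows bar_act_hom: "bar_act k A g \<in> module_hom k (tensor_power k A (src g)) (tensor_power k A (tgt g))"
    and bar_act_pure: "w \<in> words A (src g) \<Longrightarrow>
      bar_act k A g (pure_tensor k A w) = pure_tensor k A (word_act A g w)"
proof -
  note M = module_tensor_power[of "tgt g"]
  have cl: "pure_tensor k A (word_act A g w) \<in> carrier (tensor_power k A (tgt g))"
    if "w \<in> words A (src g)" for w
    by (rule pure_tensor_closed[OF word_act_words[OF g that]])
  have rel: "lin_ext k (tensor_power k A (tgt g)) (\<lambda>w. pure_tensor k A (word_act A g w)) s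
      = \<zero>\<^bsub>tensor_power k A (tgt g)\<^esub>" if "s \<in> tensor_rels k A (src g)" for s
  proof (rule multilinear_tensor_rels[OF M cl _ _ that])
    fix u a v assume w: "u @ a # v \<in> words A (src g)"
    obtain U X y V where X: "set X \<subseteq> carrier A" "y \<in> carrier A"
      and eq: "\<And>b. word_act A g (u @ b # v) = U @ foldr (\<otimes>\<^bsub>A\<^esub>) X (b \<otimes>\<^bsub>A\<^esub> y) # V"
      using word_act_slot[OF g w] by metis
    note a = words_letter(1)[OF w]
    have w': "U @ foldr (\<otimes>\<^bsub>A\<^esub>) X (a \<otimes>\<^bsub>A\<^esub> y) # V \<in> words A (tgt g)"
      using word_act_words[OF g w] by (simp add: eq)
    show "pure_tensor k A (word_act A g (u @ (a \<oplus>\<^bsub>A\<^esub> b) # v))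
        = pure_tensor k A (word_act A g (u @ a # v)) \<oplus>\<^bsub>tensor_power k A (tgt g)\<^esub>
          pure_tensor k A (word_act A g (u @ b # v))" if b: "b \<in> carrier A" for b
      using pure_tensor_add[OF w' foldr_mult_closed[OF X(1), of "b \<otimes>\<^bsub>A\<^esub> y"]] a b X
      by (simp add: eq l_distr foldr_mult_add)
    show "pure_tensor k A (word_act A g (u @ (r \<odot>\<^bsub>A\<^esub> a) # v))
        = r \<odot>\<^bsub>tensor_power k A (tgt g)\<^esub> pure_tensor k A (word_act A g (u @ a # v))"
      if r: "r \<in> carrier k" for r
      using pure_tensor_smult[OF w' r] a r X
      by (simp add: eq smult_mult_left foldr_mult_smult)
  qed
  show "bar_act k A g \<in> module_hom k (tensor_power k A (src g)) (tensor_power k A (tgt g))"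
    unfolding bar_act_def tensor_power_def[of k A "src g"]
    by (rule lin_lift_hom[OF R.is_cring tensor_rels_closed M]) (rule cl rel, assumption)+
  show "bar_act k A g (pure_tensor k A w) = pure_tensor k A (word_act A g w)"
    if "w \<in> words A (src g)"
    unfolding bar_act_def pure_tensor_gen_class[OF that]
    by (rule lin_lift_gen_class[OF R.is_cring tensor_rels_closed M]) (rule cl rel that | assumption)+
qed

lemma bar_act_closed:
  "is_arrow g \<Longrightarrow> V \<in> carrier (tensor_power k A (src g)) \<Longrightarrow> bar_act k A g V \<in> carrier (tensor_power k A (tgt g))"
  by (rule module_homD(1)[OF bar_act_hom])

lemma word_act_permutation:
  assumes "w \<in> words A p" "\<And>i. i < p \<Longrightarrow> \<gamma> i < p" "blocks g = map (\<lambda>i. [\<gamma> i]) [0..<p]"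
  shows "word_act A g w = map (\<lambda>i. w ! \<gamma> i) [0..<p]"
proof -
  have "w ! \<gamma> i \<in> carrier A" if "i < p" for i
    using assms(1,2) that by (auto simp: words_def subset_iff)
  then show ?thesis using assms(3) by (simp add: word_act_blocks)
qed

lemma bar_act_id:
  assumes V: "V \<in> carrier (tensor_power k A p)"
  shows "bar_act k A (arr_id p) V = V"
proof (rule tensor_hom_eqI[OF module_tensor_power _ module_hom_id _ V])
  show "bar_act k A (arr_id p) \<in> module_hom k (tensor_power k A p) (tensor_power k A p)"
    using bar_act_hom[of "arr_id p"] by simp
  fix w assume w: "w \<in> words A p"
  have "word_act A (arr_id p) w = w"
    unfolding word_act_permutation[OF w _ blocks_id, simplified]
    using w by (auto simp: words_def map_nth)
  then show "bar_act k A (arr_id p) (pure_tensor k A w) = pure_tensor k A w"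
    using w bar_act_pure[of "arr_id p" w] by simp
qed

text \<open>The bar construction is strictly monoidal: the blocks of \<open>f \<odot> g\<close> are those of \<open>f\<close>, which read
only letters of the first tensor factor, followed by those of \<open>g\<close>, which read only letters of the
second.\<close>

lemma bar_act_prod:
  assumes f: "is_arrow f" and g: "is_arrow g"
    and V: "V \<in> carrier (tensor_power k A (src f))" and W: "W \<in> carrier (tensor_power k A (src g))"
  shows "bar_act k A (arr_prod f g) (tensor_concat k A (src f) (src g) V W)
       = tensor_concat k A (tgt f) (tgt g) (bar_act k A f V) (bar_act k A g W)"
proof (rule tensor_bilinear_eqI[OF module_tensor_power[of "tgt f + tgt g"] _ _ _ V W])
  show "module_bilinear k (tensor_power k A (src f)) (tensor_power k A (src g)) (tensor_power k A (tgt f + tgt g))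
      (\<lambda>V W. bar_act k A (arr_prod f g) (tensor_concat k A (src f) (src g) V W))"
    using module_bilinear_hom_comp[OF bar_act_hom[OF is_arrow_prod[OF f g], simplified] tensor_concat_bilinear] .
  show "module_bilinear k (tensor_power k A (src f)) (tensor_power k A (src g)) (tensor_power k A (tgt f + tgt g))
      (\<lambda>V W. tensor_concat k A (tgt f) (tgt g) (bar_act k A f V) (bar_act k A g W))"
    by (rule module_bilinear_comp_homs[OF tensor_concat_bilinear bar_act_hom[OF f] bar_act_hom[OF g]])
  fix v w assume v: "v \<in> words A (src f)" and w: "w \<in> words A (src g)"
  have lv: "length v = src f" using v by (simp add: words_def)
  have 1: "map ((!) (v @ w)) L = map ((!) v) L" if "L \<in> set (blocks f)" for L
    using blocks_bound[OF f that] lv by (auto simp: nth_append)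
  have 2: "map (\<lambda>i. (v @ w) ! (src f + i)) L = map ((!) w) L" for L
    using lv by (auto simp: nth_append)
  have "word_act A (arr_prod f g) (v @ w) = word_act A f v @ word_act A g w"
    unfolding word_act_blocks blocks_prod[OF f g] map_append map_map o_def 2
    by (rule arg_cong2[of _ _ _ _ "(@)"]; rule map_cong[OF refl]) (simp_all add: 1 del: foldr_map)
  then show "bar_act k A (arr_prod f g) (tensor_concat k A (src f) (src g) (pure_tensor k A v) (pure_tensor k A w))
     = tensor_concat k A (tgt f) (tgt g) (bar_act k A f (pure_tensor k A v)) (bar_act k A g (pure_tensor k A w))"
    using v w f g words_append[OF v w] bar_act_pure[OF is_arrow_prod[OF f g], of "v @ w"]
    by (simp add: tensor_concat_pure bar_act_pure word_act_words)
qed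

lemma bar_act_braiding:
  assumes V: "V \<in> carrier (tensor_power k A p)" and W: "W \<in> carrier (tensor_power k A q)"
  shows "bar_act k A (braiding p q) (tensor_concat k A p q V W) = tensor_concat k A q p W V"
proof (rule tensor_bilinear_eqI[OF module_tensor_power[of "p + q"] _ _ _ V W])
  show "module_bilinear k (tensor_power k A p) (tensor_power k A q) (tensor_power k A (p + q))
      (\<lambda>V W. bar_act k A (braiding p q) (tensor_concat k A p q V W))"
    using module_bilinear_hom_comp[OF bar_act_hom[OF is_arrow_braiding[of p q], simplified] tensor_concat_bilinear] .
  show "module_bilinear k (tensor_power k A p) (tensor_power k A q) (tensor_power k A (p + q))
      (\<lambda>V W. tensor_concat k A q p W V)"
    using module_bilinear_flip[OF tensor_concat_bilinear[of q p]] by (simp add: add.commute)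
  fix v w assume v: "v \<in> words A p" and w: "w \<in> words A q"
  note vw = words_append[OF v w]
  have "word_act A (braiding p q) (v @ w) = map (\<lambda>i. (v @ w) ! (if i < q then p + i else i - q)) [0..<p + q]"
    by (rule word_act_permutation[OF vw _ blocks_braiding]) auto
  also have "\<dots> = w @ v"
    using v w by (intro nth_equalityI) (auto simp: words_def nth_append)
  finally have "word_act A (braiding p q) (v @ w) = w @ v" .
  then show "bar_act k A (braiding p q) (tensor_concat k A p q (pure_tensor k A v) (pure_tensor k A w))
     = tensor_concat k A q p (pure_tensor k A w) (pure_tensor k A v)"
    using v w vw bar_act_pure[OF is_arrow_braiding, of "v @ w" p q]
    by (simp add: tensor_concat_pure)
qed

end

section \<open>Linear and bilinear operations induced by operations on chains\<close>

text \<open>An operation on chains induces a linear map of $CA_*$ when it respects the relation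
\<open>(f g, \<dots>) \<otimes> V = (f, \<dots>) \<otimes> g V\<close> of the tensor product over $\Delta S_+$. For this it suffices that
precomposition of the first arrow with \<open>g\<close> changes the result only by precomposition of its first
arrow with \<open>g\<close>.\<close>

definition chain_op :: "nat \<Rightarrow> nat \<Rightarrow> (arrow list \<Rightarrow> arrow list) \<Rightarrow> bool" where
  "chain_op i j \<Phi> \<longleftrightarrow>
     (\<forall>F. is_chain i F \<longrightarrow> is_chain j (\<Phi> F) \<and> src (hd (\<Phi> F)) = src (hd F)) \<and>
     (\<forall>f g F. is_chain i (f # F) \<longrightarrow> is_arrow g \<longrightarrow> tgt g = src f \<longrightarrow>
        (\<exists>f' F'. \<Phi> (f # F) = f' # F' \<and> \<Phi> (arr_comp f g # F) = arr_comp f' g # F'))"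

text \<open>The analogue for operations on pairs of chains. Precomposition with \<open>g\<close> in one of the two arguments
has to precompose the first arrow of the result with the juxtaposition of \<open>g\<close> and an identity, which
acts on one tensor factor only. Both the multiplication of $CA_*$ and the prisms of the homotopy
are of this kind.\<close>

definition chain_pairing :: "nat \<Rightarrow> nat \<Rightarrow> (arrow list \<Rightarrow> arrow list \<Rightarrow> arrow list) \<Rightarrow> bool" where
  "chain_pairing i j \<Phi> \<longleftrightarrow>
     (\<forall>F G. is_chain i F \<longrightarrow> is_chain i G \<longrightarrow>
        is_chain j (\<Phi> F G) \<and> src (hd (\<Phi> F G)) = src (hd F) + src (hd G)) \<and>
     (\<forall>f g F G. is_chain i (f # F) \<longrightarrow> is_chain i G \<longrightarrow> is_arrow g \<longrightarrow> tgt g = src f \<longrightarrow>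
        (\<exists>h H. \<Phi> (f # F) G = h # H \<and>
          \<Phi> (arr_comp f g # F) G = arr_comp h (arr_prod g (arr_id (src (hd G)))) # H)) \<and>
     (\<forall>f g F G. is_chain i F \<longrightarrow> is_chain i (f # G) \<longrightarrow> is_arrow g \<longrightarrow> tgt g = src f \<longrightarrow>
        (\<exists>h H. \<Phi> F (f # G) = h # H \<and>
          \<Phi> F (arr_comp f g # G) = arr_comp h (arr_prod (arr_id (src (hd F))) g) # H))"

definition ca_pairing ::
  "('k, 'r) ring_scheme \<Rightarrow> ('k, 'a, 's) module_scheme \<Rightarrow> (arrow list \<Rightarrow> arrow list \<Rightarrow> arrow list) \<Rightarrow> nat \<Rightarrow>
   (arrow list \<times> ('a list \<Rightarrow> 'k) set \<Rightarrow> 'k) set \<Rightarrow> (arrow list \<times> ('a list \<Rightarrow> 'k) set \<Rightarrow> 'k) set \<Rightarrow>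
   (arrow list \<times> ('a list \<Rightarrow> 'k) set \<Rightarrow> 'k) set" where
  "ca_pairing k A \<Phi> j x y =
     lin_lift k (CA k A j) (\<lambda>(F, V).
       lin_lift k (CA k A j) (\<lambda>(G, W).
         ca_gen k A j (\<Phi> F G) (tensor_concat k A (src (hd F)) (src (hd G)) V W)) y) x"

lemma ca_mult_pairing: "ca_mult k A i = ca_pairing k A (map2 arr_prod) i"
  by (simp add: ca_mult_def ca_pairing_def fun_eq_iff)

context assoc_algebra
begin

lemma ca_gens_iff:
  "(F, V) \<in> ca_gens k A i \<longleftrightarrow> is_chain i F \<and> V \<in> carrier (tensor_power k A (src (hd F)))"
  by (simp add: ca_gens_def)

lemma ca_gens_precomp:
  assumes "is_chain i (f # F)" "is_arrow g" "tgt g = src f" "V \<in> carrier (tensor_power k A (src g))"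
  shows "(arr_comp f g # F, V) \<in> ca_gens k A i" and "(f # F, bar_act k A g V) \<in> ca_gens k A i"
  using assms is_chain_precomp[OF assms(1-3)] bar_act_closed[OF assms(2,4)] by (simp_all add: ca_gens_iff)

lemma ca_gens_linear:
  assumes F: "(F, V) \<in> ca_gens k A i"
  shows "(F, W) \<in> ca_gens k A i \<Longrightarrow> (F, V \<oplus>\<^bsub>tensor_power k A (src (hd F))\<^esub> W) \<in> ca_gens k A i"
    and "r \<in> carrier k \<Longrightarrow> (F, r \<odot>\<^bsub>tensor_power k A (src (hd F))\<^esub> V) \<in> ca_gens k A i"
proof -
  interpret T: module k "tensor_power k A (src (hd F))" by (rule module_tensor_power)
  show "(F, W) \<in> ca_gens k A i \<Longrightarrow> (F, V \<oplus>\<^bsub>tensor_power k A (src (hd F))\<^esub> W) \<in> ca_gens k A i"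
    and "r \<in> carrier k \<Longrightarrow> (F, r \<odot>\<^bsub>tensor_power k A (src (hd F))\<^esub> V) \<in> ca_gens k A i"
    using F by (simp_all add: ca_gens_iff)
qed

lemma ca_rels_closed: "ca_rels k A i \<subseteq> carrier (free_mod k (ca_gens k A i))"
proof
  interpret F: module k "free_mod k (ca_gens k A i)" by (rule module_free_mod) (rule R.is_cring)
  fix s assume "s \<in> ca_rels k A i"
  then show "s \<in> carrier (free_mod k (ca_gens k A i))"
  proof (cases rule: ca_relsE)
    case (add F V W)
    show ?thesis unfolding add(3)
      by (intro F.minus_closed F.a_closed basis_elt_closed R.is_cring ca_gens_linear(1) add)
  next
    case (smult F r V)
    show ?thesis unfolding smult(3)
      by (intro F.minus_closed F.smult_closed basis_elt_closed R.is_cring ca_gens_linear(2) smult)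
  next
    case (act f g F V)
    show ?thesis unfolding act(5)
      by (intro F.minus_closed basis_elt_closed R.is_cring ca_gens_precomp act)
  qed
qed

lemma module_CA: "module k (CA k A i)"
  unfolding CA_def by (rule module_presented[OF R.is_cring ca_rels_closed])

lemma ca_gen_hom:
  assumes F: "is_chain i F"
  shows "ca_gen k A i F \<in> module_hom k (tensor_power k A (src (hd F))) (CA k A i)"
proof (rule module_homI)
  fix V assume V: "V \<in> carrier (tensor_power k A (src (hd F)))"
  then have g: "(F, V) \<in> ca_gens k A i" using F by (simp add: ca_gens_iff)
  show "ca_gen k A i F V \<in> carrier (CA k A i)"
    unfolding ca_gen_def CA_def by (rule gen_class_closed[OF R.is_cring ca_rels_closed g])
  show "ca_gen k A i F (r \<odot>\<^bsub>tensor_power k A (src (hd F))\<^esub> V) = r \<odot>\<^bsub>CA k A i\<^esub> ca_gen k A i F V"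
    if r: "r \<in> carrier k" for r
    unfolding ca_gen_def CA_def
    by (rule gen_class_scalar[OF R.is_cring ca_rels_closed ca_gens_linear(2)[OF g r] g r])
       (use g r in \<open>auto simp: ca_rels_def Let_def\<close>)
  show "ca_gen k A i F (V \<oplus>\<^bsub>tensor_power k A (src (hd F))\<^esub> W)
      = ca_gen k A i F V \<oplus>\<^bsub>CA k A i\<^esub> ca_gen k A i F W"
    if W: "W \<in> carrier (tensor_power k A (src (hd F)))" for W
  proof -
    have h: "(F, W) \<in> ca_gens k A i" using F W by (simp add: ca_gens_iff)
    have "basis_elt k (F, V \<oplus>\<^bsub>tensor_power k A (src (hd F))\<^esub> W) \<ominus>\<^bsub>free_mod k (ca_gens k A i)\<^esub>
         (basis_elt k (F, V) \<oplus>\<^bsub>free_mod k (ca_gens k A i)\<^esub> basis_elt k (F, W)) \<in> ca_rels k A i"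
      unfolding ca_rels_def Let_def using g h by blast
    then show ?thesis unfolding ca_gen_def CA_def
      by (rule gen_class_additive[OF R.is_cring ca_rels_closed ca_gens_linear(1)[OF g h] g h])
  qed
qed

lemma ca_gen_closed:
  "is_chain i F \<Longrightarrow> V \<in> carrier (tensor_power k A (src (hd F))) \<Longrightarrow> ca_gen k A i F V \<in> carrier (CA k A i)"
  by (rule module_homD(1)[OF ca_gen_hom])

lemma ca_gen_precomp:
  assumes "is_chain i (f # F)" "is_arrow g" "tgt g = src f" "V \<in> carrier (tensor_power k A (src g))"
  shows "ca_gen k A i (arr_comp f g # F) V = ca_gen k A i (f # F) (bar_act k A g V)"
  unfolding ca_gen_def
  by (rule gen_class_equal[OF R.is_cring ca_rels_closed ca_gens_precomp[OF assms]])
     (use assms in \<open>auto simp: ca_rels_def Let_def\<close>)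

text \<open>To be additive and homogeneous in the coefficient and balanced over $\Delta S_+$ is to vanish on the
relators of $CA_*$.\<close>

lemma balanced_ca_rels:
  assumes M: "module k M"
    and hom: "\<And>F. is_chain i F \<Longrightarrow> \<phi> F \<in> module_hom k (tensor_power k A (src (hd F))) M"
    and act: "\<And>f g F V. is_chain i (f # F) \<Longrightarrow> is_arrow g \<Longrightarrow> tgt g = src f \<Longrightarrow>
      V \<in> carrier (tensor_power k A (src g)) \<Longrightarrow> \<phi> (arr_comp f g # F) V = \<phi> (f # F) (bar_act k A g V)"
    and s: "s \<in> ca_rels k A i"
  shows "lin_ext k M (\<lambda>(F, V). \<phi> F V) s = \<zero>\<^bsub>M\<^esub>"
proof -
  have cl: "(case x of (F, V) \<Rightarrow> \<phi> F V) \<in> carrier M" if "x \<in> ca_gens k A i" for x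
    using that module_homD(1)[OF hom] by (cases x) (simp add: ca_gens_iff)
  show ?thesis using s
  proof (cases rule: ca_relsE)
    case (add F V W)
    show ?thesis unfolding add(3)
      by (rule lin_ext_additive_relator[OF M cl ca_gens_linear(1)[OF add(1,2)] add(1,2)])
         (use add(1,2) in \<open>simp_all add: ca_gens_iff module_homD(2)[OF hom]\<close>)
  next
    case (smult F r V)
    show ?thesis unfolding smult(3)
      by (rule lin_ext_scalar_relator[OF M cl ca_gens_linear(2)[OF smult(1,2)] smult(1,2)])
         (use smult(1,2) in \<open>simp_all add: ca_gens_iff module_homD(3)[OF hom]\<close>)
  next
    case (act f g F V)
    show ?thesis unfolding act(5)
      by (rule lin_ext_equality_relator[OF M cl ca_gens_precomp[OF act(1-4)]])
         (simp_all add: assms(3)[OF act(1-4)])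
  qed
qed

lemma CA_hom_eqI:
  assumes M: "module k M" and h: "h \<in> module_hom k (CA k A i) M" and g: "g \<in> module_hom k (CA k A i) M"
    and eq: "\<And>F V. is_chain i F \<Longrightarrow> V \<in> carrier (tensor_power k A (src (hd F))) \<Longrightarrow>
      h (ca_gen k A i F V) = g (ca_gen k A i F V)"
    and x: "x \<in> carrier (CA k A i)"
  shows "h x = g x"
proof (rule presented_hom_eqI[OF R.is_cring ca_rels_closed M
      h[unfolded CA_def] g[unfolded CA_def] _ x[unfolded CA_def]])
  fix y assume "y \<in> ca_gens k A i"
  then show "h (gen_class k (ca_gens k A i) (ca_rels k A i) y) = g (gen_class k (ca_gens k A i) (ca_rels k A i) y)"
    using eq unfolding ca_gen_def by (cases y) (simp add: ca_gens_iff)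
qed

lemma CA_bilinear_eqI:
  assumes M: "module k M" and f: "module_bilinear k (CA k A i) (CA k A j) M f"
    and g: "module_bilinear k (CA k A i) (CA k A j) M g"
    and eq: "\<And>F V G W. is_chain i F \<Longrightarrow> V \<in> carrier (tensor_power k A (src (hd F))) \<Longrightarrow>
      is_chain j G \<Longrightarrow> W \<in> carrier (tensor_power k A (src (hd G))) \<Longrightarrow>
      f (ca_gen k A i F V) (ca_gen k A j G W) = g (ca_gen k A i F V) (ca_gen k A j G W)"
    and x: "x \<in> carrier (CA k A i)" and y: "y \<in> carrier (CA k A j)"
  shows "f x y = g x y"
proof (rule CA_hom_eqI[OF M bilinear_left[OF f y] bilinear_left[OF g y] _ x])
  fix F V assume F: "is_chain i F" "V \<in> carrier (tensor_power k A (src (hd F)))"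
  note c = ca_gen_closed[OF F]
  show "f (ca_gen k A i F V) y = g (ca_gen k A i F V) y"
    by (rule CA_hom_eqI[OF M bilinear_right[OF f c] bilinear_right[OF g c] eq[OF F] y])
qed

lemma chain_op:
  assumes \<Phi>: "chain_op i j \<Phi>"
  defines "H \<equiv> lin_lift k (CA k A j) (\<lambda>(F, V). ca_gen k A j (\<Phi> F) V)"
  shows chain_op_hom: "H \<in> module_hom k (CA k A i) (CA k A j)"
    and chain_op_gen: "\<And>F V. is_chain i F \<Longrightarrow> V \<in> carrier (tensor_power k A (src (hd F))) \<Longrightarrow>
      H (ca_gen k A i F V) = ca_gen k A j (\<Phi> F) V"
proof -
  have chain: "is_chain j (\<Phi> F)" "src (hd (\<Phi> F)) = src (hd F)" if "is_chain i F" for F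
    using \<Phi> that by (auto simp: chain_op_def)
  have hom: "ca_gen k A j (\<Phi> F) \<in> module_hom k (tensor_power k A (src (hd F))) (CA k A j)"
    if "is_chain i F" for F using ca_gen_hom[OF chain(1)[OF that]] chain(2)[OF that] by simp
  have cl: "(case x of (F, V) \<Rightarrow> ca_gen k A j (\<Phi> F) V) \<in> carrier (CA k A j)" if "x \<in> ca_gens k A i" for x
    using that module_homD(1)[OF hom] by (cases x) (simp add: ca_gens_iff)
  have rel: "lin_ext k (CA k A j) (\<lambda>(F, V). ca_gen k A j (\<Phi> F) V) s = \<zero>\<^bsub>CA k A j\<^esub>"
    if "s \<in> ca_rels k A i" for s
  proof (rule balanced_ca_rels[OF module_CA hom _ that])
    fix f g F V assume *: "is_chain i (f # F)" "is_arrow g" "tgt g = src f" "V \<in> carrier (tensor_power k A (src g))"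
    then obtain f' F' where f': "\<Phi> (f # F) = f' # F'" "\<Phi> (arr_comp f g # F) = arr_comp f' g # F'"
      using \<Phi> unfolding chain_op_def by blast
    show "ca_gen k A j (\<Phi> (arr_comp f g # F)) V = ca_gen k A j (\<Phi> (f # F)) (bar_act k A g V)"
      unfolding f' by (rule ca_gen_precomp) (use chain[OF *(1)] * f' in simp_all)
  qed
  show "H \<in> module_hom k (CA k A i) (CA k A j)"
    unfolding H_def CA_def[of k A i]
    by (rule lin_lift_hom[OF R.is_cring ca_rels_closed module_CA]) (rule cl rel, assumption)+
  fix F V assume *: "is_chain i F" "V \<in> carrier (tensor_power k A (src (hd F)))"
  then have g: "(F, V) \<in> ca_gens k A i" by (simp add: ca_gens_iff)
  have "H (gen_class k (ca_gens k A i) (ca_rels k A i) (F, V)) = (case (F, V) of (F, V) \<Rightarrow> ca_gen k A j (\<Phi> F) V)"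
    unfolding H_def
    by (rule lin_lift_gen_class[OF R.is_cring ca_rels_closed module_CA]) (rule cl rel g | assumption)+
  then show "H (ca_gen k A i F V) = ca_gen k A j (\<Phi> F) V" by (simp add: ca_gen_def)
qed

lemma chain_pairing:
  assumes \<Phi>: "chain_pairing i j \<Phi>"
  shows ca_pairing_bilinear: "module_bilinear k (CA k A i) (CA k A i) (CA k A j) (ca_pairing k A \<Phi> j)"
    and ca_pairing_gen: "\<And>F V G W. is_chain i F \<Longrightarrow> V \<in> carrier (tensor_power k A (src (hd F))) \<Longrightarrow>
      is_chain i G \<Longrightarrow> W \<in> carrier (tensor_power k A (src (hd G))) \<Longrightarrow>
      ca_pairing k A \<Phi> j (ca_gen k A i F V) (ca_gen k A i G W)
        = ca_gen k A j (\<Phi> F G) (tensor_concat k A (src (hd F)) (src (hd G)) V W)"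
proof -
  let ?c = "\<lambda>F G. tensor_concat k A (src (hd F)) (src (hd G))"
  define \<phi> where "\<phi> = (\<lambda>(F, V) (G, W). ca_gen k A j (\<Phi> F G) (?c F G V W))"
  have eq: "ca_pairing k A \<Phi> j = (\<lambda>x y. lin_lift k (CA k A j) (\<lambda>u. lin_lift k (CA k A j) (\<phi> u) y) x)"
    by (simp add: ca_pairing_def \<phi>_def fun_eq_iff case_prod_unfold)
  have chain: "is_chain j (\<Phi> F G)" "src (hd (\<Phi> F G)) = src (hd F) + src (hd G)"
    if "is_chain i F" "is_chain i G" for F G using \<Phi> that by (auto simp: chain_pairing_def)
  have hom: "ca_gen k A j (\<Phi> F G) \<in> module_hom k (tensor_power k A (src (hd F) + src (hd G))) (CA k A j)"
    if "is_chain i F" "is_chain i G" for F G using ca_gen_hom[OF chain(1)[OF that]] chain(2)[OF that] by simp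
  have bil: "module_bilinear k (tensor_power k A (src (hd F))) (tensor_power k A (src (hd G))) (CA k A j)
      (\<lambda>V W. ca_gen k A j (\<Phi> F G) (?c F G V W))" if "is_chain i F" "is_chain i G" for F G
    by (rule module_bilinear_hom_comp[OF hom[OF that] tensor_concat_bilinear])
  have cl: "\<phi> x y \<in> carrier (CA k A j)" if "x \<in> ca_gens k A i" "y \<in> ca_gens k A i" for x y
    using that bilinear_closed[OF bil] by (cases x; cases y) (simp add: \<phi>_def ca_gens_iff)
  have left: "lin_ext k (CA k A j) (\<lambda>x. \<phi> x y) s = \<zero>\<^bsub>CA k A j\<^esub>"
    if s: "s \<in> ca_rels k A i" and y: "y \<in> ca_gens k A i" for s y
  proof -
    obtain G W where GW: "y = (G, W)" "is_chain i G" "W \<in> carrier (tensor_power k A (src (hd G)))"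
      using y by (cases y) (auto simp: ca_gens_iff)
    have "lin_ext k (CA k A j) (\<lambda>(F, V). ca_gen k A j (\<Phi> F G) (?c F G V W)) s = \<zero>\<^bsub>CA k A j\<^esub>"
    proof (rule balanced_ca_rels[OF module_CA bilinear_left[OF bil[OF _ GW(2)] GW(3)] _ s])
      fix f g F V assume *: "is_chain i (f # F)" "is_arrow g" "tgt g = src f" "V \<in> carrier (tensor_power k A (src g))"
      obtain h H where h: "\<Phi> (f # F) G = h # H"
        "\<Phi> (arr_comp f g # F) G = arr_comp h (arr_prod g (arr_id (src (hd G)))) # H"
        using \<Phi> * GW(2) unfolding chain_pairing_def by blast
      have "ca_gen k A j (arr_comp h (arr_prod g (arr_id (src (hd G)))) # H) (tensor_concat k A (src g) (src (hd G)) V W)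
          = ca_gen k A j (h # H) (bar_act k A (arr_prod g (arr_id (src (hd G)))) (tensor_concat k A (src g) (src (hd G)) V W))"
        by (rule ca_gen_precomp)
           (use chain[OF *(1) GW(2)] * h tensor_concat_closed[OF *(4) GW(3)] in \<open>simp_all add: is_arrow_prod\<close>)
      also have "bar_act k A (arr_prod g (arr_id (src (hd G)))) (tensor_concat k A (src g) (src (hd G)) V W)
          = tensor_concat k A (src f) (src (hd G)) (bar_act k A g V) W"
        using bar_act_prod[OF *(2) is_arrow_id *(4), of W "src (hd G)"] GW(3) *(3) by (simp add: bar_act_id)
      finally show "ca_gen k A j (\<Phi> (arr_comp f g # F) G) (?c (arr_comp f g # F) G V W)
          = ca_gen k A j (\<Phi> (f # F) G) (?c (f # F) G (bar_act k A g V) W)"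
        by (simp add: h)
    qed auto
    then show ?thesis by (simp add: \<phi>_def GW(1) case_prod_unfold)
  qed
  have right: "lin_ext k (CA k A j) (\<phi> x) s = \<zero>\<^bsub>CA k A j\<^esub>"
    if s: "s \<in> ca_rels k A i" and x: "x \<in> ca_gens k A i" for s x
  proof -
    obtain F V where FV: "x = (F, V)" "is_chain i F" "V \<in> carrier (tensor_power k A (src (hd F)))"
      using x by (cases x) (auto simp: ca_gens_iff)
    have "lin_ext k (CA k A j) (\<lambda>(G, W). ca_gen k A j (\<Phi> F G) (?c F G V W)) s = \<zero>\<^bsub>CA k A j\<^esub>"
    proof (rule balanced_ca_rels[OF module_CA bilinear_right[OF bil[OF FV(2)] FV(3)] _ s])
      fix f g G W assume *: "is_chain i (f # G)" "is_arrow g" "tgt g = src f" "W \<in> carrier (tensor_power k A (src g))"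
      obtain h H where h: "\<Phi> F (f # G) = h # H"
        "\<Phi> F (arr_comp f g # G) = arr_comp h (arr_prod (arr_id (src (hd F))) g) # H"
        using \<Phi> * FV(2) unfolding chain_pairing_def by blast
      have "ca_gen k A j (arr_comp h (arr_prod (arr_id (src (hd F))) g) # H) (tensor_concat k A (src (hd F)) (src g) V W)
          = ca_gen k A j (h # H) (bar_act k A (arr_prod (arr_id (src (hd F))) g) (tensor_concat k A (src (hd F)) (src g) V W))"
        by (rule ca_gen_precomp)
           (use chain[OF FV(2) *(1)] * h tensor_concat_closed[OF FV(3) *(4)] in \<open>simp_all add: is_arrow_prod\<close>)
      also have "bar_act k A (arr_prod (arr_id (src (hd F))) g) (tensor_concat k A (src (hd F)) (src g) V W)
          = tensor_concat k A (src (hd F)) (src f) V (bar_act k A g W)"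
        using bar_act_prod[OF is_arrow_id *(2) _ *(4), of V "src (hd F)"] FV(3) *(3) by (simp add: bar_act_id)
      finally show "ca_gen k A j (\<Phi> F (arr_comp f g # G)) (?c F (arr_comp f g # G) V W)
          = ca_gen k A j (\<Phi> F (f # G)) (?c F (f # G) V (bar_act k A g W))"
        by (simp add: h)
    qed auto
    then show ?thesis by (simp add: \<phi>_def FV(1))
  qed
  show "module_bilinear k (CA k A i) (CA k A i) (CA k A j) (ca_pairing k A \<Phi> j)"
    unfolding eq CA_def[of k A i]
    by (rule bilin_lift_bilinear[OF R.is_cring ca_rels_closed ca_rels_closed module_CA])
       (rule cl left right, assumption+)+
  fix F V G W
  assume *: "is_chain i F" "V \<in> carrier (tensor_power k A (src (hd F)))"
    "is_chain i G" "W \<in> carrier (tensor_power k A (src (hd G)))"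
  then have g: "(F, V) \<in> ca_gens k A i" "(G, W) \<in> ca_gens k A i" by (simp_all add: ca_gens_iff)
  have "ca_pairing k A \<Phi> j (gen_class k (ca_gens k A i) (ca_rels k A i) (F, V))
      (gen_class k (ca_gens k A i) (ca_rels k A i) (G, W)) = \<phi> (F, V) (G, W)"
    unfolding eq
    by (rule bilin_lift_gen_class[OF R.is_cring ca_rels_closed ca_rels_closed module_CA])
       (rule cl left right g | assumption)+
  then show "ca_pairing k A \<Phi> j (ca_gen k A i F V) (ca_gen k A i G W)
        = ca_gen k A j (\<Phi> F G) (tensor_concat k A (src (hd F)) (src (hd G)) V W)"
    by (simp add: ca_gen_def \<phi>_def)
qed

end

section \<open>Operations on chains of arrows\<close>

lemma is_chain_iff:
  "is_chain i F \<longleftrightarrow> length F = Suc i \<and> (\<forall>t\<le>i. is_arrow (F ! t)) \<and> (\<forall>t<i. tgt (F ! t) = src (F ! Suc t))"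
  by (auto simp: is_chain_def all_set_conv_all_nth less_Suc_eq_le)

lemma is_chainD:
  assumes "is_chain i F"
  shows "length F = Suc i" "t \<le> i \<Longrightarrow> is_arrow (F ! t)" "t < i \<Longrightarrow> tgt (F ! t) = src (F ! Suc t)"
    and "src (hd F) = src (F ! 0)"
  using assms by (cases F; auto simp: is_chain_iff)+

lemma length_chain_face: "length (chain_face j F) = length F - 1"
  by (auto simp: chain_face_def)

lemma nth_chain_face:
  "t < length F - 1 \<Longrightarrow> chain_face j F ! t
     = (if t < j then F ! t else if t = j then arr_comp (F ! Suc j) (F ! j) else F ! Suc t)"
  by (auto simp: chain_face_def nth_append nth_butlast nth_Cons' min_def)

lemma chain_face_Cons: "F \<noteq> [] \<Longrightarrow> chain_face (Suc j) (f # F) = f # chain_face j F"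
  by (auto simp: chain_face_def)

lemma length_chain_degen: "j < length F \<Longrightarrow> length (chain_degen j F) = Suc (length F)"
  by (auto simp: chain_degen_def)

lemma nth_chain_degen:
  "j < length F \<Longrightarrow> t \<le> length F \<Longrightarrow> chain_degen j F ! t
     = (if t \<le> j then F ! t else if t = Suc j then arr_id (tgt (F ! j)) else F ! (t - 1))"
  by (auto simp: chain_degen_def nth_append nth_Cons' min_def numeral_2_eq_2 Suc_diff_Suc)

lemma is_chain_face:
  assumes F: "is_chain (Suc i) F"
  shows "is_chain i (chain_face j F)"
proof -
  note d = is_chainD[OF F]
  have "is_arrow (chain_face j F ! t)" if "t \<le> i" for t
    using that d by (auto simp: nth_chain_face intro!: is_arrow_comp)
  moreover have "tgt (chain_face j F ! t) = src (chain_face j F ! Suc t)" if "t < i" for t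
    using that d by (auto simp: nth_chain_face)
  ultimately show ?thesis using d(1) by (simp add: is_chain_iff length_chain_face)
qed

lemma src_hd_chain_face:
  assumes F: "is_chain (Suc i) F"
  shows "src (hd (chain_face j F)) = src (hd F)"
  unfolding is_chainD(4)[OF is_chain_face[OF F]] is_chainD(4)[OF F]
  using is_chainD(1)[OF F] by (simp add: nth_chain_face)

lemma chain_op_face: "chain_op (Suc i) i (chain_face j)"
  unfolding chain_op_def
proof (intro conjI allI impI)
  fix f g F assume F: "is_chain (Suc i) (f # F)" and g: "is_arrow g" "tgt g = src f"
  obtain f1 F1 where F1: "F = f1 # F1" using is_chainD(1)[OF F] by (cases F) auto
  have a: "is_arrow f" "is_arrow f1" "tgt f = src f1"
    using is_chainD(2)[OF F, of 0] is_chainD(2)[OF F, of 1] is_chainD(3)[OF F, of 0] by (auto simp: F1)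
  show "\<exists>f' F'. chain_face j (f # F) = f' # F' \<and> chain_face j (arr_comp f g # F) = arr_comp f' g # F'"
  proof (cases j)
    case 0
    then show ?thesis using a g by (simp add: chain_face_def F1 arr_comp_assoc)
  next
    case (Suc j')
    then show ?thesis by (simp add: F1 chain_face_Cons)
  qed
qed (simp_all add: is_chain_face src_hd_chain_face)

lemma is_chain_degen:
  assumes F: "is_chain i F" and j: "j \<le> i"
  shows "is_chain (Suc i) (chain_degen j F)"
proof -
  note d = is_chainD[OF F]
  have "is_arrow (chain_degen j F ! t)" if "t \<le> Suc i" for t
    using that d j by (auto simp: nth_chain_degen)
  moreover have "tgt (chain_degen j F ! t) = src (chain_degen j F ! Suc t)" if "t < Suc i" for t
  proof -
    have "tgt (F ! (t - Suc 0)) = src (F ! t)" if "t > Suc j"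
      using d(3)[of "t - 1"] that \<open>t < Suc i\<close> by simp
    then show ?thesis using that d j by (auto simp: nth_chain_degen)
  qed
  ultimately show ?thesis using d(1) j by (simp add: is_chain_iff length_chain_degen)
qed

lemma chain_degen_Cons:
  "chain_degen j (f # F) = f # take j F @ [arr_id (tgt ((f # F) ! j))] @ drop j F"
  by (simp add: chain_degen_def)

lemma chain_op_degen: "j \<le> i \<Longrightarrow> chain_op i (Suc i) (chain_degen j)"
  unfolding chain_op_def
proof (intro conjI allI impI)
  assume j: "j \<le> i"
  show "is_chain (Suc i) (chain_degen j F)" if "is_chain i F" for F using that j by (rule is_chain_degen)
  show "src (hd (chain_degen j F)) = src (hd F)" if "is_chain i F" for F
    using is_chain_Cons[OF that] by (auto simp: chain_degen_Cons)
  fix f g F assume "is_chain i (f # F)"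
  have "tgt ((arr_comp f g # F) ! j) = tgt ((f # F) ! j)" by (cases j) auto
  then show "\<exists>f' F'. chain_degen j (f # F) = f' # F' \<and> chain_degen j (arr_comp f g # F) = arr_comp f' g # F'"
    by (simp add: chain_degen_Cons)
qed

lemma is_chain_map2_prod:
  assumes F: "is_chain i F" and G: "is_chain i G"
  shows "is_chain i (map2 arr_prod F G)"
  using is_chainD[OF F] is_chainD[OF G] by (simp add: is_chain_iff is_arrow_prod)

lemma arr_prod_comp_id:
  assumes "is_arrow f" "is_arrow g" "tgt g = src f" "is_arrow h"
  shows "arr_prod (arr_comp f g) h = arr_comp (arr_prod f h) (arr_prod g (arr_id (src h)))"
    and "arr_prod h (arr_comp f g) = arr_comp (arr_prod h f) (arr_prod (arr_id (src h)) g)"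
  using arr_prod_comp[of f g h "arr_id (src h)"] arr_prod_comp[of h "arr_id (src h)" f g] assms
  by (simp_all add: arr_comp_id_right)

lemma chain_pairing_prod: "chain_pairing i i (map2 arr_prod)"
  unfolding chain_pairing_def
proof (intro conjI allI impI)
  show "is_chain i (map2 arr_prod F G)" if "is_chain i F" "is_chain i G" for F G
    by (rule is_chain_map2_prod[OF that])
  show "src (hd (map2 arr_prod F G)) = src (hd F) + src (hd G)" if "is_chain i F" "is_chain i G" for F G
    using is_chain_Cons[OF that(1)] is_chain_Cons[OF that(2)] by auto
next
  fix f g F G assume *: "is_chain i (f # F)" "is_chain i G" "is_arrow g" "tgt g = src f"
  obtain h H where G: "G = h # H" using is_chain_Cons[OF *(2)] by blast
  have "is_arrow f" "is_arrow h" using is_chain_hd_arrow[OF *(1)] is_chain_hd_arrow[OF *(2)] by (simp_all add: G)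
  then show "\<exists>h H. map2 arr_prod (f # F) G = h # H \<and>
      map2 arr_prod (arr_comp f g # F) G = arr_comp h (arr_prod g (arr_id (src (hd G)))) # H"
    using * by (simp add: G arr_prod_comp_id)
next
  fix f g F G assume *: "is_chain i F" "is_chain i (f # G)" "is_arrow g" "tgt g = src f"
  obtain h H where F: "F = h # H" using is_chain_Cons[OF *(1)] by blast
  have "is_arrow f" "is_arrow h" using is_chain_hd_arrow[OF *(1)] is_chain_hd_arrow[OF *(2)] by (simp_all add: F)
  then show "\<exists>h H. map2 arr_prod F (f # G) = h # H \<and>
      map2 arr_prod F (arr_comp f g # G) = arr_comp h (arr_prod (arr_id (src (hd F))) g) # H"
    using * by (simp add: F arr_prod_comp_id)
qed

lemma chain_face_prod:
  assumes F: "is_chain (Suc i) F" and G: "is_chain (Suc i) G" and j: "j \<le> Suc i"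
  shows "chain_face j (map2 arr_prod F G) = map2 arr_prod (chain_face j F) (chain_face j G)"
proof (rule nth_equalityI)
  note d = is_chainD[OF F] is_chainD[OF G]
  show "length (chain_face j (map2 arr_prod F G)) = length (map2 arr_prod (chain_face j F) (chain_face j G))"
    by (simp add: length_chain_face d)
  fix t assume "t < length (chain_face j (map2 arr_prod F G))"
  then have t: "t \<le> i" by (simp add: length_chain_face d)
  have "arr_comp (arr_prod (F ! Suc t) (G ! Suc t)) (arr_prod (F ! t) (G ! t))
      = arr_prod (arr_comp (F ! Suc t) (F ! t)) (arr_comp (G ! Suc t) (G ! t))"
    by (rule arr_prod_comp[symmetric]) (use d t in auto)
  then show "chain_face j (map2 arr_prod F G) ! t = map2 arr_prod (chain_face j F) (chain_face j G) ! t"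
    using t d(1,5) by (auto simp: nth_chain_face length_chain_face)
qed

lemma chain_degen_prod:
  assumes F: "is_chain i F" and G: "is_chain i G" and j: "j \<le> i"
  shows "chain_degen j (map2 arr_prod F G) = map2 arr_prod (chain_degen j F) (chain_degen j G)"
proof (rule nth_equalityI)
  note d = is_chainD[OF F] is_chainD[OF G]
  show "length (chain_degen j (map2 arr_prod F G)) = length (map2 arr_prod (chain_degen j F) (chain_degen j G))"
    using j by (simp add: length_chain_degen d)
  fix t assume "t < length (chain_degen j (map2 arr_prod F G))"
  then have t: "t \<le> Suc i" using j by (simp add: length_chain_degen d)
  then show "chain_degen j (map2 arr_prod F G) ! t = map2 arr_prod (chain_degen j F) (chain_degen j G) ! t"
    using j d(1,5) by (auto simp: nth_chain_degen length_chain_degen arr_prod_id)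
qed

lemma map2_prod_assoc:
  assumes "is_chain i F" "is_chain i G" "is_chain i H"
  shows "map2 arr_prod (map2 arr_prod F G) H = map2 arr_prod F (map2 arr_prod G H)"
  using is_chainD[OF assms(1)] is_chainD[OF assms(2)] is_chainD[OF assms(3)]
  by (intro nth_equalityI) (auto intro!: arr_prod_assoc)

lemma is_chain_units: "is_chain i (replicate (Suc i) (arr_id 0))"
  by (auto simp: is_chain_iff simp del: replicate_Suc)

lemma map2_prod_units:
  assumes "is_chain i F"
  shows "map2 arr_prod (replicate (Suc i) (arr_id 0)) F = F" "map2 arr_prod F (replicate (Suc i) (arr_id 0)) = F"
  using is_chainD[OF assms]
  by (auto intro!: nth_equalityI simp: arr_prod_unit simp del: replicate_Suc)

text \<open>The path through the ladder with sides \<open>F \<odot> G\<close> and \<open>G \<odot> F\<close> that changes over by the braiding after the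
\<open>j\<close>-th arrow. The arrow numbered 0 leads from the source object to the first object of the simplex,
so the braiding can be inserted at any object of the simplex, but not at the source.\<close>

definition prism :: "nat \<Rightarrow> arrow list \<Rightarrow> arrow list \<Rightarrow> arrow list" where
  "prism j F G = map2 arr_prod (take (Suc j) F) (take (Suc j) G)
     @ braiding (tgt (F ! j)) (tgt (G ! j)) # map2 (\<lambda>f g. arr_prod g f) (drop (Suc j) F) (drop (Suc j) G)"

lemma length_prism: "length F = Suc i \<Longrightarrow> length G = Suc i \<Longrightarrow> j \<le> i \<Longrightarrow> length (prism j F G) = Suc (Suc i)"
  by (simp add: prism_def)

lemma nth_prism:
  assumes "length F = Suc i" "length G = Suc i" "j \<le> i" "t \<le> Suc i"
  shows "prism j F G ! t = (if t \<le> j then arr_prod (F ! t) (G ! t)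
     else if t = Suc j then braiding (tgt (F ! j)) (tgt (G ! j)) else arr_prod (G ! (t - 1)) (F ! (t - 1)))"
  using assms by (auto simp: prism_def nth_append nth_Cons' min_def numeral_2_eq_2 Suc_diff_Suc)

lemma is_chain_prism:
  assumes F: "is_chain i F" and G: "is_chain i G" and j: "j \<le> i"
  shows "is_chain (Suc i) (prism j F G)"
proof -
  note d = is_chainD[OF F] is_chainD[OF G]
  note n = nth_prism[OF d(1) d(5) j]
  have "is_arrow (prism j F G ! t)" if "t \<le> Suc i" for t
    using that d j by (auto simp: n is_arrow_prod is_arrow_braiding)
  moreover have "tgt (prism j F G ! t) = src (prism j F G ! Suc t)" if "t < Suc i" for t
  proof -
    have "tgt (F ! (t - Suc 0)) = src (F ! t)" "tgt (G ! (t - Suc 0)) = src (G ! t)" if "t > Suc j"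
      using d(3)[of "t - 1"] d(7)[of "t - 1"] that \<open>t < Suc i\<close> by simp_all
    then show ?thesis using that d j by (auto simp: n)
  qed
  ultimately show ?thesis using length_prism[OF d(1) d(5) j] by (simp add: is_chain_iff)
qed

lemma prism_Cons:
  "prism j (f # F) (h # H) = arr_prod f h # map2 arr_prod (take j F) (take j H)
     @ braiding (tgt ((f # F) ! j)) (tgt ((h # H) ! j)) # map2 (\<lambda>f g. arr_prod g f) (drop j F) (drop j H)"
  by (simp add: prism_def)

lemma chain_pairing_prism: "j \<le> i \<Longrightarrow> chain_pairing i (Suc i) (prism j)"
  unfolding chain_pairing_def
proof (intro conjI allI impI)
  assume j: "j \<le> i"
  show "is_chain (Suc i) (prism j F G)" if "is_chain i F" "is_chain i G" for F G
    by (rule is_chain_prism[OF that j])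
  show "src (hd (prism j F G)) = src (hd F) + src (hd G)" if "is_chain i F" "is_chain i G" for F G
    using is_chain_Cons[OF that(1)] is_chain_Cons[OF that(2)] by (auto simp: prism_Cons)
next
  fix f g F G assume *: "is_chain i (f # F)" "is_chain i G" "is_arrow g" "tgt g = src f"
  obtain h H where G: "G = h # H" using is_chain_Cons[OF *(2)] by blast
  have "is_arrow f" "is_arrow h" using is_chain_hd_arrow[OF *(1)] is_chain_hd_arrow[OF *(2)] by (simp_all add: G)
  moreover have "tgt ((arr_comp f g # F) ! j) = tgt ((f # F) ! j)" by (cases j) auto
  ultimately show "\<exists>h H. prism j (f # F) G = h # H \<and>
      prism j (arr_comp f g # F) G = arr_comp h (arr_prod g (arr_id (src (hd G)))) # H"
    using * by (simp add: G prism_Cons arr_prod_comp_id)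
next
  fix f g F G assume *: "is_chain i F" "is_chain i (f # G)" "is_arrow g" "tgt g = src f"
  obtain h H where F: "F = h # H" using is_chain_Cons[OF *(1)] by blast
  have "is_arrow f" "is_arrow h" using is_chain_hd_arrow[OF *(1)] is_chain_hd_arrow[OF *(2)] by (simp_all add: F)
  moreover have "tgt ((arr_comp f g # G) ! j) = tgt ((f # G) ! j)" by (cases j) auto
  ultimately show "\<exists>h H. prism j F (f # G) = h # H \<and>
      prism j F (arr_comp f g # G) = arr_comp h (arr_prod (arr_id (src (hd F))) g) # H"
    using * by (simp add: F prism_Cons arr_prod_comp_id)
qed

text \<open>A face on one side of the change-over acts on both chains. If it lies before the change-over, the
latter moves down by one, and if it lies behind, the face has one index more because of the inserted
arrow.\<close>

lemma prism_face_below: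
  assumes F: "is_chain (Suc n) F" and G: "is_chain (Suc n) G" and ij: "i \<le> j" "Suc j \<le> Suc n"
  shows "chain_face i (prism (Suc j) F G) = prism j (chain_face i F) (chain_face i G)"
proof (rule nth_equalityI)
  note d = is_chainD[OF F] is_chainD[OF G]
  note d' = is_chainD[OF is_chain_face[OF F, of i]] is_chainD[OF is_chain_face[OF G, of i]]
  have j': "j \<le> n" using ij by simp
  note l = length_prism[OF d(1) d(5) ij(2)] length_prism[OF d'(1) d'(5) j']
  note n = nth_prism[OF d(1) d(5) ij(2)] nth_prism[OF d'(1) d'(5) j']
  show "length (chain_face i (prism (Suc j) F G)) = length (prism j (chain_face i F) (chain_face i G))"
    unfolding length_chain_face l by simp
  fix t assume "t < length (chain_face i (prism (Suc j) F G))"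
  then have t: "t \<le> Suc n" by (simp add: length_chain_face l)
  have comp: "arr_comp (arr_prod (F ! Suc i) (G ! Suc i)) (arr_prod (F ! i) (G ! i))
      = arr_prod (arr_comp (F ! Suc i) (F ! i)) (arr_comp (G ! Suc i) (G ! i))"
    by (rule arr_prod_comp[symmetric]) (use d ij in auto)
  have lhs: "chain_face i (prism (Suc j) F G) ! t
     = (if t < i then prism (Suc j) F G ! t else if t = i then arr_comp (prism (Suc j) F G ! Suc i) (prism (Suc j) F G ! i)
        else prism (Suc j) F G ! Suc t)"
    using t by (simp add: nth_chain_face l)
  have nf: "chain_face i F ! s = (if s < i then F ! s else if s = i then arr_comp (F ! Suc i) (F ! i) else F ! Suc s)"
    "chain_face i G ! s = (if s < i then G ! s else if s = i then arr_comp (G ! Suc i) (G ! i) else G ! Suc s)"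
    if "s \<le> n" for s using that by (simp_all add: nth_chain_face d)
  consider "t < j" | "t = j" | "t = Suc j" | "t > Suc j" by linarith
  then show "chain_face i (prism (Suc j) F G) ! t = prism j (chain_face i F) (chain_face i G) ! t"
  proof cases
    case 1
    then show ?thesis unfolding lhs using t ij comp by (simp add: n nf)
  next
    case 2
    have "prism (Suc j) F G ! Suc t = arr_prod (F ! Suc t) (G ! Suc t)"
      "prism (Suc j) F G ! t = arr_prod (F ! t) (G ! t)"
      "prism j (chain_face i F) (chain_face i G) ! t = arr_prod (chain_face i F ! t) (chain_face i G ! t)"
      using 2 t ij by (simp_all add: n)
    then show ?thesis unfolding lhs using 2 ij comp by (cases "t = i") (simp_all add: nf)
  next
    case 3
    have "tgt (chain_face i F ! j) = tgt (F ! Suc j)" "tgt (chain_face i G ! j) = tgt (G ! Suc j)"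
      using ij j' by (auto simp: nf)
    then show ?thesis unfolding lhs using 3 t ij by (simp add: n)
  next
    case 4
    then have "t - 1 \<le> n" "\<not> t - 1 < i" "t - 1 \<noteq> i" "Suc (t - 1) = t" using t ij by auto
    then show ?thesis unfolding lhs using 4 t ij by (simp add: n nf)
  qed
qed

lemma prism_face_above:
  assumes F: "is_chain (Suc n) F" and G: "is_chain (Suc n) G" and ij: "j < i" "i \<le> Suc n"
  shows "chain_face (Suc i) (prism j F G) = prism j (chain_face i F) (chain_face i G)"
proof (rule nth_equalityI)
  note d = is_chainD[OF F] is_chainD[OF G]
  note d' = is_chainD[OF is_chain_face[OF F, of i]] is_chainD[OF is_chain_face[OF G, of i]]
  have j: "j \<le> Suc n" "j \<le> n" using ij by simp_all
  note l = length_prism[OF d(1) d(5) j(1)] length_prism[OF d'(1) d'(5) j(2)]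
  note n = nth_prism[OF d(1) d(5) j(1)] nth_prism[OF d'(1) d'(5) j(2)]
  show "length (chain_face (Suc i) (prism j F G)) = length (prism j (chain_face i F) (chain_face i G))"
    unfolding length_chain_face l by simp
  fix t assume "t < length (chain_face (Suc i) (prism j F G))"
  then have t: "t \<le> Suc n" by (simp add: length_chain_face l)
  have lhs: "chain_face (Suc i) (prism j F G) ! t
     = (if t < Suc i then prism j F G ! t else if t = Suc i then arr_comp (prism j F G ! Suc (Suc i)) (prism j F G ! Suc i)
        else prism j F G ! Suc t)"
    using t by (simp add: nth_chain_face l)
  have nf: "chain_face i F ! s = (if s < i then F ! s else if s = i then arr_comp (F ! Suc i) (F ! i) else F ! Suc s)"
    "chain_face i G ! s = (if s < i then G ! s else if s = i then arr_comp (G ! Suc i) (G ! i) else G ! Suc s)"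
    if "s \<le> n" for s using that ij by (simp_all add: nth_chain_face d)
  consider "t \<le> j" | "t = Suc j" | "t > Suc j" "t < Suc i" | "t = Suc i" | "t > Suc i" by linarith
  then show "chain_face (Suc i) (prism j F G) ! t = prism j (chain_face i F) (chain_face i G) ! t"
  proof cases
    case 1
    then show ?thesis unfolding lhs using t ij j by (simp add: n nf)
  next
    case 2
    then show ?thesis unfolding lhs using t ij j by (simp add: n nf)
  next
    case 3
    then have "t - 1 \<le> n" "t - 1 < i" using t ij by auto
    then show ?thesis unfolding lhs using 3 t ij j by (simp add: n nf)
  next
    case 4
    have "arr_comp (arr_prod (G ! Suc i) (F ! Suc i)) (arr_prod (G ! i) (F ! i))
      = arr_prod (arr_comp (G ! Suc i) (G ! i)) (arr_comp (F ! Suc i) (F ! i))"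
      by (rule arr_prod_comp[symmetric]) (use d ij t 4 in auto)
    then show ?thesis unfolding lhs using 4 t ij j by (simp add: n nf)
  next
    case 5
    then have "t - 1 \<le> n" "\<not> t - 1 < i" "t - 1 \<noteq> i" "Suc (t - 1) = t" using t ij by auto
    then show ?thesis unfolding lhs using 5 t ij j by (simp add: n nf)
  qed
qed

text \<open>The two ways around the naturality square of the braiding at the arrow \<open>Suc j\<close>.\<close>

lemma prism_face_middle:
  assumes F: "is_chain i F" and G: "is_chain i G" and j: "Suc j \<le> i"
  shows "chain_face (Suc j) (prism (Suc j) F G) = chain_face (Suc j) (prism j F G)"
proof (rule nth_equalityI)
  note d = is_chainD[OF F] is_chainD[OF G]
  have j': "j \<le> i" using j by simp
  note l = length_prism[OF d(1) d(5) j] length_prism[OF d(1) d(5) j']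
  note n = nth_prism[OF d(1) d(5) j] nth_prism[OF d(1) d(5) j']
  show "length (chain_face (Suc j) (prism (Suc j) F G)) = length (chain_face (Suc j) (prism j F G))"
    by (simp add: length_chain_face l)
  fix t assume "t < length (chain_face (Suc j) (prism (Suc j) F G))"
  then have t: "t \<le> i" by (simp add: length_chain_face l)
  have f: "chain_face (Suc j) P ! t
     = (if t < Suc j then P ! t else if t = Suc j then arr_comp (P ! Suc (Suc j)) (P ! Suc j)
        else P ! Suc t)" if "length P = Suc (Suc i)" for P
    using t that by (simp add: nth_chain_face)
  have "arr_comp (braiding (tgt (F ! Suc j)) (tgt (G ! Suc j))) (arr_prod (F ! Suc j) (G ! Suc j))
      = arr_comp (arr_prod (G ! Suc j) (F ! Suc j)) (braiding (src (F ! Suc j)) (src (G ! Suc j)))"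
    by (rule braiding_natural) (use d j in auto)
  then show "chain_face (Suc j) (prism (Suc j) F G) ! t = chain_face (Suc j) (prism j F G) ! t"
    unfolding f[OF l(1)] f[OF l(2)] using t j d(3)[of j] d(7)[of j] by (auto simp: n)
qed

lemma prism_face_last:
  assumes F: "is_chain i F" and G: "is_chain i G"
  shows "chain_face (Suc i) (prism i F G) = map2 arr_prod F G"
  using is_chainD(1)[OF F] is_chainD(1)[OF G]
  by (simp add: chain_face_def prism_def butlast_append)

text \<open>Here the braiding is moved across the very first arrow by naturality and ends up as a
precomposition, which the coefficients in $CA_*$ absorb.\<close>

lemma prism_face_first:
  assumes F: "is_chain i (f # F)" and G: "is_chain i (g # G)"
  shows "chain_face 0 (prism 0 (f # F) (g # G))
    = arr_comp (arr_prod g f) (braiding (src f) (src g)) # map2 arr_prod G F"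
proof -
  have "is_arrow f" "is_arrow g" using is_chain_hd_arrow[OF F] is_chain_hd_arrow[OF G] by simp_all
  moreover have "map2 (\<lambda>f g. arr_prod g f) F G = map2 arr_prod G F"
    using is_chainD(1)[OF F] is_chainD(1)[OF G] by (intro nth_equalityI) auto
  ultimately show ?thesis by (simp add: prism_Cons chain_face_def braiding_natural)
qed

section \<open>Pullback of chains along monotone maps\<close>

text \<open>The objects of a chain, counted including the source: object 0 is the source of the first arrow,
and object \<open>Suc t\<close> is the target of the \<open>t\<close>-th arrow, that is, the \<open>t\<close>-th vertex of the simplex in
the nerve of the under-category.\<close>

definition chain_vertex :: "arrow list \<Rightarrow> nat \<Rightarrow> nat" where
  "chain_vertex F v = (case v of 0 \<Rightarrow> src (hd F) | Suc t \<Rightarrow> tgt (F ! t))"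

primrec chain_path :: "arrow list \<Rightarrow> nat \<Rightarrow> nat \<Rightarrow> arrow" where
  "chain_path F a 0 = arr_id (chain_vertex F a)"
| "chain_path F a (Suc b) =
     (if a \<le> b then arr_comp (F ! b) (chain_path F a b) else arr_id (chain_vertex F a))"

lemma chain_path_same: "chain_path F a a = arr_id (chain_vertex F a)"
  by (cases a) auto

lemma chain_vertex_src: "is_chain i F \<Longrightarrow> t \<le> i \<Longrightarrow> chain_vertex F t = src (F ! t)"
  by (cases t) (simp_all add: chain_vertex_def is_chainD)

lemma chain_path:
  assumes F: "is_chain i F" and "a \<le> b" "b \<le> Suc i"
  shows "is_arrow (chain_path F a b) \<and> src (chain_path F a b) = chain_vertex F a \<and>
    tgt (chain_path F a b) = chain_vertex F b"
  using assms(2,3)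
proof (induction b rule: dec_induct)
  case base
  then show ?case by (simp add: chain_path_same)
next
  case (step b)
  then have "is_arrow (F ! b)" "chain_vertex F b = src (F ! b)" "chain_vertex F (Suc b) = tgt (F ! b)"
    using is_chainD[OF F] chain_vertex_src[OF F] by (auto simp: chain_vertex_def)
  then show ?case using step by (auto intro!: is_arrow_comp)
qed

lemma chain_path_comp:
  assumes F: "is_chain i F" and "a \<le> b" "b \<le> c" "c \<le> Suc i"
  shows "arr_comp (chain_path F b c) (chain_path F a b) = chain_path F a c"
  using assms(3,4)
proof (induction c rule: dec_induct)
  case base
  then show ?case
    using chain_path[OF F assms(2)] arr_comp_id_left[of "chain_path F a b"] by (simp add: chain_path_same)
next
  case (step c)
  then have "is_arrow (F ! c)" "chain_vertex F c = src (F ! c)"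
    using is_chainD[OF F] chain_vertex_src[OF F] by auto
  then show ?case
    using step assms(2) chain_path[OF F assms(2)] chain_path[OF F step.hyps(1)] by (simp add: arr_comp_assoc)
qed

lemma chain_path_Suc: "is_chain i F \<Longrightarrow> t \<le> i \<Longrightarrow> chain_path F t (Suc t) = F ! t"
  by (simp add: chain_path_same chain_vertex_src arr_comp_id_right is_chainD)

text \<open>Simplicial operators act on the vertices of the simplex and leave the source of the under-category
alone. On the objects counted from the source, an operator \<open>\<theta>\<close> therefore fixes 0 and is shifted by
one elsewhere.\<close>

definition with_source :: "(nat \<Rightarrow> nat) \<Rightarrow> nat \<Rightarrow> nat" where
  "with_source \<theta> v = (case v of 0 \<Rightarrow> 0 | Suc t \<Rightarrow> Suc (\<theta> t))"

lemma with_source_simps [simp]: "with_source \<theta> 0 = 0" "with_source \<theta> (Suc t) = Suc (\<theta> t)"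
  by (simp_all add: with_source_def)

text \<open>The pullback of a simplex along a monotone map of vertices: its arrows are composites of arrows of
the given chain. Faces, degeneracies and all their composites are pullbacks, and pullback is
functorial (\<open>pull_pull\<close>), so identities between such composites reduce to identities between functions
on natural numbers.\<close>

definition pull :: "arrow list \<Rightarrow> (nat \<Rightarrow> nat) \<Rightarrow> nat \<Rightarrow> arrow list" where
  "pull F \<theta> n = map (\<lambda>t. chain_path F (with_source \<theta> t) (with_source \<theta> (Suc t))) [0..<Suc n]"

definition ord_map :: "nat \<Rightarrow> nat \<Rightarrow> (nat \<Rightarrow> nat) \<Rightarrow> bool" where
  "ord_map n p \<theta> \<longleftrightarrow> (\<forall>t\<le>n. \<theta> t \<le> p) \<and> (\<forall>s t. s \<le> t \<longrightarrow> t \<le> n \<longrightarrow> \<theta> s \<le> \<theta> t)"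

lemma ord_map_with_source:
  assumes "ord_map n p \<theta>"
  shows "v \<le> Suc n \<Longrightarrow> with_source \<theta> v \<le> Suc p" and "v \<le> w \<Longrightarrow> w \<le> Suc n \<Longrightarrow> with_source \<theta> v \<le> with_source \<theta> w"
  using assms by (cases v; cases w; auto simp: ord_map_def)+

lemma length_pull [simp]: "length (pull F \<theta> n) = Suc n"
  by (simp add: pull_def)

lemma nth_pull: "t \<le> n \<Longrightarrow> pull F \<theta> n ! t = chain_path F (with_source \<theta> t) (Suc (\<theta> t))"
  by (simp add: pull_def del: upt_Suc)

lemma pull_cong:
  assumes "\<And>t. t \<le> n \<Longrightarrow> \<theta> t = \<theta>' t"
  shows "pull F \<theta> n = pull F \<theta>' n"
proof -
  have "with_source \<theta> t = with_source \<theta>' t" if "t \<le> Suc n" for t using assms that by (cases t) auto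
  then show ?thesis by (auto simp: pull_def simp del: upt_Suc with_source_simps)
qed

lemma
  assumes F: "is_chain p F" and \<theta>: "ord_map n p \<theta>"
  shows is_chain_pull: "is_chain n (pull F \<theta> n)"
    and src_hd_pull: "src (hd (pull F \<theta> n)) = src (hd F)"
    and chain_vertex_pull: "v \<le> Suc n \<Longrightarrow> chain_vertex (pull F \<theta> n) v = chain_vertex F (with_source \<theta> v)"
proof -
  have path: "is_arrow (chain_path F (with_source \<theta> t) (Suc (\<theta> t)))"
    "src (chain_path F (with_source \<theta> t) (Suc (\<theta> t))) = chain_vertex F (with_source \<theta> t)"
    "tgt (chain_path F (with_source \<theta> t) (Suc (\<theta> t))) = chain_vertex F (Suc (\<theta> t))" if "t \<le> n" for t
    using chain_path[OF F ord_map_with_source(2)[OF \<theta>, of t "Suc t"] ord_map_with_source(1)[OF \<theta>, of "Suc t"]] that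
    by (simp_all del: chain_path.simps)
  have "src (chain_path F (Suc (\<theta> t)) (Suc (\<theta> (Suc t)))) = chain_vertex F (Suc (\<theta> t))" if "t < n" for t
    using path(2)[of "Suc t"] that by (simp del: chain_path.simps)
  then show chain: "is_chain n (pull F \<theta> n)"
    by (simp add: is_chain_iff nth_pull path del: chain_path.simps)
  show s: "src (hd (pull F \<theta> n)) = src (hd F)"
    unfolding is_chainD(4)[OF chain] using path(2)[of 0] by (simp add: nth_pull chain_vertex_def del: chain_path.simps)
  show "chain_vertex (pull F \<theta> n) v = chain_vertex F (with_source \<theta> v)" if "v \<le> Suc n"
  proof (cases v)
    case 0
    then show ?thesis using s by (simp add: chain_vertex_def)
  next
    case (Suc t)
    then show ?thesis using path(3)[of t] that
      by (simp add: chain_vertex_def[of "pull F \<theta> n"] nth_pull del: chain_path.simps)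
  qed
qed

lemma chain_path_pull:
  assumes F: "is_chain p F" and \<theta>: "ord_map n p \<theta>" and "a \<le> b" "b \<le> Suc n"
  shows "chain_path (pull F \<theta> n) a b = chain_path F (with_source \<theta> a) (with_source \<theta> b)"
  using assms(3,4)
proof (induction b rule: dec_induct)
  case base
  then show ?case by (simp add: chain_path_same chain_vertex_pull[OF F \<theta>])
next
  case (step b)
  have "arr_comp (chain_path F (with_source \<theta> b) (with_source \<theta> (Suc b))) (chain_path F (with_source \<theta> a) (with_source \<theta> b))
      = chain_path F (with_source \<theta> a) (with_source \<theta> (Suc b))"
    by (rule chain_path_comp[OF F]) (use step ord_map_with_source[OF \<theta>] in \<open>auto simp del: with_source_simps\<close>)
  then show ?case using step by (simp add: nth_pull)
qed

lemma ord_map_comp: "ord_map n p \<theta> \<Longrightarrow> ord_map m n \<eta> \<Longrightarrow> ord_map m p (\<theta> \<circ> \<eta>)"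
  by (auto simp: ord_map_def)

lemma pull_pull:
  assumes F: "is_chain p F" and \<theta>: "ord_map n p \<theta>" and \<eta>: "ord_map m n \<eta>"
  shows "pull (pull F \<theta> n) \<eta> m = pull F (\<theta> \<circ> \<eta>) m"
proof -
  have with_source_comp: "with_source (\<theta> \<circ> \<eta>) v = with_source \<theta> (with_source \<eta> v)" for v by (cases v) auto
  have "chain_path (pull F \<theta> n) (with_source \<eta> t) (with_source \<eta> (Suc t)) = chain_path F (with_source \<theta> (with_source \<eta> t)) (with_source \<theta> (with_source \<eta> (Suc t)))"
    if "t \<le> m" for t
    by (rule chain_path_pull[OF F \<theta>]) (use that ord_map_with_source[OF \<eta>] in \<open>auto simp del: with_source_simps\<close>)
  then show ?thesis by (auto simp: pull_def with_source_comp simp del: upt_Suc with_source_simps)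
qed

text \<open>The cofaces and codegeneracies of the simplex category.\<close>

definition skip :: "nat \<Rightarrow> nat \<Rightarrow> nat" where
  "skip j t = (if t < j then t else Suc t)"

definition dup :: "nat \<Rightarrow> nat \<Rightarrow> nat" where
  "dup j t = (if t \<le> j then t else t - 1)"

lemma ord_map_skip: "ord_map n (Suc n) (skip j)"
  by (auto simp: ord_map_def skip_def)

lemma ord_map_dup: "j \<le> n \<Longrightarrow> ord_map (Suc n) n (dup j)"
  by (auto simp: ord_map_def dup_def)

lemma chain_face_eq_pull:
  assumes F: "is_chain (Suc n) F" and j: "j \<le> Suc n"
  shows "chain_face j F = pull F (skip j) n"
proof (rule nth_equalityI)
  note d = is_chainD[OF F]
  show "length (chain_face j F) = length (pull F (skip j) n)" by (simp add: length_chain_face d)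
  fix t assume "t < length (chain_face j F)"
  then have t: "t \<le> n" by (simp add: length_chain_face d)
  have f: "chain_face j F ! t
     = (if t < j then F ! t else if t = j then arr_comp (F ! Suc j) (F ! j) else F ! Suc t)"
    using t by (simp add: nth_chain_face d)
  consider "t < j" | "t = j" | "t > j" by linarith
  then show "chain_face j F ! t = pull F (skip j) n ! t"
  proof cases
    case 1
    then have "with_source (skip j) t = t" by (cases t) (auto simp: skip_def)
    then show ?thesis using 1 t f chain_path_Suc[OF F, of t] by (simp add: nth_pull skip_def)
  next
    case 2
    then have "with_source (skip j) t = t" by (cases t) (auto simp: skip_def)
    then show ?thesis using 2 t f chain_path_Suc[OF F, of t] by (simp add: nth_pull skip_def)
  next
    case 3
    then have "with_source (skip j) t = Suc t" by (cases t) (auto simp: skip_def)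
    then show ?thesis using 3 t f chain_path_Suc[OF F, of "Suc t"] by (simp add: nth_pull skip_def)
  qed
qed

lemma chain_degen_eq_pull:
  assumes F: "is_chain n F" and j: "j \<le> n"
  shows "chain_degen j F = pull F (dup j) (Suc n)"
proof (rule nth_equalityI)
  note d = is_chainD[OF F]
  show "length (chain_degen j F) = length (pull F (dup j) (Suc n))" using j by (simp add: length_chain_degen d)
  fix t assume "t < length (chain_degen j F)"
  then have t: "t \<le> Suc n" using j by (simp add: length_chain_degen d)
  have f: "chain_degen j F ! t
     = (if t \<le> j then F ! t else if t = Suc j then arr_id (tgt (F ! j)) else F ! (t - 1))"
    using t j by (simp add: nth_chain_degen d)
  consider "t \<le> j" | "t = Suc j" | "t > Suc j" by linarith
  then show "chain_degen j F ! t = pull F (dup j) (Suc n) ! t"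
  proof cases
    case 1
    then have "with_source (dup j) t = t" by (cases t) (auto simp: dup_def)
    then show ?thesis using 1 t j f chain_path_Suc[OF F, of t] by (simp add: nth_pull dup_def)
  next
    case 2
    then show ?thesis using t j f by (simp add: nth_pull dup_def chain_path_same chain_vertex_def)
  next
    case 3
    then have "with_source (dup j) t = t - 1" "Suc (t - 1) = t" by (cases t; auto simp: dup_def)+
    then show ?thesis using 3 t j f chain_path_Suc[OF F, of "t - 1"] by (simp add: nth_pull dup_def)
  qed
qed

lemma pull_id:
  assumes F: "is_chain n F"
  shows "pull F (\<lambda>t. t) n = F"
proof (rule nth_equalityI)
  fix t assume "t < length (pull F (\<lambda>t. t) n)"
  moreover have "with_source (\<lambda>t. t) t = t" by (cases t) auto
  ultimately show "pull F (\<lambda>t. t) n ! t = F ! t"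
    using chain_path_Suc[OF F, of t] by (simp add: nth_pull)
qed (simp add: is_chainD[OF F])

text \<open>If \<open>S\<close> is the set of times at which a lattice path makes a step in the first direction, then
\<open>cnt S t\<close> is its first coordinate after \<open>t\<close> steps. Equivalently, \<open>cnt S\<close> is the monotone map
that repeats a vertex exactly at the times outside \<open>S\<close>.\<close>

definition cnt :: "nat set \<Rightarrow> nat \<Rightarrow> nat" where
  "cnt S t = card (S \<inter> {..<t})"

lemma cnt_0 [simp]: "cnt S 0 = 0"
  by (simp add: cnt_def)

lemma cnt_Suc: "cnt S (Suc t) = cnt S t + of_bool (t \<in> S)"
proof -
  have "S \<inter> {..<Suc t} = (if t \<in> S then insert t (S \<inter> {..<t}) else S \<inter> {..<t})"
    by (auto simp: less_Suc_eq)
  then show ?thesis by (simp add: cnt_def)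
qed

lemma cnt_mono: "s \<le> t \<Longrightarrow> cnt S s \<le> cnt S t"
  unfolding cnt_def by (intro card_mono) auto

lemma cnt_less: "s \<in> S \<Longrightarrow> s < t \<Longrightarrow> cnt S s < cnt S t"
  using cnt_mono[of "Suc s" t S] by (simp add: cnt_Suc)

lemma cnt_eq_card: "S \<subseteq> {..<n} \<Longrightarrow> cnt S n = card S"
  by (simp add: cnt_def Int_absorb2)

lemma cnt_less_iff:
  assumes "r \<in> S"
  shows "cnt S r < cnt S t \<longleftrightarrow> r < t"
  using cnt_less[OF assms, of t] cnt_mono[of t r S] by (meson linorder_not_less)

lemma inj_on_cnt: "inj_on (cnt S) S"
  by (rule inj_onI) (metis cnt_less less_irrefl linorder_neqE_nat)

lemma ord_map_cnt: "S \<subseteq> {..<n} \<Longrightarrow> card S = p \<Longrightarrow> ord_map n p (cnt S)"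
  using cnt_mono[of _ n S] by (auto simp: ord_map_def cnt_mono cnt_eq_card)

lemma cnt_compl: "t \<le> n \<Longrightarrow> cnt ({..<n} - S) t = t - cnt S t"
proof -
  assume "t \<le> n"
  then have "({..<n} - S) \<inter> {..<t} = {..<t} - (S \<inter> {..<t})" by auto
  then show ?thesis unfolding cnt_def by (simp add: card_Diff_subset)
qed

text \<open>For \<open>R \<subseteq> T\<close>, renumbering \<open>R\<close> within \<open>T\<close> and counting in two stages gives the same as
counting \<open>R\<close> directly.\<close>

lemma cnt_image_cnt:
  assumes "R \<subseteq> T"
  shows "cnt (cnt T ` R) (cnt T t) = cnt R t"
proof -
  have "cnt T ` R \<inter> {..<cnt T t} = cnt T ` (R \<inter> {..<t})"
    using assms by (auto simp: cnt_less_iff)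
  moreover have "inj_on (cnt T) (R \<inter> {..<t})"
    by (rule inj_on_subset[OF inj_on_cnt]) (use assms in auto)
  ultimately show ?thesis
    unfolding cnt_def[of "cnt T ` R"] cnt_def[of R] by (simp only: card_image)
qed

text \<open>The steps that remain of a path with \<open>Suc n\<close> steps when its vertex \<open>j\<close> is removed. If the steps
before and after that vertex have the same direction, they are merged into one; the first and the
last vertex disappear together with the only adjacent step.\<close>

definition delete_step :: "nat \<Rightarrow> nat \<Rightarrow> nat set \<Rightarrow> nat set" where
  "delete_step n j S = {t. t < n \<and> (if t < j then t \<in> S else Suc t \<in> S)}"

lemma cnt_delete_step:
  shows "t \<le> n \<Longrightarrow> t \<le> j \<Longrightarrow> cnt (delete_step n j S) t = cnt S t"
    and "t \<le> n \<Longrightarrow> j \<le> t \<Longrightarrow> cnt (delete_step n j S) t + of_bool (j \<in> S) = cnt S (Suc t)"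
proof -
  show 1: "cnt (delete_step n j S) t = cnt S t" if "t \<le> n" "t \<le> j" for t
    using that by (induction t) (auto simp: cnt_Suc delete_step_def)
  show "cnt (delete_step n j S) t + of_bool (j \<in> S) = cnt S (Suc t)" if "t \<le> n" "j \<le> t"
    using that(2,1)
  proof (induction t rule: dec_induct)
    case base
    then show ?case by (simp add: 1 cnt_Suc)
  next
    case (step t)
    have "t \<in> delete_step n j S \<longleftrightarrow> Suc t \<in> S" using step.hyps(1) step.prems by (auto simp: delete_step_def)
    then show ?case using step by (simp add: cnt_Suc)
  qed
qed

lemma delete_step_subset: "delete_step n j S \<subseteq> {..<n}"
  by (auto simp: delete_step_def)

text \<open>All steps adjacent to the vertex \<open>j\<close> of a path with \<open>n\<close> steps belong to \<open>S\<close>. The end vertices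
have only one adjacent step.\<close>

definition merged :: "nat \<Rightarrow> nat \<Rightarrow> nat set \<Rightarrow> bool" where
  "merged n j S \<longleftrightarrow> (j = 0 \<or> j - 1 \<in> S) \<and> (j = n \<or> j \<in> S)"

lemma card_delete_step_merged:
  assumes S: "S \<subseteq> {..<Suc n}" "card S = Suc p" and j: "j \<le> Suc n" "merged (Suc n) j S"
  shows "card (delete_step n j S) = p"
proof (cases "j = Suc n")
  case True
  then have "n \<in> S" using j by (simp add: merged_def)
  then have "cnt S n = p" using cnt_eq_card[OF S(1)] S(2) by (simp add: cnt_Suc)
  then show ?thesis using cnt_delete_step(1)[of n n j S] cnt_eq_card[OF delete_step_subset] True by simp
next
  case False
  then show ?thesis
    using cnt_delete_step(2)[of n n j S] cnt_eq_card[OF delete_step_subset[of n j S]] cnt_eq_card[OF S(1)] S(2) j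
    by (simp add: merged_def)
qed

text \<open>Removing a vertex between two steps of the first direction, and reading off the first
coordinate, is the same as removing the vertex \<open>cnt S j\<close> on the first axis.\<close>

lemma skip_cnt_merged:
  assumes j: "j \<le> Suc n" "merged (Suc n) j S" and t: "t \<le> n"
  shows "skip (cnt S j) (cnt (delete_step n j S) t) = cnt S (skip j t)"
proof (cases "t < j")
  case True
  then have "j - 1 \<in> S" "t \<le> j - 1" using j by (auto simp: merged_def)
  then have "cnt S t < cnt S j" using cnt_less[of "j - 1" S j] cnt_mono[of t "j - 1" S] True by simp
  then show ?thesis using True cnt_delete_step(1)[of t n j S] t by (simp add: skip_def)
next
  case False
  then have "j \<in> S" using j t by (auto simp: merged_def)
  then have "Suc (cnt (delete_step n j S) t) = cnt S (Suc t)" "Suc (cnt S j) = cnt S (Suc j)"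
    using cnt_delete_step(2)[of t n j S] t False by (simp_all add: cnt_Suc)
  then show ?thesis using False cnt_mono[of "Suc j" "Suc t" S] by (simp add: skip_def)
qed

text \<open>If both adjacent steps have the second direction, the first coordinate takes the same values
with the vertex as without it.\<close>

lemma cnt_unmerged:
  assumes j: "j \<le> Suc n" "merged (Suc n) j ({..<Suc n} - S)" and t: "t \<le> n"
  shows "cnt (delete_step n j S) t = cnt S (skip j t)"
proof (cases "t < j")
  case True
  then show ?thesis using cnt_delete_step(1)[of t n j S] t by (simp add: skip_def)
next
  case False
  then have "j \<notin> S" using j t by (auto simp: merged_def)
  then show ?thesis using cnt_delete_step(2)[of t n j S] t False by (simp add: skip_def)
qed

lemma card_delete_step_unmerged:
  assumes S: "S \<subseteq> {..<Suc n}" and j: "j \<le> Suc n" "merged (Suc n) j ({..<Suc n} - S)"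
  shows "card (delete_step n j S) = card S"
proof -
  have "card (delete_step n j S) = cnt S (skip j n)"
    using cnt_unmerged[OF j, of n] cnt_eq_card[OF delete_step_subset[of n j S]] by simp
  also have "\<dots> = card S"
  proof (cases "j = Suc n")
    case True
    then have "n \<notin> S" using j by (simp add: merged_def)
    then have "cnt S (Suc n) = cnt S n" by (simp add: cnt_Suc)
    then show ?thesis using True cnt_eq_card[OF S] by (simp add: skip_def)
  next
    case False
    then show ?thesis using j cnt_eq_card[OF S] by (simp add: skip_def)
  qed
  finally show ?thesis .
qed

text \<open>The codegeneracies that correspond to the iterated degeneracies \<open>ca_degens\<close>. A pullback is
contravariant, so the degeneracy applied first is the outermost function here.\<close>

primrec dups :: "nat list \<Rightarrow> nat \<Rightarrow> nat" where
  "dups [] t = t"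
| "dups (j # js) t = dup j (dups js t)"

primrec degens_defined :: "nat \<Rightarrow> nat list \<Rightarrow> bool" where
  "degens_defined p [] \<longleftrightarrow> True"
| "degens_defined p (j # js) \<longleftrightarrow> j \<le> p \<and> degens_defined (Suc p) js"

text \<open>In a strictly increasing list of numbers below \<open>p + length js\<close> the \<open>i\<close>-th entry is at most \<open>p + i\<close>,
which is the degree in which it is applied.\<close>

lemma degens_defined_if_sorted:
  "sorted_wrt (<) js \<Longrightarrow> \<forall>j\<in>set js. j < p + length js \<Longrightarrow> degens_defined p js"
proof (induction js arbitrary: p)
  case (Cons j js)
  have "set (j # js) \<subseteq> {j..<p + length (j # js)}" using Cons.prems by auto
  then have "card (set (j # js)) \<le> card {j..<p + length (j # js)}" by (intro card_mono) auto
  moreover have "card (set (j # js)) = length (j # js)"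
    using Cons.prems(1) by (intro distinct_card) (simp only: strict_sorted_iff)
  ultimately have "j \<le> p" by simp
  then show ?case using Cons by simp
qed simp

text \<open>Applied in increasing order, the degeneracies indexed by \<open>js\<close> make the steps \<open>js\<close> constant and leave
the others: the vertex reached after \<open>t\<close> steps is the number of steps outside \<open>js\<close>.\<close>

lemma dups_sorted:
  "sorted_wrt (<) js \<Longrightarrow> dups js t = card ({..<t} - set js)"
proof (induction js)
  case (Cons j js)
  have IH: "dups js t = card ({..<t} - set js)" using Cons by simp
  have j: "j \<notin> set js" "\<And>i. i \<in> set js \<Longrightarrow> j < i" using Cons.prems by auto
  show ?case
  proof (cases "t \<le> j")
    case True
    then have "{..<t} - set js = {..<t}" "{..<t} - set (j # js) = {..<t}" using j(2) by force+
    then show ?thesis using True IH by (simp add: dup_def)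
  next
    case False
    have "{..j} \<subseteq> {..<t} - set js" using False j(2) by force
    from card_mono[OF _ this] have "Suc j \<le> card ({..<t} - set js)" by simp
    moreover have "{..<t} - set (j # js) = ({..<t} - set js) - {j}" by auto
    moreover have "j \<in> {..<t} - set js" using False j(1) by simp
    ultimately show ?thesis using IH by (simp add: dup_def)
  qed
qed simp

text \<open>The iterated degeneracy that spreads a \<open>p\<close>-simplex over \<open>n\<close> steps so that it moves exactly at the
times in \<open>S\<close>.\<close>

definition ca_spread ::
  "('k, 'r) ring_scheme \<Rightarrow> ('k, 'a, 's) module_scheme \<Rightarrow> nat \<Rightarrow> nat \<Rightarrow> nat set \<Rightarrow>
   (arrow list \<times> ('a list \<Rightarrow> 'k) set \<Rightarrow> 'k) set \<Rightarrow> (arrow list \<times> ('a list \<Rightarrow> 'k) set \<Rightarrow> 'k) set" where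
  "ca_spread k A p n S = ca_degens k A p (sorted_list_of_set ({..<n} - S))"

lemma spread_degens:
  assumes "S \<subseteq> {..<n}" "card S = p"
  shows "degens_defined p (sorted_list_of_set ({..<n} - S))"
    and "p + length (sorted_list_of_set ({..<n} - S)) = n"
    and "t \<le> n \<Longrightarrow> dups (sorted_list_of_set ({..<n} - S)) t = cnt S t"
proof -
  have c: "card S \<le> n" "finite S" using card_mono[OF _ assms(1)] finite_subset[OF assms(1)] by auto
  show l: "p + length (sorted_list_of_set ({..<n} - S)) = n"
    using assms c by (simp add: card_Diff_subset)
  show "degens_defined p (sorted_list_of_set ({..<n} - S))"
    by (rule degens_defined_if_sorted) (use l in auto)
  assume "t \<le> n"
  then have "{..<t} - ({..<n} - S) = S \<inter> {..<t}" by auto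
  then show "dups (sorted_list_of_set ({..<n} - S)) t = cnt S t"
    by (simp add: dups_sorted cnt_def)
qed

context assoc_algebra
begin

lemma ca_face_hom: "ca_face k A (Suc i) j \<in> module_hom k (CA k A (Suc i)) (CA k A i)"
  unfolding ca_face_def using chain_op_hom[OF chain_op_face] by simp

lemma ca_face_gen:
  assumes "is_chain (Suc i) F" "V \<in> carrier (tensor_power k A (src (hd F)))"
  shows "ca_face k A (Suc i) j (ca_gen k A (Suc i) F V) = ca_gen k A i (chain_face j F) V"
  unfolding ca_face_def using chain_op_gen[OF chain_op_face assms] by simp

lemma ca_degen_hom: "j \<le> i \<Longrightarrow> ca_degen k A i j \<in> module_hom k (CA k A i) (CA k A (Suc i))"
  unfolding ca_degen_def by (rule chain_op_hom[OF chain_op_degen])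

lemma ca_degen_gen:
  assumes "j \<le> i" "is_chain i F" "V \<in> carrier (tensor_power k A (src (hd F)))"
  shows "ca_degen k A i j (ca_gen k A i F V) = ca_gen k A (Suc i) (chain_degen j F) V"
  unfolding ca_degen_def by (rule chain_op_gen[OF chain_op_degen[OF assms(1)] assms(2,3)])

lemma ca_degens_hom:
  "degens_defined p js \<Longrightarrow> ca_degens k A p js \<in> module_hom k (CA k A p) (CA k A (p + length js))"
proof (induction js arbitrary: p)
  case Nil
  then show ?case using module_hom_id by (simp add: ca_degens.simps(1)[abs_def])
next
  case (Cons j js)
  then have "ca_degens k A (Suc p) js \<in> module_hom k (CA k A (Suc p)) (CA k A (p + length (j # js)))"
    using Cons.IH[of "Suc p"] by simp
  then show ?case
    using module_hom_comp[OF _ ca_degen_hom[of j p]] Cons.prems by (simp add: ca_degens.simps(2)[abs_def])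
qed

lemma ord_map_dups: "degens_defined p js \<Longrightarrow> ord_map (p + length js) p (dups js)"
proof (induction js arbitrary: p)
  case Nil
  then show ?case by (simp add: ord_map_def)
next
  case (Cons j js)
  have "dups (j # js) = dup j \<circ> dups js" by auto
  moreover have "ord_map (Suc p + length js) p (dup j \<circ> dups js)"
    by (rule ord_map_comp[OF ord_map_dup Cons.IH]) (use Cons.prems in simp_all)
  moreover have "p + length (j # js) = Suc p + length js" by simp
  ultimately show ?case by (simp only:)
qed

lemma ca_degens_gen:
  assumes "degens_defined p js" "is_chain p F" "V \<in> carrier (tensor_power k A (src (hd F)))"
  shows "ca_degens k A p js (ca_gen k A p F V) = ca_gen k A (p + length js) (pull F (dups js) (p + length js)) V"
  using assms
proof (induction js arbitrary: p F)
  case Nil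
  then show ?case by (simp add: pull_id dups.simps(1)[abs_def])
next
  case (Cons j js)
  have j: "j \<le> p" "degens_defined (Suc p) js" using Cons.prems by simp_all
  have eq: "chain_degen j F = pull F (dup j) (Suc p)" by (rule chain_degen_eq_pull[OF Cons.prems(2) j(1)])
  have "ca_degens k A p (j # js) (ca_gen k A p F V) = ca_degens k A (Suc p) js (ca_gen k A (Suc p) (pull F (dup j) (Suc p)) V)"
    using ca_degen_gen[OF j(1) Cons.prems(2,3)] by (simp add: eq)
  also have "\<dots> = ca_gen k A (Suc p + length js) (pull (pull F (dup j) (Suc p)) (dups js) (Suc p + length js)) V"
    by (rule Cons.IH[OF j(2)])
       (use Cons.prems(2,3) j in \<open>simp_all add: is_chain_pull[OF _ ord_map_dup] src_hd_pull[OF _ ord_map_dup]\<close>)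
  also have "pull (pull F (dup j) (Suc p)) (dups js) (Suc p + length js) = pull F (dup j \<circ> dups js) (Suc p + length js)"
    by (rule pull_pull[OF Cons.prems(2) ord_map_dup[OF j(1)] ord_map_dups[OF j(2)]])
  also have "dup j \<circ> dups js = dups (j # js)" by auto
  finally show ?case by simp
qed

lemma ca_spread_hom:
  assumes S: "S \<subseteq> {..<n}" "card S = p"
  shows "ca_spread k A p n S \<in> module_hom k (CA k A p) (CA k A n)"
  using ca_degens_hom[OF spread_degens(1)[OF S]] unfolding spread_degens(2)[OF S] ca_spread_def .

lemma ca_spread_gen:
  assumes S: "S \<subseteq> {..<n}" "card S = p" and F: "is_chain p F" "V \<in> carrier (tensor_power k A (src (hd F)))"
  shows "ca_spread k A p n S (ca_gen k A p F V) = ca_gen k A n (pull F (cnt S) n) V"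
proof -
  have "ca_spread k A p n S (ca_gen k A p F V)
      = ca_gen k A n (pull F (dups (sorted_list_of_set ({..<n} - S))) n) V"
    using ca_degens_gen[OF spread_degens(1)[OF S] F] unfolding spread_degens(2)[OF S] ca_spread_def .
  also have "pull F (dups (sorted_list_of_set ({..<n} - S))) n = pull F (cnt S) n"
    by (rule pull_cong) (rule spread_degens(3)[OF S])
  finally show ?thesis .
qed

lemma pull_cnt_gen:
  assumes "S \<subseteq> {..<n}" "card S = p" "is_chain p F" "V \<in> carrier (tensor_power k A (src (hd F)))"
  shows "is_chain n (pull F (cnt S) n)" "V \<in> carrier (tensor_power k A (src (hd (pull F (cnt S) n))))"
  using is_chain_pull[OF assms(3) ord_map_cnt[OF assms(1,2)]] src_hd_pull[OF assms(3) ord_map_cnt[OF assms(1,2)]]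
    assms(4) by simp_all

lemma ca_spread_spread:
  assumes R: "R \<subseteq> T" "card R = p" and T: "T \<subseteq> {..<n}" "card T = m" and x: "x \<in> carrier (CA k A p)"
  shows "ca_spread k A m n T (ca_spread k A p m (cnt T ` R) x) = ca_spread k A p n R x"
proof (rule CA_hom_eqI[OF module_CA _ _ _ x])
  have "inj_on (cnt T) R" using inj_on_cnt R(1) by (rule inj_on_subset)
  moreover have "cnt T ` R \<subseteq> {..<m}"
    using R(1) T cnt_less[of _ T n] cnt_eq_card[OF T(1)] by auto
  ultimately have R': "cnt T ` R \<subseteq> {..<m}" "card (cnt T ` R) = p" using R(2) by (simp_all add: card_image)
  have Rn: "R \<subseteq> {..<n}" using R T by blast
  show "(\<lambda>x. ca_spread k A m n T (ca_spread k A p m (cnt T ` R) x)) \<in> module_hom k (CA k A p) (CA k A n)"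
    by (rule module_hom_comp[OF ca_spread_hom[OF T] ca_spread_hom[OF R']])
  show "ca_spread k A p n R \<in> module_hom k (CA k A p) (CA k A n)" by (rule ca_spread_hom[OF Rn R(2)])
  fix F V assume F: "is_chain p F" "V \<in> carrier (tensor_power k A (src (hd F)))"
  have "pull (pull F (cnt (cnt T ` R)) m) (cnt T) n = pull F (cnt (cnt T ` R) \<circ> cnt T) n"
    by (rule pull_pull[OF F(1) ord_map_cnt[OF R'] ord_map_cnt[OF T]])
  also have "\<dots> = pull F (cnt R) n" by (rule pull_cong) (simp add: cnt_image_cnt[OF R(1)])
  finally show "ca_spread k A m n T (ca_spread k A p m (cnt T ` R) (ca_gen k A p F V))
      = ca_spread k A p n R (ca_gen k A p F V)"
    using F by (simp add: ca_spread_gen[OF R'] ca_spread_gen[OF Rn R(2)] ca_spread_gen[OF T] pull_cnt_gen[OF R'])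
qed

lemma ca_face_spread_gen:
  assumes S: "S \<subseteq> {..<Suc n}" "card S = p" and j: "j \<le> Suc n"
    and F: "is_chain p F" "V \<in> carrier (tensor_power k A (src (hd F)))"
  shows "ca_face k A (Suc n) j (ca_spread k A p (Suc n) S (ca_gen k A p F V))
       = ca_gen k A n (pull F (cnt S \<circ> skip j) n) V"
proof -
  note c = pull_cnt_gen[OF S F]
  have "chain_face j (pull F (cnt S) (Suc n)) = pull F (cnt S \<circ> skip j) n"
    using chain_face_eq_pull[OF c(1) j] pull_pull[OF F(1) ord_map_cnt[OF S] ord_map_skip] by simp
  then show ?thesis by (simp add: ca_spread_gen[OF S F] ca_face_gen[OF c])
qed

lemma ca_face_spread_hom:
  "S \<subseteq> {..<Suc n} \<Longrightarrow> card S = p \<Longrightarrow>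
   (\<lambda>x. ca_face k A (Suc n) j (ca_spread k A p (Suc n) S x)) \<in> module_hom k (CA k A p) (CA k A n)"
  by (rule module_hom_comp[OF ca_face_hom ca_spread_hom])

text \<open>A face forgets one vertex, so two paths that differ only there have the same face.\<close>

lemma ca_face_spread_cong:
  assumes S: "S \<subseteq> {..<Suc n}" "card S = p" and S': "S' \<subseteq> {..<Suc n}" "card S' = p" and j: "j \<le> Suc n"
    and eq: "\<And>t. t \<le> Suc n \<Longrightarrow> t \<noteq> j \<Longrightarrow> cnt S t = cnt S' t" and x: "x \<in> carrier (CA k A p)"
  shows "ca_face k A (Suc n) j (ca_spread k A p (Suc n) S x) = ca_face k A (Suc n) j (ca_spread k A p (Suc n) S' x)"
proof (rule CA_hom_eqI[OF module_CA ca_face_spread_hom[OF S] ca_face_spread_hom[OF S'] _ x])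
  have "pull F (cnt S \<circ> skip j) n = pull F (cnt S' \<circ> skip j) n" for F
    by (rule pull_cong) (simp add: eq skip_def)
  then show "ca_face k A (Suc n) j (ca_spread k A p (Suc n) S (ca_gen k A p F V))
      = ca_face k A (Suc n) j (ca_spread k A p (Suc n) S' (ca_gen k A p F V))"
    if "is_chain p F" "V \<in> carrier (tensor_power k A (src (hd F)))" for F V
    by (simp only: ca_face_spread_gen[OF S j that] ca_face_spread_gen[OF S' j that])
qed

lemma ca_face_spread_merged:
  assumes S: "S \<subseteq> {..<Suc n}" "card S = Suc p" and j: "j \<le> Suc n" "merged (Suc n) j S"
    and x: "x \<in> carrier (CA k A (Suc p))"
  shows "ca_face k A (Suc n) j (ca_spread k A (Suc p) (Suc n) S x)
       = ca_spread k A p n (delete_step n j S) (ca_face k A (Suc p) (cnt S j) x)"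
proof (rule CA_hom_eqI[OF module_CA ca_face_spread_hom[OF S] _ _ x])
  note S' = delete_step_subset[of n j S] card_delete_step_merged[OF S j]
  show "(\<lambda>x. ca_spread k A p n (delete_step n j S) (ca_face k A (Suc p) (cnt S j) x))
      \<in> module_hom k (CA k A (Suc p)) (CA k A n)"
    by (rule module_hom_comp[OF ca_spread_hom[OF S'] ca_face_hom])
  fix F V assume F: "is_chain (Suc p) F" "V \<in> carrier (tensor_power k A (src (hd F)))"
  have c: "cnt S j \<le> Suc p" using ord_map_cnt[OF S] j(1) by (simp add: ord_map_def)
  have F': "is_chain p (chain_face (cnt S j) F)"
    "V \<in> carrier (tensor_power k A (src (hd (chain_face (cnt S j) F))))"
    using is_chain_face[OF F(1)] src_hd_chain_face[OF F(1)] F(2) by simp_all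
  have "pull (chain_face (cnt S j) F) (cnt (delete_step n j S)) n
      = pull F (skip (cnt S j) \<circ> cnt (delete_step n j S)) n"
    unfolding chain_face_eq_pull[OF F(1) c]
    by (rule pull_pull[OF F(1) ord_map_skip ord_map_cnt[OF S']])
  also have "\<dots> = pull F (cnt S \<circ> skip j) n"
    by (rule pull_cong) (simp add: skip_cnt_merged[OF j])
  finally show "ca_face k A (Suc n) j (ca_spread k A (Suc p) (Suc n) S (ca_gen k A (Suc p) F V))
       = ca_spread k A p n (delete_step n j S) (ca_face k A (Suc p) (cnt S j) (ca_gen k A (Suc p) F V))"
    by (simp add: ca_face_spread_gen[OF S j(1) F] ca_face_gen[OF F] ca_spread_gen[OF S' F'])
qed

text \<open>At a vertex where the simplex rests before and after, the face cancels one of the degeneracies.\<close>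

lemma ca_face_spread_unmerged:
  assumes S: "S \<subseteq> {..<Suc n}" "card S = p" and j: "j \<le> Suc n" "merged (Suc n) j ({..<Suc n} - S)"
    and x: "x \<in> carrier (CA k A p)"
  shows "ca_face k A (Suc n) j (ca_spread k A p (Suc n) S x) = ca_spread k A p n (delete_step n j S) x"
proof -
  note S' = delete_step_subset[of n j S] card_delete_step_unmerged[OF S(1) j, unfolded S(2)]
  show ?thesis
  proof (rule CA_hom_eqI[OF module_CA ca_face_spread_hom[OF S] ca_spread_hom[OF S'] _ x])
    fix F V assume F: "is_chain p F" "V \<in> carrier (tensor_power k A (src (hd F)))"
    have "pull F (cnt S \<circ> skip j) n = pull F (cnt (delete_step n j S)) n"
      by (rule pull_cong) (simp add: cnt_unmerged[OF j])
    then show "ca_face k A (Suc n) j (ca_spread k A p (Suc n) S (ca_gen k A p F V))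
        = ca_spread k A p n (delete_step n j S) (ca_gen k A p F V)"
      by (simp add: ca_face_spread_gen[OF S j(1) F] ca_spread_gen[OF S' F])
  qed
qed

lemma ca_face_face:
  assumes x: "x \<in> carrier (CA k A (Suc (Suc n)))" and ij: "i \<le> j" "j \<le> Suc n"
  shows "ca_face k A (Suc n) i (ca_face k A (Suc (Suc n)) (Suc j) x)
       = ca_face k A (Suc n) j (ca_face k A (Suc (Suc n)) i x)"
proof (rule CA_hom_eqI[OF module_CA module_hom_comp[OF ca_face_hom ca_face_hom]
      module_hom_comp[OF ca_face_hom ca_face_hom] _ x])
  fix F V assume F: "is_chain (Suc (Suc n)) F" "V \<in> carrier (tensor_power k A (src (hd F)))"
  have F': "is_chain (Suc n) (chain_face l F)" "V \<in> carrier (tensor_power k A (src (hd (chain_face l F))))" for l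
    using is_chain_face[OF F(1)] src_hd_chain_face[OF F(1)] F(2) by simp_all
  have pp: "chain_face a (chain_face b F) = pull F (skip b \<circ> skip a) n" if "a \<le> Suc n" "b \<le> Suc (Suc n)" for a b
  proof -
    have "chain_face a (chain_face b F) = pull (chain_face b F) (skip a) n"
      by (rule chain_face_eq_pull[OF F'(1) that(1)])
    also have "\<dots> = pull (pull F (skip b) (Suc n)) (skip a) n"
      by (simp only: chain_face_eq_pull[OF F(1) that(2)])
    also have "pull (pull F (skip b) (Suc n)) (skip a) n = pull F (skip b \<circ> skip a) n"
      by (rule pull_pull[OF F(1) ord_map_skip ord_map_skip])
    finally show ?thesis .
  qed
  have "pull F (skip (Suc j) \<circ> skip i) n = pull F (skip i \<circ> skip j) n"
    by (rule pull_cong) (use ij in \<open>auto simp: skip_def\<close>)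
  then have "chain_face i (chain_face (Suc j) F) = chain_face j (chain_face i F)"
    using pp[of i "Suc j"] pp[of j i] ij by simp
  then show "ca_face k A (Suc n) i (ca_face k A (Suc (Suc n)) (Suc j) (ca_gen k A (Suc (Suc n)) F V))
       = ca_face k A (Suc n) j (ca_face k A (Suc (Suc n)) i (ca_gen k A (Suc (Suc n)) F V))"
    by (simp add: ca_face_gen[OF F] ca_face_gen[OF F'])
qed

lemma ca_mult_bilinear: "module_bilinear k (CA k A i) (CA k A i) (CA k A i) (ca_mult k A i)"
  unfolding ca_mult_pairing by (rule ca_pairing_bilinear[OF chain_pairing_prod])

lemma ca_mult_closed:
  "x \<in> carrier (CA k A i) \<Longrightarrow> y \<in> carrier (CA k A i) \<Longrightarrow> ca_mult k A i x y \<in> carrier (CA k A i)"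
  by (rule bilinear_closed[OF ca_mult_bilinear])

lemma ca_mult_gen:
  assumes "is_chain i F" "V \<in> carrier (tensor_power k A (src (hd F)))"
    "is_chain i G" "W \<in> carrier (tensor_power k A (src (hd G)))"
  shows "ca_mult k A i (ca_gen k A i F V) (ca_gen k A i G W)
    = ca_gen k A i (map2 arr_prod F G) (tensor_concat k A (src (hd F)) (src (hd G)) V W)"
  unfolding ca_mult_pairing by (rule ca_pairing_gen[OF chain_pairing_prod assms])

lemma prod_gen:
  assumes "is_chain i F" "V \<in> carrier (tensor_power k A (src (hd F)))"
    "is_chain i G" "W \<in> carrier (tensor_power k A (src (hd G)))"
  shows "is_chain i (map2 arr_prod F G)" "src (hd (map2 arr_prod F G)) = src (hd F) + src (hd G)"
    "tensor_concat k A (src (hd F)) (src (hd G)) V W \<in> carrier (tensor_power k A (src (hd (map2 arr_prod F G))))"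
  using chain_pairing_prod[of i] assms tensor_concat_closed[OF assms(2,4)] unfolding chain_pairing_def by auto

lemma ca_face_mult:
  assumes x: "x \<in> carrier (CA k A (Suc i))" and y: "y \<in> carrier (CA k A (Suc i))" and j: "j \<le> Suc i"
  shows "ca_face k A (Suc i) j (ca_mult k A (Suc i) x y)
       = ca_mult k A i (ca_face k A (Suc i) j x) (ca_face k A (Suc i) j y)"
proof (rule CA_bilinear_eqI[OF module_CA module_bilinear_hom_comp[OF ca_face_hom ca_mult_bilinear]
      module_bilinear_comp_homs[OF ca_mult_bilinear ca_face_hom ca_face_hom] _ x y])
  fix F V G W
  assume F: "is_chain (Suc i) F" "V \<in> carrier (tensor_power k A (src (hd F)))"
    and G: "is_chain (Suc i) G" "W \<in> carrier (tensor_power k A (src (hd G)))"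
  show "ca_face k A (Suc i) j (ca_mult k A (Suc i) (ca_gen k A (Suc i) F V) (ca_gen k A (Suc i) G W))
     = ca_mult k A i (ca_face k A (Suc i) j (ca_gen k A (Suc i) F V)) (ca_face k A (Suc i) j (ca_gen k A (Suc i) G W))"
    unfolding ca_mult_gen[OF F G] ca_face_gen[OF prod_gen(1,3)[OF F G]] ca_face_gen[OF F] ca_face_gen[OF G]
    using F G by (simp add: ca_mult_gen is_chain_face src_hd_chain_face chain_face_prod[OF F(1) G(1) j])
qed

lemma ca_degen_mult:
  assumes x: "x \<in> carrier (CA k A i)" and y: "y \<in> carrier (CA k A i)" and j: "j \<le> i"
  shows "ca_degen k A i j (ca_mult k A i x y) = ca_mult k A (Suc i) (ca_degen k A i j x) (ca_degen k A i j y)"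
proof (rule CA_bilinear_eqI[OF module_CA module_bilinear_hom_comp[OF ca_degen_hom[OF j] ca_mult_bilinear]
      module_bilinear_comp_homs[OF ca_mult_bilinear ca_degen_hom[OF j] ca_degen_hom[OF j]] _ x y])
  fix F V G W
  assume F: "is_chain i F" "V \<in> carrier (tensor_power k A (src (hd F)))"
    and G: "is_chain i G" "W \<in> carrier (tensor_power k A (src (hd G)))"
  have src: "src (hd (chain_degen j F)) = src (hd F)" "src (hd (chain_degen j G)) = src (hd G)"
    using chain_op_degen[OF j] F G unfolding chain_op_def by auto
  show "ca_degen k A i j (ca_mult k A i (ca_gen k A i F V) (ca_gen k A i G W))
     = ca_mult k A (Suc i) (ca_degen k A i j (ca_gen k A i F V)) (ca_degen k A i j (ca_gen k A i G W))"
    unfolding ca_mult_gen[OF F G] ca_degen_gen[OF j prod_gen(1,3)[OF F G]] ca_degen_gen[OF j F] ca_degen_gen[OF j G]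
    using F G j by (simp add: ca_mult_gen is_chain_degen src chain_degen_prod[OF F(1) G(1) j])
qed

lemma ca_degens_mult:
  "degens_defined i js \<Longrightarrow> x \<in> carrier (CA k A i) \<Longrightarrow> y \<in> carrier (CA k A i) \<Longrightarrow>
   ca_degens k A i js (ca_mult k A i x y) = ca_mult k A (i + length js) (ca_degens k A i js x) (ca_degens k A i js y)"
proof (induction js arbitrary: i x y)
  case (Cons j js)
  then have "ca_degen k A i j x \<in> carrier (CA k A (Suc i))" "ca_degen k A i j y \<in> carrier (CA k A (Suc i))"
    using module_homD(1)[OF ca_degen_hom] by auto
  then show ?case using Cons.prems Cons.IH[of "Suc i"] by (simp add: ca_degen_mult)
qed simp

lemma ca_spread_mult:
  assumes S: "S \<subseteq> {..<n}" "card S = p" and x: "x \<in> carrier (CA k A p)" and y: "y \<in> carrier (CA k A p)"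
  shows "ca_spread k A p n S (ca_mult k A p x y) = ca_mult k A n (ca_spread k A p n S x) (ca_spread k A p n S y)"
  using ca_degens_mult[OF spread_degens(1)[OF S] x y] unfolding spread_degens(2)[OF S] ca_spread_def .

lemma ca_mult_assoc:
  assumes x: "x \<in> carrier (CA k A i)" and y: "y \<in> carrier (CA k A i)" and z: "z \<in> carrier (CA k A i)"
  shows "ca_mult k A i (ca_mult k A i x y) z = ca_mult k A i x (ca_mult k A i y z)"
proof (rule CA_hom_eqI[OF module_CA _ _ _ x])
  note b = ca_mult_bilinear[of i]
  show "(\<lambda>x. ca_mult k A i (ca_mult k A i x y) z) \<in> module_hom k (CA k A i) (CA k A i)"
    by (rule module_hom_comp[OF bilinear_left[OF b z] bilinear_left[OF b y]])
  show "(\<lambda>x. ca_mult k A i x (ca_mult k A i y z)) \<in> module_hom k (CA k A i) (CA k A i)"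
    by (rule bilinear_left[OF b ca_mult_closed[OF y z]])
  fix F U assume F: "is_chain i F" "U \<in> carrier (tensor_power k A (src (hd F)))"
  note c = ca_gen_closed[OF F]
  show "ca_mult k A i (ca_mult k A i (ca_gen k A i F U) y) z = ca_mult k A i (ca_gen k A i F U) (ca_mult k A i y z)"
  proof (rule CA_bilinear_eqI[OF module_CA _ _ _ y z])
    show "module_bilinear k (CA k A i) (CA k A i) (CA k A i)
       (\<lambda>y z. ca_mult k A i (ca_mult k A i (ca_gen k A i F U) y) z)"
      by (rule module_bilinear_comp_homs[OF b bilinear_right[OF b c] module_hom_id])
    show "module_bilinear k (CA k A i) (CA k A i) (CA k A i)
       (\<lambda>y z. ca_mult k A i (ca_gen k A i F U) (ca_mult k A i y z))"
      by (rule module_bilinear_hom_comp[OF bilinear_right[OF b c] b])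
    fix G V H W
    assume G: "is_chain i G" "V \<in> carrier (tensor_power k A (src (hd G)))"
      and H: "is_chain i H" "W \<in> carrier (tensor_power k A (src (hd H)))"
    show "ca_mult k A i (ca_mult k A i (ca_gen k A i F U) (ca_gen k A i G V)) (ca_gen k A i H W)
        = ca_mult k A i (ca_gen k A i F U) (ca_mult k A i (ca_gen k A i G V) (ca_gen k A i H W))"
      unfolding ca_mult_gen[OF F G] ca_mult_gen[OF G H] ca_mult_gen[OF prod_gen(1,3)[OF F G] H]
        ca_mult_gen[OF F prod_gen(1,3)[OF G H]] prod_gen(2)[OF F G] prod_gen(2)[OF G H]
      by (simp add: tensor_concat_assoc[OF F(2) G(2) H(2)] map2_prod_assoc[OF F(1) G(1) H(1)])
  qed
qed

text \<open>The unit is the class of $1 \in k = A^{\otimes 0}$ over the degenerate chains at the initial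
object.\<close>

definition ca_unit where
  "ca_unit i = ca_gen k A i (replicate (Suc i) (arr_id 0)) (pure_tensor k A [])"

lemma unit_gen:
  "is_chain i (replicate (Suc i) (arr_id 0))"
  "pure_tensor k A [] \<in> carrier (tensor_power k A (src (hd (replicate (Suc i) (arr_id 0)))))"
  using is_chain_units pure_tensor_closed[OF Nil_word] by simp_all

lemma ca_unit_closed: "ca_unit i \<in> carrier (CA k A i)"
  unfolding ca_unit_def by (rule ca_gen_closed[OF unit_gen])

lemma ca_mult_unit:
  assumes x: "x \<in> carrier (CA k A i)"
  shows "ca_mult k A i (ca_unit i) x = x" and "ca_mult k A i x (ca_unit i) = x"
proof -
  note b = ca_mult_bilinear[of i]
  show "ca_mult k A i (ca_unit i) x = x"
  proof (rule CA_hom_eqI[OF module_CA bilinear_right[OF b ca_unit_closed] module_hom_id _ x])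
    fix F V assume F: "is_chain i F" "V \<in> carrier (tensor_power k A (src (hd F)))"
    show "ca_mult k A i (ca_unit i) (ca_gen k A i F V) = ca_gen k A i F V"
      unfolding ca_unit_def ca_mult_gen[OF unit_gen F] map2_prod_units[OF F(1)]
      by (simp add: tensor_concat_unit[OF F(2)])
  qed
  show "ca_mult k A i x (ca_unit i) = x"
  proof (rule CA_hom_eqI[OF module_CA bilinear_left[OF b ca_unit_closed] module_hom_id _ x])
    fix F V assume F: "is_chain i F" "V \<in> carrier (tensor_power k A (src (hd F)))"
    show "ca_mult k A i (ca_gen k A i F V) (ca_unit i) = ca_gen k A i F V"
      unfolding ca_unit_def ca_mult_gen[OF F unit_gen] map2_prod_units[OF F(1)]
      by (simp add: tensor_concat_unit[OF F(2)])
  qed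
qed

lemma ca_spread_unit:
  "ca_spread k A 0 n {} (ca_unit 0) = ca_unit n"
proof -
  have "chain_path (replicate (Suc 0) (arr_id 0)) a b = arr_id 0" if "a \<le> b" "b \<le> Suc 0" for a b
  proof -
    have "a = 0 \<and> b = 0 \<or> a = 0 \<and> b = 1 \<or> a = 1 \<and> b = 1" using that by auto
    then show ?thesis
      using arr_comp_id_left[of "arr_id 0"] by (auto simp: chain_vertex_def)
  qed
  moreover have "cnt {} t = 0" "with_source (cnt {}) t \<le> Suc 0" for t by (cases t; simp add: cnt_def)+
  ultimately have "pull (replicate (Suc 0) (arr_id 0)) (cnt {}) n = replicate (Suc n) (arr_id 0)"
    by (intro nth_equalityI) (simp_all add: nth_pull del: replicate_Suc chain_path.simps)
  then show ?thesis unfolding ca_unit_def by (subst ca_spread_gen[OF _ _ unit_gen]) auto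
qed

lemma ca_spread_all:
  assumes x: "x \<in> carrier (CA k A n)"
  shows "ca_spread k A n n {..<n} x = x"
  by (simp add: ca_spread_def)

definition ca_prism where "ca_prism i j = ca_pairing k A (prism j) (Suc i)"

lemma ca_prism_bilinear: "j \<le> i \<Longrightarrow> module_bilinear k (CA k A i) (CA k A i) (CA k A (Suc i)) (ca_prism i j)"
  unfolding ca_prism_def by (rule ca_pairing_bilinear[OF chain_pairing_prism])

lemma ca_prism_gen:
  assumes "j \<le> i" "is_chain i F" "V \<in> carrier (tensor_power k A (src (hd F)))"
    "is_chain i G" "W \<in> carrier (tensor_power k A (src (hd G)))"
  shows "ca_prism i j (ca_gen k A i F V) (ca_gen k A i G W)
    = ca_gen k A (Suc i) (prism j F G) (tensor_concat k A (src (hd F)) (src (hd G)) V W)"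
  unfolding ca_prism_def by (rule ca_pairing_gen[OF chain_pairing_prism[OF assms(1)] assms(2-)])

lemma ca_face_prism_gen:
  assumes j: "j \<le> i" and F: "is_chain i F" "V \<in> carrier (tensor_power k A (src (hd F)))"
    and G: "is_chain i G" "W \<in> carrier (tensor_power k A (src (hd G)))"
  shows "ca_face k A (Suc i) l (ca_prism i j (ca_gen k A i F V) (ca_gen k A i G W))
    = ca_gen k A i (chain_face l (prism j F G)) (tensor_concat k A (src (hd F)) (src (hd G)) V W)"
proof -
  have "src (hd (prism j F G)) = src (hd F) + src (hd G)"
    using chain_pairing_prism[OF j] F G unfolding chain_pairing_def by blast
  then show ?thesis unfolding ca_prism_gen[OF j F G]
    by (intro ca_face_gen is_chain_prism F G j) (simp add: tensor_concat_closed[OF F(2) G(2)])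
qed

lemma ca_face_prism_bilinear:
  "j \<le> i \<Longrightarrow> module_bilinear k (CA k A i) (CA k A i) (CA k A i) (\<lambda>x y. ca_face k A (Suc i) l (ca_prism i j x y))"
  by (rule module_bilinear_hom_comp[OF ca_face_hom ca_prism_bilinear])

lemma ca_face_prism_below:
  assumes x: "x \<in> carrier (CA k A (Suc n))" and y: "y \<in> carrier (CA k A (Suc n))" and ij: "i \<le> j" "j \<le> n"
  shows "ca_face k A (Suc (Suc n)) i (ca_prism (Suc n) (Suc j) x y)
    = ca_prism n j (ca_face k A (Suc n) i x) (ca_face k A (Suc n) i y)"
proof -
  have j: "Suc j \<le> Suc n" using ij by simp
  show ?thesis
  proof (rule CA_bilinear_eqI[OF module_CA ca_face_prism_bilinear[OF j]
        module_bilinear_comp_homs[OF ca_prism_bilinear[OF ij(2)] ca_face_hom ca_face_hom] _ x y])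
    fix F V G W
    assume F: "is_chain (Suc n) F" "V \<in> carrier (tensor_power k A (src (hd F)))"
      and G: "is_chain (Suc n) G" "W \<in> carrier (tensor_power k A (src (hd G)))"
    show "ca_face k A (Suc (Suc n)) i (ca_prism (Suc n) (Suc j) (ca_gen k A (Suc n) F V) (ca_gen k A (Suc n) G W))
      = ca_prism n j (ca_face k A (Suc n) i (ca_gen k A (Suc n) F V)) (ca_face k A (Suc n) i (ca_gen k A (Suc n) G W))"
      unfolding ca_face_prism_gen[OF j F G] ca_face_gen[OF F] ca_face_gen[OF G] prism_face_below[OF F(1) G(1) ij(1) j]
      using F G by (simp add: ca_prism_gen[OF ij(2)] is_chain_face src_hd_chain_face)
  qed
qed

lemma ca_face_prism_above:
  assumes x: "x \<in> carrier (CA k A (Suc n))" and y: "y \<in> carrier (CA k A (Suc n))"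
    and ij: "j < i" "i \<le> Suc n"
  shows "ca_face k A (Suc (Suc n)) (Suc i) (ca_prism (Suc n) j x y)
    = ca_prism n j (ca_face k A (Suc n) i x) (ca_face k A (Suc n) i y)"
proof -
  have j: "j \<le> n" "j \<le> Suc n" using ij by simp_all
  show ?thesis
  proof (rule CA_bilinear_eqI[OF module_CA ca_face_prism_bilinear[OF j(2)]
        module_bilinear_comp_homs[OF ca_prism_bilinear[OF j(1)] ca_face_hom ca_face_hom] _ x y])
    fix F V G W
    assume F: "is_chain (Suc n) F" "V \<in> carrier (tensor_power k A (src (hd F)))"
      and G: "is_chain (Suc n) G" "W \<in> carrier (tensor_power k A (src (hd G)))"
    show "ca_face k A (Suc (Suc n)) (Suc i) (ca_prism (Suc n) j (ca_gen k A (Suc n) F V) (ca_gen k A (Suc n) G W))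
      = ca_prism n j (ca_face k A (Suc n) i (ca_gen k A (Suc n) F V)) (ca_face k A (Suc n) i (ca_gen k A (Suc n) G W))"
      unfolding ca_face_prism_gen[OF j(2) F G] ca_face_gen[OF F] ca_face_gen[OF G] prism_face_above[OF F(1) G(1) ij]
      using F G by (simp add: ca_prism_gen[OF j(1)] is_chain_face src_hd_chain_face)
  qed
qed

lemma ca_face_prism_middle:
  assumes x: "x \<in> carrier (CA k A i)" and y: "y \<in> carrier (CA k A i)" and j: "Suc j \<le> i"
  shows "ca_face k A (Suc i) (Suc j) (ca_prism i (Suc j) x y) = ca_face k A (Suc i) (Suc j) (ca_prism i j x y)"
proof -
  have j': "j \<le> i" using j by simp
  show ?thesis
    by (rule CA_bilinear_eqI[OF module_CA ca_face_prism_bilinear[OF j] ca_face_prism_bilinear[OF j'] _ x y])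
       (simp only: ca_face_prism_gen[OF j] ca_face_prism_gen[OF j'] prism_face_middle[OF _ _ j])
qed

lemma ca_face_prism_last:
  assumes x: "x \<in> carrier (CA k A i)" and y: "y \<in> carrier (CA k A i)"
  shows "ca_face k A (Suc i) (Suc i) (ca_prism i i x y) = ca_mult k A i x y"
  by (rule CA_bilinear_eqI[OF module_CA ca_face_prism_bilinear[OF order.refl] ca_mult_bilinear _ x y])
     (simp only: ca_face_prism_gen[OF order.refl] prism_face_last ca_mult_gen)

lemma ca_face_prism_first:
  assumes x: "x \<in> carrier (CA k A i)" and y: "y \<in> carrier (CA k A i)"
  shows "ca_face k A (Suc i) 0 (ca_prism i 0 x y) = ca_mult k A i y x"
proof (rule CA_bilinear_eqI[OF module_CA ca_face_prism_bilinear[OF le0] module_bilinear_flip[OF ca_mult_bilinear] _ x y])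
  fix F V G W
  assume F: "is_chain i F" "V \<in> carrier (tensor_power k A (src (hd F)))"
    and G: "is_chain i G" "W \<in> carrier (tensor_power k A (src (hd G)))"
  obtain f F' where F': "F = f # F'" using is_chain_Cons[OF F(1)] by blast
  obtain g G' where G': "G = g # G'" using is_chain_Cons[OF G(1)] by blast
  have "ca_face k A (Suc i) 0 (ca_prism i 0 (ca_gen k A i F V) (ca_gen k A i G W))
      = ca_gen k A i (arr_comp (arr_prod g f) (braiding (src f) (src g)) # map2 arr_prod G' F')
          (tensor_concat k A (src f) (src g) V W)"
    unfolding ca_face_prism_gen[OF le0 F G] using prism_face_first F(1) G(1) by (simp add: F' G')
  also have "\<dots> = ca_gen k A i (map2 arr_prod G F) (bar_act k A (braiding (src f) (src g)) (tensor_concat k A (src f) (src g) V W))"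
    using prod_gen(1)[OF G F] tensor_concat_closed[OF F(2) G(2)]
    by (subst ca_gen_precomp) (simp_all add: F' G' is_arrow_braiding)
  also have "\<dots> = ca_mult k A i (ca_gen k A i G W) (ca_gen k A i F V)"
    unfolding ca_mult_gen[OF G F] using F(2) G(2) by (simp add: F' G' bar_act_braiding)
  finally show "ca_face k A (Suc i) 0 (ca_prism i 0 (ca_gen k A i F V) (ca_gen k A i G W))
      = ca_mult k A i (ca_gen k A i G W) (ca_gen k A i F V)" .
qed

end

section \<open>Combinatorics of shuffles and signed sums\<close>

text \<open>The number of pairs of an element of \<open>S\<close> and a smaller element of \<open>T\<close>. For complementary sets its
parity is the sign of the shuffle; for three sets that partition the steps, the three pairwise numbers
add up to the sign exponent of the triple shuffle.\<close>

definition crossings :: "nat set \<Rightarrow> nat set \<Rightarrow> nat" where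
  "crossings S T = (\<Sum>s\<in>S. cnt T s)"

definition shuffle_sets :: "nat \<Rightarrow> nat \<Rightarrow> nat set set" where
  "shuffle_sets n p = {S. S \<subseteq> {..<n} \<and> card S = p}"

lemma finite_shuffle_sets [simp]: "finite (shuffle_sets n p)"
  by (rule finite_subset[of _ "Pow {..<n}"]) (auto simp: shuffle_sets_def)

lemma shuffle_setsD:
  assumes "S \<in> shuffle_sets n p"
  shows "S \<subseteq> {..<n}" "card S = p" "finite S"
  using assms finite_subset[of S "{..<n}"] by (auto simp: shuffle_sets_def)

lemma compl_shuffle_sets: "S \<in> shuffle_sets (p + q) p \<Longrightarrow> {..<p + q} - S \<in> shuffle_sets (p + q) q"
  using card_Diff_subset[of S "{..<p + q}"] finite_subset[of S "{..<p + q}"] by (auto simp: shuffle_sets_def)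

lemma shuffle_sets_compl_bij: "bij_betw (\<lambda>S. {..<p + q} - S) (shuffle_sets (p + q) p) (shuffle_sets (p + q) q)"
proof (rule bij_betw_byWitness[where f' = "\<lambda>S. {..<p + q} - S"])
  show "(\<lambda>S. {..<p + q} - S) ` shuffle_sets (p + q) p \<subseteq> shuffle_sets (p + q) q"
    using compl_shuffle_sets by blast
  show "(\<lambda>S. {..<p + q} - S) ` shuffle_sets (p + q) q \<subseteq> shuffle_sets (p + q) p"
    using compl_shuffle_sets[of _ q p] by (auto simp: add.commute)
qed (auto simp: shuffle_sets_def)

lemma inversions_crossings:
  assumes "finite S"
  shows "card {(m, t). m \<in> S \<and> t \<in> {..<n} - S \<and> t < m} = crossings S ({..<n} - S)"
proof -
  have "{(m, t). m \<in> S \<and> t \<in> {..<n} - S \<and> t < m} = Sigma S (\<lambda>m. ({..<n} - S) \<inter> {..<m})" by auto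
  then show ?thesis using assms by (simp add: crossings_def cnt_def)
qed

lemma cnt_Un: "S \<inter> T = {} \<Longrightarrow> cnt (S \<union> T) t = cnt S t + cnt T t"
proof -
  assume "S \<inter> T = {}"
  then have "card (S \<inter> {..<t} \<union> T \<inter> {..<t}) = card (S \<inter> {..<t}) + card (T \<inter> {..<t})"
    by (intro card_Un_disjoint) auto
  then show ?thesis by (simp add: cnt_def Int_Un_distrib2)
qed

lemma crossings_Un:
  assumes "finite S" "finite T" "S \<inter> T = {}"
  shows "crossings (S \<union> T) U = crossings S U + crossings T U"
    and "crossings U (S \<union> T) = crossings U S + crossings U T"
  using assms by (simp_all add: crossings_def sum.union_disjoint cnt_Un sum.distrib)

lemma crossings_image_cnt:
  assumes "R \<subseteq> T" "R' \<subseteq> T"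
  shows "crossings (cnt T ` R) (cnt T ` R') = crossings R R'"
proof -
  have "inj_on (cnt T) R" by (rule inj_on_subset[OF inj_on_cnt assms(1)])
  then show ?thesis by (simp add: crossings_def sum.reindex cnt_image_cnt[OF assms(2)])
qed

lemma cnt_image_shuffle:
  assumes T: "T \<in> shuffle_sets n m" and R: "R \<subseteq> T"
  shows "cnt T ` R \<in> shuffle_sets m (card R)" and "{..<m} - cnt T ` R = cnt T ` (T - R)"
proof -
  note T' = shuffle_setsD[OF T]
  have sub: "cnt T ` T \<subseteq> {..<m}"
    using T' cnt_less[of _ T n] cnt_eq_card[OF T'(1)] by auto
  then have "cnt T ` T = {..<m}"
    using T' by (intro card_subset_eq) (simp_all add: card_image[OF inj_on_cnt])
  then show "{..<m} - cnt T ` R = cnt T ` (T - R)"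
    using inj_on_image_set_diff[OF inj_on_cnt[of T], of T R] R by simp
  show "cnt T ` R \<in> shuffle_sets m (card R)"
    using sub R card_image[OF inj_on_subset[OF inj_on_cnt R]] by (auto simp: shuffle_sets_def)
qed

lemma sum_cnt_self: "finite S \<Longrightarrow> (\<Sum>s\<in>S. cnt S s) = \<Sum>{..<card S}"
proof -
  assume fin: "finite S"
  obtain n where "S \<subseteq> {..<n}" using fin unfolding finite_nat_set_iff_bounded by blast
  then have S: "S \<in> shuffle_sets n (card S)" by (simp add: shuffle_sets_def)
  from cnt_image_shuffle(2)[OF S, of "{}"] have "cnt S ` S = {..<card S}" by simp
  then show ?thesis using sum.reindex[OF inj_on_cnt[of S], of "\<lambda>i. i"] by simp
qed

text \<open>Below the \<open>i\<close>-th element \<open>s\<close> of \<open>S\<close> (counted from 0) there are \<open>s - i\<close> elements of the complement.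
So the sign of a shuffle is determined, up to a constant that depends only on \<open>card S\<close>, by
the sum of its elements, which is easy to follow under changes of \<open>S\<close>.\<close>

lemma crossings_compl_sum:
  assumes "S \<subseteq> {..<n}"
  shows "crossings S ({..<n} - S) + \<Sum>{..<card S} = \<Sum>S"
proof -
  have fin: "finite S" using assms finite_subset by blast
  have "cnt ({..<n} - S) s + cnt S s = s" if "s \<in> S" for s
  proof -
    have "cnt S s \<le> s" unfolding cnt_def using card_mono[of "{..<s}" "S \<inter> {..<s}"] by simp
    then show ?thesis using cnt_compl[of s n S] that assms by auto
  qed
  then have "crossings S ({..<n} - S) + (\<Sum>s\<in>S. cnt S s) = \<Sum>S"
    by (simp add: crossings_def flip: sum.distrib)
  then show ?thesis by (simp add: sum_cnt_self[OF fin])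
qed

lemma sum_lessThan_add: "\<Sum>{..<p + q} = \<Sum>{..<p} + \<Sum>{..<q} + p * q" for p q :: nat
  by (induction q) simp_all

text \<open>Each pair of an element of \<open>S\<close> and one outside \<open>S\<close> is counted by exactly one of the two terms.\<close>

lemma crossings_flip:
  assumes S: "S \<in> shuffle_sets (p + q) p"
  shows "crossings S ({..<p + q} - S) + crossings ({..<p + q} - S) S = p * q"
proof -
  note S' = shuffle_setsD[OF S] and C = shuffle_setsD[OF compl_shuffle_sets[OF S]]
  have dd: "{..<p + q} - ({..<p + q} - S) = S" using S' by auto
  have "\<Sum>S + \<Sum>({..<p + q} - S) = \<Sum>{..<p + q}"
    using S' sum.subset_diff[of S "{..<p + q}" "\<lambda>i. i"] by simp
  then show ?thesis
    using crossings_compl_sum[OF S'(1)] crossings_compl_sum[OF C(1)] S'(2) C(2) sum_lessThan_add[of p q]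
    unfolding dd by simp
qed

text \<open>Removing the step \<open>j\<close> from \<open>S\<close> lowers the elements above \<open>j\<close> by one, and there are
\<open>p - cnt S j\<close> of them. At the last vertex there is no step \<open>j\<close>; there the step before it is removed, and
the count holds with \<open>cnt S j = Suc p\<close>.\<close>

lemma sum_delete_step:
  assumes S: "S \<subseteq> {..<Suc n}" "card S = Suc p" and j: "j \<le> Suc n" "merged (Suc n) j S"
  shows "\<Sum>S + cnt S j = \<Sum>(delete_step n j S) + p + j"
proof -
  let ?D = "delete_step n j S"
  define w where "w = (\<lambda>(S :: nat set) t. \<Sum>(S \<inter> {..<t}))"
  have w0: "w S 0 = 0" for S by (simp add: w_def)
  have wS: "w S (Suc t) = w S t + (if t \<in> S then t else 0)" for S :: "nat set" and t
  proof -
    have "S \<inter> {..<Suc t} = (if t \<in> S then insert t (S \<inter> {..<t}) else S \<inter> {..<t})"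
      by (auto simp: less_Suc_eq)
    then show ?thesis by (simp add: w_def)
  qed
  have wall: "w S m = \<Sum>S" if "S \<subseteq> {..<m}" for S m using that by (simp add: w_def Int_absorb2)
  have 1: "w ?D t = w S t" if "t \<le> n" "t \<le> j" for t
    using that by (induction t) (auto simp: w0 wS delete_step_def)
  show ?thesis
  proof (cases "j = Suc n")
    case True
    then have n: "n \<in> S" using j by (simp add: merged_def)
    have "\<Sum>S = w S n + n" using wall[OF S(1)] wS[of S n] n by simp
    moreover have "\<Sum>?D = w S n" using 1[of n] wall[OF delete_step_subset[of n j S]] True by simp
    moreover have "cnt S j = Suc p" using cnt_eq_card[OF S(1)] S(2) True by simp
    ultimately show ?thesis using True by simp
  next
    case False
    then have jS: "j \<in> S" "j \<le> n" using j by (auto simp: merged_def)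
    have 2: "w S (Suc t) + cnt S (Suc j) = w ?D t + j + cnt S (Suc t)" if "j \<le> t" "t \<le> n" for t
      using that
    proof (induction t rule: dec_induct)
      case base
      then show ?case using jS 1[of j] by (simp add: wS)
    next
      case (step t)
      have "t \<in> ?D \<longleftrightarrow> Suc t \<in> S" using step.hyps step.prems by (auto simp: delete_step_def)
      then show ?case using step by (simp add: wS cnt_Suc[of S "Suc t"])
    qed
    have "\<Sum>S + cnt S (Suc j) = \<Sum>?D + j + Suc p"
      using 2[of n] jS(2) wall[OF S(1)] wall[OF delete_step_subset[of n j S]] cnt_eq_card[OF S(1)] S(2) by simp
    then show ?thesis using jS(1) by (simp add: cnt_Suc)
  qed
qed

text \<open>The sign comparison for the Leibniz rule: the sign of the shuffle times that of its \<open>j\<close>-th face equals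
the sign of the shortened shuffle times that of the face \<open>cnt S j\<close> of the first factor.\<close>

lemma crossings_delete_step:
  assumes S: "S \<in> shuffle_sets (Suc n) (Suc p)" and j: "j \<le> Suc n" "merged (Suc n) j S"
  shows "crossings S ({..<Suc n} - S) + cnt S j = crossings (delete_step n j S) ({..<n} - delete_step n j S) + j"
proof -
  note S' = shuffle_setsD[OF S]
  have "card (delete_step n j S) = p" by (rule card_delete_step_merged[OF S'(1,2) j])
  then show ?thesis
    using crossings_compl_sum[OF S'(1)] crossings_compl_sum[OF delete_step_subset[of n j S]]
      sum_delete_step[OF S'(1,2) j] S'(2) by simp
qed

lemma compl_delete_step:
  "{..<n} - delete_step n j S = delete_step n j ({..<Suc n} - S)"
  by (auto simp: delete_step_def)

lemma ex_cnt_eq: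
  assumes "a \<le> cnt S n"
  shows "\<exists>j\<le>n. cnt S j = a \<and> (j = 0 \<or> j - 1 \<in> S)"
proof -
  define j where "j = (LEAST j. a \<le> cnt S j)"
  have le: "a \<le> cnt S j" "j \<le> n"
    using assms LeastI[of "\<lambda>j. a \<le> cnt S j" n] Least_le[of "\<lambda>j. a \<le> cnt S j" n] by (auto simp: j_def)
  show ?thesis
  proof (cases j)
    case 0
    then show ?thesis using le by auto
  next
    case (Suc i)
    then have "\<not> a \<le> cnt S i" using not_less_Least[of i "\<lambda>j. a \<le> cnt S j"] by (auto simp: j_def)
    then have "i \<in> S \<and> cnt S j = a" using le Suc by (cases "i \<in> S") (auto simp: cnt_Suc)
    then show ?thesis using Suc le by auto
  qed
qed

text \<open>A straight vertex of a path with \<open>Suc n\<close> steps corresponds to a path with \<open>n\<close> steps and a vertex \<open>a\<close> on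
the first axis: removing the vertex remembers its first coordinate. Conversely, among the vertices of
the short path with first coordinate \<open>a\<close> the first one is the only place where a new step can be inserted
such that the step before it has the first direction as well; for \<open>a = Suc p\<close>, which the short path
does not reach, the new step is appended at the end.\<close>

lemma merged_bij:
  "bij_betw (\<lambda>(S, j). (delete_step n j S, cnt S j))
     {(S, j). S \<in> shuffle_sets (Suc n) (Suc p) \<and> j \<le> Suc n \<and> merged (Suc n) j S}
     (shuffle_sets n p \<times> {..Suc p})" (is "bij_betw ?g ?I ?J")
proof (rule bij_betw_imageI)
  have cntD: "cnt (delete_step n j S) j = cnt S j" if "j \<le> n" for S j
    using cnt_delete_step(1)[OF that] by simp
  have last: "cnt S j = Suc p \<longleftrightarrow> j = Suc n"
    if "S \<in> shuffle_sets (Suc n) (Suc p)" "j \<le> Suc n" "merged (Suc n) j S" for S j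
  proof
    note S = shuffle_setsD[OF that(1)]
    show "cnt S j = Suc p" if "j = Suc n" using cnt_eq_card[OF S(1)] S(2) that by simp
    show "j = Suc n" if c: "cnt S j = Suc p"
    proof (rule ccontr)
      assume "j \<noteq> Suc n"
      then have "j \<in> S" "j < Suc n" using \<open>merged (Suc n) j S\<close> \<open>j \<le> Suc n\<close> by (auto simp: merged_def)
      then have "cnt S j < cnt S (Suc n)" by (rule cnt_less)
      then show False using c cnt_eq_card[OF S(1)] S(2) by simp
    qed
  qed
  show "inj_on ?g ?I"
  proof (rule inj_onI, clarify)
    fix S j S' j'
    assume S: "S \<in> shuffle_sets (Suc n) (Suc p)" "j \<le> Suc n" "merged (Suc n) j S"
      and S': "S' \<in> shuffle_sets (Suc n) (Suc p)" "j' \<le> Suc n" "merged (Suc n) j' S'"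
      and D: "delete_step n j S = delete_step n j' S'" and c: "cnt S j = cnt S' j'"
    \<comment> \<open>Suppose \<open>j < j'\<close>. The step before \<open>j'\<close> survives in the common shortened path and has the first
      direction, so the first coordinate at \<open>j'\<close> exceeds that at \<open>j\<close>.\<close>
    have no_less: False
      if "j < j'" "j' \<le> n" "merged (Suc n) j' S'" "delete_step n j S = delete_step n j' S'" "cnt S j = cnt S' j'"
      for S j S' j'
    proof -
      have "j' - 1 \<in> delete_step n j' S'" using that(1,2,3) by (auto simp: merged_def delete_step_def)
      from cnt_less[OF this, of j'] have "cnt (delete_step n j' S') (j' - 1) < cnt (delete_step n j' S') j'"
        using that(1) by simp
      moreover have "cnt (delete_step n j' S') j \<le> cnt (delete_step n j' S') (j' - 1)"
        by (rule cnt_mono) (use that(1) in simp)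
      ultimately show False using that(1,2,4,5) cntD[of j S] cntD[of j' S'] by simp
    qed
    have "j = Suc n \<longleftrightarrow> j' = Suc n" using last[OF S] last[OF S'] c by simp
    then have jj: "j = j'"
      using no_less[of j j' S' S] no_less[of j' j S S'] S S' D c by (metis le_SucE linorder_neqE_nat)
    have "t \<in> S \<longleftrightarrow> t \<in> S'" for t
    proof -
      have d: "u \<in> delete_step n j S \<longleftrightarrow> u \<in> delete_step n j S'" for u using D jj by simp
      show ?thesis
      proof (cases "t < Suc n")
        case True
        consider "t < j" "t < n" | "t = j \<or> t = n \<and> j = Suc n" | "t > j" using True S(2) by linarith
        then show ?thesis
        proof cases
          case 1
          then show ?thesis using d[of t] by (simp add: delete_step_def)
        next
          case 2
          then show ?thesis using S(3) S'(3) jj True by (auto simp: merged_def)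
        next
          case 3
          then obtain u where "t = Suc u" by (cases t) auto
          then show ?thesis using 3 d[of u] True by (simp add: delete_step_def)
        qed
      next
        case False
        then show ?thesis using shuffle_setsD(1)[OF S(1)] shuffle_setsD(1)[OF S'(1)] by blast
      qed
    qed
    then show "S = S' \<and> j = j'" using jj by blast
  qed
  show "?g ` ?I = ?J"
  proof
    show "?g ` ?I \<subseteq> ?J"
    proof clarify
      fix S j assume *: "S \<in> shuffle_sets (Suc n) (Suc p)" "j \<le> Suc n" "merged (Suc n) j S"
      note S = shuffle_setsD[OF *(1)]
      show "delete_step n j S \<in> shuffle_sets n p \<and> cnt S j \<in> {..Suc p}"
        using card_delete_step_merged[OF S(1,2) *(2,3)] delete_step_subset ord_map_cnt[OF S(1,2)] *(2)
        by (simp add: shuffle_sets_def ord_map_def)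
    qed
    show "?J \<subseteq> ?g ` ?I"
    proof (rule subsetI, erule SigmaE)
      fix u D a assume D: "D \<in> shuffle_sets n p" and a: "a \<in> {..Suc p}" and u: "u = (D, a)"
      note D' = shuffle_setsD[OF D]
      obtain S j where "S \<in> shuffle_sets (Suc n) (Suc p)" "j \<le> Suc n" "merged (Suc n) j S"
        "delete_step n j S = D" "cnt S j = a"
      proof (cases "a = Suc p")
        case True
        have nD: "n \<notin> D" using D' by auto
        show thesis
        proof (rule that[of "insert n D" "Suc n"])
          show "insert n D \<in> shuffle_sets (Suc n) (Suc p)" using D' nD by (auto simp: shuffle_sets_def)
          then show "cnt (insert n D) (Suc n) = a" using cnt_eq_card[of "insert n D" "Suc n"] True
            by (simp add: shuffle_sets_def)
          show "delete_step n (Suc n) (insert n D) = D" using D' by (auto simp: delete_step_def)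
        qed (auto simp: merged_def)
      next
        case False
        then have "a \<le> cnt D n" using a cnt_eq_card[OF D'(1)] D'(2) by simp
        then obtain j where j: "j \<le> n" "cnt D j = a" "j = 0 \<or> j - 1 \<in> D" using ex_cnt_eq by blast
        \<comment> \<open>Insert the new step at \<open>j\<close> and shift the later ones.\<close>
        define S where "S = insert j (D \<inter> {..<j} \<union> Suc ` (D - {..<j}))"
        have mem: "t \<in> S \<longleftrightarrow> t = j \<or> (t < j \<and> t \<in> D) \<or> (t > j \<and> t - 1 \<in> D)" for t
          unfolding S_def by (cases t) auto
        have "card (D \<inter> {..<j} \<union> Suc ` (D - {..<j})) = card (D \<inter> {..<j}) + card (D - {..<j})"
          using D'(3) by (subst card_Un_disjoint) (auto simp: card_image)
        also have "\<dots> = p" using card_Int_Diff[OF D'(3), of "{..<j}"] D'(2) by simp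
        finally have "card S = Suc p" unfolding S_def using D'(3) by (subst card_insert_disjoint) auto
        moreover have "S \<subseteq> {..<Suc n}"
        proof
          fix t assume "t \<in> S"
          then show "t \<in> {..<Suc n}" using mem[of t] j(1) D'(1) by (auto simp: subset_iff)
        qed
        ultimately have S: "S \<in> shuffle_sets (Suc n) (Suc p)" by (simp add: shuffle_sets_def)
        have del: "delete_step n j S = D"
          using D'(1) by (auto simp: delete_step_def mem)
        have "merged (Suc n) j S" using j(1,3) by (auto simp: merged_def mem)
        moreover have "cnt S j = a" using cntD[OF j(1), of S] del j(2) by simp
        ultimately show thesis using that[OF S _ _ del] j(1) by simp
      qed
      then show "u \<in> ?g ` ?I" unfolding u by (intro image_eqI[of _ _ "(S, j)"]) auto
    qed
  qed
qed

context abelian_group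
begin

lemma finsum_uminus:
  assumes "\<And>i. i \<in> I \<Longrightarrow> f i \<in> carrier G"
  shows "(\<Oplus>i\<in>I. \<ominus> f i) = \<ominus> (\<Oplus>i\<in>I. f i)"
proof (cases "finite I")
  have zero: "\<ominus> \<zero> = \<zero>" using minus_equality[of \<zero> \<zero>] by simp
  case True
  then show ?thesis using assms
    by (induction I) (auto simp: Pi_iff minus_add zero)
next
  have zero: "\<ominus> \<zero> = \<zero>" using minus_equality[of \<zero> \<zero>] by simp
  case False
  then show ?thesis by (simp add: zero)
qed

lemma finsum_Sigma:
  assumes "finite A" "\<And>a. a \<in> A \<Longrightarrow> finite (B a)"
    and f: "\<And>a b. a \<in> A \<Longrightarrow> b \<in> B a \<Longrightarrow> f a b \<in> carrier G"
  shows "(\<Oplus>a\<in>A. \<Oplus>b\<in>B a. f a b) = (\<Oplus>u\<in>Sigma A B. f (fst u) (snd u))"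
  using assms
proof (induction A)
  case (insert a A)
  have inj: "inj_on (Pair a) (B a)" by (rule inj_onI) simp
  have split: "Sigma (insert a A) B = Pair a ` B a \<union> Sigma A B" by auto
  have "(\<Oplus>u\<in>Sigma (insert a A) B. f (fst u) (snd u))
      = (\<Oplus>u\<in>Pair a ` B a. f (fst u) (snd u)) \<oplus> (\<Oplus>u\<in>Sigma A B. f (fst u) (snd u))"
    unfolding split using insert by (intro finsum_Un_disjoint finite_imageI finite_SigmaI) auto
  also have "(\<Oplus>u\<in>Pair a ` B a. f (fst u) (snd u)) = (\<Oplus>b\<in>B a. f a b)"
    using insert inj by (subst finsum_reindex) auto
  finally show ?case using insert by (subst finsum_insert) auto
qed simp

text \<open>Cancellation along a sign-reversing bijection between two parts of the index set. It serves for
the corners of lattice paths, the inner faces of prisms and the square of the boundary.\<close>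

lemma finsum_cancel:
  assumes fin: "finite I" and disj: "I \<inter> J = {}" and bij: "bij_betw h I J"
    and f: "\<And>i. i \<in> I \<union> J \<Longrightarrow> f i \<in> carrier G" and neg: "\<And>i. i \<in> I \<Longrightarrow> f (h i) = \<ominus> f i"
  shows "(\<Oplus>i\<in>I \<union> J. f i) = \<zero>"
proof -
  have J: "J = h ` I" "inj_on h I" using bij by (auto simp: bij_betw_def)
  have "(\<Oplus>i\<in>I \<union> J. f i) = (\<Oplus>i\<in>I. f i) \<oplus> (\<Oplus>i\<in>J. f i)"
    using fin disj f J by (intro finsum_Un_disjoint) auto
  also have "(\<Oplus>i\<in>J. f i) = (\<Oplus>i\<in>I. f (h i))"
    unfolding J(1) using f J by (intro finsum_reindex) auto
  also have "\<dots> = (\<Oplus>i\<in>I. \<ominus> f i)" using neg f by (intro finsum_cong') auto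
  also have "\<dots> = \<ominus> (\<Oplus>i\<in>I. f i)" using f by (intro finsum_uminus) auto
  finally show ?thesis using f by (simp add: r_neg Pi_iff)
qed

lemma finsum_bij:
  assumes bij: "bij_betw h I J" and f: "\<And>i. i \<in> J \<Longrightarrow> f i \<in> carrier G"
    and eq: "\<And>i. i \<in> I \<Longrightarrow> g i = f (h i)"
  shows "(\<Oplus>i\<in>I. g i) = (\<Oplus>i\<in>J. f i)"
proof -
  have J: "J = h ` I" "inj_on h I" using bij by (auto simp: bij_betw_def)
  have "(\<Oplus>i\<in>J. f i) = (\<Oplus>i\<in>I. f (h i))"
    unfolding J(1) using f J by (intro finsum_reindex) auto
  also have "\<dots> = (\<Oplus>i\<in>I. g i)" using eq f J by (intro finsum_cong') auto
  finally show ?thesis ..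
qed

end

context module
begin

lemma alt_sign_closed [simp]: "x \<in> carrier M \<Longrightarrow> alt_sign M n x \<in> carrier M"
  by (simp add: alt_sign_def)

lemma alt_sign_alt_sign: "x \<in> carrier M \<Longrightarrow> alt_sign M m (alt_sign M n x) = alt_sign M (m + n) x"
  by (simp add: alt_sign_def)

lemma alt_sign_Suc: "x \<in> carrier M \<Longrightarrow> alt_sign M (Suc n) x = \<ominus>\<^bsub>M\<^esub> alt_sign M n x"
  by (simp add: alt_sign_def)

lemma alt_sign_parity: "even m = even n \<Longrightarrow> alt_sign M m x = alt_sign M n x"
  by (simp add: alt_sign_def)

lemma alt_sign_zero [simp]: "alt_sign M n \<zero>\<^bsub>M\<^esub> = \<zero>\<^bsub>M\<^esub>"
  by (simp add: alt_sign_def)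

lemma alt_sign_finsum:
  assumes "\<And>i. i \<in> I \<Longrightarrow> f i \<in> carrier M"
  shows "alt_sign M n (\<Oplus>\<^bsub>M\<^esub>i\<in>I. f i) = (\<Oplus>\<^bsub>M\<^esub>i\<in>I. alt_sign M n (f i))"
  using M.finsum_uminus[of I f] assms by (simp add: alt_sign_def)

lemma alt_sign_finsum_alt_sign:
  assumes "\<And>i. i \<in> I \<Longrightarrow> f i \<in> carrier M"
  shows "alt_sign M m (\<Oplus>\<^bsub>M\<^esub>i\<in>I. alt_sign M (g i) (f i)) = (\<Oplus>\<^bsub>M\<^esub>i\<in>I. alt_sign M (m + g i) (f i))"
  using assms
  by (subst alt_sign_finsum) (auto intro!: M.finsum_cong' simp: alt_sign_alt_sign)

end

lemma hom_alt_sign: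
  "h \<in> module_hom k M N \<Longrightarrow> module k M \<Longrightarrow> module k N \<Longrightarrow> x \<in> carrier M \<Longrightarrow>
   h (alt_sign M n x) = alt_sign N n (h x)"
  by (simp add: alt_sign_def module_hom_neg)

section \<open>The shuffle product is a chain map\<close>

text \<open>Shuffles of the steps in \<open>T\<close> and subsets of \<open>T\<close> of the same size correspond by renumbering; this turns
a shuffle of shuffles into an ordered partition into three sets.\<close>

lemma cnt_image_bij:
  assumes T: "T \<in> shuffle_sets n m"
  shows "bij_betw ((`) (cnt T)) {R. R \<subseteq> T \<and> card R = p} (shuffle_sets m p)"
proof (rule bij_betw_imageI)
  show "inj_on ((`) (cnt T)) {R. R \<subseteq> T \<and> card R = p}"
    by (rule inj_onI) (use inj_on_image_eq_iff[OF inj_on_cnt[of T]] in auto)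
  have "cnt T ` T = {..<m}" using cnt_image_shuffle(2)[OF T, of "{}"] by auto
  show "(`) (cnt T) ` {R. R \<subseteq> T \<and> card R = p} = shuffle_sets m p"
  proof
    show "(`) (cnt T) ` {R. R \<subseteq> T \<and> card R = p} \<subseteq> shuffle_sets m p"
      using cnt_image_shuffle(1)[OF T] by auto
    show "shuffle_sets m p \<subseteq> (`) (cnt T) ` {R. R \<subseteq> T \<and> card R = p}"
    proof
      fix S assume S: "S \<in> shuffle_sets m p"
      define R where "R = {t \<in> T. cnt T t \<in> S}"
      have "cnt T ` R = S"
        using shuffle_setsD(1)[OF S] \<open>cnt T ` T = {..<m}\<close> by (auto simp: R_def)
      moreover have "R \<subseteq> T" by (auto simp: R_def)
      moreover have "card R = p"
        using card_image[OF inj_on_subset[OF inj_on_cnt \<open>R \<subseteq> T\<close>]] \<open>cnt T ` R = S\<close> shuffle_setsD(2)[OF S] by simp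
      ultimately show "S \<in> (`) (cnt T) ` {R. R \<subseteq> T \<and> card R = p}" by blast
    qed
  qed
qed

text \<open>Replacing a corner of the path by the opposite corner moves only the vertex \<open>j\<close> and creates one
inversion.\<close>

lemma swap_step:
  assumes S: "S \<in> shuffle_sets (Suc n) p" and j: "0 < j" "j \<le> n" "j - 1 \<in> S" "j \<notin> S"
  defines "S' \<equiv> insert j (S - {j - 1})"
  shows "S' \<in> shuffle_sets (Suc n) p" and "{..<Suc n} - S' = insert (j - 1) ({..<Suc n} - S - {j})"
    and "t \<noteq> j \<Longrightarrow> cnt S t = cnt S' t"
    and "crossings S' ({..<Suc n} - S') = Suc (crossings S ({..<Suc n} - S))"
proof -
  note S_ = shuffle_setsD[OF S]
  have jj: "j - 1 \<noteq> j" using j(1) by simp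
  have card: "card S' = card S"
    using card.remove[OF S_(3) j(3)] S_(3) j(4) unfolding S'_def by (subst card_insert_disjoint) auto
  show S': "S' \<in> shuffle_sets (Suc n) p"
    using S_ card j(2) by (auto simp: shuffle_sets_def S'_def)
  show "{..<Suc n} - S' = insert (j - 1) ({..<Suc n} - S - {j})"
    using j by (auto simp: S'_def)
  show "cnt S t = cnt S' t" if "t \<noteq> j"
  proof (cases "t < j")
    case True
    then have "S \<inter> {..<t} = S' \<inter> {..<t}" by (auto simp: S'_def)
    then show ?thesis by (simp add: cnt_def)
  next
    case False
    then have eq: "S' \<inter> {..<t} = insert j (S \<inter> {..<t} - {j - 1})" using that by (auto simp: S'_def)
    have "j - 1 \<in> S \<inter> {..<t}" using False j(3) that by simp
    then have "card (S \<inter> {..<t}) = Suc (card (S \<inter> {..<t} - {j - 1}))" by (intro card.remove) auto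
    then show ?thesis unfolding cnt_def eq using j(4) by simp
  qed
  have "\<Sum>S' = j + \<Sum>(S - {j - 1})" using S_(3) j(4) by (simp add: S'_def)
  moreover have "\<Sum>S = (j - 1) + \<Sum>(S - {j - 1})" using S_(3) j(3) by (rule sum.remove)
  ultimately have "\<Sum>S' = Suc (\<Sum>S)" using j(1) by simp
  then show "crossings S' ({..<Suc n} - S') = Suc (crossings S ({..<Suc n} - S))"
    using crossings_compl_sum[OF S_(1)] crossings_compl_sum[OF shuffle_setsD(1)[OF S']] card by simp
qed

text \<open>The Eilenberg-Zilber shuffle sum followed by an arbitrary bilinear map \<open>b\<close>. Besides \<open>ca_mult\<close>, it
is needed for the opposite of \<open>ca_mult\<close> and for the homotopy between the two, which takes values one
degree higher.\<close>

definition shuffle_sum ::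
  "('k, 'r) ring_scheme \<Rightarrow> ('k, 'a, 's) module_scheme \<Rightarrow> ('k, 'm, 't) module_scheme \<Rightarrow>
   ((arrow list \<times> ('a list \<Rightarrow> 'k) set \<Rightarrow> 'k) set \<Rightarrow> (arrow list \<times> ('a list \<Rightarrow> 'k) set \<Rightarrow> 'k) set \<Rightarrow> 'm) \<Rightarrow>
   nat \<Rightarrow> nat \<Rightarrow> (arrow list \<times> ('a list \<Rightarrow> 'k) set \<Rightarrow> 'k) set \<Rightarrow> (arrow list \<times> ('a list \<Rightarrow> 'k) set \<Rightarrow> 'k) set \<Rightarrow> 'm" where
  "shuffle_sum k A M b p q x y =
     (\<Oplus>\<^bsub>M\<^esub>S\<in>shuffle_sets (p + q) p. alt_sign M (crossings S ({..<p + q} - S))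
        (b (ca_spread k A p (p + q) S x) (ca_spread k A q (p + q) ({..<p + q} - S) y)))"

context assoc_algebra
begin

interpretation C: module k "CA k A n" for n by (rule module_CA)

lemma spread_shuffle_hom:
  "S \<in> shuffle_sets n p \<Longrightarrow> ca_spread k A p n S \<in> module_hom k (CA k A p) (CA k A n)"
  by (rule ca_spread_hom[OF shuffle_setsD(1,2)])

lemma spread_shuffle_closed:
  "S \<in> shuffle_sets n p \<Longrightarrow> x \<in> carrier (CA k A p) \<Longrightarrow> ca_spread k A p n S x \<in> carrier (CA k A n)"
  by (rule module_homD(1)[OF spread_shuffle_hom])

lemma compl_spread_hom:
  "S \<in> shuffle_sets (p + q) p \<Longrightarrow>
   ca_spread k A q (p + q) ({..<p + q} - S) \<in> module_hom k (CA k A q) (CA k A (p + q))"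
  by (rule spread_shuffle_hom[OF compl_shuffle_sets])

lemma shuffle_sum_bilinear:
  assumes M: "module k M" and b: "module_bilinear k (CA k A (p + q)) (CA k A (p + q)) M b"
  shows "module_bilinear k (CA k A p) (CA k A q) M (shuffle_sum k A M b p q)"
  unfolding shuffle_sum_def[abs_def]
  by (intro module_bilinear_sum[OF module_CA module_CA M] module_bilinear_alt_sign[OF M]
      module_bilinear_comp_homs[OF b] spread_shuffle_hom compl_spread_hom)

lemma shuffle_sum_closed:
  "module k M \<Longrightarrow> module_bilinear k (CA k A (p + q)) (CA k A (p + q)) M b \<Longrightarrow>
   x \<in> carrier (CA k A p) \<Longrightarrow> y \<in> carrier (CA k A q) \<Longrightarrow> shuffle_sum k A M b p q x y \<in> carrier M"
  by (rule bilinear_closed[OF shuffle_sum_bilinear])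

lemma ca_shuffle_mult_eq:
  assumes x: "x \<in> carrier (CA k A p)" and y: "y \<in> carrier (CA k A q)"
  shows "ca_shuffle_mult k A p q x y = shuffle_sum k A (CA k A (p + q)) (ca_mult k A (p + q)) p q x y"
  unfolding ca_shuffle_mult_def shuffle_sum_def shuffle_sets_def[symmetric]
proof (rule C.M.finsum_cong'[OF refl])
  fix S assume S: "S \<in> shuffle_sets (p + q) p"
  have "{..<p + q} - ({..<p + q} - S) = S" using shuffle_setsD(1)[OF S] by auto
  then show "alt_sign (CA k A (p + q)) (card {(m, n). m \<in> S \<and> n \<in> {..<p + q} - S \<and> n < m})
          (ca_mult k A (p + q) (ca_degens k A p (sorted_list_of_set ({..<p + q} - S)) x)
            (ca_degens k A q (sorted_list_of_set S) y))
      = alt_sign (CA k A (p + q)) (crossings S ({..<p + q} - S))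
          (ca_mult k A (p + q) (ca_spread k A p (p + q) S x) (ca_spread k A q (p + q) ({..<p + q} - S) y))"
    using inversions_crossings[OF shuffle_setsD(3)[OF S], of "p + q"] by (simp add: ca_spread_def)
qed (use x y in \<open>auto intro!: C.alt_sign_closed ca_mult_closed spread_shuffle_closed compl_shuffle_sets\<close>)

text \<open>Reindex by complements; the inversions of a shuffle and of its flip add up to \<open>p * q\<close>.\<close>

lemma shuffle_sum_flip:
  assumes M: "module k M" and b: "module_bilinear k (CA k A (p + q)) (CA k A (p + q)) M b"
    and x: "x \<in> carrier (CA k A p)" and y: "y \<in> carrier (CA k A q)"
  shows "shuffle_sum k A M (\<lambda>u v. b v u) q p y x = alt_sign M (p * q) (shuffle_sum k A M b p q x y)"
proof -
  interpret M: module k M by fact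
  let ?n = "p + q"
  have cl: "b (ca_spread k A p ?n S x) (ca_spread k A q ?n ({..<?n} - S) y) \<in> carrier M"
    if "S \<in> shuffle_sets ?n p" for S
    using bilinear_closed[OF b] spread_shuffle_closed[OF that x] spread_shuffle_closed[OF compl_shuffle_sets[OF that] y]
    by blast
  have "alt_sign M (p * q) (shuffle_sum k A M b p q x y)
      = (\<Oplus>\<^bsub>M\<^esub>S\<in>shuffle_sets ?n p. alt_sign M (p * q + crossings S ({..<?n} - S))
        (b (ca_spread k A p ?n S x) (ca_spread k A q ?n ({..<?n} - S) y)))"
    unfolding shuffle_sum_def using cl
    by (subst M.alt_sign_finsum) (auto intro!: M.M.finsum_cong' simp: M.alt_sign_alt_sign)
  also have "\<dots> = (\<Oplus>\<^bsub>M\<^esub>S\<in>shuffle_sets ?n q. alt_sign M (crossings S ({..<?n} - S))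
        (b (ca_spread k A p ?n ({..<?n} - S) x) (ca_spread k A q ?n S y)))"
  proof (rule M.M.finsum_bij[OF shuffle_sets_compl_bij])
    show "alt_sign M (crossings S ({..<?n} - S)) (b (ca_spread k A p ?n ({..<?n} - S) x) (ca_spread k A q ?n S y))
        \<in> carrier M" if "S \<in> shuffle_sets ?n q" for S
      using that x y compl_shuffle_sets[of S q p] bilinear_closed[OF b]
      by (intro M.alt_sign_closed bilinear_closed[OF b] spread_shuffle_closed) (simp_all add: add.commute)
    fix S assume S: "S \<in> shuffle_sets ?n p"
    have dd: "{..<?n} - ({..<?n} - S) = S" using shuffle_setsD(1)[OF S] by auto
    have "even (p * q + crossings S ({..<?n} - S)) = even (crossings ({..<?n} - S) S)"
      unfolding crossings_flip[OF S, symmetric] by auto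
    then show "alt_sign M (p * q + crossings S ({..<?n} - S)) (b (ca_spread k A p ?n S x) (ca_spread k A q ?n ({..<?n} - S) y))
        = alt_sign M (crossings ({..<?n} - S) ({..<?n} - ({..<?n} - S)))
            (b (ca_spread k A p ?n ({..<?n} - ({..<?n} - S)) x) (ca_spread k A q ?n ({..<?n} - S) y))"
      unfolding dd by (rule M.alt_sign_parity)
  qed
  finally show ?thesis by (simp add: shuffle_sum_def add.commute[of q p])
qed

lemma ca_boundary_hom: "ca_boundary k A (Suc n) \<in> module_hom k (CA k A (Suc n)) (CA k A n)"
  unfolding ca_boundary_def[abs_def] diff_Suc_1
  by (intro module_hom_sum[OF module_CA module_CA] module_hom_comp[OF alt_sign_hom[OF module_CA]] ca_face_hom)

lemma ca_boundary_eq: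
  "ca_boundary k A (Suc n) x = (\<Oplus>\<^bsub>CA k A n\<^esub>j\<in>{..Suc n}. alt_sign (CA k A n) j (ca_face k A (Suc n) j x))"
  by (simp add: ca_boundary_def)

lemma hom_boundary:
  assumes M: "module k M" and h: "h \<in> module_hom k (CA k A n) M" and x: "x \<in> carrier (CA k A (Suc n))"
  shows "h (ca_boundary k A (Suc n) x) = (\<Oplus>\<^bsub>M\<^esub>j\<in>{..Suc n}. alt_sign M j (h (ca_face k A (Suc n) j x)))"
proof -
  interpret M: module k M by fact
  have f: "ca_face k A (Suc n) j x \<in> carrier (CA k A n)" for j by (rule module_homD(1)[OF ca_face_hom x])
  have "h (ca_boundary k A (Suc n) x)
      = (\<Oplus>\<^bsub>M\<^esub>j\<in>{..Suc n}. h (alt_sign (CA k A n) j (ca_face k A (Suc n) j x)))"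
    unfolding ca_boundary_eq by (rule module_hom_finsum[OF h module_CA M]) (simp add: f)
  also have "\<dots> = (\<Oplus>\<^bsub>M\<^esub>j\<in>{..Suc n}. alt_sign M j (h (ca_face k A (Suc n) j x)))"
    using f module_homD(1)[OF h]
    by (intro M.M.finsum_cong') (auto simp: hom_alt_sign[OF h module_CA M])
  finally show ?thesis .
qed

text \<open>The usual argument: by the simplicial identity for faces, the term for \<open>i < j\<close> cancels
against that for \<open>(j - 1, i)\<close>.\<close>

lemma ca_boundary_boundary:
  assumes x: "x \<in> carrier (CA k A (Suc (Suc n)))"
  shows "ca_boundary k A (Suc n) (ca_boundary k A (Suc (Suc n)) x) = \<zero>\<^bsub>CA k A n\<^esub>"
proof -
  let ?f = "\<lambda>i j. ca_face k A (Suc n) i (ca_face k A (Suc (Suc n)) j x)"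
  let ?t = "\<lambda>u. alt_sign (CA k A n) (snd u + fst u) (?f (fst u) (snd u))"
  have f: "?f i j \<in> carrier (CA k A n)" for i j
    by (rule module_homD(1)[OF ca_face_hom module_homD(1)[OF ca_face_hom x]])
  let ?I = "{(i, j). i < j \<and> j \<le> Suc (Suc n)}" and ?J = "{(i, j). j \<le> i \<and> i \<le> Suc n}"
  have fin: "finite ?I" by (rule finite_subset[of _ "{..Suc (Suc n)} \<times> {..Suc (Suc n)}"]) auto
  have IJ: "{..Suc (Suc n)} \<times> {..Suc n} = (\<lambda>(i, j). (j, i)) ` (?I \<union> ?J)"
  proof
    show "{..Suc (Suc n)} \<times> {..Suc n} \<subseteq> (\<lambda>(i, j). (j, i)) ` (?I \<union> ?J)"
    proof (rule subsetI, erule SigmaE)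
      fix u j i assume "j \<in> {..Suc (Suc n)}" "i \<in> {..Suc n}" and u: "u = (j, i)"
      then have "(i, j) \<in> ?I \<union> ?J" by auto
      then show "u \<in> (\<lambda>(i, j). (j, i)) ` (?I \<union> ?J)"
        unfolding u by (rule rev_image_eqI) simp
    qed
  qed auto
  have "ca_boundary k A (Suc n) (ca_boundary k A (Suc (Suc n)) x)
      = (\<Oplus>\<^bsub>CA k A n\<^esub>j\<in>{..Suc (Suc n)}. alt_sign (CA k A n) j
          (ca_boundary k A (Suc n) (ca_face k A (Suc (Suc n)) j x)))"
    by (rule hom_boundary[OF module_CA ca_boundary_hom x])
  also have "\<dots> = (\<Oplus>\<^bsub>CA k A n\<^esub>j\<in>{..Suc (Suc n)}. \<Oplus>\<^bsub>CA k A n\<^esub>i\<in>{..Suc n}. alt_sign (CA k A n) (j + i) (?f i j))"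
    unfolding ca_boundary_eq[of n] using f
    by (intro C.M.finsum_cong' refl C.alt_sign_finsum_alt_sign) (simp_all add: Pi_iff)
  also have "\<dots> = (\<Oplus>\<^bsub>CA k A n\<^esub>u\<in>{..Suc (Suc n)} \<times> {..Suc n}. alt_sign (CA k A n) (fst u + snd u) (?f (snd u) (fst u)))"
    by (rule C.M.finsum_Sigma) (auto simp: f)
  also have "\<dots> = (\<Oplus>\<^bsub>CA k A n\<^esub>u\<in>?I \<union> ?J. ?t u)"
    unfolding IJ using f by (subst C.M.finsum_reindex) (auto simp: inj_on_def case_prod_unfold)
  also have "\<dots> = \<zero>\<^bsub>CA k A n\<^esub>"
  proof (rule C.M.finsum_cancel[OF fin])
    show "?I \<inter> ?J = {}" by auto
    show "bij_betw (\<lambda>(i, j). (j - 1, i)) ?I ?J"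
      by (rule bij_betw_byWitness[where f' = "\<lambda>(i, j). (j, Suc i)"]) auto
    show "?t u \<in> carrier (CA k A n)" for u using f by simp
    fix u assume "u \<in> ?I"
    then obtain i j where u: "u = (i, Suc j)" "i \<le> j" "j \<le> Suc n" by (cases u; cases "snd u") auto
    have "?f j i = ?f i (Suc j)" using ca_face_face[OF x u(2,3)] by simp
    then show "?t (case u of (i, j) \<Rightarrow> (j - 1, i)) = \<ominus>\<^bsub>CA k A n\<^esub> ?t u"
      using f by (simp add: u C.alt_sign_Suc add.commute)
  qed
  finally show ?thesis .
qed

text \<open>The part of the Leibniz rule in which \<open>x\<close> loses a step: at a vertex between two
steps of the first direction, the face acts on \<open>x\<close> as the face \<open>cnt S j\<close> and cancels a degeneracy of \<open>y\<close>. By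
\<open>merged_bij\<close> these terms are in bijection with the terms of the shuffle sum of the boundary of \<open>x\<close>,
and by \<open>crossings_delete_step\<close> the signs agree.\<close>

lemma merged_part:
  fixes p q
  defines "n \<equiv> p + q"
  assumes M: "module k M" and b: "module_bilinear k (CA k A n) (CA k A n) M b"
    and x: "x \<in> carrier (CA k A (Suc p))" and y: "y \<in> carrier (CA k A q)"
  shows "(\<Oplus>\<^bsub>M\<^esub>u\<in>{(S, j). S \<in> shuffle_sets (Suc n) (Suc p) \<and> j \<le> Suc n \<and> merged (Suc n) j S}.
      alt_sign M (crossings (fst u) ({..<Suc n} - fst u) + snd u)
        (b (ca_face k A (Suc n) (snd u) (ca_spread k A (Suc p) (Suc n) (fst u) x))
           (ca_face k A (Suc n) (snd u) (ca_spread k A q (Suc n) ({..<Suc n} - fst u) y))))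
    = shuffle_sum k A M b p q (ca_boundary k A (Suc p) x) y"
proof -
  interpret M: module k M by fact
  let ?t = "\<lambda>S a. alt_sign M (crossings S ({..<n} - S) + a)
      (b (ca_spread k A p n S (ca_face k A (Suc p) a x)) (ca_spread k A q n ({..<n} - S) y))"
  have cy: "ca_spread k A q n ({..<n} - S) y \<in> carrier (CA k A n)" if "S \<in> shuffle_sets n p" for S
    using spread_shuffle_closed[OF compl_shuffle_sets y] that by (simp add: n_def)
  have cl: "b (ca_spread k A p n S u) (ca_spread k A q n ({..<n} - S) y) \<in> carrier M"
    if "S \<in> shuffle_sets n p" "u \<in> carrier (CA k A p)" for S u
    by (rule bilinear_closed[OF b spread_shuffle_closed[OF that] cy[OF that(1)]])
  have fx: "ca_face k A (Suc p) a x \<in> carrier (CA k A p)" for a by (rule module_homD(1)[OF ca_face_hom x])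
  have "(\<Oplus>\<^bsub>M\<^esub>u\<in>{(S, j). S \<in> shuffle_sets (Suc n) (Suc p) \<and> j \<le> Suc n \<and> merged (Suc n) j S}.
      alt_sign M (crossings (fst u) ({..<Suc n} - fst u) + snd u)
        (b (ca_face k A (Suc n) (snd u) (ca_spread k A (Suc p) (Suc n) (fst u) x))
           (ca_face k A (Suc n) (snd u) (ca_spread k A q (Suc n) ({..<Suc n} - fst u) y))))
     = (\<Oplus>\<^bsub>M\<^esub>u\<in>shuffle_sets n p \<times> {..Suc p}. ?t (fst u) (snd u))"
  proof (rule M.M.finsum_bij[OF merged_bij])
    show "?t (fst u) (snd u) \<in> carrier M" if "u \<in> shuffle_sets n p \<times> {..Suc p}" for u
      using that cl fx by auto
    fix u assume "u \<in> {(S, j). S \<in> shuffle_sets (Suc n) (Suc p) \<and> j \<le> Suc n \<and> merged (Suc n) j S}"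
    then obtain S j where u: "u = (S, j)" and S: "S \<in> shuffle_sets (Suc n) (Suc p)" and j: "j \<le> Suc n" "merged (Suc n) j S"
      by auto
    note S' = shuffle_setsD[OF S]
    have C: "{..<Suc n} - S \<in> shuffle_sets (Suc n) q" using compl_shuffle_sets[of S "Suc p" q] S by (simp add: n_def)
    have dd: "{..<Suc n} - ({..<Suc n} - S) = S" using S'(1) by auto
    have 1: "ca_face k A (Suc n) j (ca_spread k A (Suc p) (Suc n) S x)
        = ca_spread k A p n (delete_step n j S) (ca_face k A (Suc p) (cnt S j) x)"
      by (rule ca_face_spread_merged[OF S'(1,2) j x])
    have 2: "ca_face k A (Suc n) j (ca_spread k A q (Suc n) ({..<Suc n} - S) y)
        = ca_spread k A q n ({..<n} - delete_step n j S) y"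
      unfolding compl_delete_step
      by (rule ca_face_spread_unmerged[OF shuffle_setsD(1,2)[OF C] j(1) _ y]) (simp only: dd j(2))
    have "even (crossings S ({..<Suc n} - S) + j)
        = even (crossings (delete_step n j S) ({..<n} - delete_step n j S) + cnt S j)"
      using arg_cong[OF crossings_delete_step[OF S j], of even] by auto
    then show "alt_sign M (crossings (fst u) ({..<Suc n} - fst u) + snd u)
        (b (ca_face k A (Suc n) (snd u) (ca_spread k A (Suc p) (Suc n) (fst u) x))
           (ca_face k A (Suc n) (snd u) (ca_spread k A q (Suc n) ({..<Suc n} - fst u) y)))
      = ?t (fst (case u of (S, j) \<Rightarrow> (delete_step n j S, cnt S j))) (snd (case u of (S, j) \<Rightarrow> (delete_step n j S, cnt S j)))"
      unfolding u prod.case fst_conv snd_conv 1 2 by (rule M.alt_sign_parity)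
  qed
  also have "\<dots> = (\<Oplus>\<^bsub>M\<^esub>S\<in>shuffle_sets n p. \<Oplus>\<^bsub>M\<^esub>a\<in>{..Suc p}. ?t S a)"
    by (rule M.M.finsum_Sigma[symmetric]) (auto simp: cl fx)
  also have "\<dots> = shuffle_sum k A M b p q (ca_boundary k A (Suc p) x) y"
    unfolding shuffle_sum_def n_def[symmetric]
  proof (rule M.M.finsum_cong'[OF refl])
    fix S assume S: "S \<in> shuffle_sets n p"
    have h: "(\<lambda>u. b (ca_spread k A p n S u) (ca_spread k A q n ({..<n} - S) y)) \<in> module_hom k (CA k A p) M"
      by (rule module_hom_comp[OF bilinear_left[OF b cy[OF S]] spread_shuffle_hom[OF S]])
    show "(\<Oplus>\<^bsub>M\<^esub>a\<in>{..Suc p}. ?t S a)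
       = alt_sign M (crossings S ({..<n} - S))
          (b (ca_spread k A p n S (ca_boundary k A (Suc p) x)) (ca_spread k A q n ({..<n} - S) y))"
      unfolding hom_boundary[OF M h x] using cl[OF S fx]
      by (subst M.alt_sign_finsum) (auto intro!: M.M.finsum_cong' simp: M.alt_sign_alt_sign)
  qed (use cl module_homD(1)[OF ca_boundary_hom x] in auto)
  finally show ?thesis .
qed

text \<open>The left-hand side is what becomes of the boundary of a shuffle sum if the pairing is simplicial: the
faces act on both factors. It is sorted by the position of the removed vertex on the lattice path.
Corners cancel in pairs, and the remaining terms are the two shuffle sums of boundaries. The case distinctions
concern degree 0, in which a chain has no boundary.\<close>

lemma shuffle_leibniz:
  assumes M: "module k M" and b: "module_bilinear k (CA k A n) (CA k A n) M b" and n: "p + q = Suc n"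
    and x: "x \<in> carrier (CA k A p)" and y: "y \<in> carrier (CA k A q)"
  shows "(\<Oplus>\<^bsub>M\<^esub>S\<in>shuffle_sets (Suc n) p. alt_sign M (crossings S ({..<Suc n} - S))
      (\<Oplus>\<^bsub>M\<^esub>j\<in>{..Suc n}. alt_sign M j
        (b (ca_face k A (Suc n) j (ca_spread k A p (Suc n) S x))
           (ca_face k A (Suc n) j (ca_spread k A q (Suc n) ({..<Suc n} - S) y)))))
    = (if p = 0 then \<zero>\<^bsub>M\<^esub> else shuffle_sum k A M b (p - 1) q (ca_boundary k A p x) y)
      \<oplus>\<^bsub>M\<^esub> alt_sign M p (if q = 0 then \<zero>\<^bsub>M\<^esub> else shuffle_sum k A M b p (q - 1) x (ca_boundary k A q y))"
proof -
  interpret M: module k M by fact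
  let ?N = "Suc n"
  let ?fx = "\<lambda>S j. ca_face k A ?N j (ca_spread k A p ?N S x)"
  let ?fy = "\<lambda>S j. ca_face k A ?N j (ca_spread k A q ?N ({..<?N} - S) y)"
  define t where "t = (\<lambda>u. alt_sign M (crossings (fst u) ({..<?N} - fst u) + snd u) (b (?fx (fst u) (snd u)) (?fy (fst u) (snd u))))"
  have compl: "{..<?N} - S \<in> shuffle_sets ?N q" if "S \<in> shuffle_sets ?N p" for S
    using compl_shuffle_sets[of S p q] that n by simp
  have cl: "b (?fx S j) (?fy S j) \<in> carrier M" if "S \<in> shuffle_sets ?N p" for S j
    using that x y
    by (intro bilinear_closed[OF b] module_homD(1)[OF ca_face_hom] spread_shuffle_closed compl)
  have tcl: "t u \<in> carrier M" if "fst u \<in> shuffle_sets ?N p" for u using cl[OF that] by (simp add: t_def)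
  \<comment> \<open>\<open>I\<close> and \<open>J\<close> collect the two kinds of corners, \<open>X\<close> the vertices where only \<open>x\<close> moves, \<open>Y\<close> those
    where only \<open>y\<close> moves.\<close>
  define I where "I = {(S, j). S \<in> shuffle_sets ?N p \<and> 0 < j \<and> j \<le> n \<and> j - 1 \<in> S \<and> j \<notin> S}"
  define J where "J = {(S, j). S \<in> shuffle_sets ?N p \<and> 0 < j \<and> j \<le> n \<and> j - 1 \<notin> S \<and> j \<in> S}"
  define X where "X = {(S, j). S \<in> shuffle_sets ?N p \<and> j \<le> ?N \<and> merged ?N j S}"
  define Y where "Y = {(S, j). S \<in> shuffle_sets ?N p \<and> j \<le> ?N \<and> merged ?N j ({..<?N} - S)}"
  have union: "shuffle_sets ?N p \<times> {..?N} = (I \<union> J) \<union> (X \<union> Y)"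
  proof
    show "shuffle_sets ?N p \<times> {..?N} \<subseteq> (I \<union> J) \<union> (X \<union> Y)"
    proof (rule subsetI, erule SigmaE)
      fix u S j assume S: "S \<in> shuffle_sets ?N p" and j: "j \<in> {..?N}" and u: "u = (S, j)"
      consider "j = 0" | "j = ?N" | "0 < j" "j \<le> n" using j by force
      then show "u \<in> (I \<union> J) \<union> (X \<union> Y)"
      proof cases
        case 1
        then show ?thesis using S by (cases "0 \<in> S") (simp_all add: u X_def Y_def merged_def)
      next
        case 2
        then show ?thesis using S by (cases "n \<in> S") (simp_all add: u X_def Y_def merged_def)
      next
        case 3
        then show ?thesis using S
          by (cases "j - 1 \<in> S"; cases "j \<in> S") (simp_all add: u I_def J_def X_def Y_def merged_def)
      qed
    qed
  qed (auto simp: I_def J_def X_def Y_def)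
  have mixed: "(S, j) \<notin> X \<union> Y" if "(S, j) \<in> I \<union> J" for S j
    using that unfolding I_def J_def X_def Y_def merged_def by (elim UnE) simp_all
  have "\<not> (merged ?N j S \<and> merged ?N j ({..<?N} - S))" for S j
    unfolding merged_def by (cases j) auto
  then have XY: "X \<inter> Y = {}" unfolding X_def Y_def by blast
  have "I \<inter> J = {}" unfolding I_def J_def by blast
  with mixed XY have disj: "(I \<union> J) \<inter> (X \<union> Y) = {}" "X \<inter> Y = {}" "I \<inter> J = {}"
    by (auto simp del: Un_iff)
  have fin: "finite (shuffle_sets ?N p \<times> {..?N})" by simp
  then have fin': "finite I" "finite J" "finite X" "finite Y" unfolding union by auto
  have sh: "fst u \<in> shuffle_sets ?N p" if "u \<in> (I \<union> J) \<union> (X \<union> Y)" for u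
    using that by (auto simp: I_def J_def X_def Y_def)
  have cancel: "(\<Oplus>\<^bsub>M\<^esub>u\<in>I \<union> J. t u) = \<zero>\<^bsub>M\<^esub>"
  proof (rule M.M.finsum_cancel[OF fin'(1) disj(3)])
    show "bij_betw (\<lambda>(S, j). (insert j (S - {j - 1}), j)) I J"
    proof (rule bij_betw_byWitness[where f' = "\<lambda>(S, j). (insert (j - 1) (S - {j}), j)"])
      show "(\<lambda>(S, j). (insert j (S - {j - 1}), j)) ` I \<subseteq> J"
        using swap_step(1) by (auto simp: I_def J_def)
      show "(\<lambda>(S, j). (insert (j - 1) (S - {j}), j)) ` J \<subseteq> I"
      proof clarify
        fix S j assume "(S, j) \<in> J"
        then have *: "S \<in> shuffle_sets ?N p" "0 < j" "j \<le> n" "j - 1 \<notin> S" "j \<in> S" by (auto simp: J_def)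
        note S = shuffle_setsD[OF *(1)]
        have "card (insert (j - 1) (S - {j})) = card S"
          using card.remove[OF S(3) *(5)] S(3) *(4) by (subst card_insert_disjoint) auto
        then have "insert (j - 1) (S - {j}) \<in> shuffle_sets ?N p" using S *(3) by (auto simp: shuffle_sets_def)
        then show "(insert (j - 1) (S - {j}), j) \<in> I" using * by (auto simp: I_def)
      qed
    qed (auto simp: I_def J_def)
    show "t u \<in> carrier M" if "u \<in> I \<union> J" for u by (rule tcl[OF sh]) (use that in blast)
    fix u assume "u \<in> I"
    then obtain S j where u: "u = (S, j)" and S: "S \<in> shuffle_sets ?N p" and j: "0 < j" "j \<le> n" "j - 1 \<in> S" "j \<notin> S"
      by (auto simp: I_def)
    let ?S = "insert j (S - {j - 1})"
    note sw = swap_step[OF S j]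
    have jN: "j \<le> ?N" using j by simp
    have 1: "?fx ?S j = ?fx S j"
      by (rule ca_face_spread_cong[OF shuffle_setsD(1,2)[OF sw(1)] shuffle_setsD(1,2)[OF S] jN _ x])
         (simp add: sw(3))
    have 2: "?fy ?S j = ?fy S j"
      by (rule ca_face_spread_cong[OF shuffle_setsD(1,2)[OF compl[OF sw(1)]] shuffle_setsD(1,2)[OF compl[OF S]] jN _ y])
         (simp add: cnt_compl sw(3))
    show "t (case u of (S, j) \<Rightarrow> (insert j (S - {j - 1}), j)) = \<ominus>\<^bsub>M\<^esub> t u"
      unfolding t_def u prod.case fst_conv snd_conv 1 2 sw(4) add_Suc
      by (rule M.alt_sign_Suc[OF cl[OF S]])
  qed
  have sumX: "(\<Oplus>\<^bsub>M\<^esub>u\<in>X. t u) = (if p = 0 then \<zero>\<^bsub>M\<^esub> else shuffle_sum k A M b (p - 1) q (ca_boundary k A p x) y)"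
  proof (cases p)
    case 0
    have "X = {}"
      using shuffle_setsD(2,3) unfolding X_def 0 merged_def by fastforce
    then show ?thesis using 0 by simp
  next
    case (Suc p')
    have n': "n = p' + q" using n Suc by simp
    show ?thesis
      using merged_part[OF M, of p' q b x y] b x y unfolding X_def t_def Suc n' by simp
  qed
  have sumY: "(\<Oplus>\<^bsub>M\<^esub>u\<in>Y. t u) = alt_sign M p (if q = 0 then \<zero>\<^bsub>M\<^esub> else shuffle_sum k A M b p (q - 1) x (ca_boundary k A q y))"
  proof (cases q)
    case 0
    have "S = {..<?N}" if "S \<in> shuffle_sets ?N p" for S
      using shuffle_setsD[OF that] n 0 by (intro card_subset_eq) auto
    then have "Y = {}" unfolding Y_def merged_def by fastforce
    then show ?thesis using 0 by simp
  next
    case (Suc q')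
    have n': "n = q' + p" using n Suc by simp
    let ?b = "\<lambda>u v. b v u"
    let ?s = "\<lambda>u. alt_sign M (crossings (fst u) ({..<?N} - fst u) + snd u)
        (?b (ca_face k A ?N (snd u) (ca_spread k A q ?N (fst u) y))
            (ca_face k A ?N (snd u) (ca_spread k A p ?N ({..<?N} - fst u) x)))"
    let ?Z = "{(S, j). S \<in> shuffle_sets ?N q \<and> j \<le> ?N \<and> merged ?N j S}"
    have compl': "{..<?N} - S \<in> shuffle_sets ?N p" if "S \<in> shuffle_sets ?N q" for S
      using compl_shuffle_sets[of S q p] that n by (simp add: add.commute)
    have dd: "{..<?N} - ({..<?N} - S) = S" if "S \<in> shuffle_sets ?N r" for S r using shuffle_setsD(1)[OF that] by auto
    have scl: "?s u \<in> carrier M" if "fst u \<in> shuffle_sets ?N q" for u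
      using that x y
      by (intro M.alt_sign_closed bilinear_closed[OF b] module_homD(1)[OF ca_face_hom] spread_shuffle_closed compl')
    have bij: "bij_betw (\<lambda>(S, j). ({..<?N} - S, j)) Y ?Z"
      by (rule bij_betw_byWitness[where f' = "\<lambda>(S, j). ({..<?N} - S, j)"])
         (auto simp: Y_def dd compl compl' dest: subsetD[OF shuffle_setsD(1)])
    \<comment> \<open>Exchanging the roles of \<open>x\<close> and \<open>y\<close> reduces this part to the previous one. It costs the sign of
      \<open>p * q\<close>, and the exchange back, in one degree less, costs that of \<open>p * (q - 1)\<close>; together this is the sign
      of \<open>p\<close>.\<close>
    have "(\<Oplus>\<^bsub>M\<^esub>u\<in>Y. t u) = (\<Oplus>\<^bsub>M\<^esub>u\<in>?Z. alt_sign M (p * q) (?s u))"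
    proof (rule M.M.finsum_bij[OF bij])
      show "alt_sign M (p * q) (?s u) \<in> carrier M" if "u \<in> ?Z" for u
        using that by (intro M.alt_sign_closed[OF scl]) auto
      fix u assume "u \<in> Y"
      then obtain S j where u: "u = (S, j)" and S: "S \<in> shuffle_sets ?N p" by (auto simp: Y_def)
      have "crossings S ({..<?N} - S) + crossings ({..<?N} - S) S = p * q"
        using crossings_flip[of S p q] S n by simp
      then have "even (crossings S ({..<?N} - S) + j) = even (p * q + (crossings ({..<?N} - S) S + j))"
        by (metis even_add)
      then show "t u = alt_sign M (p * q) (?s (case u of (S, j) \<Rightarrow> ({..<?N} - S, j)))"
        unfolding t_def u prod.case fst_conv snd_conv dd[OF S] M.alt_sign_alt_sign[OF cl[OF S]]
        by (rule M.alt_sign_parity)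
    qed
    also have "\<dots> = alt_sign M (p * q) (\<Oplus>\<^bsub>M\<^esub>u\<in>?Z. ?s u)"
      by (rule M.alt_sign_finsum[symmetric], rule scl) auto
    also have "(\<Oplus>\<^bsub>M\<^esub>u\<in>?Z. ?s u) = shuffle_sum k A M ?b q' p (ca_boundary k A q y) x"
      using merged_part[OF M, of q' p ?b y x] module_bilinear_flip[OF b] x y unfolding Suc n' by simp
    also have "\<dots> = alt_sign M (p * q') (shuffle_sum k A M b p q' x (ca_boundary k A q y))"
    proof (rule shuffle_sum_flip[OF M _ x])
      show "module_bilinear k (CA k A (p + q')) (CA k A (p + q')) M b" using b n' by (simp add: add.commute)
      show "ca_boundary k A q y \<in> carrier (CA k A q')" using module_homD(1)[OF ca_boundary_hom] y Suc by simp
    qed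
    also have "alt_sign M (p * q) \<dots> = alt_sign M p (shuffle_sum k A M b p q' x (ca_boundary k A q y))"
    proof -
      have "shuffle_sum k A M b p q' x (ca_boundary k A q y) \<in> carrier M"
        using b n' module_homD(1)[OF ca_boundary_hom] y Suc
        by (intro shuffle_sum_closed[OF M _ x]) (simp_all add: add.commute)
      moreover have "even (p * q + p * q') = even p"
        by (cases "even p"; cases "even q'") (simp_all add: Suc)
      ultimately show ?thesis by (simp only: M.alt_sign_alt_sign) (rule M.alt_sign_parity)
    qed
    finally show ?thesis using Suc by simp
  qed
  have "(\<Oplus>\<^bsub>M\<^esub>S\<in>shuffle_sets ?N p. alt_sign M (crossings S ({..<?N} - S)) (\<Oplus>\<^bsub>M\<^esub>j\<in>{..?N}. alt_sign M j (b (?fx S j) (?fy S j))))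
      = (\<Oplus>\<^bsub>M\<^esub>S\<in>shuffle_sets ?N p. \<Oplus>\<^bsub>M\<^esub>j\<in>{..?N}. t (S, j))"
    unfolding t_def fst_conv snd_conv
    by (intro M.M.finsum_cong' refl M.alt_sign_finsum_alt_sign funcsetI M.M.finsum_closed M.alt_sign_closed cl)
  also have "\<dots> = (\<Oplus>\<^bsub>M\<^esub>u\<in>shuffle_sets ?N p \<times> {..?N}. t (fst u, snd u))"
    by (rule M.M.finsum_Sigma) (auto simp: tcl)
  also have "\<dots> = (\<Oplus>\<^bsub>M\<^esub>u\<in>(I \<union> J) \<union> (X \<union> Y). t u)" unfolding union by simp
  also have "\<dots> = (\<Oplus>\<^bsub>M\<^esub>u\<in>I \<union> J. t u) \<oplus>\<^bsub>M\<^esub> (\<Oplus>\<^bsub>M\<^esub>u\<in>X \<union> Y. t u)"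
    using fin' disj(1) tcl sh by (intro M.M.finsum_Un_disjoint) auto
  also have "(\<Oplus>\<^bsub>M\<^esub>u\<in>X \<union> Y. t u) = (\<Oplus>\<^bsub>M\<^esub>u\<in>X. t u) \<oplus>\<^bsub>M\<^esub> (\<Oplus>\<^bsub>M\<^esub>u\<in>Y. t u)"
    using fin' disj(2) tcl sh by (intro M.M.finsum_Un_disjoint) auto
  finally have "(\<Oplus>\<^bsub>M\<^esub>S\<in>shuffle_sets ?N p. alt_sign M (crossings S ({..<?N} - S)) (\<Oplus>\<^bsub>M\<^esub>j\<in>{..?N}. alt_sign M j (b (?fx S j) (?fy S j))))
    = (\<Oplus>\<^bsub>M\<^esub>u\<in>X. t u) \<oplus>\<^bsub>M\<^esub> (\<Oplus>\<^bsub>M\<^esub>u\<in>Y. t u)"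
    using cancel tcl sh by (simp add: M.M.finsum_closed Pi_iff)
  then show ?thesis by (simp only: sumX sumY)
qed

end

section \<open>Associativity, unit and commutativity up to homotopy\<close>

context assoc_algebra
begin

interpretation C: module k "CA k A n" for n by (rule module_CA)

lemma alt_sign_add:
  assumes M: "module k M" and x: "x \<in> carrier M" "y \<in> carrier M"
  shows "alt_sign M n (x \<oplus>\<^bsub>M\<^esub> y) = alt_sign M n x \<oplus>\<^bsub>M\<^esub> alt_sign M n y"
  by (rule module_homD(2)[OF alt_sign_hom[OF M] x])

abbreviation shuffle_product where "shuffle_product p q \<equiv> shuffle_sum k A (CA k A (p + q)) (ca_mult k A (p + q)) p q"

lemma shuffle_product_bilinear: "module_bilinear k (CA k A p) (CA k A q) (CA k A (p + q)) (shuffle_product p q)"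
  by (rule shuffle_sum_bilinear[OF module_CA ca_mult_bilinear])

lemma shuffle_product_closed: "x \<in> carrier (CA k A p) \<Longrightarrow> y \<in> carrier (CA k A q) \<Longrightarrow> shuffle_product p q x y \<in> carrier (CA k A (p + q))"
  by (rule bilinear_closed[OF shuffle_product_bilinear])

text \<open>The term of a triple shuffle, in which \<open>x\<close>, \<open>y\<close> and \<open>z\<close> move at the times in \<open>R\<close>, in \<open>R'\<close> and at
the remaining times.\<close>

definition triple_term where
  "triple_term p q r x y z R R' = (let n = p + q + r; R'' = {..<n} - R - R' in
     alt_sign (CA k A n) (crossings R R' + crossings R R'' + crossings R' R'')
       (ca_mult k A n (ca_mult k A n (ca_spread k A p n R x) (ca_spread k A q n R' y)) (ca_spread k A r n R'' z)))"

context
  fixes p q r x y z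
  assumes x: "x \<in> carrier (CA k A p)" and y: "y \<in> carrier (CA k A q)" and z: "z \<in> carrier (CA k A r)"
begin

lemma triple_term_closed:
  assumes "R \<in> shuffle_sets (p + q + r) p" "R' \<subseteq> {..<p + q + r} - R" "card R' = q"
  shows "triple_term p q r x y z R R' \<in> carrier (CA k A (p + q + r))"
proof -
  let ?n = "p + q + r"
  note R = shuffle_setsD[OF assms(1)]
  have R': "R' \<in> shuffle_sets ?n q" "finite R'" using assms(2,3) finite_subset[of R' "{..<?n}"] by (auto simp: shuffle_sets_def)
  have "card ({..<?n} - R - R') = r"
    using R R' assms(2,3) by (simp add: card_Diff_subset)
  then have R'': "{..<?n} - R - R' \<in> shuffle_sets ?n r" by (auto simp: shuffle_sets_def)
  show ?thesis unfolding triple_term_def Let_def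
    by (intro C.alt_sign_closed ca_mult_closed spread_shuffle_closed assms(1) R' R'' x y z)
qed

text \<open>An outer shuffle \<open>T\<close> for the pair \<open>(x, y)\<close> together with an inner shuffle of \<open>T\<close> amounts to a subset
\<open>R\<close> of \<open>T\<close>, hence to the partition into \<open>R\<close>, \<open>T - R\<close> and the rest. The degeneracies compose because
\<open>ca_spread\<close> is functorial and commutes with the multiplication, and the crossings of \<open>T\<close> with the rest
split into those of its two parts.\<close>

lemma shuffle_triple_left:
  "shuffle_product (p + q) r (shuffle_product p q x y) z
   = (\<Oplus>\<^bsub>CA k A (p + q + r)\<^esub>u\<in>Sigma (shuffle_sets (p + q + r) p) (\<lambda>R. {R'. R' \<subseteq> {..<p + q + r} - R \<and> card R' = q}).
        triple_term p q r x y z (fst u) (snd u))"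
proof -
  let ?n = "p + q + r" and ?m = "p + q"
  let ?C = "CA k A ?n"
  let ?W = "Sigma (shuffle_sets ?n p) (\<lambda>R. {R'. R' \<subseteq> {..<?n} - R \<and> card R' = q})"
  let ?V = "Sigma (shuffle_sets ?n ?m) (\<lambda>T. {R. R \<subseteq> T \<and> card R = p})"
  have tcl: "triple_term p q r x y z (fst u) (snd u) \<in> carrier ?C" if "u \<in> ?W" for u
    using that triple_term_closed by auto
  have bij: "bij_betw (\<lambda>(T, R). (R, T - R)) ?V ?W"
  proof (rule bij_betw_byWitness[where f' = "\<lambda>(R, R'). (R \<union> R', R)"])
    show "(\<lambda>(T, R). (R, T - R)) ` ?V \<subseteq> ?W"
    proof (rule image_subsetI, erule SigmaE)
      fix u T R assume T: "T \<in> shuffle_sets ?n ?m" and "R \<in> {R. R \<subseteq> T \<and> card R = p}" and u: "u = (T, R)"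
      then have R: "R \<subseteq> T" "card R = p" by auto
      note T' = shuffle_setsD[OF T]
      have "card (T - R) = q" using T' R finite_subset[OF R(1) T'(3)] by (simp add: card_Diff_subset)
      then show "(case u of (T, R) \<Rightarrow> (R, T - R)) \<in> ?W"
        using T' R by (auto simp: u shuffle_sets_def)
    qed
    show "(\<lambda>(R, R'). (R \<union> R', R)) ` ?W \<subseteq> ?V"
    proof (rule image_subsetI, erule SigmaE)
      fix u R R' assume R: "R \<in> shuffle_sets ?n p" and "R' \<in> {R'. R' \<subseteq> {..<?n} - R \<and> card R' = q}"
        and u: "u = (R, R')"
      then have R': "R' \<subseteq> {..<?n} - R" "card R' = q" by auto
      have "card (R \<union> R') = p + q"
        using shuffle_setsD[OF R] R' finite_subset[of R' "{..<?n}"] by (subst card_Un_disjoint) auto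
      then show "(case u of (R, R') \<Rightarrow> (R \<union> R', R)) \<in> ?V"
        using shuffle_setsD[OF R] R' by (auto simp: u shuffle_sets_def)
    qed
  qed auto
  have eq: "alt_sign ?C (crossings T ({..<?n} - T)) (ca_mult k A ?n (ca_spread k A ?m ?n T (shuffle_product p q x y)) (ca_spread k A r ?n ({..<?n} - T) z))
      = (\<Oplus>\<^bsub>?C\<^esub>R\<in>{R. R \<subseteq> T \<and> card R = p}. triple_term p q r x y z R (T - R))" if T: "T \<in> shuffle_sets ?n ?m" for T
  proof -
    note T' = shuffle_setsD[OF T]
    have cz: "ca_spread k A r ?n ({..<?n} - T) z \<in> carrier ?C"
      using spread_shuffle_closed[OF compl_shuffle_sets[OF T] z] .
    have h: "(\<lambda>u. ca_mult k A ?n (ca_spread k A ?m ?n T u) (ca_spread k A r ?n ({..<?n} - T) z)) \<in> module_hom k (CA k A ?m) ?C"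
      (is "?h \<in> _")
      by (rule module_hom_comp[OF bilinear_left[OF ca_mult_bilinear cz] spread_shuffle_hom[OF T]])
    let ?b = "\<lambda>S. ca_mult k A ?m (ca_spread k A p ?m S x) (ca_spread k A q ?m ({..<?m} - S) y)"
    have b: "?b S \<in> carrier (CA k A ?m)" if "S \<in> shuffle_sets ?m p" for S
      by (intro ca_mult_closed spread_shuffle_closed that compl_shuffle_sets x y)
    have "?h (shuffle_product p q x y) = (\<Oplus>\<^bsub>?C\<^esub>S\<in>shuffle_sets ?m p. ?h (alt_sign (CA k A ?m) (crossings S ({..<?m} - S)) (?b S)))"
      unfolding shuffle_sum_def by (rule module_hom_finsum[OF h module_CA module_CA]) (simp add: b)
    also have "\<dots> = (\<Oplus>\<^bsub>?C\<^esub>S\<in>shuffle_sets ?m p. alt_sign ?C (crossings S ({..<?m} - S)) (?h (?b S)))"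
      using b module_homD(1)[OF h] by (intro C.M.finsum_cong') (auto simp: hom_alt_sign[OF h module_CA module_CA])
    finally have "alt_sign ?C (crossings T ({..<?n} - T)) (?h (shuffle_product p q x y))
        = (\<Oplus>\<^bsub>?C\<^esub>S\<in>shuffle_sets ?m p. alt_sign ?C (crossings T ({..<?n} - T) + crossings S ({..<?m} - S)) (?h (?b S)))"
      using b module_homD(1)[OF h] by (simp add: C.alt_sign_finsum_alt_sign)
    also have "\<dots> = (\<Oplus>\<^bsub>?C\<^esub>R\<in>{R. R \<subseteq> T \<and> card R = p}. triple_term p q r x y z R (T - R))"
    proof (rule C.M.finsum_bij[OF cnt_image_bij[OF T], symmetric])
      show "alt_sign ?C (crossings T ({..<?n} - T) + crossings S ({..<?m} - S)) (?h (?b S)) \<in> carrier ?C"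
        if "S \<in> shuffle_sets ?m p" for S using b[OF that] module_homD(1)[OF h] by simp
      fix R assume "R \<in> {R. R \<subseteq> T \<and> card R = p}"
      then have R: "R \<subseteq> T" "card R = p" by auto
      have fin: "finite R" "finite (T - R)" using R T'(3) finite_subset by auto
      have S: "cnt T ` R \<in> shuffle_sets ?m p" "{..<?m} - cnt T ` R = cnt T ` (T - R)"
        using cnt_image_shuffle[OF T R(1)] R(2) by simp_all
      have q: "card (T - R) = q" using R T' fin by (simp add: card_Diff_subset)
      have rest: "{..<?n} - R - (T - R) = {..<?n} - T" using R by auto
      have TR: "T = R \<union> (T - R)" using R by auto
      have "crossings T ({..<?n} - T) = crossings R ({..<?n} - T) + crossings (T - R) ({..<?n} - T)"
        using crossings_Un(1)[OF fin, of "{..<?n} - T"] TR by auto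
      moreover have "crossings (cnt T ` R) (cnt T ` (T - R)) = crossings R (T - R)"
        by (rule crossings_image_cnt) (use R in auto)
      ultimately have sg: "crossings T ({..<?n} - T) + crossings (cnt T ` R) (cnt T ` (T - R))
          = crossings R (T - R) + crossings R ({..<?n} - T) + crossings (T - R) ({..<?n} - T)" by simp
      have "ca_spread k A ?m ?n T (?b (cnt T ` R))
          = ca_mult k A ?n (ca_spread k A ?m ?n T (ca_spread k A p ?m (cnt T ` R) x))
              (ca_spread k A ?m ?n T (ca_spread k A q ?m (cnt T ` (T - R)) y))"
        unfolding S(2)
        by (rule ca_spread_mult[OF T'(1,2) spread_shuffle_closed[OF S(1) x]])
           (use spread_shuffle_closed[OF compl_shuffle_sets[OF S(1)] y] in \<open>simp only: S(2)\<close>)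
      also have "\<dots> = ca_mult k A ?n (ca_spread k A p ?n R x) (ca_spread k A q ?n (T - R) y)"
        using ca_spread_spread[OF R T'(1,2) x] ca_spread_spread[OF _ q T'(1,2) y] by auto
      finally show "triple_term p q r x y z R (T - R)
          = alt_sign ?C (crossings T ({..<?n} - T) + crossings (cnt T ` R) ({..<?m} - cnt T ` R)) (?h (?b (cnt T ` R)))"
        unfolding triple_term_def Let_def rest S(2) sg by simp
    qed
    finally show ?thesis .
  qed
  have vcl: "triple_term p q r x y z R (T - R) \<in> carrier ?C" if "T \<in> shuffle_sets ?n ?m" "R \<subseteq> T" "card R = p" for T R
    using tcl[of "(R, T - R)"] bij_betwE[OF bij] that by auto
  have "shuffle_product ?m r (shuffle_product p q x y) z
      = (\<Oplus>\<^bsub>?C\<^esub>T\<in>shuffle_sets ?n ?m. \<Oplus>\<^bsub>?C\<^esub>R\<in>{R. R \<subseteq> T \<and> card R = p}. triple_term p q r x y z R (T - R))"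
    unfolding shuffle_sum_def[of k A _ _ ?m r] using vcl
    by (intro C.M.finsum_cong' refl) (auto simp: eq intro!: C.M.finsum_closed)
  also have "\<dots> = (\<Oplus>\<^bsub>?C\<^esub>u\<in>?V. triple_term p q r x y z (snd u) (fst u - snd u))"
  proof (rule C.M.finsum_Sigma)
    show "finite {R. R \<subseteq> T \<and> card R = p}" if "T \<in> shuffle_sets ?n ?m" for T
      using shuffle_setsD(3)[OF that] by (auto intro: finite_subset[of _ "Pow T"])
  qed (auto simp: vcl)
  also have "\<dots> = (\<Oplus>\<^bsub>?C\<^esub>u\<in>?W. triple_term p q r x y z (fst u) (snd u))"
    by (rule C.M.finsum_bij[OF bij tcl]) auto
  finally show ?thesis .
qed

text \<open>Symmetrically, the inner shuffle now divides the complement of \<open>R\<close>. Associativity of \<open>ca_mult\<close>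
enters here, in rebracketing each single term.\<close>

lemma shuffle_triple_right:
  "shuffle_product p (q + r) x (shuffle_product q r y z)
   = (\<Oplus>\<^bsub>CA k A (p + q + r)\<^esub>u\<in>Sigma (shuffle_sets (p + q + r) p) (\<lambda>R. {R'. R' \<subseteq> {..<p + q + r} - R \<and> card R' = q}).
        triple_term p q r x y z (fst u) (snd u))"
proof -
  let ?n = "p + q + r" and ?m = "q + r"
  let ?C = "CA k A ?n"
  have eq: "alt_sign ?C (crossings R ({..<?n} - R)) (ca_mult k A ?n (ca_spread k A p ?n R x) (ca_spread k A ?m ?n ({..<?n} - R) (shuffle_product q r y z)))
      = (\<Oplus>\<^bsub>?C\<^esub>R'\<in>{R'. R' \<subseteq> {..<?n} - R \<and> card R' = q}. triple_term p q r x y z R R')" if R: "R \<in> shuffle_sets ?n p" for R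
  proof -
    let ?T = "{..<?n} - R"
    have T: "?T \<in> shuffle_sets ?n ?m" using compl_shuffle_sets[of R p ?m] R by (simp add: add.assoc)
    note T' = shuffle_setsD[OF T]
    have cx: "ca_spread k A p ?n R x \<in> carrier ?C" by (rule spread_shuffle_closed[OF R x])
    have h: "(\<lambda>u. ca_mult k A ?n (ca_spread k A p ?n R x) (ca_spread k A ?m ?n ?T u)) \<in> module_hom k (CA k A ?m) ?C"
      (is "?h \<in> _")
      by (rule module_hom_comp[OF bilinear_right[OF ca_mult_bilinear cx] spread_shuffle_hom[OF T]])
    let ?b = "\<lambda>S. ca_mult k A ?m (ca_spread k A q ?m S y) (ca_spread k A r ?m ({..<?m} - S) z)"
    have b: "?b S \<in> carrier (CA k A ?m)" if "S \<in> shuffle_sets ?m q" for S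
      by (intro ca_mult_closed spread_shuffle_closed that compl_shuffle_sets y z)
    have "?h (shuffle_product q r y z) = (\<Oplus>\<^bsub>?C\<^esub>S\<in>shuffle_sets ?m q. ?h (alt_sign (CA k A ?m) (crossings S ({..<?m} - S)) (?b S)))"
      unfolding shuffle_sum_def by (rule module_hom_finsum[OF h module_CA module_CA]) (simp add: b)
    also have "\<dots> = (\<Oplus>\<^bsub>?C\<^esub>S\<in>shuffle_sets ?m q. alt_sign ?C (crossings S ({..<?m} - S)) (?h (?b S)))"
      using b module_homD(1)[OF h] by (intro C.M.finsum_cong') (auto simp: hom_alt_sign[OF h module_CA module_CA])
    finally have "alt_sign ?C (crossings R ?T) (?h (shuffle_product q r y z))
        = (\<Oplus>\<^bsub>?C\<^esub>S\<in>shuffle_sets ?m q. alt_sign ?C (crossings R ?T + crossings S ({..<?m} - S)) (?h (?b S)))"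
      using b module_homD(1)[OF h] by (simp add: C.alt_sign_finsum_alt_sign)
    also have "\<dots> = (\<Oplus>\<^bsub>?C\<^esub>R'\<in>{R'. R' \<subseteq> ?T \<and> card R' = q}. triple_term p q r x y z R R')"
    proof (rule C.M.finsum_bij[OF cnt_image_bij[OF T], symmetric])
      show "alt_sign ?C (crossings R ?T + crossings S ({..<?m} - S)) (?h (?b S)) \<in> carrier ?C"
        if "S \<in> shuffle_sets ?m q" for S using b[OF that] module_homD(1)[OF h] by simp
      fix R' assume "R' \<in> {R'. R' \<subseteq> ?T \<and> card R' = q}"
      then have R': "R' \<subseteq> ?T" "card R' = q" by auto
      have fin: "finite R'" "finite (?T - R')" using finite_subset[OF R'(1)] by auto
      have S: "cnt ?T ` R' \<in> shuffle_sets ?m q" "{..<?m} - cnt ?T ` R' = cnt ?T ` (?T - R')"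
        using cnt_image_shuffle[OF T R'(1)] R'(2) by simp_all
      have r: "card (?T - R') = r" using R' T' fin by (simp add: card_Diff_subset)
      have sub: "?T - R' \<subseteq> ?T" by auto
      have TR: "?T = R' \<union> (?T - R')" using R' by auto
      have "crossings R ?T = crossings R R' + crossings R (?T - R')"
        using crossings_Un(2)[OF fin, of R] TR by auto
      moreover have "crossings (cnt ?T ` R') (cnt ?T ` (?T - R')) = crossings R' (?T - R')"
        by (rule crossings_image_cnt[OF R'(1) sub])
      ultimately have sg: "crossings R ?T + crossings (cnt ?T ` R') (cnt ?T ` (?T - R'))
          = crossings R R' + crossings R (?T - R') + crossings R' (?T - R')" by simp
      have "ca_spread k A ?m ?n ?T (?b (cnt ?T ` R'))
          = ca_mult k A ?n (ca_spread k A ?m ?n ?T (ca_spread k A q ?m (cnt ?T ` R') y))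
              (ca_spread k A ?m ?n ?T (ca_spread k A r ?m (cnt ?T ` (?T - R')) z))"
        unfolding S(2)
        by (rule ca_spread_mult[OF T'(1,2) spread_shuffle_closed[OF S(1) y]])
           (use spread_shuffle_closed[OF compl_shuffle_sets[OF S(1)] z] in \<open>simp only: S(2)\<close>)
      also have "\<dots> = ca_mult k A ?n (ca_spread k A q ?n R' y) (ca_spread k A r ?n (?T - R') z)"
        by (simp only: ca_spread_spread[OF R' T'(1,2) y] ca_spread_spread[OF sub r T'(1,2) z])
      finally have sp: "ca_spread k A ?m ?n ?T (?b (cnt ?T ` R'))
          = ca_mult k A ?n (ca_spread k A q ?n R' y) (ca_spread k A r ?n (?T - R') z)" .
      have R's: "R' \<in> shuffle_sets ?n q" "?T - R' \<in> shuffle_sets ?n r" using R' r by (auto simp: shuffle_sets_def)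
      show "triple_term p q r x y z R R'
          = alt_sign ?C (crossings R ?T + crossings (cnt ?T ` R') ({..<?m} - cnt ?T ` R')) (?h (?b (cnt ?T ` R')))"
        unfolding triple_term_def Let_def sp[unfolded S(2)] S(2) sg
        by (simp only: ca_mult_assoc[OF cx spread_shuffle_closed[OF R's(1) y] spread_shuffle_closed[OF R's(2) z]])
    qed
    finally show ?thesis .
  qed
  have "shuffle_product p ?m x (shuffle_product q r y z)
      = (\<Oplus>\<^bsub>?C\<^esub>R\<in>shuffle_sets ?n p. \<Oplus>\<^bsub>?C\<^esub>R'\<in>{R'. R' \<subseteq> {..<?n} - R \<and> card R' = q}. triple_term p q r x y z R R')"
    unfolding shuffle_sum_def[of k A _ _ p ?m] add.assoc[symmetric] using triple_term_closed
    by (intro C.M.finsum_cong' refl) (auto simp: eq intro!: C.M.finsum_closed)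
  also have "\<dots> = (\<Oplus>\<^bsub>?C\<^esub>u\<in>Sigma (shuffle_sets ?n p) (\<lambda>R. {R'. R' \<subseteq> {..<?n} - R \<and> card R' = q}). triple_term p q r x y z (fst u) (snd u))"
    by (rule C.M.finsum_Sigma) (auto simp: triple_term_closed intro: finite_subset[of _ "Pow {..<?n}"])
  finally show ?thesis .
qed

lemma shuffle_product_assoc: "shuffle_product (p + q) r (shuffle_product p q x y) z = shuffle_product p (q + r) x (shuffle_product q r y z)"
  unfolding shuffle_triple_left shuffle_triple_right ..

end

lemma shuffle_product_unit:
  assumes x: "x \<in> carrier (CA k A p)"
  shows "shuffle_product 0 p (ca_unit 0) x = x" and "shuffle_product p 0 x (ca_unit 0) = x"
proof -
  have 1: "shuffle_sets p 0 = {{}}" using finite_subset[of _ "{..<p}"] by (auto simp: shuffle_sets_def)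
  show "shuffle_product 0 p (ca_unit 0) x = x"
    unfolding shuffle_sum_def add_0 1 using x
    by (simp add: crossings_def alt_sign_def ca_spread_unit ca_spread_all ca_mult_unit ca_unit_closed)
  have 2: "shuffle_sets p p = {{..<p}}"
    using card_subset_eq[of "{..<p}"] by (auto simp: shuffle_sets_def)
  have 3: "crossings {..<p} {} = 0" by (simp add: crossings_def cnt_def)
  show "shuffle_product p 0 x (ca_unit 0) = x"
    unfolding shuffle_sum_def add_0_right 2 using x
    by (simp add: 3 alt_sign_def ca_spread_unit ca_spread_all ca_mult_unit ca_unit_closed)
qed

text \<open>The alternating sum of the prisms. It is the homotopy operator of the simplicial homotopy from \<open>ca_mult\<close>
to its opposite.\<close>

definition ca_homotopy where
  "ca_homotopy i x y = (\<Oplus>\<^bsub>CA k A (Suc i)\<^esub>j\<in>{..i}. alt_sign (CA k A (Suc i)) j (ca_prism i j x y))"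

lemma ca_homotopy_bilinear: "module_bilinear k (CA k A i) (CA k A i) (CA k A (Suc i)) (ca_homotopy i)"
  unfolding ca_homotopy_def[abs_def]
  by (intro module_bilinear_sum[OF module_CA module_CA module_CA] module_bilinear_alt_sign[OF module_CA] ca_prism_bilinear) simp

text \<open>The homotopy applied to the boundary: the alternating sum of the homotopies of the faces of a pair.
There are no faces in degree 0.\<close>

definition ca_homotopy_faces where
  "ca_homotopy_faces i x y = (case i of 0 \<Rightarrow> \<zero>\<^bsub>CA k A 0\<^esub> | Suc n \<Rightarrow>
     (\<Oplus>\<^bsub>CA k A i\<^esub>l\<in>{..i}. alt_sign (CA k A i) l (ca_homotopy n (ca_face k A i l x) (ca_face k A i l y))))"

text \<open>The homotopy identity. In the double sum over prisms \<open>j\<close> and faces \<open>l\<close>, the two extreme terms are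
the two products, the faces next to the braiding cancel between adjacent prisms by naturality, and the others are
prisms of faces.\<close>

lemma ca_homotopy_boundary:
  assumes x: "x \<in> carrier (CA k A i)" and y: "y \<in> carrier (CA k A i)"
  shows "ca_mult k A i y x = ca_boundary k A (Suc i) (ca_homotopy i x y) \<oplus>\<^bsub>CA k A i\<^esub> ca_mult k A i x y
      \<oplus>\<^bsub>CA k A i\<^esub> ca_homotopy_faces i x y"
    and "ca_homotopy_faces i x y \<in> carrier (CA k A i)"
proof -
  let ?C = "CA k A i"
  let ?F = "\<lambda>j l. ca_face k A (Suc i) l (ca_prism i j x y)"
  define t where "t = (\<lambda>u. alt_sign ?C (fst u + snd u) (?F (fst u) (snd u)))"
  have P: "ca_prism i j x y \<in> carrier (CA k A (Suc i))" if "j \<le> i" for j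
    by (rule bilinear_closed[OF ca_prism_bilinear[OF that] x y])
  have F: "?F j l \<in> carrier ?C" if "j \<le> i" for j l by (rule module_homD(1)[OF ca_face_hom P[OF that]])
  have tcl: "t u \<in> carrier ?C" if "fst u \<le> i" for u using F[OF that] by (simp add: t_def)
  \<comment> \<open>Besides the two extreme faces: \<open>I\<close> and \<open>J\<close> are the faces just before and just after the braiding, \<open>U\<close> the
    faces that do not involve it.\<close>
  define I where "I = {(j, l). l = j \<and> 0 < j \<and> j \<le> i}"
  define J where "J = {(j, l). l = Suc j \<and> j < i}"
  define U where "U = {(j, l). l < j \<and> j \<le> i} \<union> {(j, l). Suc j < l \<and> l \<le> Suc i}"
  have all: "{..i} \<times> {..Suc i} = insert (0, 0) (insert (i, Suc i) ((I \<union> J) \<union> U))"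
    by (auto simp: I_def J_def U_def)
  have notin: "(0, 0) \<notin> insert (i, Suc i) ((I \<union> J) \<union> U)" "(i, Suc i) \<notin> (I \<union> J) \<union> U"
    "(I \<union> J) \<inter> U = {}" "I \<inter> J = {}"
    by (auto simp: I_def J_def U_def)
  have "finite ({..i} \<times> {..Suc i})" by simp
  then have fin: "finite I" "finite J" "finite U" unfolding all by auto
  have idx: "fst u \<le> i" if "u \<in> insert (0, 0) (insert (i, Suc i) ((I \<union> J) \<union> U))" for u
    using that unfolding all[symmetric] by auto
  have "ca_boundary k A (Suc i) (ca_homotopy i x y)
      = (\<Oplus>\<^bsub>?C\<^esub>j\<in>{..i}. ca_boundary k A (Suc i) (alt_sign (CA k A (Suc i)) j (ca_prism i j x y)))"
    unfolding ca_homotopy_def by (rule module_hom_finsum[OF ca_boundary_hom module_CA module_CA]) (simp add: P)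
  also have "\<dots> = (\<Oplus>\<^bsub>?C\<^esub>j\<in>{..i}. \<Oplus>\<^bsub>?C\<^esub>l\<in>{..Suc i}. t (j, l))"
  proof (rule C.M.finsum_cong'[OF refl])
    show "(\<lambda>j. \<Oplus>\<^bsub>?C\<^esub>l\<in>{..Suc i}. t (j, l)) \<in> {..i} \<rightarrow> carrier ?C"
      using tcl by (intro funcsetI C.M.finsum_closed) auto
    fix j assume "j \<in> {..i}"
    then have j: "j \<le> i" by simp
    have "ca_boundary k A (Suc i) (alt_sign (CA k A (Suc i)) j (ca_prism i j x y))
        = alt_sign ?C j (ca_boundary k A (Suc i) (ca_prism i j x y))"
      by (rule hom_alt_sign[OF ca_boundary_hom module_CA module_CA P[OF j]])
    also have "\<dots> = (\<Oplus>\<^bsub>?C\<^esub>l\<in>{..Suc i}. t (j, l))"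
      unfolding ca_boundary_eq t_def fst_conv snd_conv by (rule C.alt_sign_finsum_alt_sign[OF F[OF j]])
    finally show "ca_boundary k A (Suc i) (alt_sign (CA k A (Suc i)) j (ca_prism i j x y))
        = (\<Oplus>\<^bsub>?C\<^esub>l\<in>{..Suc i}. t (j, l))" .
  qed
  also have "\<dots> = (\<Oplus>\<^bsub>?C\<^esub>u\<in>{..i} \<times> {..Suc i}. t (fst u, snd u))"
    by (rule C.M.finsum_Sigma) (auto simp: tcl)
  also have "\<dots> = (\<Oplus>\<^bsub>?C\<^esub>u\<in>insert (0, 0) (insert (i, Suc i) ((I \<union> J) \<union> U)). t u)"
    unfolding all by simp
  also have "\<dots> = t (0, 0) \<oplus>\<^bsub>?C\<^esub> (t (i, Suc i) \<oplus>\<^bsub>?C\<^esub> (\<Oplus>\<^bsub>?C\<^esub>u\<in>(I \<union> J) \<union> U. t u))"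
  proof -
    have "(\<Oplus>\<^bsub>?C\<^esub>u\<in>insert (i, Suc i) ((I \<union> J) \<union> U). t u) = t (i, Suc i) \<oplus>\<^bsub>?C\<^esub> (\<Oplus>\<^bsub>?C\<^esub>u\<in>(I \<union> J) \<union> U. t u)"
      using fin notin(2) by (intro C.M.finsum_insert) (auto intro!: tcl idx)
    moreover have "(\<Oplus>\<^bsub>?C\<^esub>u\<in>insert (0, 0) (insert (i, Suc i) ((I \<union> J) \<union> U)). t u)
        = t (0, 0) \<oplus>\<^bsub>?C\<^esub> (\<Oplus>\<^bsub>?C\<^esub>u\<in>insert (i, Suc i) ((I \<union> J) \<union> U). t u)"
      using fin notin(1) by (intro C.M.finsum_insert) (auto intro!: tcl idx)
    ultimately show ?thesis by simp
  qed
  also have "(\<Oplus>\<^bsub>?C\<^esub>u\<in>(I \<union> J) \<union> U. t u) = (\<Oplus>\<^bsub>?C\<^esub>u\<in>I \<union> J. t u) \<oplus>\<^bsub>?C\<^esub> (\<Oplus>\<^bsub>?C\<^esub>u\<in>U. t u)"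
    using fin notin(3) by (intro C.M.finsum_Un_disjoint) (auto intro!: tcl idx)
  also have "(\<Oplus>\<^bsub>?C\<^esub>u\<in>I \<union> J. t u) = \<zero>\<^bsub>?C\<^esub>"
  proof (rule C.M.finsum_cancel[OF fin(1) notin(4)])
    show "bij_betw (\<lambda>(j, l). (j - 1, l)) I J"
      by (rule bij_betw_byWitness[where f' = "\<lambda>(j, l). (Suc j, l)"]) (auto simp: I_def J_def)
    show "t u \<in> carrier ?C" if "u \<in> I \<union> J" for u using that by (intro tcl idx) auto
    fix u assume "u \<in> I"
    then obtain j where u: "u = (Suc j, Suc j)" "Suc j \<le> i"
      by (cases u; cases "fst u") (auto simp: I_def)
    have "?F (Suc j) (Suc j) = ?F j (Suc j)" by (rule ca_face_prism_middle[OF x y u(2)])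
    then have "t (j, Suc j) = alt_sign ?C (j + Suc j) (?F (Suc j) (Suc j))" by (simp add: t_def)
    moreover have "t u = \<ominus>\<^bsub>?C\<^esub> alt_sign ?C (j + Suc j) (?F (Suc j) (Suc j))"
      unfolding t_def u fst_conv snd_conv add_Suc by (rule C.alt_sign_Suc[OF F[OF u(2)]])
    ultimately show "t (case u of (j, l) \<Rightarrow> (j - 1, l)) = \<ominus>\<^bsub>?C\<^esub> t u"
      using F[OF u(2)] by (simp add: u del: add_Suc_right)
  qed
  also have "t (0, 0) = ca_mult k A i y x"
    using ca_face_prism_first[OF x y] by (simp add: t_def alt_sign_def)
  also have "t (i, Suc i) = \<ominus>\<^bsub>?C\<^esub> ca_mult k A i x y"
    using ca_face_prism_last[OF x y] by (simp add: t_def alt_sign_def)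
  finally have bd: "ca_boundary k A (Suc i) (ca_homotopy i x y)
      = ca_mult k A i y x \<oplus>\<^bsub>?C\<^esub> (\<ominus>\<^bsub>?C\<^esub> ca_mult k A i x y \<oplus>\<^bsub>?C\<^esub> (\<zero>\<^bsub>?C\<^esub> \<oplus>\<^bsub>?C\<^esub> (\<Oplus>\<^bsub>?C\<^esub>u\<in>U. t u)))" .
  have faces: "ca_homotopy_faces i x y \<in> carrier ?C \<and> (\<Oplus>\<^bsub>?C\<^esub>u\<in>U. t u) = \<ominus>\<^bsub>?C\<^esub> ca_homotopy_faces i x y"
  proof (cases i)
    case 0
    then have "U = {}" by (auto simp: U_def)
    have zero: "\<ominus>\<^bsub>CA k A 0\<^esub> \<zero>\<^bsub>CA k A 0\<^esub> = \<zero>\<^bsub>CA k A 0\<^esub>"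
      by (rule module_hom_zero[OF module_hom_uminus[OF module_CA module_hom_id] module_CA module_CA])
    show ?thesis
      using 0 \<open>U = {}\<close> by (simp add: ca_homotopy_faces_def) (rule zero[symmetric])
  next
    case (Suc n)
    note x' = x[unfolded Suc] and y' = y[unfolded Suc]
    let ?G = "\<lambda>l j. ca_prism n j (ca_face k A i l x) (ca_face k A i l y)"
    have d: "ca_face k A i l x \<in> carrier (CA k A n)" "ca_face k A i l y \<in> carrier (CA k A n)" for l
      using module_homD(1)[OF ca_face_hom x'] module_homD(1)[OF ca_face_hom y'] Suc by simp_all
    have G: "?G l j \<in> carrier ?C" if "j \<le> n" for l j
      using bilinear_closed[OF ca_prism_bilinear[OF that] d] Suc by simp
    have Hc: "ca_homotopy n (ca_face k A i l x) (ca_face k A i l y) \<in> carrier ?C" for l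
      using bilinear_closed[OF ca_homotopy_bilinear d] Suc by simp
    have f1: "ca_homotopy_faces i x y = (\<Oplus>\<^bsub>?C\<^esub>l\<in>{..i}. alt_sign ?C l (ca_homotopy n (ca_face k A i l x) (ca_face k A i l y)))"
      by (simp only: ca_homotopy_faces_def Suc nat.case)
    also have "\<dots> = (\<Oplus>\<^bsub>?C\<^esub>l\<in>{..i}. \<Oplus>\<^bsub>?C\<^esub>j\<in>{..n}. alt_sign ?C (l + j) (?G l j))"
    proof (rule C.M.finsum_cong'[OF refl])
      show "(\<lambda>l. \<Oplus>\<^bsub>?C\<^esub>j\<in>{..n}. alt_sign ?C (l + j) (?G l j)) \<in> {..i} \<rightarrow> carrier ?C"
        using G by (intro funcsetI C.M.finsum_closed) auto
      show "alt_sign ?C l (ca_homotopy n (ca_face k A i l x) (ca_face k A i l y))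
          = (\<Oplus>\<^bsub>?C\<^esub>j\<in>{..n}. alt_sign ?C (l + j) (?G l j))" for l
        unfolding ca_homotopy_def Suc[symmetric] by (rule C.alt_sign_finsum_alt_sign) (simp add: G)
    qed
    also have "\<dots> = (\<Oplus>\<^bsub>?C\<^esub>u\<in>{..i} \<times> {..n}. alt_sign ?C (fst u + snd u) (?G (fst u) (snd u)))"
      by (rule C.M.finsum_Sigma) (auto simp: G)
    finally have f2: "ca_homotopy_faces i x y
        = (\<Oplus>\<^bsub>?C\<^esub>u\<in>{..i} \<times> {..n}. alt_sign ?C (fst u + snd u) (?G (fst u) (snd u)))" .
    \<comment> \<open>The face \<open>l\<close> of a prism in degree \<open>i\<close> that avoids the braiding is a prism in degree \<open>n\<close>: a face before it
      lowers \<open>j\<close>, a face behind it lowers \<open>l\<close>. In either case the parity of \<open>j + l\<close> changes.\<close>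
    have bij: "bij_betw (\<lambda>(l, j). if l \<le> j then (Suc j, l) else (j, Suc l)) ({..i} \<times> {..n}) U"
      by (rule bij_betw_byWitness[where f' = "\<lambda>(j, l). if l < j then (l, j - 1) else (l - 1, j)"])
         (auto simp: U_def Suc split: if_splits)
    have "(\<Oplus>\<^bsub>?C\<^esub>u\<in>U. t u) = (\<Oplus>\<^bsub>?C\<^esub>u\<in>{..i} \<times> {..n}. \<ominus>\<^bsub>?C\<^esub> alt_sign ?C (fst u + snd u) (?G (fst u) (snd u)))"
    proof (rule C.M.finsum_bij[OF bij, symmetric])
      show "t u \<in> carrier ?C" if "u \<in> U" for u using that by (intro tcl idx) auto
      fix u assume "u \<in> {..i} \<times> {..n}"
      then obtain l j where u: "u = (l, j)" "l \<le> i" "j \<le> n" by auto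
      note neg = C.alt_sign_Suc[OF G[OF u(3), of l], of "l + j", symmetric]
      show "\<ominus>\<^bsub>?C\<^esub> alt_sign ?C (fst u + snd u) (?G (fst u) (snd u))
          = t (case u of (l, j) \<Rightarrow> if l \<le> j then (Suc j, l) else (j, Suc l))"
      proof (cases "l \<le> j")
        case True
        then show ?thesis
          using neg ca_face_prism_below[OF x' y' True u(3)] by (simp add: u t_def Suc add.commute)
      next
        case False
        then show ?thesis
          using neg ca_face_prism_above[OF x' y', of j l] u by (simp add: t_def Suc add.commute)
      qed
    qed
    also have "\<dots> = \<ominus>\<^bsub>?C\<^esub> ca_homotopy_faces i x y"
      unfolding f2 by (rule C.M.finsum_uminus) (auto simp: G)
    finally show ?thesis using Hc by (simp add: f1)
  qed
  then show fc: "ca_homotopy_faces i x y \<in> carrier ?C" by simp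
  have yx: "ca_mult k A i y x \<in> carrier ?C" "ca_mult k A i x y \<in> carrier ?C"
    by (rule ca_mult_closed[OF y x], rule ca_mult_closed[OF x y])
  have "(a \<oplus>\<^bsub>?C\<^esub> (\<ominus>\<^bsub>?C\<^esub> b \<oplus>\<^bsub>?C\<^esub> (\<zero>\<^bsub>?C\<^esub> \<oplus>\<^bsub>?C\<^esub> \<ominus>\<^bsub>?C\<^esub> c))) \<oplus>\<^bsub>?C\<^esub> b \<oplus>\<^bsub>?C\<^esub> c = a"
    if "a \<in> carrier ?C" "b \<in> carrier ?C" "c \<in> carrier ?C" for a b c
  proof -
    have "(a \<oplus>\<^bsub>?C\<^esub> (\<ominus>\<^bsub>?C\<^esub> b \<oplus>\<^bsub>?C\<^esub> \<ominus>\<^bsub>?C\<^esub> c)) \<oplus>\<^bsub>?C\<^esub> b \<oplus>\<^bsub>?C\<^esub> c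
        = a \<oplus>\<^bsub>?C\<^esub> ((\<ominus>\<^bsub>?C\<^esub> b \<oplus>\<^bsub>?C\<^esub> b) \<oplus>\<^bsub>?C\<^esub> (\<ominus>\<^bsub>?C\<^esub> c \<oplus>\<^bsub>?C\<^esub> c))"
      using that by (simp add: C.M.a_ac)
    then show ?thesis using that by (simp add: C.M.l_neg)
  qed
  then show "ca_mult k A i y x = ca_boundary k A (Suc i) (ca_homotopy i x y) \<oplus>\<^bsub>?C\<^esub> ca_mult k A i x y
      \<oplus>\<^bsub>?C\<^esub> ca_homotopy_faces i x y"
    unfolding bd using faces yx by simp
qed

lemma ca_cycles_iff:
  "x \<in> ca_cycles k A p \<longleftrightarrow> x \<in> carrier (CA k A p) \<and> (\<forall>n. p = Suc n \<longrightarrow> ca_boundary k A p x = \<zero>\<^bsub>CA k A n\<^esub>)"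
  by (cases p) (auto simp: ca_cycles_def a_kernel_def')

text \<open>On cycles both terms of the Leibniz rule are shuffle sums with a zero argument.\<close>

lemma shuffle_leibniz_cycles:
  assumes M: "module k M" and b: "module_bilinear k (CA k A n) (CA k A n) M b" and n: "p + q = Suc n"
    and x: "x \<in> ca_cycles k A p" and y: "y \<in> ca_cycles k A q"
  shows "(\<Oplus>\<^bsub>M\<^esub>S\<in>shuffle_sets (Suc n) p. alt_sign M (crossings S ({..<Suc n} - S))
      (\<Oplus>\<^bsub>M\<^esub>j\<in>{..Suc n}. alt_sign M j
        (b (ca_face k A (Suc n) j (ca_spread k A p (Suc n) S x))
           (ca_face k A (Suc n) j (ca_spread k A q (Suc n) ({..<Suc n} - S) y))))) = \<zero>\<^bsub>M\<^esub>"
proof -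
  interpret M: module k M by fact
  have c: "x \<in> carrier (CA k A p)" "y \<in> carrier (CA k A q)" using x y by (simp_all add: ca_cycles_iff)
  have 1: "(if p = 0 then \<zero>\<^bsub>M\<^esub> else shuffle_sum k A M b (p - 1) q (ca_boundary k A p x) y) = \<zero>\<^bsub>M\<^esub>"
  proof (cases p)
    case (Suc p')
    have "module_bilinear k (CA k A (p' + q)) (CA k A (p' + q)) M b" using b n Suc by simp
    note h = bilinear_left[OF shuffle_sum_bilinear[OF M this] c(2)]
    have "ca_boundary k A p x = \<zero>\<^bsub>CA k A p'\<^esub>" using x Suc by (simp add: ca_cycles_iff)
    then show ?thesis using module_hom_zero[OF h module_CA M] Suc by simp
  qed simp
  have 2: "(if q = 0 then \<zero>\<^bsub>M\<^esub> else shuffle_sum k A M b p (q - 1) x (ca_boundary k A q y)) = \<zero>\<^bsub>M\<^esub>"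
  proof (cases q)
    case (Suc q')
    have "module_bilinear k (CA k A (p + q')) (CA k A (p + q')) M b" using b n Suc by simp
    note h = bilinear_right[OF shuffle_sum_bilinear[OF M this] c(1)]
    have "ca_boundary k A q y = \<zero>\<^bsub>CA k A q'\<^esub>" using y Suc by (simp add: ca_cycles_iff)
    then show ?thesis using module_hom_zero[OF h module_CA M] Suc by simp
  qed simp
  show ?thesis unfolding shuffle_leibniz[OF M b n c] 1 2 by simp
qed

lemma hom_shuffle_sum:
  assumes M: "module k M" and N: "module k N" and h: "h \<in> module_hom k M N"
    and b: "module_bilinear k (CA k A (p + q)) (CA k A (p + q)) M b"
    and x: "x \<in> carrier (CA k A p)" and y: "y \<in> carrier (CA k A q)"
  shows "h (shuffle_sum k A M b p q x y) = shuffle_sum k A N (\<lambda>u v. h (b u v)) p q x y"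
proof -
  interpret M: module k M by fact
  interpret N: module k N by fact
  have cl: "b (ca_spread k A p (p + q) S x) (ca_spread k A q (p + q) ({..<p + q} - S) y) \<in> carrier M"
    if "S \<in> shuffle_sets (p + q) p" for S
    by (intro bilinear_closed[OF b] spread_shuffle_closed that compl_shuffle_sets x y)
  have "h (shuffle_sum k A M b p q x y) = (\<Oplus>\<^bsub>N\<^esub>S\<in>shuffle_sets (p + q) p. h (alt_sign M (crossings S ({..<p + q} - S))
        (b (ca_spread k A p (p + q) S x) (ca_spread k A q (p + q) ({..<p + q} - S) y))))"
    unfolding shuffle_sum_def by (rule module_hom_finsum[OF h M N]) (simp add: cl)
  also have "\<dots> = shuffle_sum k A N (\<lambda>u v. h (b u v)) p q x y"
    unfolding shuffle_sum_def using cl module_homD(1)[OF h]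
    by (intro N.M.finsum_cong') (auto simp: hom_alt_sign[OF h M N])
  finally show ?thesis .
qed

lemma shuffle_product_boundary:
  assumes n: "p + q = Suc n" and x: "x \<in> carrier (CA k A p)" and y: "y \<in> carrier (CA k A q)"
  shows "ca_boundary k A (Suc n) (shuffle_product p q x y)
    = (if p = 0 then \<zero>\<^bsub>CA k A n\<^esub> else shuffle_sum k A (CA k A n) (ca_mult k A n) (p - 1) q (ca_boundary k A p x) y)
      \<oplus>\<^bsub>CA k A n\<^esub> alt_sign (CA k A n) p
        (if q = 0 then \<zero>\<^bsub>CA k A n\<^esub> else shuffle_sum k A (CA k A n) (ca_mult k A n) p (q - 1) x (ca_boundary k A q y))"
proof -
  let ?N = "Suc n"
  have cl: "ca_spread k A p ?N S x \<in> carrier (CA k A ?N)" "ca_spread k A q ?N ({..<?N} - S) y \<in> carrier (CA k A ?N)"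
    if "S \<in> shuffle_sets ?N p" for S
    using spread_shuffle_closed[OF that x] spread_shuffle_closed[OF compl_shuffle_sets y, of S p] that n by simp_all
  have "ca_boundary k A ?N (shuffle_product p q x y)
     = shuffle_sum k A (CA k A n) (\<lambda>u v. ca_boundary k A ?N (ca_mult k A ?N u v)) p q x y"
    using hom_shuffle_sum[OF module_CA module_CA ca_boundary_hom _ x y, of n "ca_mult k A (Suc n)"] ca_mult_bilinear n
    by simp
  also have "\<dots> = (\<Oplus>\<^bsub>CA k A n\<^esub>S\<in>shuffle_sets ?N p. alt_sign (CA k A n) (crossings S ({..<?N} - S))
      (\<Oplus>\<^bsub>CA k A n\<^esub>j\<in>{..?N}. alt_sign (CA k A n) j
        (ca_mult k A n (ca_face k A ?N j (ca_spread k A p ?N S x))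
           (ca_face k A ?N j (ca_spread k A q ?N ({..<?N} - S) y)))))"
    unfolding shuffle_sum_def n
  proof (rule C.M.finsum_cong'[OF refl])
    fix S assume S: "S \<in> shuffle_sets ?N p"
    have f: "ca_face k A ?N j (ca_spread k A p ?N S x) \<in> carrier (CA k A n)"
      "ca_face k A ?N j (ca_spread k A q ?N ({..<?N} - S) y) \<in> carrier (CA k A n)" for j
      by (rule module_homD(1)[OF ca_face_hom cl(1)[OF S]], rule module_homD(1)[OF ca_face_hom cl(2)[OF S]])
    have "ca_boundary k A ?N (ca_mult k A ?N (ca_spread k A p ?N S x) (ca_spread k A q ?N ({..<?N} - S) y))
       = (\<Oplus>\<^bsub>CA k A n\<^esub>j\<in>{..?N}. alt_sign (CA k A n) j
        (ca_mult k A n (ca_face k A ?N j (ca_spread k A p ?N S x))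
           (ca_face k A ?N j (ca_spread k A q ?N ({..<?N} - S) y))))"
      unfolding ca_boundary_eq
      by (rule C.M.finsum_cong'[OF refl]) (auto simp: ca_face_mult[OF cl[OF S]] ca_mult_closed f)
    then show "alt_sign (CA k A n) (crossings S ({..<?N} - S))
       (ca_boundary k A ?N (ca_mult k A ?N (ca_spread k A p ?N S x) (ca_spread k A q ?N ({..<?N} - S) y)))
       = alt_sign (CA k A n) (crossings S ({..<?N} - S)) (\<Oplus>\<^bsub>CA k A n\<^esub>j\<in>{..?N}. alt_sign (CA k A n) j
        (ca_mult k A n (ca_face k A ?N j (ca_spread k A p ?N S x))
           (ca_face k A ?N j (ca_spread k A q ?N ({..<?N} - S) y))))" by (rule arg_cong)
  next
    have "ca_mult k A n (ca_face k A ?N j (ca_spread k A p ?N S x)) (ca_face k A ?N j (ca_spread k A q ?N ({..<?N} - S) y))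
        \<in> carrier (CA k A n)" if "S \<in> shuffle_sets ?N p" for S j
      by (intro ca_mult_closed module_homD(1)[OF ca_face_hom] cl that)
    then show "(\<lambda>S. alt_sign (CA k A n) (crossings S ({..<?N} - S)) (\<Oplus>\<^bsub>CA k A n\<^esub>j\<in>{..?N}. alt_sign (CA k A n) j
        (ca_mult k A n (ca_face k A ?N j (ca_spread k A p ?N S x))
           (ca_face k A ?N j (ca_spread k A q ?N ({..<?N} - S) y))))) \<in> shuffle_sets ?N p \<rightarrow> carrier (CA k A n)"
      by (intro funcsetI C.alt_sign_closed C.M.finsum_closed) simp
  qed
  finally show ?thesis using shuffle_leibniz[OF module_CA ca_mult_bilinear n x y] by simp
qed

lemma shuffle_product_cycles:
  assumes x: "x \<in> ca_cycles k A p" and y: "y \<in> ca_cycles k A q"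
  shows "shuffle_product p q x y \<in> ca_cycles k A (p + q)"
proof -
  have c: "x \<in> carrier (CA k A p)" "y \<in> carrier (CA k A q)" using x y by (simp_all add: ca_cycles_iff)
  have "ca_boundary k A (Suc n) (shuffle_product p q x y) = \<zero>\<^bsub>CA k A n\<^esub>" if n: "p + q = Suc n" for n
    using shuffle_product_boundary[OF n c] shuffle_leibniz[OF module_CA ca_mult_bilinear n c]
      shuffle_leibniz_cycles[OF module_CA ca_mult_bilinear n x y] by simp
  then show ?thesis using shuffle_product_closed[OF c] by (auto simp: ca_cycles_iff)
qed

lemma ca_boundariesE:
  assumes "b \<in> ca_boundaries k A p"
  obtains u where "u \<in> carrier (CA k A (Suc p))" "b = ca_boundary k A (Suc p) u"
  using assms by (auto simp: ca_boundaries_def)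

lemma shuffle_product_boundaries:
  shows "x \<in> ca_boundaries k A p \<Longrightarrow> y \<in> ca_cycles k A q \<Longrightarrow> shuffle_product p q x y \<in> ca_boundaries k A (p + q)"
    and "x \<in> ca_cycles k A p \<Longrightarrow> y \<in> ca_boundaries k A q \<Longrightarrow> shuffle_product p q x y \<in> ca_boundaries k A (p + q)"
proof -
  assume x: "x \<in> ca_boundaries k A p" and y: "y \<in> ca_cycles k A q"
  obtain u where u: "u \<in> carrier (CA k A (Suc p))" "x = ca_boundary k A (Suc p) u" using x by (rule ca_boundariesE)
  have yc: "y \<in> carrier (CA k A q)" using y by (simp add: ca_cycles_iff)
  have xc: "x \<in> carrier (CA k A p)" unfolding u(2) by (rule module_homD(1)[OF ca_boundary_hom u(1)])
  have z: "(if q = 0 then \<zero>\<^bsub>CA k A (p + q)\<^esub> else shuffle_sum k A (CA k A (p + q)) (ca_mult k A (p + q)) (Suc p) (q - 1) u (ca_boundary k A q y)) = \<zero>\<^bsub>CA k A (p + q)\<^esub>"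
  proof (cases q)
    case (Suc q')
    have "module_bilinear k (CA k A (Suc p + q')) (CA k A (Suc p + q')) (CA k A (p + q)) (ca_mult k A (p + q))"
      using ca_mult_bilinear[of "p + q"] Suc by simp
    note h = bilinear_right[OF shuffle_sum_bilinear[OF module_CA this] u(1)]
    have "ca_boundary k A q y = \<zero>\<^bsub>CA k A q'\<^esub>" using y Suc by (simp add: ca_cycles_iff)
    then show ?thesis using module_hom_zero[OF h module_CA module_CA] Suc by simp
  qed simp
  have "ca_boundary k A (Suc (p + q)) (shuffle_product (Suc p) q u y) = shuffle_product p q x y"
    using shuffle_product_boundary[of "Suc p" q "p + q" u y] u yc z shuffle_product_closed[OF xc yc] by simp
  moreover have "shuffle_product (Suc p) q u y \<in> carrier (CA k A (Suc (p + q)))" using shuffle_product_closed[OF u(1) yc] by simp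
  ultimately show "shuffle_product p q x y \<in> ca_boundaries k A (p + q)" unfolding ca_boundaries_def by (metis imageI)
next
  assume x: "x \<in> ca_cycles k A p" and y: "y \<in> ca_boundaries k A q"
  obtain u where u: "u \<in> carrier (CA k A (Suc q))" "y = ca_boundary k A (Suc q) u" using y by (rule ca_boundariesE)
  have xc: "x \<in> carrier (CA k A p)" using x by (simp add: ca_cycles_iff)
  have yc: "y \<in> carrier (CA k A q)" unfolding u(2) by (rule module_homD(1)[OF ca_boundary_hom u(1)])
  have z: "(if p = 0 then \<zero>\<^bsub>CA k A (p + q)\<^esub> else shuffle_sum k A (CA k A (p + q)) (ca_mult k A (p + q)) (p - 1) (Suc q) (ca_boundary k A p x) u) = \<zero>\<^bsub>CA k A (p + q)\<^esub>"
  proof (cases p)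
    case (Suc p')
    have "module_bilinear k (CA k A (p' + Suc q)) (CA k A (p' + Suc q)) (CA k A (p + q)) (ca_mult k A (p + q))"
      using ca_mult_bilinear[of "p + q"] Suc by simp
    note h = bilinear_left[OF shuffle_sum_bilinear[OF module_CA this] u(1)]
    have "ca_boundary k A p x = \<zero>\<^bsub>CA k A p'\<^esub>" using x Suc by (simp add: ca_cycles_iff)
    then show ?thesis using module_hom_zero[OF h module_CA module_CA] Suc by simp
  qed simp
  note sc = shuffle_product_closed[OF xc yc]
  have "ca_boundary k A (Suc (p + q)) (shuffle_product p (Suc q) x u) = alt_sign (CA k A (p + q)) p (shuffle_product p q x y)"
    using shuffle_product_boundary[of p "Suc q" "p + q" x u] u xc z sc by simp
  moreover have w: "shuffle_product p (Suc q) x u \<in> carrier (CA k A (Suc (p + q)))" using shuffle_product_closed[OF xc u(1)] by simp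
  ultimately have "ca_boundary k A (Suc (p + q)) (alt_sign (CA k A (Suc (p + q))) p (shuffle_product p (Suc q) x u))
      = alt_sign (CA k A (p + q)) p (alt_sign (CA k A (p + q)) p (shuffle_product p q x y))"
    using hom_alt_sign[OF ca_boundary_hom module_CA module_CA] by simp
  also have "\<dots> = shuffle_product p q x y" using sc by (simp add: alt_sign_def)
  finally show "shuffle_product p q x y \<in> ca_boundaries k A (p + q)"
    unfolding ca_boundaries_def using C.alt_sign_closed[OF w] by (metis imageI)
qed

text \<open>The boundary is that of the shuffle sum \<open>Z\<close> of the homotopy. Its difference from the two products is the shuffle
sum of the error terms \<open>ca_homotopy_faces\<close>, which is the left-hand side of the Leibniz rule for the
homotopy as the bilinear map, and so vanishes on cycles.\<close>

lemma shuffle_product_commute: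
  assumes x: "x \<in> ca_cycles k A p" and y: "y \<in> ca_cycles k A q"
  obtains b where "b \<in> ca_boundaries k A (p + q)"
    "alt_sign (CA k A (p + q)) (p * q) (shuffle_product q p y x) = b \<oplus>\<^bsub>CA k A (p + q)\<^esub> shuffle_product p q x y"
proof -
  let ?n = "p + q"
  let ?C = "CA k A ?n"
  let ?u = "\<lambda>S. ca_spread k A p ?n S x" and ?v = "\<lambda>S. ca_spread k A q ?n ({..<?n} - S) y"
  let ?s = "\<lambda>S. alt_sign ?C (crossings S ({..<?n} - S))"
  have c: "x \<in> carrier (CA k A p)" "y \<in> carrier (CA k A q)" using x y by (simp_all add: ca_cycles_iff)
  have cl: "?u S \<in> carrier ?C" "?v S \<in> carrier ?C" if "S \<in> shuffle_sets ?n p" for S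
    using spread_shuffle_closed[OF that c(1)] spread_shuffle_closed[OF compl_shuffle_sets[OF that] c(2)] by simp_all
  define Z where "Z = shuffle_sum k A (CA k A (Suc ?n)) (ca_homotopy ?n) p q x y"
  have Z: "Z \<in> carrier (CA k A (Suc ?n))"
    unfolding Z_def by (rule shuffle_sum_closed[OF module_CA ca_homotopy_bilinear c])
  have bZ: "ca_boundary k A (Suc ?n) Z = (\<Oplus>\<^bsub>?C\<^esub>S\<in>shuffle_sets ?n p. ?s S (ca_boundary k A (Suc ?n) (ca_homotopy ?n (?u S) (?v S))))"
    unfolding Z_def hom_shuffle_sum[OF module_CA module_CA ca_boundary_hom ca_homotopy_bilinear c]
    by (simp add: shuffle_sum_def)
  have hcl: "ca_boundary k A (Suc ?n) (ca_homotopy ?n (?u S) (?v S)) \<in> carrier ?C"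
    "ca_mult k A ?n (?u S) (?v S) \<in> carrier ?C" "ca_homotopy_faces ?n (?u S) (?v S) \<in> carrier ?C"
    if "S \<in> shuffle_sets ?n p" for S
    using module_homD(1)[OF ca_boundary_hom bilinear_closed[OF ca_homotopy_bilinear cl[OF that]]]
      ca_mult_closed[OF cl[OF that]] ca_homotopy_boundary(2)[OF cl[OF that]] by simp_all
  have "alt_sign ?C (q * p) (shuffle_product q p y x) = shuffle_sum k A ?C (\<lambda>u v. ca_mult k A ?n v u) p q x y"
    using shuffle_sum_flip[of ?C q p "ca_mult k A ?n" y x] module_CA ca_mult_bilinear[of ?n] c
    by (simp add: add.commute[of q p])
  also have "\<dots> = (\<Oplus>\<^bsub>?C\<^esub>S\<in>shuffle_sets ?n p. ?s S (ca_boundary k A (Suc ?n) (ca_homotopy ?n (?u S) (?v S)))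
      \<oplus>\<^bsub>?C\<^esub> ?s S (ca_mult k A ?n (?u S) (?v S)) \<oplus>\<^bsub>?C\<^esub> ?s S (ca_homotopy_faces ?n (?u S) (?v S)))"
    unfolding shuffle_sum_def
  proof (rule C.M.finsum_cong'[OF refl])
    fix S assume S: "S \<in> shuffle_sets ?n p"
    show "?s S (ca_mult k A ?n (?v S) (?u S))
        = ?s S (ca_boundary k A (Suc ?n) (ca_homotopy ?n (?u S) (?v S)))
      \<oplus>\<^bsub>?C\<^esub> ?s S (ca_mult k A ?n (?u S) (?v S)) \<oplus>\<^bsub>?C\<^esub> ?s S (ca_homotopy_faces ?n (?u S) (?v S))"
      unfolding ca_homotopy_boundary(1)[OF cl[OF S]] using hcl[OF S]
      by (simp add: alt_sign_add[OF module_CA])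
  qed (use hcl in auto)
  also have "\<dots> = (\<Oplus>\<^bsub>?C\<^esub>S\<in>shuffle_sets ?n p. ?s S (ca_boundary k A (Suc ?n) (ca_homotopy ?n (?u S) (?v S)))
      \<oplus>\<^bsub>?C\<^esub> ?s S (ca_mult k A ?n (?u S) (?v S))) \<oplus>\<^bsub>?C\<^esub> (\<Oplus>\<^bsub>?C\<^esub>S\<in>shuffle_sets ?n p. ?s S (ca_homotopy_faces ?n (?u S) (?v S)))"
    using hcl by (intro C.M.finsum_addf) auto
  also have "(\<Oplus>\<^bsub>?C\<^esub>S\<in>shuffle_sets ?n p. ?s S (ca_boundary k A (Suc ?n) (ca_homotopy ?n (?u S) (?v S)))
      \<oplus>\<^bsub>?C\<^esub> ?s S (ca_mult k A ?n (?u S) (?v S))) = ca_boundary k A (Suc ?n) Z \<oplus>\<^bsub>?C\<^esub> shuffle_product p q x y"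
    unfolding bZ shuffle_sum_def using hcl by (intro C.M.finsum_addf) auto
  also have "(\<Oplus>\<^bsub>?C\<^esub>S\<in>shuffle_sets ?n p. ?s S (ca_homotopy_faces ?n (?u S) (?v S))) = \<zero>\<^bsub>?C\<^esub>"
  proof (cases ?n)
    case 0
    then have "?s S (ca_homotopy_faces ?n (?u S) (?v S)) = \<zero>\<^bsub>?C\<^esub>" for S
      by (simp only: ca_homotopy_faces_def nat.case C.alt_sign_zero)
    then show ?thesis by (simp add: C.M.finsum_zero)
  next
    case (Suc m)
    show ?thesis
      using shuffle_leibniz_cycles[OF module_CA[of "Suc m"] ca_homotopy_bilinear[of m] Suc x y]
      unfolding ca_homotopy_faces_def Suc nat.case .
  qed
  finally have "alt_sign ?C (p * q) (shuffle_product q p y x) = ca_boundary k A (Suc ?n) Z \<oplus>\<^bsub>?C\<^esub> shuffle_product p q x y"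
    using shuffle_product_closed[OF c] module_homD(1)[OF ca_boundary_hom Z] by (simp add: mult.commute)
  moreover have "ca_boundary k A (Suc ?n) Z \<in> ca_boundaries k A ?n"
    unfolding ca_boundaries_def using Z by (rule imageI)
  ultimately show thesis using that by blast
qed

end

section \<open>The algebra structure on symmetric homology\<close>

context assoc_algebra
begin

interpretation C: module k "CA k A n" for n by (rule module_CA)

lemma submodule_cycles: "submodule (ca_cycles k A i) k (CA k A i)"
proof (cases i)
  case 0
  then show ?thesis by (simp add: ca_cycles_def C.carrier_is_submodule)
next
  case (Suc n)
  have "ca_cycles k A i = {x \<in> carrier (CA k A (Suc n)). ca_boundary k A (Suc n) x = \<zero>\<^bsub>CA k A n\<^esub>}"
    using Suc by (auto simp: ca_cycles_iff)
  then show ?thesis using submodule_kernel[OF ca_boundary_hom module_CA module_CA] Suc by simp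
qed

lemma submodule_boundaries: "submodule (ca_boundaries k A i) k (CA k A i)"
  unfolding ca_boundaries_def by (rule submodule_image[OF ca_boundary_hom module_CA module_CA])

lemma boundaries_cycles: "ca_boundaries k A i \<subseteq> ca_cycles k A i"
proof
  fix b assume "b \<in> ca_boundaries k A i"
  then obtain u where "u \<in> carrier (CA k A (Suc i))" "b = ca_boundary k A (Suc i) u" by (rule ca_boundariesE)
  then show "b \<in> ca_cycles k A i"
    using module_homD(1)[OF ca_boundary_hom] ca_boundary_boundary by (auto simp: ca_cycles_iff)
qed

text \<open>Homology is the quotient of the cycles, regarded as a module of their own, whereas classes are
formed as cosets in the module of all chains. The cosets are the same, but additive inverses are defined
through the carrier, so that statements involving signs have to be transferred (\<open>hs_class_alt_sign\<close>).\<close>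

abbreviation cycle_module where "cycle_module i \<equiv> (CA k A i)\<lparr>carrier := ca_cycles k A i\<rparr>"

lemma module_cycle_module: "module k (cycle_module i)"
  by (rule submodule.submodule_is_module[OF submodule_cycles module_CA])

lemma submodule_boundaries_cycle_module: "submodule (ca_boundaries k A i) k (cycle_module i)"
proof (rule module.module_incl_imp_submodule[OF module_cycle_module])
  show "ca_boundaries k A i \<subseteq> carrier (cycle_module i)" using boundaries_cycles by simp
  show "module k ((cycle_module i)\<lparr>carrier := ca_boundaries k A i\<rparr>)"
    using submodule.submodule_is_module[OF submodule_boundaries module_CA] by simp
qed

lemma hs_class_cycle_module: "hs_class k A i z = ca_boundaries k A i +>\<^bsub>cycle_module i\<^esub> z"
  by (simp add: hs_class_def a_r_coset_def')

lemma module_HS: "module k (HS k A i)"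
  unfolding HS_def by (rule module_quot_mod[OF module_cycle_module submodule_boundaries_cycle_module])

lemma carrier_HS: "carrier (HS k A i) = hs_class k A i ` ca_cycles k A i"
  unfolding HS_def quot_mod_simps(1) by (simp add: hs_class_cycle_module)

lemma hs_class_hom: "hs_class k A i \<in> module_hom k (cycle_module i) (HS k A i)"
proof -
  have "hs_class k A i = (\<lambda>z. ca_boundaries k A i +>\<^bsub>cycle_module i\<^esub> z)"
    by (rule ext) (rule hs_class_cycle_module)
  then show ?thesis
    unfolding HS_def using coset_hom[OF module_cycle_module submodule_boundaries_cycle_module, of i] by (simp only:)
qed

lemma hs_class_linear:
  shows hs_class_closed: "z \<in> ca_cycles k A i \<Longrightarrow> hs_class k A i z \<in> carrier (HS k A i)"
    and hs_class_add: "z \<in> ca_cycles k A i \<Longrightarrow> w \<in> ca_cycles k A i \<Longrightarrow>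
      hs_class k A i (z \<oplus>\<^bsub>CA k A i\<^esub> w) = hs_class k A i z \<oplus>\<^bsub>HS k A i\<^esub> hs_class k A i w"
    and hs_class_smult: "r \<in> carrier k \<Longrightarrow> z \<in> ca_cycles k A i \<Longrightarrow>
      hs_class k A i (r \<odot>\<^bsub>CA k A i\<^esub> z) = r \<odot>\<^bsub>HS k A i\<^esub> hs_class k A i z"
  using module_homD[OF hs_class_hom] by simp_all

lemma cycles_closed:
  shows "x \<in> ca_cycles k A i \<Longrightarrow> x \<in> carrier (CA k A i)"
    and "x \<in> ca_cycles k A i \<Longrightarrow> y \<in> ca_cycles k A i \<Longrightarrow> x \<oplus>\<^bsub>CA k A i\<^esub> y \<in> ca_cycles k A i"
    and "r \<in> carrier k \<Longrightarrow> x \<in> ca_cycles k A i \<Longrightarrow> r \<odot>\<^bsub>CA k A i\<^esub> x \<in> ca_cycles k A i"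
    and "x \<in> ca_cycles k A i \<Longrightarrow> \<ominus>\<^bsub>CA k A i\<^esub> x \<in> ca_cycles k A i"
    and "b \<in> ca_boundaries k A i \<Longrightarrow> b \<in> ca_cycles k A i"
  using subsetD[OF C.submoduleE(1)[OF submodule_cycles]] C.submoduleE(5)[OF submodule_cycles]
    C.submoduleE(4)[OF submodule_cycles] C.submoduleE(3)[OF submodule_cycles] subsetD[OF boundaries_cycles]
  by simp_all

lemma hs_class_eq_if_boundary:
  assumes b: "b \<in> ca_boundaries k A i" and z: "z \<in> ca_cycles k A i"
  shows "hs_class k A i (b \<oplus>\<^bsub>CA k A i\<^esub> z) = hs_class k A i z"
proof -
  note c = cycles_closed(1)[OF cycles_closed(5)[OF b]] cycles_closed(1)[OF z]
  have "(b \<oplus>\<^bsub>CA k A i\<^esub> z) \<ominus>\<^bsub>CA k A i\<^esub> z = b"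
    using c by (simp add: a_minus_def C.M.a_assoc C.M.r_neg)
  then show ?thesis unfolding hs_class_def
    using coset_eq_iff[OF module_CA submodule_boundaries, of "b \<oplus>\<^bsub>CA k A i\<^esub> z" i z] c b by simp
qed

lemma hs_class_alt_sign:
  assumes z: "z \<in> ca_cycles k A i"
  shows "hs_class k A i (alt_sign (CA k A i) n z) = alt_sign (HS k A i) n (hs_class k A i z)"
proof -
  interpret H: module k "HS k A i" by (rule module_HS)
  note c = cycles_closed(1)[OF z] and m = cycles_closed(4)[OF z]
  have "hs_class k A i (\<ominus>\<^bsub>CA k A i\<^esub> z) \<oplus>\<^bsub>HS k A i\<^esub> hs_class k A i z = hs_class k A i (\<zero>\<^bsub>CA k A i\<^esub>)"
    using hs_class_add[OF m z] c by (simp add: C.M.l_neg)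
  also have "\<dots> = \<zero>\<^bsub>HS k A i\<^esub>"
    using module_hom_zero[OF hs_class_hom module_cycle_module module_HS] by simp
  finally have "\<ominus>\<^bsub>HS k A i\<^esub> hs_class k A i z = hs_class k A i (\<ominus>\<^bsub>CA k A i\<^esub> z)"
    using hs_class_closed[OF m] hs_class_closed[OF z] by (intro H.M.minus_equality)
  then show ?thesis by (simp add: alt_sign_def)
qed

lemma ca_shuffle_mult_shuffle_product:
  "x \<in> ca_cycles k A p \<Longrightarrow> y \<in> ca_cycles k A q \<Longrightarrow> ca_shuffle_mult k A p q x y = shuffle_product p q x y"
  by (rule ca_shuffle_mult_eq) (rule cycles_closed(1), assumption)+

lemma shuffle_product_class_cong:
  assumes b: "b \<in> ca_boundaries k A p" and c: "c \<in> ca_boundaries k A q"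
    and x: "x \<in> ca_cycles k A p" and y: "y \<in> ca_cycles k A q"
  shows "hs_class k A (p + q) (shuffle_product p q (b \<oplus>\<^bsub>CA k A p\<^esub> x) (c \<oplus>\<^bsub>CA k A q\<^esub> y)) = hs_class k A (p + q) (shuffle_product p q x y)"
proof -
  note cc = cycles_closed(1)
  let ?y = "c \<oplus>\<^bsub>CA k A q\<^esub> y"
  have y': "?y \<in> ca_cycles k A q" by (rule cycles_closed(2)[OF cycles_closed(5)[OF c] y])
  note bl = shuffle_product_bilinear[of p q]
  have "shuffle_product p q (b \<oplus>\<^bsub>CA k A p\<^esub> x) ?y = shuffle_product p q b ?y \<oplus>\<^bsub>CA k A (p + q)\<^esub> shuffle_product p q x ?y"
    by (rule module_homD(2)[OF bilinear_left[OF bl cc[OF y']] cc[OF cycles_closed(5)[OF b]] cc[OF x]])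
  then have "hs_class k A (p + q) (shuffle_product p q (b \<oplus>\<^bsub>CA k A p\<^esub> x) ?y) = hs_class k A (p + q) (shuffle_product p q x ?y)"
    using hs_class_eq_if_boundary[OF shuffle_product_boundaries(1)[OF b y'] shuffle_product_cycles[OF x y']] by simp
  also have "shuffle_product p q x ?y = shuffle_product p q x c \<oplus>\<^bsub>CA k A (p + q)\<^esub> shuffle_product p q x y"
    by (rule module_homD(2)[OF bilinear_right[OF bl cc[OF x]] cc[OF cycles_closed(5)[OF c]] cc[OF y]])
  also have "hs_class k A (p + q) \<dots> = hs_class k A (p + q) (shuffle_product p q x y)"
    by (rule hs_class_eq_if_boundary[OF shuffle_product_boundaries(2)[OF x c] shuffle_product_cycles[OF x y]])
  finally show ?thesis .
qed

text \<open>The representatives of a class differ by boundaries, and a product with a boundary is a boundary. So the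
set of all product classes formed from representatives is a singleton, and \<open>pontryagin\<close> is its element.\<close>

lemma pontryagin_class:
  assumes x: "x \<in> ca_cycles k A p" and y: "y \<in> ca_cycles k A q"
  shows "pontryagin k A p q (hs_class k A p x) (hs_class k A q y) = hs_class k A (p + q) (shuffle_product p q x y)"
proof -
  have mem: "u \<in> hs_class k A i z \<longleftrightarrow> (\<exists>b\<in>ca_boundaries k A i. u = b \<oplus>\<^bsub>CA k A i\<^esub> z)" for u i z
    by (auto simp: hs_class_def a_r_coset_def')
  have val: "hs_class k A (p + q) (ca_shuffle_mult k A p q u v) = hs_class k A (p + q) (shuffle_product p q x y)"
    if u: "u \<in> hs_class k A p x" and v: "v \<in> hs_class k A q y" for u v
  proof -
    obtain b where b: "b \<in> ca_boundaries k A p" "u = b \<oplus>\<^bsub>CA k A p\<^esub> x"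
      using u[unfolded mem] by (rule bexE)
    obtain c where c: "c \<in> ca_boundaries k A q" "v = c \<oplus>\<^bsub>CA k A q\<^esub> y"
      using v[unfolded mem] by (rule bexE)
    have "u \<in> ca_cycles k A p"
      unfolding b(2) by (rule cycles_closed(2)[OF cycles_closed(5)[OF b(1)] x])
    moreover have "v \<in> ca_cycles k A q"
      unfolding c(2) by (rule cycles_closed(2)[OF cycles_closed(5)[OF c(1)] y])
    ultimately show ?thesis using shuffle_product_class_cong[OF b(1) c(1) x y] by (simp add: ca_shuffle_mult_shuffle_product b(2) c(2))
  qed
  have self: "x \<in> hs_class k A p x" "y \<in> hs_class k A q y"
    unfolding hs_class_def
    by (rule abelian_subgroup.a_rcos_self[OF submodule_abelian_subgroup[OF module_CA submodule_boundaries]],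
        rule cycles_closed(1), rule x y)+
  have "(\<lambda>(u, v). hs_class k A (p + q) (ca_shuffle_mult k A p q u v)) ` (hs_class k A p x \<times> hs_class k A q y)
      = (\<lambda>_. hs_class k A (p + q) (shuffle_product p q x y)) ` (hs_class k A p x \<times> hs_class k A q y)"
    by (rule image_cong) (auto simp: val)
  also have "\<dots> = {hs_class k A (p + q) (shuffle_product p q x y)}"
    by (rule image_constant[of "(x, y)"]) (use self in blast)
  finally have "(\<lambda>(u, v). hs_class k A (p + q) (ca_shuffle_mult k A p q u v)) ` (hs_class k A p x \<times> hs_class k A q y)
      = {hs_class k A (p + q) (shuffle_product p q x y)}" .
  then show ?thesis unfolding pontryagin_def by (metis the_elem_eq)
qed

lemma pontryagin_bilinear:
  "module_bilinear k (HS k A p) (HS k A q) (HS k A (p + q)) (pontryagin k A p q)"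
  unfolding module_bilinear_def
proof (intro conjI ballI)
  note cl = cycles_closed
  fix Y assume "Y \<in> carrier (HS k A q)"
  then obtain y where y: "y \<in> ca_cycles k A q" "Y = hs_class k A q y" by (auto simp: carrier_HS)
  note h = bilinear_left[OF shuffle_product_bilinear[of p q] cl(1)[OF y(1)]]
  show "(\<lambda>X. pontryagin k A p q X Y) \<in> module_hom k (HS k A p) (HS k A (p + q))"
  proof (rule module_homI)
    fix X assume "X \<in> carrier (HS k A p)"
    then obtain x where x: "x \<in> ca_cycles k A p" "X = hs_class k A p x" by (auto simp: carrier_HS)
    show "pontryagin k A p q X Y \<in> carrier (HS k A (p + q))"
      unfolding x y pontryagin_class[OF x(1) y(1)] by (rule hs_class_closed[OF shuffle_product_cycles[OF x(1) y(1)]])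
    show "pontryagin k A p q (r \<odot>\<^bsub>HS k A p\<^esub> X) Y = r \<odot>\<^bsub>HS k A (p + q)\<^esub> pontryagin k A p q X Y"
      if r: "r \<in> carrier k" for r
      unfolding x y hs_class_smult[OF r x(1), symmetric] pontryagin_class[OF x(1) y(1)]
        pontryagin_class[OF cl(3)[OF r x(1)] y(1)] module_homD(3)[OF h r cl(1)[OF x(1)]]
      by (rule hs_class_smult[OF r shuffle_product_cycles[OF x(1) y(1)]])
    fix X' assume "X' \<in> carrier (HS k A p)"
    then obtain x' where x': "x' \<in> ca_cycles k A p" "X' = hs_class k A p x'" by (auto simp: carrier_HS)
    show "pontryagin k A p q (X \<oplus>\<^bsub>HS k A p\<^esub> X') Y = pontryagin k A p q X Y \<oplus>\<^bsub>HS k A (p + q)\<^esub> pontryagin k A p q X' Y"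
      unfolding x y x' hs_class_add[OF x(1) x'(1), symmetric] pontryagin_class[OF x(1) y(1)]
        pontryagin_class[OF x'(1) y(1)] pontryagin_class[OF cl(2)[OF x(1) x'(1)] y(1)]
        module_homD(2)[OF h cl(1)[OF x(1)] cl(1)[OF x'(1)]]
      by (rule hs_class_add[OF shuffle_product_cycles[OF x(1) y(1)] shuffle_product_cycles[OF x'(1) y(1)]])
  qed
next
  note cl = cycles_closed
  fix X assume "X \<in> carrier (HS k A p)"
  then obtain x where x: "x \<in> ca_cycles k A p" "X = hs_class k A p x" by (auto simp: carrier_HS)
  note h = bilinear_right[OF shuffle_product_bilinear[of p q] cl(1)[OF x(1)]]
  show "pontryagin k A p q X \<in> module_hom k (HS k A q) (HS k A (p + q))"
  proof (rule module_homI)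
    fix Y assume "Y \<in> carrier (HS k A q)"
    then obtain y where y: "y \<in> ca_cycles k A q" "Y = hs_class k A q y" by (auto simp: carrier_HS)
    show "pontryagin k A p q X Y \<in> carrier (HS k A (p + q))"
      unfolding x y pontryagin_class[OF x(1) y(1)] by (rule hs_class_closed[OF shuffle_product_cycles[OF x(1) y(1)]])
    show "pontryagin k A p q X (r \<odot>\<^bsub>HS k A q\<^esub> Y) = r \<odot>\<^bsub>HS k A (p + q)\<^esub> pontryagin k A p q X Y"
      if r: "r \<in> carrier k" for r
      unfolding x y hs_class_smult[OF r y(1), symmetric] pontryagin_class[OF x(1) y(1)]
        pontryagin_class[OF x(1) cl(3)[OF r y(1)]] module_homD(3)[OF h r cl(1)[OF y(1)]]
      by (rule hs_class_smult[OF r shuffle_product_cycles[OF x(1) y(1)]])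
    fix Y' assume "Y' \<in> carrier (HS k A q)"
    then obtain y' where y': "y' \<in> ca_cycles k A q" "Y' = hs_class k A q y'" by (auto simp: carrier_HS)
    show "pontryagin k A p q X (Y \<oplus>\<^bsub>HS k A q\<^esub> Y') = pontryagin k A p q X Y \<oplus>\<^bsub>HS k A (p + q)\<^esub> pontryagin k A p q X Y'"
      unfolding x y y' hs_class_add[OF y(1) y'(1), symmetric] pontryagin_class[OF x(1) y(1)]
        pontryagin_class[OF x(1) y'(1)] pontryagin_class[OF x(1) cl(2)[OF y(1) y'(1)]]
        module_homD(2)[OF h cl(1)[OF y(1)] cl(1)[OF y'(1)]]
      by (rule hs_class_add[OF shuffle_product_cycles[OF x(1) y(1)] shuffle_product_cycles[OF x(1) y'(1)]])
  qed
qed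

lemma graded_comm_algebra_HS: "graded_comm_algebra k (HS k A) (pontryagin k A)"
proof (rule graded_comm_algebra.intro)
  show "module k (HS k A n)" for n by (rule module_HS)
  show "module_bilinear k (HS k A p) (HS k A q) (HS k A (p + q)) (pontryagin k A p q)" for p q
    by (rule pontryagin_bilinear)
  show "pontryagin k A (p + q) r (pontryagin k A p q X Y) Z = pontryagin k A p (q + r) X (pontryagin k A q r Y Z)"
    if "X \<in> carrier (HS k A p)" "Y \<in> carrier (HS k A q)" "Z \<in> carrier (HS k A r)" for X p Y q Z r
  proof -
    obtain x y z where x: "x \<in> ca_cycles k A p" "X = hs_class k A p x"
      and y: "y \<in> ca_cycles k A q" "Y = hs_class k A q y"
      and z: "z \<in> ca_cycles k A r" "Z = hs_class k A r z"
      using \<open>X \<in> _\<close> \<open>Y \<in> _\<close> \<open>Z \<in> _\<close> by (auto simp: carrier_HS)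
    note c = cycles_closed(1)
    show ?thesis
      unfolding x(2) y(2) z(2) pontryagin_class[OF x(1) y(1)] pontryagin_class[OF y(1) z(1)]
        pontryagin_class[OF shuffle_product_cycles[OF x(1) y(1)] z(1)] pontryagin_class[OF x(1) shuffle_product_cycles[OF y(1) z(1)]]
        shuffle_product_assoc[OF c[OF x(1)] c[OF y(1)] c[OF z(1)]]
      by (simp only: add.assoc)
  qed
  have e: "ca_unit 0 \<in> ca_cycles k A 0" using ca_unit_closed by (simp add: ca_cycles_iff)
  have "pontryagin k A 0 p (hs_class k A 0 (ca_unit 0)) X = X \<and> pontryagin k A p 0 X (hs_class k A 0 (ca_unit 0)) = X"
    if "X \<in> carrier (HS k A p)" for p X
  proof -
    obtain x where x: "x \<in> ca_cycles k A p" "X = hs_class k A p x"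
      using \<open>X \<in> carrier (HS k A p)\<close> by (auto simp: carrier_HS)
    show ?thesis
      unfolding x(2) pontryagin_class[OF e x(1)] pontryagin_class[OF x(1) e]
        shuffle_product_unit[OF cycles_closed(1)[OF x(1)]] by simp
  qed
  then show "\<exists>e\<in>carrier (HS k A 0). \<forall>p. \<forall>X\<in>carrier (HS k A p). pontryagin k A 0 p e X = X \<and> pontryagin k A p 0 X e = X"
    using hs_class_closed[OF e] by blast
  show "pontryagin k A p q X Y = alt_sign (HS k A (p + q)) (p * q) (pontryagin k A q p Y X)"
    if "X \<in> carrier (HS k A p)" "Y \<in> carrier (HS k A q)" for X p Y q
  proof -
    obtain x y where x: "x \<in> ca_cycles k A p" "X = hs_class k A p x"
      and y: "y \<in> ca_cycles k A q" "Y = hs_class k A q y"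
      using \<open>X \<in> _\<close> \<open>Y \<in> _\<close> by (auto simp: carrier_HS)
    obtain b where b: "b \<in> ca_boundaries k A (p + q)"
      "alt_sign (CA k A (p + q)) (p * q) (shuffle_product q p y x) = b \<oplus>\<^bsub>CA k A (p + q)\<^esub> shuffle_product p q x y"
      using shuffle_product_commute[OF x(1) y(1)] by blast
    have "shuffle_product q p y x \<in> ca_cycles k A (p + q)" using shuffle_product_cycles[OF y(1) x(1)] by (simp only: add.commute)
    from hs_class_alt_sign[OF this, of "p * q"]
    have "alt_sign (HS k A (p + q)) (p * q) (hs_class k A (p + q) (shuffle_product q p y x)) = hs_class k A (p + q) (shuffle_product p q x y)"
      using hs_class_eq_if_boundary[OF b(1) shuffle_product_cycles[OF x(1) y(1)]] b(2) by simp
    then show ?thesis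
      unfolding x(2) y(2) pontryagin_class[OF x(1) y(1)] pontryagin_class[OF y(1) x(1)]
      by (simp only: add.commute[of q p])
  qed
qed

end

theorem theorem20:
  fixes k :: "('k, 'r) ring_scheme" and A :: "('k, 'a, 's) module_scheme"
  assumes "assoc_algebra k A"
  shows "graded_comm_algebra k (HS k A) (pontryagin k A) \<and>
    (\<forall>p q x y. x \<in> ca_cycles k A p \<longrightarrow> y \<in> ca_cycles k A q \<longrightarrow>
       ca_shuffle_mult k A p q x y \<in> ca_cycles k A (p + q) \<and>
       pontryagin k A p q (hs_class k A p x) (hs_class k A q y)
         = hs_class k A (p + q) (ca_shuffle_mult k A p q x y))"
proof -
  interpret assoc_algebra k A by fact
  show ?thesis
  proof (intro conjI allI impI)
    show "graded_comm_algebra k (HS k A) (pontryagin k A)" by (rule graded_comm_algebra_HS)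
    fix p q x y assume xy: "x \<in> ca_cycles k A p" "y \<in> ca_cycles k A q"
    show "ca_shuffle_mult k A p q x y \<in> ca_cycles k A (p + q)"
      unfolding ca_shuffle_mult_shuffle_product[OF xy] by (rule shuffle_product_cycles[OF xy])
    show "pontryagin k A p q (hs_class k A p x) (hs_class k A q y) = hs_class k A (p + q) (ca_shuffle_mult k A p q x y)"
      unfolding ca_shuffle_mult_shuffle_product[OF xy] by (rule pontryagin_class[OF xy])
  qed
qed

end
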